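(* An abstract zeta element for $(x_{U_v},\mathfrak H_v,L_v)$ exists if and only if, for every $1\le i\le r_v$, there exists $x_{v,i}\in N_v(V_{v,i})$ such that $$\mathfrak h_{v,i,*}(x_{U_v})-\mathrm{pr}_{V_{v,i},H_{v,i},*}(x_{v,i})$$ is a $\mathbb Z_p$-torsion element of $N_v(H_{v,i})$.
   Context: **RIC functors.** Let $H$ be a locally profinite group and $\Upsilon$ a non-empty collection of compact open subgroups such that (T1) $\Upsilon$ is stable under conjugation; (T2) for $K,L\in\Upsilon$ there is $K'\in\Upsilon$ with $K'\triangleleft K$, $K'\subset L$; (T3) $\Upsilon$ is closed under pairwise intersection. $\mathcal P(H,\Upsilon)$ is the category with objects $\Upsilon$, $\mathrm{Hom}(L,K)=\{g\in H: g^{-1}Lg\subset K\}$ and composition $(L\xrightarrow{g}K)\circ(L'\xrightarrow{h}L)=(L'\xrightarrow{hg}K)$. A RIC functor $M$ valued in $R$-modules is a pair of functors $M^*:\mathcal P(H,\Upsilon)^{op}\to R\text{-Mod}$, $M_*:\mathcal P(H,\Upsilon)\to R\text{-Mod}$ agreeing on objects (common value $M(K)$), with induced maps $[g]^*_{L,K}:M(K)\to M(L)$, $[g]_{L,K,*}:M(L)\to M(K)$, $\mathrm{pr}_{L,K}$ for $g=e$, such that $[g]^*_{L,K}=[g^{-1}]_{K,L,*}$ if $g^{-1}Lg=K$ and $[\gamma]_{K,K,*}=\mathrm{id}$ for $\gamma\in K$. $M$ is *CoMack* if it is cohomological ($\mathrm{pr}_{L,K,*}\circ\mathrm{pr}_{L,K}^*=[K:L]$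 for $L\subset K$) and Mackey (for $L,L'\subset K$: $\mathrm{pr}_{L,K}^*\circ\mathrm{pr}_{L',K,*}=\sum_{\gamma\in L\backslash K/L'}\mathrm{pr}_{L_\gamma,L,*}\circ[\gamma]^*_{L_\gamma,L'}$, $L_\gamma=L\cap\gamma L'\gamma^{-1}$). The Hecke correspondence $[K'\sigma K]:M(K)\to M(K')$ is $\mathrm{pr}_{K'\cap\sigma K\sigma^{-1},K',*}\circ[\sigma]^*\circ\mathrm{pr}^*_{K\cap\sigma^{-1}K'\sigma,K}$, and $[K'\sigma K]_*:=[K\sigma^{-1}K']$. **Setting.** $H_v\subset G_v$ is a closed subgroup, both unimodular locally profinite groups; $\Upsilon_{H_v}$, $\Upsilon_{G_v}$ are collections of compact open subgroups satisfying (T1)-(T3) with $\{K'\cap H_v:K'\in\Upsilon_{G_v}\}\subset\Upsilon_{H_v}$; $K_v,L_v\in\Upsilon_{G_v}$ with $L_v\triangleleft K_v$; $U_v=H_v\cap K_v$. $N_v$ is a CoMack functor on $(H_v,\Upsilon_{H_v})$ valued in $\mathbb Z_p$-modules and $x_{U_v}\in N_v(U_v)$. $\mathfrak H_v$ is a non-zero finite $\mathbb Z_p$-linear combination of characteristic functions of double cosets in $K_v\backslash G_v/K_v$; $g_{v,1},\dots,g_{v,r_v}$ are representatives of $H_v\backslash H_v\cdot\mathrm{supp}(\mathfrak H_v)/K_v$; $H_{v,i}=H_v\cap g_{v,i}K_vg_{v,i}^{-1}$, $V_{v,i}=H_v\cap g_{v,i}L_vg_{v,i}^{-1}$. The function $\mathfrak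 h_{v,i}:h\mapsto\mathfrak H_v(hg_{v,i})$ on $H_v$ equals $\sum_jc_j\,\mathrm{ch}(U_vh_jH_{v,i})$ (finite sum, distinct double cosets) and $\mathfrak h_{v,i,*}=\sum_jc_j[U_vh_jH_{v,i}]_*:N_v(U_v)\to N_v(H_{v,i})$. **Zeta elements.** Let $\widehat N_v=\varinjlim_VN_v(V)\otimes_{\mathbb Z_p}\mathbb Q_p$ (limit over $V\in\Upsilon_{H_v}$ under restriction maps $\mathrm{pr}^*$), with natural maps $j_V:N_v(V)\to\widehat N_v$ and smooth left $H_v$-action $h\cdot j_V(x)=j_{hVh^{-1}}([h]^*_{hVh^{-1},V}(x))$. Let $\mathcal C(G_v/K_v,\widehat N_v)$ be the space of functions $\xi:G_v\to\widehat N_v$ that are right $K_v$-invariant with compact support, with left $H_v$-action $(h\xi)(g)=h\cdot\xi(h^{-1}g)$. For $V_1,V_2\in\Upsilon_{H_v}$ put $[V_1:V_2]=\mu(V_1)/\mu(V_2)$ for a Haar measure $\mu$ on $H_v$. A function $\xi$ is *integral at level $L_v$* if for each $g\in G_v$ there are finitely many $V_k\in\Upsilon_{H_v}$ with $V_k\subset gL_vg^{-1}$ and $x_k\in N_v(V_k)$ with $\xi(g)=\sum_k[U_v:V_k]\,j_{V_k}(x_k)$. An *abstract zeta element* for $(x_{U_v},\mathfrak H_v,L_v)$ is an element of $\mathcal C(G_v/K_v,\widehat N_v)$ that is integral at level $L_v$ and has the same class in the $H_v$-coinvariants $\mathcal C(G_v/K_v,\widehat N_v)_{H_v}$ as the function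 $j_{U_v}(x_{U_v})\otimes\mathfrak H_v:g\mapsto\mathfrak H_v(g)\,j_{U_v}(x_{U_v})$. *)

theory Defs
  imports "HOL-Analysis.Analysis" "HOL-Algebra.Algebra"
begin

text \<open>Inverse limit of the rings of integers modulo \<open>p ^ n\<close>, with least non-negative residues
  as representatives.\<close>

definition padic_integers :: "nat \<Rightarrow> (nat \<Rightarrow> int) ring" where
  "padic_integers p =
    \<lparr>carrier = {a. \<forall>n. 0 \<le> a n \<and> a n < int p ^ n \<and> a (Suc n) mod int p ^ n = a n},
     monoid.mult = (\<lambda>a b n. (a n * b n) mod int p ^ n),
     one = (\<lambda>n. 1 mod int p ^ n),
     ring.zero = (\<lambda>n. 0),
     add = (\<lambda>a b n. (a n + b n) mod int p ^ n)\<rparr>"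

text \<open>The field of fractions of a domain \<open>R\<close>, as an \<open>R\<close>-algebra. An element is an
  equivalence class of pairs (numerator, denominator).\<close>

definition fraction_rel :: "('a, 'b) ring_scheme \<Rightarrow> (('a \<times> 'a) \<times> ('a \<times> 'a)) set" where
  "fraction_rel R = {((a, s), (b, t)).
     a \<in> carrier R \<and> s \<in> carrier R - {\<zero>\<^bsub>R\<^esub>} \<and> b \<in> carrier R \<and> t \<in> carrier R - {\<zero>\<^bsub>R\<^esub>} \<and>
     a \<otimes>\<^bsub>R\<^esub> t = b \<otimes>\<^bsub>R\<^esub> s}"

definition fraction :: "('a, 'b) ring_scheme \<Rightarrow> 'a \<Rightarrow> 'a \<Rightarrow> ('a \<times> 'a) set" where
  "fraction R a s = fraction_rel R `` {(a, s)}"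

definition fraction_field :: "('a, 'b) ring_scheme \<Rightarrow> ('a, ('a \<times> 'a) set) module" where
  "fraction_field R =
    \<lparr>carrier = (carrier R \<times> (carrier R - {\<zero>\<^bsub>R\<^esub>})) // fraction_rel R,
     monoid.mult = (\<lambda>x y. \<Union>(a, s)\<in>x. \<Union>(b, t)\<in>y. fraction R (a \<otimes>\<^bsub>R\<^esub> b) (s \<otimes>\<^bsub>R\<^esub> t)),
     one = fraction R \<one>\<^bsub>R\<^esub> \<one>\<^bsub>R\<^esub>,
     ring.zero = fraction R \<zero>\<^bsub>R\<^esub> \<one>\<^bsub>R\<^esub>,
     add = (\<lambda>x y. \<Union>(a, s)\<in>x. \<Union>(b, t)\<in>y.
              fraction R ((a \<otimes>\<^bsub>R\<^esub> t) \<oplus>\<^bsub>R\<^esub> (b \<otimes>\<^bsub>R\<^esub> s)) (s \<otimes>\<^bsub>R\<^esub> t)),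
     smult = (\<lambda>r x. \<Union>(a, s)\<in>x. fraction R (r \<otimes>\<^bsub>R\<^esub> a) s)\<rparr>"

text \<open>The image of a rational number in a field \<open>F\<close> of characteristic zero.\<close>

definition rat_in :: "('a, 'b) ring_scheme \<Rightarrow> rat \<Rightarrow> 'a" where
  "rat_in F q = (case quotient_of q of (a, b) \<Rightarrow>
     ([a] \<cdot>\<^bsub>F\<^esub> \<one>\<^bsub>F\<^esub>) \<otimes>\<^bsub>F\<^esub> inv\<^bsub>F\<^esub> ([b] \<cdot>\<^bsub>F\<^esub> \<one>\<^bsub>F\<^esub>))"

definition linear_map ::
  "('r, 'x) ring_scheme \<Rightarrow> ('r, 'm, 'y) module_scheme \<Rightarrow> ('r, 'n, 'z) module_scheme \<Rightarrow> ('m \<Rightarrow> 'n) \<Rightarrow> bool"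
  where
  "linear_map R M N f \<longleftrightarrow>
     f \<in> carrier M \<rightarrow> carrier N \<and>
     (\<forall>x\<in>carrier M. \<forall>y\<in>carrier M. f (x \<oplus>\<^bsub>M\<^esub> y) = f x \<oplus>\<^bsub>N\<^esub> f y) \<and>
     (\<forall>r\<in>carrier R. \<forall>x\<in>carrier M. f (r \<odot>\<^bsub>M\<^esub> x) = r \<odot>\<^bsub>N\<^esub> f x)"

definition is_torsion :: "('r, 'x) ring_scheme \<Rightarrow> ('r, 'm, 'y) module_scheme \<Rightarrow> 'm \<Rightarrow> bool" where
  "is_torsion R M x \<longleftrightarrow>
     x \<in> carrier M \<and> (\<exists>r\<in>carrier R. r \<noteq> \<zero>\<^bsub>R\<^esub> \<and> r \<odot>\<^bsub>M\<^esub> x = \<zero>\<^bsub>M\<^esub>)"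

text \<open>The tensor product of an \<open>R\<close>-module \<open>M\<close> with an \<open>R\<close>-algebra \<open>A\<close>, as an \<open>A\<close>-module: the
  free abelian group on \<open>M \<times> A\<close> modulo the bilinearity relations, so that elements are cosets.
  Here and below, the record type \<open>module\<close> extends rings, and the multiplicative fields of a
  record that is only a module are irrelevant.\<close>

definition tensor_relations ::
  "('r, 'x) ring_scheme \<Rightarrow> ('r, 'm, 'y) module_scheme \<Rightarrow> ('r, 'a, 'z) module_scheme \<Rightarrow>
   ('m \<times> 'a \<Rightarrow>\<^sub>0 int) set" where
  "tensor_relations R M A =
     {frag_of (x \<oplus>\<^bsub>M\<^esub> y, a) - frag_of (x, a) - frag_of (y, a) | x y a.
        x \<in> carrier M \<and> y \<in> carrier M \<and> a \<in> carrier A} \<union>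
     {frag_of (x, a \<oplus>\<^bsub>A\<^esub> b) - frag_of (x, a) - frag_of (x, b) | x a b.
        x \<in> carrier M \<and> a \<in> carrier A \<and> b \<in> carrier A} \<union>
     {frag_of (r \<odot>\<^bsub>M\<^esub> x, a) - frag_of (x, r \<odot>\<^bsub>A\<^esub> a) | r x a.
        r \<in> carrier R \<and> x \<in> carrier M \<and> a \<in> carrier A}"

definition tensor_free ::
  "('r, 'm, 'y) module_scheme \<Rightarrow> ('r, 'a, 'z) module_scheme \<Rightarrow> ('m \<times> 'a \<Rightarrow>\<^sub>0 int) monoid" where
  "tensor_free M A = free_Abelian_group (carrier M \<times> carrier A)"

definition tensor_class ::
  "('r, 'x) ring_scheme \<Rightarrow> ('r, 'm, 'y) module_scheme \<Rightarrow> ('r, 'a, 'z) module_scheme \<Rightarrow>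
   ('m \<times> 'a \<Rightarrow>\<^sub>0 int) \<Rightarrow> ('m \<times> 'a \<Rightarrow>\<^sub>0 int) set" where
  "tensor_class R M A z =
     generate (tensor_free M A) (tensor_relations R M A) #>\<^bsub>tensor_free M A\<^esub> z"

definition tensor ::
  "('r, 'x) ring_scheme \<Rightarrow> ('r, 'm, 'y) module_scheme \<Rightarrow> ('r, 'a, 'z) module_scheme \<Rightarrow>
   ('a, ('m \<times> 'a \<Rightarrow>\<^sub>0 int) set) module" where
  "tensor R M A =
    \<lparr>carrier = carrier (tensor_free M A Mod generate (tensor_free M A) (tensor_relations R M A)),
     monoid.mult = undefined,
     one = undefined,
     ring.zero = tensor_class R M A 0,
     add = (\<lambda>u v. u <#>\<^bsub>tensor_free M A\<^esub> v),
     smult = (\<lambda>a u. \<Union>z\<in>u.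
       tensor_class R M A (frag_extend (\<lambda>(x, b). frag_of (x, a \<otimes>\<^bsub>A\<^esub> b)) z))\<rparr>"

definition pure_tensor ::
  "('r, 'x) ring_scheme \<Rightarrow> ('r, 'm, 'y) module_scheme \<Rightarrow> ('r, 'a, 'z) module_scheme \<Rightarrow>
   'm \<Rightarrow> 'a \<Rightarrow> ('m \<times> 'a \<Rightarrow>\<^sub>0 int) set" where
  "pure_tensor R M A x a = tensor_class R M A (frag_of (x, a))"

text \<open>The map \<open>f \<otimes> id\<close> on tensor products with \<open>A\<close>; here \<open>N\<close> is the codomain of \<open>f\<close>.\<close>

definition tensor_map ::
  "('r, 'x) ring_scheme \<Rightarrow> ('r, 'n, 'y) module_scheme \<Rightarrow> ('r, 'a, 'z) module_scheme \<Rightarrow>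
   ('m \<Rightarrow> 'n) \<Rightarrow> ('m \<times> 'a \<Rightarrow>\<^sub>0 int) set \<Rightarrow> ('n \<times> 'a \<Rightarrow>\<^sub>0 int) set" where
  "tensor_map R N A f u =
     (\<Union>z\<in>u. tensor_class R N A (frag_extend (\<lambda>(x, a). frag_of (f x, a)) z))"

text \<open>The direct limit of modules \<open>D V\<close> indexed by a family \<open>\<Upsilon>\<close> of sets that is directed under
  reverse inclusion; \<open>t L K\<close> is the transition map from \<open>D K\<close> to \<open>D L\<close> for \<open>L \<subseteq> K\<close>.\<close>

definition limit_rel ::
  "'i set set \<Rightarrow> ('i set \<Rightarrow> ('f, 'm, 'y) module_scheme) \<Rightarrow> ('i set \<Rightarrow> 'i set \<Rightarrow> 'm \<Rightarrow> 'm) \<Rightarrow>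
   (('i set \<times> 'm) \<times> ('i set \<times> 'm)) set" where
  "limit_rel \<Upsilon> D t = {((V, x), (W, y)).
     V \<in> \<Upsilon> \<and> W \<in> \<Upsilon> \<and> x \<in> carrier (D V) \<and> y \<in> carrier (D W) \<and>
     (\<exists>Z\<in>\<Upsilon>. Z \<subseteq> V \<and> Z \<subseteq> W \<and> t Z V x = t Z W y)}"

definition limit_class ::
  "'i set set \<Rightarrow> ('i set \<Rightarrow> ('f, 'm, 'y) module_scheme) \<Rightarrow> ('i set \<Rightarrow> 'i set \<Rightarrow> 'm \<Rightarrow> 'm) \<Rightarrow>
   'i set \<Rightarrow> 'm \<Rightarrow> ('i set \<times> 'm) set" where
  "limit_class \<Upsilon> D t V x = limit_rel \<Upsilon> D t `` {(V, x)}"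

definition direct_limit ::
  "'i set set \<Rightarrow> ('i set \<Rightarrow> ('f, 'm, 'y) module_scheme) \<Rightarrow> ('i set \<Rightarrow> 'i set \<Rightarrow> 'm \<Rightarrow> 'm) \<Rightarrow>
   ('f, ('i set \<times> 'm) set) module" where
  "direct_limit \<Upsilon> D t =
    \<lparr>carrier = (SIGMA V:\<Upsilon>. carrier (D V)) // limit_rel \<Upsilon> D t,
     monoid.mult = undefined,
     one = undefined,
     ring.zero = (\<Union>V\<in>\<Upsilon>. limit_class \<Upsilon> D t V \<zero>\<^bsub>D V\<^esub>),
     add = (\<lambda>u v. \<Union>(V, x)\<in>u. \<Union>(W, y)\<in>v. \<Union>Z\<in>{Z \<in> \<Upsilon>. Z \<subseteq> V \<and> Z \<subseteq> W}.
              limit_class \<Upsilon> D t Z (t Z V x \<oplus>\<^bsub>D Z\<^esub> t Z W y)),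
     smult = (\<lambda>a u. \<Union>(V, x)\<in>u. limit_class \<Upsilon> D t V (a \<odot>\<^bsub>D V\<^esub> x))\<rparr>"

text \<open>The class of \<open>\<xi>\<close> in the coinvariants of \<open>C\<close> under operators \<open>act h\<close>, for \<open>h \<in> S\<close>. When
  each \<open>act h\<close> is linear, the subgroup generated by the elements \<open>act h \<eta> - \<eta>\<close> is a submodule.\<close>

definition coinvariant_class ::
  "('f, 'm, 'y) module_scheme \<Rightarrow> 'h set \<Rightarrow> ('h \<Rightarrow> 'm \<Rightarrow> 'm) \<Rightarrow> 'm \<Rightarrow> 'm set" where
  "coinvariant_class C S act \<xi> =
     generate (add_monoid C) {act h \<eta> \<ominus>\<^bsub>C\<^esub> \<eta> | h \<eta>. h \<in> S \<and> \<eta> \<in> carrier C} +>\<^bsub>C\<^esub> \<xi>"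

locale locally_profinite_group = group G
  for G :: "('g, 'b) monoid_scheme" (structure) and T :: "'g topology" +
  assumes topspace_eq: "topspace T = carrier G"
    and continuous_mult: "continuous_map (prod_topology T T) T (\<lambda>(x, y). x \<otimes> y)"
    and continuous_inv: "continuous_map T T (\<lambda>x. inv x)"
    and Hausdorff: "Hausdorff_space T"
    and compact_open_basis:
      "\<And>W. openin T W \<Longrightarrow> \<one> \<in> W \<Longrightarrow>
         \<exists>K. subgroup K G \<and> openin T K \<and> compactin T K \<and> K \<subseteq> W"

definition left_haar_measure :: "('g, 'b) monoid_scheme \<Rightarrow> 'g topology \<Rightarrow> 'g measure \<Rightarrow> bool" where
  "left_haar_measure G T \<mu> \<longleftrightarrow>
     space \<mu> = topspace T \<and>
     sets \<mu> = sigma_sets (topspace T) {W. openin T W} \<and>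
     (\<forall>C. compactin T C \<longrightarrow> emeasure \<mu> C < \<infinity>) \<and>
     (\<forall>A\<in>sets \<mu>. emeasure \<mu> A = (INF W\<in>{W. openin T W \<and> A \<subseteq> W}. emeasure \<mu> W)) \<and>
     (\<forall>W. openin T W \<longrightarrow> emeasure \<mu> W = (SUP C\<in>{C. compactin T C \<and> C \<subseteq> W}. emeasure \<mu> C)) \<and>
     emeasure \<mu> (space \<mu>) \<noteq> 0 \<and>
     (\<forall>g\<in>carrier G. \<forall>A\<in>sets \<mu>. emeasure \<mu> (g <#\<^bsub>G\<^esub> A) = emeasure \<mu> A)"

definition unimodular :: "('g, 'b) monoid_scheme \<Rightarrow> 'g topology \<Rightarrow> bool" where
  "unimodular G T \<longleftrightarrow>
     (\<exists>\<mu>. left_haar_measure G T \<mu> \<and>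
          (\<forall>g\<in>carrier G. \<forall>A\<in>sets \<mu>. emeasure \<mu> (A #>\<^bsub>G\<^esub> g) = emeasure \<mu> A))"

text \<open>The quotient \<open>\<mu> V\<^sub>1 / \<mu> V\<^sub>2\<close>, which is rational for compact open subgroups: both groups
  have finite index over their intersection.\<close>

definition haar_index :: "'g measure \<Rightarrow> 'g set \<Rightarrow> 'g set \<Rightarrow> rat" where
  "haar_index \<mu> V\<^sub>1 V\<^sub>2 = (THE q. real_of_rat q = measure \<mu> V\<^sub>1 / measure \<mu> V\<^sub>2)"

definition conjugate :: "('g, 'b) monoid_scheme \<Rightarrow> 'g \<Rightarrow> 'g set \<Rightarrow> 'g set" where
  "conjugate G g K = (\<lambda>k. g \<otimes>\<^bsub>G\<^esub> k \<otimes>\<^bsub>G\<^esub> inv\<^bsub>G\<^esub> g) ` K"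

definition double_coset :: "('g, 'b) monoid_scheme \<Rightarrow> 'g set \<Rightarrow> 'g \<Rightarrow> 'g set \<Rightarrow> 'g set" where
  "double_coset G A g B = A <#>\<^bsub>G\<^esub> {g} <#>\<^bsub>G\<^esub> B"

locale level_collection = locally_profinite_group G T
  for G :: "('g, 'b) monoid_scheme" (structure) and T :: "'g topology" and \<Upsilon> :: "'g set set" +
  assumes nonempty: "\<Upsilon> \<noteq> {}"
    and compact_open: "\<And>K. K \<in> \<Upsilon> \<Longrightarrow> subgroup K G \<and> openin T K \<and> compactin T K"
    and T1: "\<And>K g. K \<in> \<Upsilon> \<Longrightarrow> g \<in> carrier G \<Longrightarrow> conjugate G g K \<in> \<Upsilon>"
    and T2: "\<And>K L. K \<in> \<Upsilon> \<Longrightarrow> L \<in> \<Upsilon> \<Longrightarrow> \<exists>K'\<in>\<Upsilon>. K' \<lhd> G\<lparr>carrier := K\<rparr> \<and> K' \<subseteq> L"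
    and T3: "\<And>K L. K \<in> \<Upsilon> \<Longrightarrow> L \<in> \<Upsilon> \<Longrightarrow> K \<inter> L \<in> \<Upsilon>"

text \<open>\<open>obj M K\<close> is the common value at \<open>K\<close>; \<open>pull M g L K\<close> and \<open>push M g L K\<close> are the
  contravariant map from \<open>M(K)\<close> to \<open>M(L)\<close> and the covariant map from \<open>M(L)\<close> to \<open>M(K)\<close> attached
  to a morphism \<open>g\<close> from \<open>L\<close> to \<open>K\<close>.\<close>

record ('g, 'r, 'm) ric =
  obj :: "'g set \<Rightarrow> ('r, 'm) module"
  pull :: "'g \<Rightarrow> 'g set \<Rightarrow> 'g set \<Rightarrow> 'm \<Rightarrow> 'm"
  push :: "'g \<Rightarrow> 'g set \<Rightarrow> 'g set \<Rightarrow> 'm \<Rightarrow> 'm"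

definition level_hom ::
  "('g, 'b) monoid_scheme \<Rightarrow> 'g set set \<Rightarrow> 'g set \<Rightarrow> 'g set \<Rightarrow> 'g set" where
  "level_hom G \<Upsilon> L K =
     {g \<in> carrier G. L \<in> \<Upsilon> \<and> K \<in> \<Upsilon> \<and> conjugate G (inv\<^bsub>G\<^esub> g) L \<subseteq> K}"

locale ric_functor = level_collection G T \<Upsilon>
  for G :: "('g, 'b) monoid_scheme" (structure) and T :: "'g topology" and \<Upsilon> :: "'g set set"
    and R :: "('r, 'x) ring_scheme" and M :: "('g, 'r, 'm) ric" +
  assumes obj_module: "\<And>K. K \<in> \<Upsilon> \<Longrightarrow> Module.module R (obj M K)"
    and pull_linear:
      "\<And>L K g. g \<in> level_hom G \<Upsilon> L K \<Longrightarrow> linear_map R (obj M K) (obj M L) (pull M g L K)"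
    and push_linear:
      "\<And>L K g. g \<in> level_hom G \<Upsilon> L K \<Longrightarrow> linear_map R (obj M L) (obj M K) (push M g L K)"
    and pull_id: "\<And>K x. K \<in> \<Upsilon> \<Longrightarrow> x \<in> carrier (obj M K) \<Longrightarrow> pull M \<one> K K x = x"
    and push_id: "\<And>K x. K \<in> \<Upsilon> \<Longrightarrow> x \<in> carrier (obj M K) \<Longrightarrow> push M \<one> K K x = x"
    and pull_comp:
      "\<And>L' L K g h x. h \<in> level_hom G \<Upsilon> L' L \<Longrightarrow> g \<in> level_hom G \<Upsilon> L K \<Longrightarrow> x \<in> carrier (obj M K) \<Longrightarrow>
         pull M (h \<otimes> g) L' K x = pull M h L' L (pull M g L K x)"
    and push_comp:
      "\<And>L' L K g h x. h \<in> level_hom G \<Upsilon> L' L \<Longrightarrow> g \<in> level_hom G \<Upsilon> L K \<Longrightarrow> x \<in> carrier (obj M L') \<Longrightarrow>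
         push M (h \<otimes> g) L' K x = push M g L K (push M h L' L x)"
    and pull_eq_push_inv:
      "\<And>L K g x. L \<in> \<Upsilon> \<Longrightarrow> K \<in> \<Upsilon> \<Longrightarrow> g \<in> carrier G \<Longrightarrow> conjugate G (inv g) L = K \<Longrightarrow>
         x \<in> carrier (obj M K) \<Longrightarrow> pull M g L K x = push M (inv g) K L x"
    and push_inner:
      "\<And>K \<gamma> x. K \<in> \<Upsilon> \<Longrightarrow> \<gamma> \<in> K \<Longrightarrow> x \<in> carrier (obj M K) \<Longrightarrow> push M \<gamma> K K x = x"

locale comack_functor = ric_functor G T \<Upsilon> R M
  for G :: "('g, 'b) monoid_scheme" (structure) and T :: "'g topology" and \<Upsilon> :: "'g set set"
    and R :: "('r, 'x) ring_scheme" and M :: "('g, 'r, 'm) ric" +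
  assumes cohomological:
      "\<And>L K x. L \<in> \<Upsilon> \<Longrightarrow> K \<in> \<Upsilon> \<Longrightarrow> L \<subseteq> K \<Longrightarrow> x \<in> carrier (obj M K) \<Longrightarrow>
         push M \<one> L K (pull M \<one> L K x) = [card (rcosets\<^bsub>G\<lparr>carrier := K\<rparr>\<^esub> L)] \<cdot>\<^bsub>obj M K\<^esub> x"
    and mackey:
      "\<And>L L' K \<Gamma> x. L \<in> \<Upsilon> \<Longrightarrow> L' \<in> \<Upsilon> \<Longrightarrow> K \<in> \<Upsilon> \<Longrightarrow> L \<subseteq> K \<Longrightarrow> L' \<subseteq> K \<Longrightarrow>
         \<Gamma> \<subseteq> K \<Longrightarrow> (\<And>k. k \<in> K \<Longrightarrow> \<exists>!\<gamma>. \<gamma> \<in> \<Gamma> \<and> k \<in> double_coset G L \<gamma> L') \<Longrightarrow>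
         x \<in> carrier (obj M L') \<Longrightarrow>
         pull M \<one> L K (push M \<one> L' K x) =
           (\<Oplus>\<^bsub>obj M L\<^esub> \<gamma>\<in>\<Gamma>. push M \<one> (L \<inter> conjugate G \<gamma> L') L
                                (pull M \<gamma> (L \<inter> conjugate G \<gamma> L') L' x))"

text \<open>\<open>hecke_corr G M K' \<sigma> K\<close> is \<open>[K' \<sigma> K]\<close>, a map from \<open>M(K)\<close> to \<open>M(K')\<close>, and
  \<open>hecke_corr_push G M K' \<sigma> K\<close> is \<open>[K' \<sigma> K]\<^sub>*\<close>, a map from \<open>M(K')\<close> to \<open>M(K)\<close>.\<close>

definition hecke_corr ::
  "('g, 'b) monoid_scheme \<Rightarrow> ('g, 'r, 'm) ric \<Rightarrow> 'g set \<Rightarrow> 'g \<Rightarrow> 'g set \<Rightarrow> 'm \<Rightarrow> 'm" where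
  "hecke_corr G M K' \<sigma> K x =
     push M \<one>\<^bsub>G\<^esub> (K' \<inter> conjugate G \<sigma> K) K'
       (pull M \<sigma> (K' \<inter> conjugate G \<sigma> K) (K \<inter> conjugate G (inv\<^bsub>G\<^esub> \<sigma>) K')
         (pull M \<one>\<^bsub>G\<^esub> (K \<inter> conjugate G (inv\<^bsub>G\<^esub> \<sigma>) K') K x))"

definition hecke_corr_push ::
  "('g, 'b) monoid_scheme \<Rightarrow> ('g, 'r, 'm) ric \<Rightarrow> 'g set \<Rightarrow> 'g \<Rightarrow> 'g set \<Rightarrow> 'm \<Rightarrow> 'm" where
  "hecke_corr_push G M K' \<sigma> K = hecke_corr G M K (inv\<^bsub>G\<^esub> \<sigma>) K'"

text \<open>The limit of \<open>M(V) \<otimes> Frac R\<close> over \<open>V \<in> \<Upsilon>\<close> along the restriction maps.\<close>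

definition rational_obj ::
  "('r, 'x) ring_scheme \<Rightarrow> ('g, 'r, 'm) ric \<Rightarrow> 'g set \<Rightarrow>
   (('r \<times> 'r) set, ('m \<times> ('r \<times> 'r) set \<Rightarrow>\<^sub>0 int) set) module" where
  "rational_obj R M V = tensor R (obj M V) (fraction_field R)"

definition rational_pull ::
  "('r, 'x) ring_scheme \<Rightarrow> ('g, 'r, 'm) ric \<Rightarrow> 'g \<Rightarrow> 'g set \<Rightarrow> 'g set \<Rightarrow>
   ('m \<times> ('r \<times> 'r) set \<Rightarrow>\<^sub>0 int) set \<Rightarrow> ('m \<times> ('r \<times> 'r) set \<Rightarrow>\<^sub>0 int) set" where
  "rational_pull R M g L K = tensor_map R (obj M L) (fraction_field R) (pull M g L K)"

type_synonym ('g, 'r, 'm) completion_elt =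
  "('g set \<times> ('m \<times> ('r \<times> 'r) set \<Rightarrow>\<^sub>0 int) set) set"

definition completion ::
  "('g, 'b) monoid_scheme \<Rightarrow> 'g set set \<Rightarrow> ('r, 'x) ring_scheme \<Rightarrow> ('g, 'r, 'm) ric \<Rightarrow>
   (('r \<times> 'r) set, ('g, 'r, 'm) completion_elt) module" where
  "completion G \<Upsilon> R M = direct_limit \<Upsilon> (rational_obj R M) (rational_pull R M \<one>\<^bsub>G\<^esub>)"

definition completion_class ::
  "('g, 'b) monoid_scheme \<Rightarrow> 'g set set \<Rightarrow> ('r, 'x) ring_scheme \<Rightarrow> ('g, 'r, 'm) ric \<Rightarrow>
   'g set \<Rightarrow> ('m \<times> ('r \<times> 'r) set \<Rightarrow>\<^sub>0 int) set \<Rightarrow> ('g, 'r, 'm) completion_elt" where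
  "completion_class G \<Upsilon> R M = limit_class \<Upsilon> (rational_obj R M) (rational_pull R M \<one>\<^bsub>G\<^esub>)"

definition completion_map ::
  "('g, 'b) monoid_scheme \<Rightarrow> 'g set set \<Rightarrow> ('r, 'x) ring_scheme \<Rightarrow> ('g, 'r, 'm) ric \<Rightarrow>
   'g set \<Rightarrow> 'm \<Rightarrow> ('g, 'r, 'm) completion_elt" where
  "completion_map G \<Upsilon> R M V x =
     completion_class G \<Upsilon> R M V
       (pure_tensor R (obj M V) (fraction_field R) x \<one>\<^bsub>fraction_field R\<^esub>)"

definition completion_act ::
  "('g, 'b) monoid_scheme \<Rightarrow> 'g set set \<Rightarrow> ('r, 'x) ring_scheme \<Rightarrow> ('g, 'r, 'm) ric \<Rightarrow>
   'g \<Rightarrow> ('g, 'r, 'm) completion_elt \<Rightarrow> ('g, 'r, 'm) completion_elt" where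
  "completion_act G \<Upsilon> R M h v =
     (\<Union>(V, y)\<in>v. completion_class G \<Upsilon> R M (conjugate G h V)
                    (rational_pull R M h (conjugate G h V) V y))"

definition char_fun :: "('r, 'x) ring_scheme \<Rightarrow> 'g set \<Rightarrow> 'g \<Rightarrow> 'r" where
  "char_fun R A x = (if x \<in> A then \<one>\<^bsub>R\<^esub> else \<zero>\<^bsub>R\<^esub>)"

text \<open>Finite linear combinations of characteristic functions of double cosets of \<open>K\<close>; only the
  values on the carrier of \<open>G\<close> matter.\<close>

definition hecke_function ::
  "('g, 'b) monoid_scheme \<Rightarrow> ('r, 'x) ring_scheme \<Rightarrow> 'g set \<Rightarrow> ('g \<Rightarrow> 'r) \<Rightarrow> bool" where
  "hecke_function G R K \<HH> \<longleftrightarrow>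
     (\<exists>\<D> c. finite \<D> \<and> \<D> \<subseteq> {double_coset G K g K | g. g \<in> carrier G} \<and> c \<in> \<D> \<rightarrow> carrier R \<and>
        (\<forall>x\<in>carrier G. \<HH> x = (\<Oplus>\<^bsub>R\<^esub> A\<in>\<D>. c A \<otimes>\<^bsub>R\<^esub> char_fun R A x)))"

definition supp :: "('g, 'b) monoid_scheme \<Rightarrow> ('r, 'x) ring_scheme \<Rightarrow> ('g \<Rightarrow> 'r) \<Rightarrow> 'g set" where
  "supp G R \<HH> = {x \<in> carrier G. \<HH> x \<noteq> \<zero>\<^bsub>R\<^esub>}"

text \<open>Right \<open>K\<close>-invariant functions on \<open>G\<close> with values in \<open>A\<close> and compact support, extended
  by \<open>undefined\<close> outside the carrier of \<open>G\<close>.\<close>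

definition compact_functions ::
  "('g, 'b) monoid_scheme \<Rightarrow> 'g topology \<Rightarrow> 'g set \<Rightarrow> ('f, 'n, 'y) module_scheme \<Rightarrow>
   ('f, 'g \<Rightarrow> 'n) module" where
  "compact_functions G T K A =
    \<lparr>carrier = {\<xi> \<in> carrier G \<rightarrow>\<^sub>E carrier A.
        (\<forall>g\<in>carrier G. \<forall>k\<in>K. \<xi> (g \<otimes>\<^bsub>G\<^esub> k) = \<xi> g) \<and>
        compactin T (T closure_of {g \<in> carrier G. \<xi> g \<noteq> \<zero>\<^bsub>A\<^esub>})},
     monoid.mult = undefined,
     one = undefined,
     ring.zero = (\<lambda>g\<in>carrier G. \<zero>\<^bsub>A\<^esub>),
     add = (\<lambda>\<xi> \<eta>. \<lambda>g\<in>carrier G. \<xi> g \<oplus>\<^bsub>A\<^esub> \<eta> g),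
     smult = (\<lambda>a \<xi>. \<lambda>g\<in>carrier G. a \<odot>\<^bsub>A\<^esub> \<xi> g)\<rparr>"

definition translate ::
  "('g, 'b) monoid_scheme \<Rightarrow> ('g \<Rightarrow> 'n \<Rightarrow> 'n) \<Rightarrow> 'g \<Rightarrow> ('g \<Rightarrow> 'n) \<Rightarrow> 'g \<Rightarrow> 'n" where
  "translate G act h \<xi> = (\<lambda>g\<in>carrier G. act h (\<xi> (inv\<^bsub>G\<^esub> h \<otimes>\<^bsub>G\<^esub> g)))"

text \<open>In the remaining definitions \<open>N\<close> is a functor on the subgroup \<open>H\<close> of \<open>G\<close>.\<close>

definition integral_at_level ::
  "('g, 'b) monoid_scheme \<Rightarrow> 'g set \<Rightarrow> 'g measure \<Rightarrow> 'g set set \<Rightarrow> ('r, 'x) ring_scheme \<Rightarrow>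
   ('g, 'r, 'm) ric \<Rightarrow> 'g set \<Rightarrow> 'g set \<Rightarrow> ('g \<Rightarrow> ('g, 'r, 'm) completion_elt) \<Rightarrow> bool" where
  "integral_at_level G H \<mu> \<Upsilon> R N U L \<xi> \<longleftrightarrow>
     (\<forall>g\<in>carrier G. \<exists>(n::nat) V x.
        (\<forall>k<n. V k \<in> \<Upsilon> \<and> V k \<subseteq> conjugate G g L \<and> x k \<in> carrier (obj N (V k))) \<and>
        \<xi> g = (\<Oplus>\<^bsub>completion (G\<lparr>carrier := H\<rparr>) \<Upsilon> R N\<^esub> k\<in>{..<n}.
                 rat_in (fraction_field R) (haar_index \<mu> U (V k))
                   \<odot>\<^bsub>completion (G\<lparr>carrier := H\<rparr>) \<Upsilon> R N\<^esub>
                 completion_map (G\<lparr>carrier := H\<rparr>) \<Upsilon> R N (V k) (x k)))"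

definition elementary_function ::
  "('g, 'b) monoid_scheme \<Rightarrow> 'g set \<Rightarrow> 'g set set \<Rightarrow> ('r, 'x) ring_scheme \<Rightarrow> ('g, 'r, 'm) ric \<Rightarrow>
   'g set \<Rightarrow> 'm \<Rightarrow> ('g \<Rightarrow> 'r) \<Rightarrow> 'g \<Rightarrow> ('g, 'r, 'm) completion_elt" where
  "elementary_function G H \<Upsilon> R N U x \<HH> =
     (\<lambda>g\<in>carrier G. fraction R (\<HH> g) \<one>\<^bsub>R\<^esub>
        \<odot>\<^bsub>completion (G\<lparr>carrier := H\<rparr>) \<Upsilon> R N\<^esub> completion_map (G\<lparr>carrier := H\<rparr>) \<Upsilon> R N U x)"

definition abstract_zeta_element ::
  "('g, 'b) monoid_scheme \<Rightarrow> 'g topology \<Rightarrow> 'g set \<Rightarrow> 'g measure \<Rightarrow> 'g set set \<Rightarrow>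
   ('r, 'x) ring_scheme \<Rightarrow> ('g, 'r, 'm) ric \<Rightarrow> 'g set \<Rightarrow> 'm \<Rightarrow> ('g \<Rightarrow> 'r) \<Rightarrow> 'g set \<Rightarrow>
   ('g \<Rightarrow> ('g, 'r, 'm) completion_elt) \<Rightarrow> bool" where
  "abstract_zeta_element G T H \<mu> \<Upsilon> R N K x \<HH> L \<xi> \<longleftrightarrow>
     (let C = compact_functions G T K (completion (G\<lparr>carrier := H\<rparr>) \<Upsilon> R N);
          act = translate G (completion_act (G\<lparr>carrier := H\<rparr>) \<Upsilon> R N)
      in \<xi> \<in> carrier C \<and>
         integral_at_level G H \<mu> \<Upsilon> R N (H \<inter> K) L \<xi> \<and>
         coinvariant_class C H act \<xi> =
           coinvariant_class C H act (elementary_function G H \<Upsilon> R N (H \<inter> K) x \<HH>))"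

end

theory Submission
  imports Defs
begin

text \<open>Let \<open>\<mu>\<close> be a Haar measure on \<open>H\<close> and \<open>J\<^sub>V(x) = [U : V] j\<^sub>V(x)\<close>. Unimodularity gives
  \<open>h J\<^sub>V(x) = J\<^sub>V\<^sub>'([h]\<^sup>* x)\<close> for \<open>V' = hVh\<^sup>-\<^sup>1\<close>, and averaging over a compact open subgroup \<open>W \<supseteq> V\<close> is a well
  defined operator \<open>e\<^sub>W\<close> on the completion with \<open>e\<^sub>W(J\<^sub>V(x)) = J\<^sub>W(pr\<^sub>* x)\<close>: compatibility with
  restriction is the cohomological axiom, and the Mackey formula for a normal subgroup shows that
  \<open>e\<^sub>W v\<close> and \<open>v\<close> have the same class in the \<open>W\<close>-coinvariants. The kernel of \<open>J\<^sub>W\<close> is the torsion.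

  For \<open>g\<close> in \<open>G\<close> let \<open>W = H \<inter> gKg\<^sup>-\<^sup>1\<close> and let \<open>\<Phi>\<^sub>g(\<xi>)\<close> be the sum of \<open>e\<^sub>W(h\<^sup>-\<^sup>1 \<xi>(hg))\<close> over \<open>hW\<close> in
  \<open>H/W\<close>. It is \<open>H\<close>-invariant, and a function supported on the union of the \<open>H g\<^sub>i K\<close> is congruent to
  the sum of the functions supported on \<open>g\<^sub>i K\<close> with value \<open>\<Phi>\<^sub>g(\<xi>)\<close>, \<open>g = g\<^sub>i\<close>; so the class of
  such a function in the coinvariants is determined by these values. For \<open>j\<^sub>U(x) \<otimes> \<HH>\<close> the value is
  \<open>J\<^sub>W\<close> of the Hecke expression (a count of left cosets in \<open>U h W\<close>), and for functions integral at
  level \<open>L\<close> the values are exactly the \<open>J\<^sub>W(pr\<^sub>* y)\<close> with \<open>y\<close> in \<open>N(H \<inter> gLg\<^sup>-\<^sup>1)\<close>.\<close>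

section \<open>The p-adic integers\<close>

text \<open>The orbit sums are used asymmetrically. They vanish on the augmentation part for every
  function, so a zeta element of arbitrary support can be tested against them. That they determine a
  class is used only in the converse, for two functions supported in the double cosets H g_i K; the
  witness there can be placed on the cosets g_i K alone.

  The factor [U : V] is what keeps integrality visible. Plain classes j_V are compatible with
  restriction, and averaging them over W produces the denominator [W : V]. In J_V this denominator
  is absorbed, so averages of integral values are images of honest push-forwards, and integrality at
  level L says that every value is a sum of J_V(x) with V inside gLg^-1. In the other direction,
  restricting x before the Hecke push-forward costs an index, and this index is the number of cosets
  over which the orbit sum runs; hence the Hecke expression appears without denominators.

  Fractions, tensors and limits are sets of representatives with operations defined as unions, so
  each operation needs a compatibility proof before it can be computed.\<close>

lemma padic_integers_mod:
  assumes "a \<in> carrier (padic_integers p)" "m \<le> n"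
  shows "a n mod int p ^ m = a m"
  using assms(2)
proof (induction n rule: dec_induct)
  case base
  then show ?case using assms(1) by (simp add: padic_integers_def)
next
  case (step n)
  have "a (Suc n) mod int p ^ m = (a (Suc n) mod int p ^ n) mod int p ^ m"
    using step(1) by (simp add: mod_mod_cancel le_imp_power_dvd)
  also have "\<dots> = a n mod int p ^ m"
    using assms(1) by (simp add: padic_integers_def)
  finally show ?case using step by simp
qed

text \<open>Since p^n divides p^(n+1), the reduced sequence is coherent as soon as the unreduced one
  is coherent modulo each p^n. Closure under sums, products and negatives, and membership of one,
  are instances.\<close>

lemma padic_integers_closed:
  assumes "p > 0" "\<And>n. f (Suc n) mod int p ^ n = f n mod int p ^ n"
  shows "(\<lambda>n. f n mod int p ^ n) \<in> carrier (padic_integers p)"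
  using assms by (simp add: padic_integers_def mod_mod_cancel)

lemma cring_padic_integers:
  assumes "p > 0"
  shows "cring (padic_integers p)"
proof (rule cringI)
  let ?Z = "padic_integers p"
  have red: "a n mod int p ^ n = a n" "a (Suc n) mod int p ^ n = a n" if "a \<in> carrier ?Z" for a n
    using that by (simp_all add: padic_integers_def)
  have cl_add: "a \<oplus>\<^bsub>?Z\<^esub> b \<in> carrier ?Z" and cl_mult: "a \<otimes>\<^bsub>?Z\<^esub> b \<in> carrier ?Z"
    if "a \<in> carrier ?Z" "b \<in> carrier ?Z" for a b
  proof -
    have "(a (Suc n) + b (Suc n)) mod int p ^ n = (a n + b n) mod int p ^ n" for n
      by (metis mod_add_eq red(2) that)
    then show "a \<oplus>\<^bsub>?Z\<^esub> b \<in> carrier ?Z"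
      using padic_integers_closed[OF assms, of "\<lambda>n. a n + b n"] by (simp add: padic_integers_def)
    have "(a (Suc n) * b (Suc n)) mod int p ^ n = (a n * b n) mod int p ^ n" for n
      by (metis mod_mult_eq red(2) that)
    then show "a \<otimes>\<^bsub>?Z\<^esub> b \<in> carrier ?Z"
      using padic_integers_closed[OF assms, of "\<lambda>n. a n * b n"] by (simp add: padic_integers_def)
  qed
  have zero: "\<zero>\<^bsub>?Z\<^esub> \<in> carrier ?Z" using assms by (simp add: padic_integers_def)
  have one: "\<one>\<^bsub>?Z\<^esub> \<in> carrier ?Z"
    using padic_integers_closed[OF assms, of "\<lambda>n. 1"] by (simp add: padic_integers_def)
  show "abelian_group ?Z"
  proof (rule abelian_groupI)
    fix a assume a: "a \<in> carrier ?Z"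
    have "(- a (Suc n)) mod int p ^ n = (- a n) mod int p ^ n" for n
      by (metis mod_minus_eq red(2)[OF a])
    then have "(\<lambda>n. (- a n) mod int p ^ n) \<in> carrier ?Z"
      by (rule padic_integers_closed[OF assms])
    moreover have "(\<lambda>n. (- a n) mod int p ^ n) \<oplus>\<^bsub>?Z\<^esub> a = \<zero>\<^bsub>?Z\<^esub>"
      by (auto simp: padic_integers_def mod_simps)
    ultimately show "\<exists>y\<in>carrier ?Z. y \<oplus>\<^bsub>?Z\<^esub> a = \<zero>\<^bsub>?Z\<^esub>" by blast
  qed (auto intro: cl_add zero, auto simp: padic_integers_def mod_simps ac_simps)
  show "comm_monoid ?Z"
    by (rule comm_monoidI)
       (auto intro: cl_mult one simp: red, auto simp: padic_integers_def mod_simps ac_simps)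
qed (auto simp: padic_integers_def mod_simps algebra_simps)

lemma padic_integers_add_pow:
  fixes k :: nat
  assumes "p > 0"
  shows "[k] \<cdot>\<^bsub>padic_integers p\<^esub> \<one>\<^bsub>padic_integers p\<^esub> = (\<lambda>n. int k mod int p ^ n)"
proof -
  interpret cring "padic_integers p" by (rule cring_padic_integers[OF assms])
  show ?thesis
  proof (induction k)
    case 0
    have "\<zero>\<^bsub>padic_integers p\<^esub> = (\<lambda>n. 0)" by (simp add: padic_integers_def)
    then show ?case by simp
  next
    case (Suc k)
    then show ?case
      by (simp add: add.nat_pow_Suc2) (simp add: padic_integers_def mod_simps ac_simps)
  qed
qed

text \<open>If \<open>a m\<close> and \<open>b k\<close> are nonzero, coherence shows that p^m does
  not divide \<open>a n\<close> and p^k does not divide \<open>b n\<close> at the level n = m + k.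
  Multiplicities of p add up, so the product is still nonzero modulo p^n.\<close>

lemma domain_padic_integers:
  assumes "Factorial_Ring.prime p"
  shows "domain (padic_integers p)"
proof -
  let ?Z = "padic_integers p"
  have p: "p > 0" "p > 1" using assms prime_gt_0_nat prime_gt_1_nat by auto
  interpret cring ?Z by (rule cring_padic_integers[OF p(1)])
  have pp: "Factorial_Ring.prime (int p)" using assms by simp
  show ?thesis
  proof (rule domainI[OF is_cring])
    have "\<one>\<^bsub>?Z\<^esub> 1 \<noteq> \<zero>\<^bsub>?Z\<^esub> 1" using p by (simp add: padic_integers_def)
    then show "\<one>\<^bsub>?Z\<^esub> \<noteq> \<zero>\<^bsub>?Z\<^esub>" by (rule contrapos_nn) simp
  next
    fix a b assume ab: "a \<otimes>\<^bsub>?Z\<^esub> b = \<zero>\<^bsub>?Z\<^esub>" and a: "a \<in> carrier ?Z" and b: "b \<in> carrier ?Z"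
    show "a = \<zero>\<^bsub>?Z\<^esub> \<or> b = \<zero>\<^bsub>?Z\<^esub>"
    proof (rule ccontr)
      assume "\<not> ?thesis"
      then obtain m k where "a m \<noteq> 0" "b k \<noteq> 0"
        by (auto simp: padic_integers_def fun_eq_iff)
      define n where "n = m + k"
      have am: "\<not> int p ^ m dvd a n" and bk: "\<not> int p ^ k dvd b n"
        using padic_integers_mod[OF a, of m n] padic_integers_mod[OF b, of k n] \<open>a m \<noteq> 0\<close> \<open>b k \<noteq> 0\<close>
        by (auto simp: n_def dvd_eq_mod_eq_0)
      then have nz: "a n \<noteq> 0" "b n \<noteq> 0" by auto
      have "(a n * b n) mod int p ^ n = 0"
        using fun_cong[OF ab, of n] by (simp add: padic_integers_def)
      then have "int p ^ n dvd a n * b n" by (simp add: dvd_eq_mod_eq_0)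
      then have "n \<le> multiplicity (int p) (a n * b n)"
        using nz pp p by (intro multiplicity_geI) auto
      also have "\<dots> = multiplicity (int p) (a n) + multiplicity (int p) (b n)"
        using nz pp by (intro prime_elem_multiplicity_mult_distrib) auto
      finally have "m \<le> multiplicity (int p) (a n) \<or> k \<le> multiplicity (int p) (b n)"
        by (auto simp: n_def)
      then show False
        using am bk by (auto simp: multiplicity_dvd')
    qed
  qed
qed

text \<open>Level k separates k from zero: k < p^k, so k is its own residue there. This is the
  characteristic zero input that makes group indices invertible after localisation.\<close>

lemma padic_integers_add_pow_nonzero:
  fixes k :: nat
  assumes "Factorial_Ring.prime p" "k > 0"
  shows "[k] \<cdot>\<^bsub>padic_integers p\<^esub> \<one>\<^bsub>padic_integers p\<^esub> \<noteq> \<zero>\<^bsub>padic_integers p\<^esub>"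
proof -
  have "k < p ^ k"
    using power_gt_expt[of p k] assms(1) prime_gt_1_nat[of p] by simp
  then have "int k mod int p ^ k = int k"
    by (metis of_nat_less_iff of_nat_power mod_pos_pos_trivial of_nat_0_le_iff)
  then have "([k] \<cdot>\<^bsub>padic_integers p\<^esub> \<one>\<^bsub>padic_integers p\<^esub>) k \<noteq> \<zero>\<^bsub>padic_integers p\<^esub> k"
    using assms padic_integers_add_pow[of p k] prime_gt_0_nat[of p] by (simp add: padic_integers_def)
  then show ?thesis by (rule contrapos_nn) simp
qed

section \<open>The field of fractions\<close>

context domain
begin

abbreviation frac where "frac \<equiv> fraction R"
abbreviation Frac where "Frac \<equiv> fraction_field R"
abbreviation dens where "dens \<equiv> carrier R - {\<zero>}"

text \<open>Transitivity is where the domain enters: the middle denominator is nonzero and can be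
  cancelled.\<close>

lemma equiv_fraction_rel: "equiv (carrier R \<times> dens) (fraction_rel R)"
proof (rule equivI)
  show "trans (fraction_rel R)"
  proof (rule transI)
    fix x y z assume xy: "(x, y) \<in> fraction_rel R" and yz: "(y, z) \<in> fraction_rel R"
    obtain a s where [simp]: "x = (a, s)" by (cases x)
    obtain b t where [simp]: "y = (b, t)" by (cases y)
    obtain c u where [simp]: "z = (c, u)" by (cases z)
    have cl: "a \<in> carrier R" "s \<in> dens" "b \<in> carrier R" "t \<in> dens" "c \<in> carrier R" "u \<in> dens"
      and e: "a \<otimes> t = b \<otimes> s" "b \<otimes> u = c \<otimes> t"
      using xy yz unfolding fraction_rel_def by simp_all
    have "t \<otimes> (a \<otimes> u) = (a \<otimes> t) \<otimes> u" using cl by (simp add: m_ac)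
    also have "\<dots> = (b \<otimes> s) \<otimes> u" by (simp only: e(1))
    also have "\<dots> = s \<otimes> (b \<otimes> u)" using cl by (simp add: m_ac)
    also have "\<dots> = s \<otimes> (c \<otimes> t)" by (simp only: e(2))
    also have "\<dots> = t \<otimes> (c \<otimes> s)" using cl by (simp add: m_ac)
    finally have "a \<otimes> u = c \<otimes> s" using cl m_lcancel[of t "a \<otimes> u" "c \<otimes> s"] by simp
    then show "(x, z) \<in> fraction_rel R" using cl by (simp add: fraction_rel_def)
  qed
  show "sym (fraction_rel R)"
    by (rule symI) (clarsimp simp: fraction_rel_def)
  show "refl_on (carrier R \<times> dens) (fraction_rel R)"
    by (rule refl_onI) (clarsimp simp: fraction_rel_def)
  show "fraction_rel R \<subseteq> (carrier R \<times> dens) \<times> (carrier R \<times> dens)"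
    by (auto simp: fraction_rel_def)
qed

lemma fraction_eq_iff:
  assumes "a \<in> carrier R" "s \<in> dens" "b \<in> carrier R" "t \<in> dens"
  shows "frac a s = frac b t \<longleftrightarrow> a \<otimes> t = b \<otimes> s"
  using eq_equiv_class_iff[OF equiv_fraction_rel, of "(a, s)" "(b, t)"] assms
  by (simp add: fraction_def fraction_rel_def)

lemma fraction_closed [simp]:
  assumes "a \<in> carrier R" "s \<in> dens"
  shows "frac a s \<in> carrier Frac"
  using assms by (auto simp: fraction_field_def fraction_def intro!: quotientI)

lemma fraction_cases:
  assumes "x \<in> carrier Frac"
  obtains a s where "a \<in> carrier R" "s \<in> dens" "x = frac a s"
  using assms by (auto simp: fraction_field_def fraction_def elim!: quotientE)

text \<open>The operations of \<open>fraction_field\<close> are unions over all representatives. A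
  union of a constant family is its value, so they can be computed on one pair once the term is
  known to respect the relation.\<close>

lemma UN_fraction:
  assumes "a \<in> carrier R" "s \<in> dens"
    and "\<And>b t. b \<in> carrier R \<Longrightarrow> t \<in> dens \<Longrightarrow> a \<otimes> t = b \<otimes> s \<Longrightarrow> f b t = f a s"
  shows "(\<Union>(b, t)\<in>frac a s. f b t) = f a s"
proof -
  have "f b t = f a s" if "(b, t) \<in> frac a s" for b t
  proof (rule assms(3))
    show "b \<in> carrier R" "t \<in> dens" "a \<otimes> t = b \<otimes> s"
      using that by (simp_all add: fraction_def fraction_rel_def)
  qed
  then have "\<forall>z\<in>frac a s. (case z of (b, t) \<Rightarrow> f b t) = f a s" by (simp add: split_paired_all)
  moreover have "(a, s) \<in> frac a s" using assms(1,2) by (simp add: fraction_def fraction_rel_def)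
  ultimately show ?thesis by (rule UN_constant_eq[rotated])
qed

lemma fraction_mult:
  assumes "a \<in> carrier R" "s \<in> dens" "b \<in> carrier R" "t \<in> dens"
  shows "frac a s \<otimes>\<^bsub>Frac\<^esub> frac b t = frac (a \<otimes> b) (s \<otimes> t)"
proof -
  have *: "frac (a' \<otimes> b') (s' \<otimes> t') = frac (a \<otimes> b) (s \<otimes> t)"
    if "a' \<in> carrier R" "s' \<in> dens" "a \<otimes> s' = a' \<otimes> s"
       "b' \<in> carrier R" "t' \<in> dens" "b \<otimes> t' = b' \<otimes> t" for a' s' b' t'
  proof -
    note cl = that(1,2,4,5) assms
    have "(a' \<otimes> b') \<otimes> (s \<otimes> t) = (a' \<otimes> s) \<otimes> (b' \<otimes> t)" using cl by (simp add: m_ac)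
    also have "\<dots> = (a \<otimes> s') \<otimes> (b \<otimes> t')" using that by simp
    also have "\<dots> = (a \<otimes> b) \<otimes> (s' \<otimes> t')" using cl by (simp add: m_ac)
    finally show ?thesis using cl by (subst fraction_eq_iff) (auto simp: integral_iff)
  qed
  \<comment> \<open>The outer union still runs over all pairs representing the first factor, so the
    inner union has to be collapsed for each of them and not only for (a, s).\<close>
  have inner: "(\<Union>(b', t')\<in>frac b t. frac (a' \<otimes> b') (s' \<otimes> t')) = frac (a' \<otimes> b) (s' \<otimes> t)"
    if "a' \<in> carrier R" "s' \<in> dens" "a \<otimes> s' = a' \<otimes> s" for a' s'
  proof (rule UN_fraction)
    fix b' t' assume "b' \<in> carrier R" "t' \<in> dens" "b \<otimes> t' = b' \<otimes> t"
    then show "frac (a' \<otimes> b') (s' \<otimes> t') = frac (a' \<otimes> b) (s' \<otimes> t)"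
      using *[OF that] *[OF that assms(3,4)] assms by simp
  qed (use assms in auto)
  have "(\<Union>(a', s')\<in>frac a s. \<Union>(b', t')\<in>frac b t. frac (a' \<otimes> b') (s' \<otimes> t')) =
      (\<Union>(b', t')\<in>frac b t. frac (a \<otimes> b') (s \<otimes> t'))"
    by (rule UN_fraction[OF assms(1,2)])
       (simp only: inner inner[OF assms(1,2) refl] *[OF _ _ _ assms(3,4) refl])
  also have "\<dots> = frac (a \<otimes> b) (s \<otimes> t)"
    by (rule inner[OF assms(1,2) refl])
  finally show ?thesis by (simp add: fraction_field_def)
qed

lemma fraction_add:
  assumes "a \<in> carrier R" "s \<in> dens" "b \<in> carrier R" "t \<in> dens"
  shows "frac a s \<oplus>\<^bsub>Frac\<^esub> frac b t = frac ((a \<otimes> t) \<oplus> (b \<otimes> s)) (s \<otimes> t)"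
proof -
  have *: "frac ((a' \<otimes> t') \<oplus> (b' \<otimes> s')) (s' \<otimes> t') = frac ((a \<otimes> t) \<oplus> (b \<otimes> s)) (s \<otimes> t)"
    if "a' \<in> carrier R" "s' \<in> dens" "a \<otimes> s' = a' \<otimes> s"
       "b' \<in> carrier R" "t' \<in> dens" "b \<otimes> t' = b' \<otimes> t" for a' s' b' t'
  proof -
    note cl = that(1,2,4,5) assms
    have "((a' \<otimes> t') \<oplus> (b' \<otimes> s')) \<otimes> (s \<otimes> t)
        = (a' \<otimes> s) \<otimes> (t' \<otimes> t) \<oplus> (b' \<otimes> t) \<otimes> (s \<otimes> s')"
      using cl by (simp add: m_ac l_distr r_distr)
    also have "\<dots> = (a \<otimes> s') \<otimes> (t' \<otimes> t) \<oplus> (b \<otimes> t') \<otimes> (s \<otimes> s')" using that by simp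
    also have "\<dots> = ((a \<otimes> t) \<oplus> (b \<otimes> s)) \<otimes> (s' \<otimes> t')"
      using cl by (simp add: m_ac l_distr r_distr)
    finally show ?thesis using cl by (subst fraction_eq_iff) (auto simp: integral_iff)
  qed
  have inner: "(\<Union>(b', t')\<in>frac b t. frac ((a' \<otimes> t') \<oplus> (b' \<otimes> s')) (s' \<otimes> t')) =
      frac ((a' \<otimes> t) \<oplus> (b \<otimes> s')) (s' \<otimes> t)"
    if "a' \<in> carrier R" "s' \<in> dens" "a \<otimes> s' = a' \<otimes> s" for a' s'
  proof (rule UN_fraction)
    fix b' t' assume "b' \<in> carrier R" "t' \<in> dens" "b \<otimes> t' = b' \<otimes> t"
    then show "frac ((a' \<otimes> t') \<oplus> (b' \<otimes> s')) (s' \<otimes> t') = frac ((a' \<otimes> t) \<oplus> (b \<otimes> s')) (s' \<otimes> t)"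
      using *[OF that] *[OF that assms(3,4)] assms by simp
  qed (use assms in auto)
  have "(\<Union>(a', s')\<in>frac a s. \<Union>(b', t')\<in>frac b t.
        frac ((a' \<otimes> t') \<oplus> (b' \<otimes> s')) (s' \<otimes> t')) =
      (\<Union>(b', t')\<in>frac b t. frac ((a \<otimes> t') \<oplus> (b' \<otimes> s)) (s \<otimes> t'))"
    by (rule UN_fraction[OF assms(1,2)])
       (simp only: inner inner[OF assms(1,2) refl] *[OF _ _ _ assms(3,4) refl])
  also have "\<dots> = frac ((a \<otimes> t) \<oplus> (b \<otimes> s)) (s \<otimes> t)"
    by (rule inner[OF assms(1,2) refl])
  finally show ?thesis by (simp add: fraction_field_def)
qed

lemma fraction_smult:
  assumes "r \<in> carrier R" "a \<in> carrier R" "s \<in> dens"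
  shows "r \<odot>\<^bsub>Frac\<^esub> frac a s = frac (r \<otimes> a) s"
proof -
  have "(\<Union>(a', s')\<in>frac a s. frac (r \<otimes> a') s') = frac (r \<otimes> a) s"
  proof (rule UN_fraction)
    fix b t assume bt: "b \<in> carrier R" "t \<in> dens" "a \<otimes> t = b \<otimes> s"
    have "(r \<otimes> b) \<otimes> s = r \<otimes> (b \<otimes> s)" using assms bt(1,2) by (simp add: m_ac)
    also have "\<dots> = r \<otimes> (a \<otimes> t)" using bt by simp
    also have "\<dots> = (r \<otimes> a) \<otimes> t" using assms bt(1,2) by (simp add: m_ac)
    finally show "frac (r \<otimes> b) t = frac (r \<otimes> a) s"
      using assms bt(1,2) by (subst fraction_eq_iff) auto
  qed (use assms in auto)
  then show ?thesis by (simp add: fraction_field_def)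
qed

lemma fraction_zero: "\<zero>\<^bsub>Frac\<^esub> = frac \<zero> \<one>" and fraction_one: "\<one>\<^bsub>Frac\<^esub> = frac \<one> \<one>"
  by (simp_all add: fraction_field_def)

lemma fraction_eq_zero_iff:
  assumes "a \<in> carrier R" "s \<in> dens"
  shows "frac a s = \<zero>\<^bsub>Frac\<^esub> \<longleftrightarrow> a = \<zero>"
  using assms by (simp add: fraction_zero fraction_eq_iff)

lemma cring_Frac: "cring Frac"
proof (rule cringI)
  show "abelian_group Frac"
  proof (rule abelian_groupI)
    fix x y z assume "x \<in> carrier Frac" "y \<in> carrier Frac" "z \<in> carrier Frac"
    then show "x \<oplus>\<^bsub>Frac\<^esub> y \<oplus>\<^bsub>Frac\<^esub> z = x \<oplus>\<^bsub>Frac\<^esub> (y \<oplus>\<^bsub>Frac\<^esub> z)"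
      by (elim fraction_cases)
         (simp add: fraction_add integral_iff l_distr r_distr m_ac a_ac)
  next
    fix x y assume "x \<in> carrier Frac" "y \<in> carrier Frac"
    then show "x \<oplus>\<^bsub>Frac\<^esub> y = y \<oplus>\<^bsub>Frac\<^esub> x"
      by (elim fraction_cases) (simp add: fraction_add fraction_eq_iff integral_iff m_ac a_ac)
  next
    fix x assume "x \<in> carrier Frac"
    then obtain a s where *: "a \<in> carrier R" "s \<in> dens" "x = frac a s" by (rule fraction_cases)
    then have "frac (\<ominus> a) s \<oplus>\<^bsub>Frac\<^esub> x = \<zero>\<^bsub>Frac\<^esub>"
      by (simp add: fraction_add fraction_zero fraction_eq_iff integral_iff l_minus l_neg)
    then show "\<exists>y\<in>carrier Frac. y \<oplus>\<^bsub>Frac\<^esub> x = \<zero>\<^bsub>Frac\<^esub>"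
      using * by (meson a_inv_closed fraction_closed)
  next
    fix x y assume "x \<in> carrier Frac" "y \<in> carrier Frac"
    then show "x \<oplus>\<^bsub>Frac\<^esub> y \<in> carrier Frac"
      by (elim fraction_cases) (simp add: fraction_add fraction_closed integral_iff)
  qed (auto elim!: fraction_cases simp: fraction_add fraction_zero integral_iff)
  show "comm_monoid Frac"
  proof (rule comm_monoidI)
    fix x y z assume "x \<in> carrier Frac" "y \<in> carrier Frac" "z \<in> carrier Frac"
    then show "x \<otimes>\<^bsub>Frac\<^esub> y \<otimes>\<^bsub>Frac\<^esub> z = x \<otimes>\<^bsub>Frac\<^esub> (y \<otimes>\<^bsub>Frac\<^esub> z)"
      by (elim fraction_cases) (simp add: fraction_mult integral_iff m_ac)
  next
    fix x y assume "x \<in> carrier Frac" "y \<in> carrier Frac"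
    then show "x \<otimes>\<^bsub>Frac\<^esub> y = y \<otimes>\<^bsub>Frac\<^esub> x"
      by (elim fraction_cases) (simp add: fraction_mult m_ac)
  next
    fix x y assume "x \<in> carrier Frac" "y \<in> carrier Frac"
    then show "x \<otimes>\<^bsub>Frac\<^esub> y \<in> carrier Frac"
      by (elim fraction_cases) (simp add: fraction_mult integral_iff)
  qed (auto elim!: fraction_cases simp: fraction_mult fraction_one)
  fix x y z assume "x \<in> carrier Frac" "y \<in> carrier Frac" "z \<in> carrier Frac"
  then show "(x \<oplus>\<^bsub>Frac\<^esub> y) \<otimes>\<^bsub>Frac\<^esub> z = x \<otimes>\<^bsub>Frac\<^esub> z \<oplus>\<^bsub>Frac\<^esub> y \<otimes>\<^bsub>Frac\<^esub> z"
    by (elim fraction_cases)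
       (simp add: fraction_add fraction_mult fraction_eq_iff integral_iff l_distr r_distr m_ac a_ac)
qed

lemma fraction_inverse:
  assumes "a \<in> dens" "s \<in> dens"
  shows "frac a s \<otimes>\<^bsub>Frac\<^esub> frac s a = \<one>\<^bsub>Frac\<^esub>"
  using assms by (simp add: fraction_mult fraction_one fraction_eq_iff integral_iff m_ac)

lemma field_Frac: "Ring.field Frac"
proof -
  interpret F: cring Frac by (rule cring_Frac)
  show ?thesis
  proof (rule F.cring_fieldI2)
    show "\<zero>\<^bsub>Frac\<^esub> \<noteq> \<one>\<^bsub>Frac\<^esub>" by (simp add: fraction_zero fraction_one fraction_eq_iff)
    fix x assume x: "x \<in> carrier Frac" "x \<noteq> \<zero>\<^bsub>Frac\<^esub>"
    then obtain a s where *: "a \<in> carrier R" "s \<in> dens" "x = frac a s" by (meson fraction_cases)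
    then have "a \<in> dens" using x by (auto simp: fraction_eq_zero_iff)
    then show "\<exists>b\<in>carrier Frac. x \<otimes>\<^bsub>Frac\<^esub> b = \<one>\<^bsub>Frac\<^esub>"
      using * fraction_inverse by (metis DiffD1 fraction_closed)
  qed
qed

lemma module_Frac: "Module.module R Frac"
proof (rule moduleI)
  show "abelian_group Frac" using cring_Frac by (simp add: cring.axioms ring.is_abelian_group)
  fix r r' x y assume "r \<in> carrier R" "r' \<in> carrier R" "x \<in> carrier Frac" "y \<in> carrier Frac"
  then show "(r \<oplus> r') \<odot>\<^bsub>Frac\<^esub> x = r \<odot>\<^bsub>Frac\<^esub> x \<oplus>\<^bsub>Frac\<^esub> r' \<odot>\<^bsub>Frac\<^esub> x"
    and "r \<odot>\<^bsub>Frac\<^esub> (x \<oplus>\<^bsub>Frac\<^esub> y) = r \<odot>\<^bsub>Frac\<^esub> x \<oplus>\<^bsub>Frac\<^esub> r \<odot>\<^bsub>Frac\<^esub> y"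
    by (elim fraction_cases,
        simp add: fraction_smult fraction_add fraction_eq_iff integral_iff l_distr r_distr m_ac)+
next
  fix r x assume "r \<in> carrier R" "x \<in> carrier Frac"
  then show "r \<odot>\<^bsub>Frac\<^esub> x \<in> carrier Frac"
    by (elim fraction_cases) (simp add: fraction_smult)
qed (auto elim!: fraction_cases simp: fraction_smult is_cring m_ac)

text \<open>The remaining axiom that makes the fraction field an R-algebra, as required for
  extending scalars to it.\<close>

lemma Frac_smult_assoc:
  assumes "r \<in> carrier R" "x \<in> carrier Frac" "y \<in> carrier Frac"
  shows "(r \<odot>\<^bsub>Frac\<^esub> x) \<otimes>\<^bsub>Frac\<^esub> y = r \<odot>\<^bsub>Frac\<^esub> (x \<otimes>\<^bsub>Frac\<^esub> y)"
  using assms by (auto elim!: fraction_cases simp: fraction_smult fraction_mult m_ac integral_iff)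

lemma fraction_add_pow:
  "add_pow Frac k \<one>\<^bsub>Frac\<^esub> = frac (add_pow R (k::nat) \<one>) \<one>"
proof -
  interpret F: cring Frac by (rule cring_Frac)
  show ?thesis
    by (induction k) (simp_all add: fraction_zero fraction_one fraction_add)
qed

end

text \<open>\<open>rat_in\<close> reads off the reduced fraction a/b, whereas indices come as
  quotients m/n of cardinalities. The two are linked by m b = a n, an identity of natural numbers
  that can be transported to the field and divided by the nonzero images of n and b.\<close>

lemma (in field) rat_in_div:
  assumes char0: "\<And>k::nat. k > 0 \<Longrightarrow> add_pow R k \<one> \<noteq> \<zero>" and "n > 0"
  shows "rat_in R (of_nat m / of_nat n) = (add_pow R m \<one>) \<otimes> inv (add_pow R n \<one>)"
proof -
  obtain a b where q: "quotient_of (of_nat m / of_nat n) = (a, b)" by (metis surj_pair)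
  have b: "b > 0" using quotient_of_denom_pos[OF q] .
  have e: "of_nat m / of_nat n = (of_int a / of_int b :: rat)" using quotient_of_div[OF q] .
  then have "(of_int (int m * b) :: rat) = of_int (a * int n)"
    using b \<open>n > 0\<close> by (simp add: field_simps)
  then have mb: "int m * b = a * int n" by (simp only: of_int_eq_iff)
  moreover have "0 \<le> int m * b" using b by simp
  ultimately have "a \<ge> 0" using \<open>n > 0\<close> by (simp add: zero_le_mult_iff)
  define a' where "a' = nat a"
  define b' where "b' = nat b"
  have ab: "a = int a'" "b = int b'" "b' > 0"
    using b \<open>a \<ge> 0\<close> by (simp_all add: a'_def b'_def)
  have eq: "m * b' = a' * n" using mb ab by (metis of_nat_eq_iff of_nat_mult)
  have mult: "(add_pow R k \<one>) \<otimes> (add_pow R l \<one>) = add_pow R (k * l) \<one>" for k l :: nat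
    by (simp add: add_pow_ldistr add.nat_pow_pow mult.commute)
  have U: "add_pow R n \<one> \<in> Units R" "add_pow R b' \<one> \<in> Units R"
    using char0 \<open>n > 0\<close> ab by (auto simp: field_Units)
  have "(add_pow R a' \<one>) \<otimes> inv (add_pow R b' \<one>)
      = (add_pow R a' \<one>) \<otimes> ((add_pow R n \<one>) \<otimes> inv (add_pow R n \<one>)) \<otimes> inv (add_pow R b' \<one>)" using U by simp
  also have "\<dots> = ((add_pow R a' \<one>) \<otimes> (add_pow R n \<one>)) \<otimes> inv (add_pow R n \<one>) \<otimes> inv (add_pow R b' \<one>)"
    using U by (simp add: m_assoc)
  also have "\<dots> = ((add_pow R m \<one>) \<otimes> (add_pow R b' \<one>)) \<otimes> inv (add_pow R n \<one>) \<otimes> inv (add_pow R b' \<one>)"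
    by (simp only: mult eq)
  also have "\<dots> = (add_pow R m \<one>) \<otimes> inv (add_pow R n \<one>) \<otimes> ((add_pow R b' \<one>) \<otimes> inv (add_pow R b' \<one>))"
    using U by (simp add: m_ac del: Units_r_inv)
  finally show ?thesis using U q ab by (simp add: rat_in_def add_pow_int_ge)
qed

section \<open>Tensor products\<close>

text \<open>The map \<open>f \<otimes> k\<close> on representatives; both \<^const>\<open>tensor_map\<close> and the scalar
  multiplication of \<^const>\<open>tensor\<close> are instances.\<close>

definition frag_pair :: "('m \<Rightarrow> 'n) \<Rightarrow> ('a \<Rightarrow> 'b) \<Rightarrow> ('m \<times> 'a \<Rightarrow>\<^sub>0 int) \<Rightarrow> ('n \<times> 'b \<Rightarrow>\<^sub>0 int)" where
  "frag_pair f k = frag_extend (\<lambda>(x, a). frag_of (f x, k a))"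

lemma frag_pair_of [simp]: "frag_pair f k (frag_of (x, a)) = frag_of (f x, k a)"
  by (simp add: frag_pair_def)

lemma frag_pair_diff: "frag_pair f k (z - w) = frag_pair f k z - frag_pair f k w"
  by (simp add: frag_pair_def frag_extend_diff)

lemma frag_pair_add: "frag_pair f k (z + w) = frag_pair f k z + frag_pair f k w"
  by (simp add: frag_pair_def frag_extend_add)

lemma frag_pair_zero [simp]: "frag_pair f k 0 = 0"
  by (simp add: frag_pair_def)

lemma keys_frag_pair:
  assumes "Poly_Mapping.keys z \<subseteq> S \<times> U" "f \<in> S \<rightarrow> S'" "k \<in> U \<rightarrow> U'"
  shows "Poly_Mapping.keys (frag_pair f k z) \<subseteq> S' \<times> U'"
  using assms(1)
proof (induction z rule: free_Abelian_group_induct [consumes 1, case_names zero diff gen])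
  case (diff x y)
  then show ?case using keys_diff[of "frag_pair f k x" "frag_pair f k y"]
    by (auto simp: frag_pair_diff)
qed (use assms in auto)

locale scalar_extension = A?: algebra R A
  for R :: "('r, 'x) ring_scheme" (structure) and A :: "('r, 'a, 'z) module_scheme"
begin

abbreviation tker where "tker M \<equiv> generate (tensor_free M A) (tensor_relations R M A)"
abbreviation tcls where "tcls M \<equiv> tensor_class R M A"
abbreviation tns where "tns M \<equiv> tensor R M A"
abbreviation frags where "frags M \<equiv> carrier (tensor_free M A)"

lemma frags_iff: "z \<in> frags M \<longleftrightarrow> Poly_Mapping.keys z \<subseteq> carrier M \<times> carrier A"
  by (simp add: tensor_free_def)

lemma frags_of: "x \<in> carrier M \<Longrightarrow> a \<in> carrier A \<Longrightarrow> frag_of (x, a) \<in> frags M"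
  by (simp add: frags_iff)

lemma frags_zero [simp]: "0 \<in> frags M"
  by (simp add: frags_iff)

lemma frags_minus: "z \<in> frags M \<Longrightarrow> - z \<in> frags M"
  by (simp add: frags_iff)

lemma frags_diff: "z \<in> frags M \<Longrightarrow> w \<in> frags M \<Longrightarrow> z - w \<in> frags M"
  using keys_diff[of z w] by (auto simp: frags_iff)

lemma frags_add: "z \<in> frags M \<Longrightarrow> w \<in> frags M \<Longrightarrow> z + w \<in> frags M"
  using keys_add[of z w] by (auto simp: frags_iff)

lemma tensor_relations_incl:
  assumes "Module.module R M"
  shows "tensor_relations R M A \<subseteq> frags M"
proof -
  interpret M: Module.module R M by (rule assms)
  show ?thesis
    by (auto simp: tensor_relations_def intro!: frags_diff frags_of)
qed

lemma tker_relation: "z \<in> tensor_relations R M A \<Longrightarrow> z \<in> tker M"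
  by (rule generate.incl)

lemma tker_zero: "0 \<in> tker M"
  using generate.one[of "tensor_free M A" "tensor_relations R M A"] by (simp add: tensor_free_def)

lemma tker_add: "z \<in> tker M \<Longrightarrow> w \<in> tker M \<Longrightarrow> z + w \<in> tker M"
  using generate.eng[of z "tensor_free M A" "tensor_relations R M A" w] by (simp add: tensor_free_def)

lemma tker_incl:
  assumes "Module.module R M"
  shows "tker M \<subseteq> frags M"
  using group.generate_incl[of "tensor_free M A"] tensor_relations_incl[OF assms]
  by (simp add: tensor_free_def)

lemma tker_minus:
  assumes "Module.module R M" "z \<in> tker M"
  shows "- z \<in> tker M"
proof -
  have "inv\<^bsub>tensor_free M A\<^esub> z \<in> tker M"
    using group.generate_m_inv_closed[of "tensor_free M A"] tensor_relations_incl[OF assms(1)] assms(2)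
    by (simp add: tensor_free_def)
  then show ?thesis
    using tker_incl[OF assms(1)] assms(2) by (auto simp: frags_iff tensor_free_def)
qed

lemma tker_diff:
  assumes "Module.module R M" "z \<in> tker M" "w \<in> tker M"
  shows "z - w \<in> tker M"
  using tker_add[OF assms(2) tker_minus[OF assms(1,3)]] by simp

text \<open>Additive form of the induction for \<open>generate\<close>. Inverses are introduced for
  generators only, so the minus case concerns relations and not arbitrary members of the
  kernel.\<close>

lemma tker_induct [consumes 2, case_names relation zero add minus]:
  assumes "Module.module R M" "z \<in> tker M"
    and "\<And>z. z \<in> tensor_relations R M A \<Longrightarrow> P z"
    and "P 0"
    and "\<And>z w. z \<in> tker M \<Longrightarrow> w \<in> tker M \<Longrightarrow> P z \<Longrightarrow> P w \<Longrightarrow> P (z + w)"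
    and "\<And>z. z \<in> tensor_relations R M A \<Longrightarrow> P (- z)"
  shows "P z"
  using assms(2)
proof induction
  case (inv h)
  have "h \<in> frags M" using inv tensor_relations_incl[OF assms(1)] by blast
  then have "inv\<^bsub>tensor_free M A\<^esub> h = - h" by (simp add: frags_iff) (simp add: tensor_free_def)
  then show ?case using assms(6)[OF inv] by simp
next
  case (eng h1 h2)
  then show ?case using assms(5) by (simp add: tensor_free_def)
qed (use assms in \<open>simp_all add: tensor_free_def\<close>)

text \<open>Turns cosets into conditions on differences, the form in which tensors are compared from
  here on.\<close>

lemma tensor_class_eq: "tcls M z = {w. w - z \<in> tker M}"
proof -
  have "w \<in> tcls M z \<longleftrightarrow> w - z \<in> tker M" for w
    unfolding tensor_class_def r_coset_def
    by (auto simp: tensor_free_def) (metis diff_add_cancel)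
  then show ?thesis by blast
qed

lemma tensor_class_self: "z \<in> tcls M z"
  by (simp add: tensor_class_eq tker_zero)

lemma tensor_class_eq_iff:
  assumes "Module.module R M"
  shows "tcls M z = tcls M w \<longleftrightarrow> z - w \<in> tker M"
proof
  assume "z - w \<in> tker M"
  have "v - z \<in> tker M \<longleftrightarrow> v - w \<in> tker M" for v
    using tker_add[OF _ \<open>z - w \<in> tker M\<close>, of "v - z"]
      tker_diff[OF assms _ \<open>z - w \<in> tker M\<close>, of "v - w"] by auto
  then show "tcls M z = tcls M w" by (simp add: tensor_class_eq)
next
  assume "tcls M z = tcls M w"
  then show "z - w \<in> tker M" using tensor_class_self[of z M] by (simp add: tensor_class_eq)
qed

lemma carrier_tensor: "carrier (tns M) = tcls M ` frags M"
  unfolding tensor_def FactGroup_def RCOSETS_def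
  by (auto simp: tensor_class_def)

lemma zero_tensor: "\<zero>\<^bsub>tns M\<^esub> = tcls M 0"
  by (simp add: tensor_def)

lemma add_tensor:
  assumes "Module.module R M"
  shows "tcls M z \<oplus>\<^bsub>tns M\<^esub> tcls M w = tcls M (z + w)"
proof -
  have "v \<in> tcls M z <#>\<^bsub>tensor_free M A\<^esub> tcls M w \<longleftrightarrow> v \<in> tcls M (z + w)" for v
  proof
    assume "v \<in> tcls M z <#>\<^bsub>tensor_free M A\<^esub> tcls M w"
    then obtain a b where ab: "a - z \<in> tker M" "b - w \<in> tker M" "v = a + b"
      by (auto simp: set_mult_def tensor_class_eq tensor_free_def)
    then have "v - (z + w) = (a - z) + (b - w)" by simp
    then show "v \<in> tcls M (z + w)"
      using tker_add[OF ab(1,2)] by (simp only: tensor_class_eq mem_Collect_eq)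
  next
    assume "v \<in> tcls M (z + w)"
    then have "(v - w) - z \<in> tker M" by (simp add: tensor_class_eq algebra_simps)
    then have "v - w \<in> tcls M z" "w \<in> tcls M w" "v = (v - w) \<otimes>\<^bsub>tensor_free M A\<^esub> w"
      by (simp_all add: tensor_class_eq tker_zero) (simp add: tensor_free_def)
    then show "v \<in> tcls M z <#>\<^bsub>tensor_free M A\<^esub> tcls M w"
      unfolding set_mult_def by blast
  qed
  then show ?thesis by (auto simp: tensor_def)
qed

lemma abelian_group_tensor:
  assumes "Module.module R M"
  shows "abelian_group (tns M)"
proof (rule abelian_groupI)
  show "\<exists>y\<in>carrier (tns M). y \<oplus>\<^bsub>tns M\<^esub> x = \<zero>\<^bsub>tns M\<^esub>" if x: "x \<in> carrier (tns M)" for x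
  proof -
    obtain z where z: "z \<in> frags M" "x = tcls M z" using x by (auto simp: carrier_tensor)
    then have "tcls M (- z) \<in> carrier (tns M)" by (auto simp: carrier_tensor frags_minus)
    moreover have "tcls M (- z) \<oplus>\<^bsub>tns M\<^esub> x = \<zero>\<^bsub>tns M\<^esub>"
      by (simp add: z add_tensor[OF assms] zero_tensor)
    ultimately show ?thesis by blast
  qed
qed (auto simp: carrier_tensor add_tensor[OF assms] zero_tensor ac_simps intro!: imageI frags_add)

text \<open>Both f and k are R-linear, so f tensor k maps each of the three kinds of relations to a
  relation of the same kind and hence kernel to kernel. With f the identity and k a multiplication
  this gives scalar multiplication; with k the identity it gives \<open>tensor_map\<close>.\<close>

lemma UN_frag_pair:
  assumes M: "Module.module R M" and M': "Module.module R M'"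
    and f: "linear_map R M M' f" and k: "linear_map R A A k"
    and z: "z \<in> frags M"
  shows "(\<Union>w\<in>tcls M z. tcls M' (frag_pair f k w)) = tcls M' (frag_pair f k z)"
proof -
  interpret M: Module.module R M by (rule M)
  have f': "\<And>x. x \<in> carrier M \<Longrightarrow> f x \<in> carrier M'" and k': "\<And>a. a \<in> carrier A \<Longrightarrow> k a \<in> carrier A"
    using f k by (auto simp: linear_map_def)
  have rel: "frag_pair f k w \<in> tker M'" if "w \<in> tensor_relations R M A" for w
    using that[unfolded tensor_relations_def]
  proof (elim UnE CollectE exE conjE)
    fix x y a assume "w = frag_of (x \<oplus>\<^bsub>M\<^esub> y, a) - frag_of (x, a) - frag_of (y, a)"
      and *: "x \<in> carrier M" "y \<in> carrier M" "a \<in> carrier A"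
    then have "frag_pair f k w = frag_of (f x \<oplus>\<^bsub>M'\<^esub> f y, k a) - frag_of (f x, k a) - frag_of (f y, k a)"
      using f by (simp add: frag_pair_diff linear_map_def)
    then have "frag_pair f k w \<in> tensor_relations R M' A"
      unfolding tensor_relations_def using * f' k' by blast
    then show ?thesis by (rule tker_relation)
  next
    fix x a b assume "w = frag_of (x, a \<oplus>\<^bsub>A\<^esub> b) - frag_of (x, a) - frag_of (x, b)"
      and *: "x \<in> carrier M" "a \<in> carrier A" "b \<in> carrier A"
    then have "frag_pair f k w = frag_of (f x, k a \<oplus>\<^bsub>A\<^esub> k b) - frag_of (f x, k a) - frag_of (f x, k b)"
      using k by (simp add: frag_pair_diff linear_map_def)
    then have "frag_pair f k w \<in> tensor_relations R M' A"
      unfolding tensor_relations_def using * f' k' by blast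
    then show ?thesis by (rule tker_relation)
  next
    fix r x a assume "w = frag_of (r \<odot>\<^bsub>M\<^esub> x, a) - frag_of (x, r \<odot>\<^bsub>A\<^esub> a)"
      and *: "r \<in> carrier R" "x \<in> carrier M" "a \<in> carrier A"
    then have "frag_pair f k w = frag_of (r \<odot>\<^bsub>M'\<^esub> f x, k a) - frag_of (f x, r \<odot>\<^bsub>A\<^esub> k a)"
      using f k by (simp add: frag_pair_diff linear_map_def)
    then have "frag_pair f k w \<in> tensor_relations R M' A"
      unfolding tensor_relations_def using * f' k' by blast
    then show ?thesis by (rule tker_relation)
  qed
  have neg: "frag_pair f k (- w) = - frag_pair f k w" for w
    using frag_pair_diff[of f k 0 w] by simp
  have ker: "frag_pair f k w \<in> tker M'" if "w \<in> tker M" for w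
    using M that
    by (induction rule: tker_induct) (auto simp: rel tker_zero frag_pair_add tker_add neg tker_minus[OF M'])
  have "tcls M' (frag_pair f k w) = tcls M' (frag_pair f k z)" if "w \<in> tcls M z" for w
    using ker[of "w - z"] that
    by (simp add: tensor_class_eq_iff[OF M'] frag_pair_diff) (simp add: tensor_class_eq)
  then show ?thesis
    by (intro UN_constant_eq[OF tensor_class_self]) blast
qed

lemma linear_map_id: "Module.module R M \<Longrightarrow> linear_map R M M (\<lambda>x. x)"
  by (simp add: linear_map_def)

lemma linear_map_mult:
  assumes "b \<in> carrier A"
  shows "linear_map R A A (\<lambda>a. b \<otimes>\<^bsub>A\<^esub> a)"
  using assms smult_assoc2 by (auto simp: linear_map_def A.r_distr A.m_comm)

lemma smult_tensor:
  assumes "Module.module R M" "b \<in> carrier A" "z \<in> frags M"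
  shows "b \<odot>\<^bsub>tns M\<^esub> tcls M z = tcls M (frag_pair (\<lambda>x. x) (\<lambda>a. b \<otimes>\<^bsub>A\<^esub> a) z)"
  using UN_frag_pair[OF assms(1,1) linear_map_id linear_map_mult assms(3)] assms
  by (simp add: tensor_def frag_pair_def)

lemma tensor_map_class:
  assumes "Module.module R M" "Module.module R M'" "linear_map R M M' f" "z \<in> frags M"
  shows "tensor_map R M' A f (tcls M z) = tcls M' (frag_pair f (\<lambda>a. a) z)"
  using UN_frag_pair[OF assms(1,2,3) _ assms(4), of "\<lambda>a. a"] linear_map_id[OF module_axioms]
  by (simp add: tensor_map_def frag_pair_def)

abbreviation ptens where "ptens M \<equiv> pure_tensor R M A"

lemma pure_tensor_closed: "x \<in> carrier M \<Longrightarrow> a \<in> carrier A \<Longrightarrow> ptens M x a \<in> carrier (tns M)"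
  by (auto simp: pure_tensor_def carrier_tensor frags_of)

lemma pure_tensor_add_left:
  assumes "Module.module R M" "x \<in> carrier M" "y \<in> carrier M" "a \<in> carrier A"
  shows "ptens M (x \<oplus>\<^bsub>M\<^esub> y) a = ptens M x a \<oplus>\<^bsub>tns M\<^esub> ptens M y a"
proof -
  have "frag_of (x \<oplus>\<^bsub>M\<^esub> y, a) - frag_of (x, a) - frag_of (y, a) \<in> tensor_relations R M A"
    using assms unfolding tensor_relations_def by blast
  then have "frag_of (x \<oplus>\<^bsub>M\<^esub> y, a) - (frag_of (x, a) + frag_of (y, a)) \<in> tker M"
    using tker_relation by (metis diff_diff_eq)
  then show ?thesis
    by (simp add: pure_tensor_def add_tensor[OF assms(1)] tensor_class_eq_iff[OF assms(1)])
qed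

lemma pure_tensor_add_right:
  assumes "Module.module R M" "x \<in> carrier M" "a \<in> carrier A" "b \<in> carrier A"
  shows "ptens M x (a \<oplus>\<^bsub>A\<^esub> b) = ptens M x a \<oplus>\<^bsub>tns M\<^esub> ptens M x b"
proof -
  have "frag_of (x, a \<oplus>\<^bsub>A\<^esub> b) - frag_of (x, a) - frag_of (x, b) \<in> tensor_relations R M A"
    using assms unfolding tensor_relations_def by blast
  then have "frag_of (x, a \<oplus>\<^bsub>A\<^esub> b) - (frag_of (x, a) + frag_of (x, b)) \<in> tker M"
    using tker_relation by (metis diff_diff_eq)
  then show ?thesis
    by (simp add: pure_tensor_def add_tensor[OF assms(1)] tensor_class_eq_iff[OF assms(1)])
qed

lemma pure_tensor_smult:
  assumes "Module.module R M" "r \<in> carrier R" "x \<in> carrier M" "a \<in> carrier A"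
  shows "ptens M (r \<odot>\<^bsub>M\<^esub> x) a = ptens M x (r \<odot>\<^bsub>A\<^esub> a)"
proof -
  have "frag_of (r \<odot>\<^bsub>M\<^esub> x, a) - frag_of (x, r \<odot>\<^bsub>A\<^esub> a) \<in> tensor_relations R M A"
    using assms unfolding tensor_relations_def by blast
  then show ?thesis
    by (simp add: pure_tensor_def tensor_class_eq_iff[OF assms(1)] tker_relation)
qed

lemma smult_pure_tensor:
  assumes "Module.module R M" "x \<in> carrier M" "a \<in> carrier A" "b \<in> carrier A"
  shows "b \<odot>\<^bsub>tns M\<^esub> ptens M x a = ptens M x (b \<otimes>\<^bsub>A\<^esub> a)"
  unfolding pure_tensor_def by (subst smult_tensor) (use assms in \<open>auto simp: frags_of\<close>)

lemma tensor_map_pure: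
  assumes "Module.module R M" "Module.module R M'" "linear_map R M M' f"
    "x \<in> carrier M" "a \<in> carrier A"
  shows "tensor_map R M' A f (ptens M x a) = ptens M' (f x) a"
  unfolding pure_tensor_def by (subst tensor_map_class[where M=M]) (use assms in \<open>auto simp: frags_of\<close>)

lemma minus_tensor:
  assumes M: "Module.module R M" and "z \<in> frags M" "w \<in> frags M"
  shows "tcls M z \<ominus>\<^bsub>tns M\<^esub> tcls M w = tcls M (z - w)"
proof -
  interpret T: abelian_group "tns M" by (rule abelian_group_tensor[OF M])
  have cl: "tcls M z \<in> carrier (tns M)" if "z \<in> frags M" for z using that by (auto simp: carrier_tensor)
  have "tcls M (z - w) \<oplus>\<^bsub>tns M\<^esub> tcls M w = tcls M z" by (simp add: add_tensor[OF M])
  then show ?thesis using cl[OF assms(2)] cl[OF assms(3)] cl[OF frags_diff[OF assms(2,3)]]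
    by (metis T.add.inv_solve_right' a_minus_def)
qed

text \<open>The free abelian group is generated from its basis by differences, so pure tensors and
  differences suffice; no separate case for zero remains.\<close>

lemma tensor_induct [consumes 2, case_names pure diff]:
  assumes M: "Module.module R M" and u: "u \<in> carrier (tns M)"
    and pure: "\<And>x a. x \<in> carrier M \<Longrightarrow> a \<in> carrier A \<Longrightarrow> P (ptens M x a)"
    and diff: "\<And>u v. u \<in> carrier (tns M) \<Longrightarrow> v \<in> carrier (tns M) \<Longrightarrow> P u \<Longrightarrow> P v \<Longrightarrow> P (u \<ominus>\<^bsub>tns M\<^esub> v)"
  shows "P u"
proof -
  interpret M: Module.module R M by (rule M)
  have cl: "tcls M z \<in> carrier (tns M)" if "z \<in> frags M" for z using that by (auto simp: carrier_tensor)
  note minus = minus_tensor[OF M]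
  obtain z where z: "z \<in> frags M" "u = tcls M z" using u by (auto simp: carrier_tensor)
  have "P (tcls M z)"
    using z(1)[unfolded frags_iff]
  proof (induction z rule: free_Abelian_group_induct [consumes 1, case_names zero diff gen])
    case zero
    \<comment> \<open>Zero is obtained as the difference of one pure tensor with itself, which keeps
      the induction rule down to two cases.\<close>
    have "ptens M \<zero>\<^bsub>M\<^esub> \<zero>\<^bsub>A\<^esub> \<ominus>\<^bsub>tns M\<^esub> ptens M \<zero>\<^bsub>M\<^esub> \<zero>\<^bsub>A\<^esub> = tcls M 0"
      unfolding pure_tensor_def by (subst minus) (auto simp: frags_of)
    moreover have "P (ptens M \<zero>\<^bsub>M\<^esub> \<zero>\<^bsub>A\<^esub> \<ominus>\<^bsub>tns M\<^esub> ptens M \<zero>\<^bsub>M\<^esub> \<zero>\<^bsub>A\<^esub>)"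
      by (intro assms(4) pure pure_tensor_closed) auto
    ultimately show ?case by simp
  next
    case (diff x y)
    then have "x \<in> frags M" "y \<in> frags M" by (simp_all add: frags_iff)
    then show ?case using diff.IH assms(4)[OF cl cl, of x y] minus[of x y] by simp
  next
    case (gen s)
    then show ?case using pure by (cases s) (auto simp: pure_tensor_def)
  qed
  then show ?thesis by (simp add: z)
qed

end

text \<open>Maps such as \<open>jmap\<close> go from an R-module to a module over the fraction
  field, where linearity over a common ring is not expressible by \<open>linear_map\<close>.
  Additivity is the common ground; typed over \<open>ring_scheme\<close> it covers rings, modules
  and function spaces.\<close>

definition additive_map :: "('m, 'y) ring_scheme \<Rightarrow> ('n, 'z) ring_scheme \<Rightarrow> ('m \<Rightarrow> 'n) \<Rightarrow> bool" where
  "additive_map M N f \<longleftrightarrow> f \<in> carrier M \<rightarrow> carrier N \<and>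
     (\<forall>x\<in>carrier M. \<forall>y\<in>carrier M. f (x \<oplus>\<^bsub>M\<^esub> y) = f x \<oplus>\<^bsub>N\<^esub> f y)"

lemma additive_mapI:
  assumes "\<And>x. x \<in> carrier M \<Longrightarrow> f x \<in> carrier N"
    and "\<And>x y. x \<in> carrier M \<Longrightarrow> y \<in> carrier M \<Longrightarrow> f (x \<oplus>\<^bsub>M\<^esub> y) = f x \<oplus>\<^bsub>N\<^esub> f y"
  shows "additive_map M N f"
  using assms by (simp add: additive_map_def)

lemma additive_map_closed: "additive_map M N f \<Longrightarrow> x \<in> carrier M \<Longrightarrow> f x \<in> carrier N"
  by (auto simp: additive_map_def)

lemma additive_map_add:
  "additive_map M N f \<Longrightarrow> x \<in> carrier M \<Longrightarrow> y \<in> carrier M \<Longrightarrow> f (x \<oplus>\<^bsub>M\<^esub> y) = f x \<oplus>\<^bsub>N\<^esub> f y"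
  by (auto simp: additive_map_def)

lemma linear_imp_additive: "linear_map R M N f \<Longrightarrow> additive_map M N f"
  by (simp add: additive_map_def linear_map_def)

lemma additive_map_comp:
  "additive_map L M g \<Longrightarrow> additive_map M N f \<Longrightarrow> additive_map L N (\<lambda>x. f (g x))"
  by (simp add: additive_map_def Pi_iff)

lemma linear_map_smult:
  "linear_map R M N f \<Longrightarrow> r \<in> carrier R \<Longrightarrow> x \<in> carrier M \<Longrightarrow> f (r \<odot>\<^bsub>M\<^esub> x) = r \<odot>\<^bsub>N\<^esub> f x"
  by (simp add: linear_map_def)

lemma linear_map_closed: "linear_map R M N f \<Longrightarrow> x \<in> carrier M \<Longrightarrow> f x \<in> carrier N"
  by (auto simp: linear_map_def)

context
  fixes M :: "('m, 'y) ring_scheme" and N :: "('n, 'z) ring_scheme" and f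
  assumes M: "abelian_group M" and N: "abelian_group N" and f: "additive_map M N f"
begin

interpretation M: abelian_group M by (rule M)
interpretation N: abelian_group N by (rule N)

lemma additive_map_zero: "f \<zero>\<^bsub>M\<^esub> = \<zero>\<^bsub>N\<^esub>"
  using additive_map_add[OF f, of "\<zero>\<^bsub>M\<^esub>" "\<zero>\<^bsub>M\<^esub>"] additive_map_closed[OF f, of "\<zero>\<^bsub>M\<^esub>"]
    N.add.l_cancel_one'[of "f \<zero>\<^bsub>M\<^esub>" "f \<zero>\<^bsub>M\<^esub>"] by simp

lemma additive_map_minus:
  assumes "x \<in> carrier M" "y \<in> carrier M"
  shows "f (x \<ominus>\<^bsub>M\<^esub> y) = f x \<ominus>\<^bsub>N\<^esub> f y"
proof -
  have "f (x \<ominus>\<^bsub>M\<^esub> y) \<oplus>\<^bsub>N\<^esub> f y = f x"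
    using assms by (simp add: additive_map_add[OF f, symmetric] a_minus_def M.a_assoc M.l_neg)
  then show ?thesis
    using assms additive_map_closed[OF f] by (metis N.add.inv_solve_right' a_minus_def M.minus_closed)
qed

lemma additive_map_finsum:
  assumes "finite A" "g \<in> A \<rightarrow> carrier M"
  shows "f (\<Oplus>\<^bsub>M\<^esub>i\<in>A. g i) = (\<Oplus>\<^bsub>N\<^esub>i\<in>A. f (g i))"
  using assms
proof (induction A)
  case (insert a A)
  then show ?case
    using additive_map_closed[OF f]
    by (simp add: additive_map_add[OF f] Pi_iff)
qed (simp add: additive_map_zero)

lemma additive_map_add_pow:
  assumes "x \<in> carrier M"
  shows "f (add_pow M (k::nat) x) = add_pow N k (f x)"
  using assms
  by (induction k) (simp_all add: additive_map_zero additive_map_add[OF f])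

end

lemma (in abelian_group) minus_eq_zero_iff:
  assumes "x \<in> carrier G" "y \<in> carrier G"
  shows "x \<ominus> y = \<zero> \<longleftrightarrow> x = y"
proof
  assume zero: "x \<ominus> y = \<zero>"
  have "x = (x \<ominus> y) \<oplus> y" using assms by (simp add: a_minus_def a_assoc l_neg)
  then show "x = y" using zero assms by simp
qed (use assms in \<open>simp add: a_minus_def r_neg\<close>)

lemma (in abelian_group) add_minus_minus:
  assumes "x \<in> carrier G" "y \<in> carrier G"
  shows "(x \<oplus> y \<ominus> x) \<ominus> y = \<zero>"
proof -
  have "(x \<oplus> y \<ominus> x) \<ominus> y = (x \<oplus> y) \<ominus> (x \<oplus> y)"
    using assms by (simp add: a_minus_def minus_add a_assoc)
  then show ?thesis using assms by (simp add: a_minus_def r_neg)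
qed

context scalar_extension
begin

text \<open>Reduces identities between additive maps on a tensor product to pure tensors; the module
  axioms, functoriality, and the tensored cohomological and Mackey formulas are all obtained in this
  way.\<close>

lemma tensor_ext:
  assumes M: "Module.module R M" and B: "abelian_group B"
    and f: "additive_map (tns M) B f" and k: "additive_map (tns M) B k"
    and pure: "\<And>x a. x \<in> carrier M \<Longrightarrow> a \<in> carrier A \<Longrightarrow> f (ptens M x a) = k (ptens M x a)"
    and u: "u \<in> carrier (tns M)"
  shows "f u = k u"
  using M u
proof (induction rule: tensor_induct)
  case (diff u v)
  then show ?case
    by (simp add: additive_map_minus[OF abelian_group_tensor[OF M] B f]
        additive_map_minus[OF abelian_group_tensor[OF M] B k])
qed (rule pure)

lemma smult_tensor_additive:
  assumes M: "Module.module R M" and a: "a \<in> carrier A"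
  shows "additive_map (tns M) (tns M) (\<lambda>u. a \<odot>\<^bsub>tns M\<^esub> u)"
proof (rule additive_mapI)
  have cl: "frag_pair (\<lambda>x. x) (\<lambda>b. a \<otimes>\<^bsub>A\<^esub> b) z \<in> frags M" if "z \<in> frags M" for z
    using keys_frag_pair[of z "carrier M" "carrier A" "\<lambda>x. x" "carrier M" "\<lambda>b. a \<otimes>\<^bsub>A\<^esub> b" "carrier A"]
      that a by (simp add: frags_iff)
  fix u assume "u \<in> carrier (tns M)"
  then obtain z where z: "z \<in> frags M" "u = tcls M z" by (auto simp: carrier_tensor)
  then show "a \<odot>\<^bsub>tns M\<^esub> u \<in> carrier (tns M)"
    using cl[OF z(1)] by (simp add: smult_tensor[OF M a]) (simp add: carrier_tensor)
  fix v assume "v \<in> carrier (tns M)"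
  then obtain w where w: "w \<in> frags M" "v = tcls M w" by (auto simp: carrier_tensor)
  show "a \<odot>\<^bsub>tns M\<^esub> (u \<oplus>\<^bsub>tns M\<^esub> v) = a \<odot>\<^bsub>tns M\<^esub> u \<oplus>\<^bsub>tns M\<^esub> a \<odot>\<^bsub>tns M\<^esub> v"
    by (simp add: z w add_tensor[OF M] smult_tensor[OF M a] frags_add frag_pair_add)
qed

lemma module_tensor:
  assumes M: "Module.module R M"
  shows "Module.module A (tns M)"
proof -
  interpret M: Module.module R M by (rule M)
  interpret T: abelian_group "tns M" by (rule abelian_group_tensor[OF M])
  note sm = smult_tensor_additive[OF M]
  note cl = additive_map_closed[OF sm]
  show ?thesis
  proof (rule moduleI)
    show "cring A" by (rule A.is_cring)
    show "abelian_group (tns M)" by (rule abelian_group_tensor[OF M])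
    fix a u assume a: "a \<in> carrier A" and u: "u \<in> carrier (tns M)"
    show "a \<odot>\<^bsub>tns M\<^esub> u \<in> carrier (tns M)" by (rule cl[OF a u])
    fix b assume b: "b \<in> carrier A"
    show "(a \<oplus>\<^bsub>A\<^esub> b) \<odot>\<^bsub>tns M\<^esub> u = a \<odot>\<^bsub>tns M\<^esub> u \<oplus>\<^bsub>tns M\<^esub> b \<odot>\<^bsub>tns M\<^esub> u"
    proof (rule tensor_ext[OF M T.abelian_group_axioms sm _ _ u,
          where k = "\<lambda>u. a \<odot>\<^bsub>tns M\<^esub> u \<oplus>\<^bsub>tns M\<^esub> b \<odot>\<^bsub>tns M\<^esub> u"])
      show "additive_map (tns M) (tns M) (\<lambda>u. a \<odot>\<^bsub>tns M\<^esub> u \<oplus>\<^bsub>tns M\<^esub> b \<odot>\<^bsub>tns M\<^esub> u)"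
        by (rule additive_mapI)
           (auto simp: cl[OF a] cl[OF b] additive_map_add[OF sm[OF a]] additive_map_add[OF sm[OF b]] T.a_ac)
    qed (use a b in \<open>auto simp: smult_pure_tensor[OF M] pure_tensor_add_right[OF M] A.l_distr\<close>)
    show "(a \<otimes>\<^bsub>A\<^esub> b) \<odot>\<^bsub>tns M\<^esub> u = a \<odot>\<^bsub>tns M\<^esub> (b \<odot>\<^bsub>tns M\<^esub> u)"
      by (rule tensor_ext[OF M T.abelian_group_axioms sm additive_map_comp[OF sm[OF b] sm[OF a]] _ u])
         (use a b in \<open>auto simp: smult_pure_tensor[OF M] A.m_assoc\<close>)
  next
    fix a u v assume "a \<in> carrier A" "u \<in> carrier (tns M)" "v \<in> carrier (tns M)"
    then show "a \<odot>\<^bsub>tns M\<^esub> (u \<oplus>\<^bsub>tns M\<^esub> v) = a \<odot>\<^bsub>tns M\<^esub> u \<oplus>\<^bsub>tns M\<^esub> a \<odot>\<^bsub>tns M\<^esub> v"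
      by (rule additive_map_add[OF sm])
  next
    fix u assume u: "u \<in> carrier (tns M)"
    show "\<one>\<^bsub>A\<^esub> \<odot>\<^bsub>tns M\<^esub> u = u"
      by (rule tensor_ext[OF M T.abelian_group_axioms sm _ _ u, where k = "\<lambda>u. u"])
         (auto simp: additive_map_def smult_pure_tensor[OF M])
  qed
qed

lemma tensor_map_additive:
  assumes M: "Module.module R M" and M': "Module.module R M'" and f: "linear_map R M M' f"
  shows "additive_map (tns M) (tns M') (tensor_map R M' A f)"
proof (rule additive_mapI)
  have cl: "frag_pair f (\<lambda>a. a) z \<in> frags M'" if "z \<in> frags M" for z
    using keys_frag_pair[of z "carrier M" "carrier A" f "carrier M'" "\<lambda>a. a" "carrier A"]
      that f by (auto simp: frags_iff linear_map_def)
  fix u assume "u \<in> carrier (tns M)"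
  then obtain z where z: "z \<in> frags M" "u = tcls M z" by (auto simp: carrier_tensor)
  then show "tensor_map R M' A f u \<in> carrier (tns M')"
    using cl[OF z(1)] by (simp add: tensor_map_class[OF M M' f]) (simp add: carrier_tensor)
  fix v assume "v \<in> carrier (tns M)"
  then obtain w where w: "w \<in> frags M" "v = tcls M w" by (auto simp: carrier_tensor)
  show "tensor_map R M' A f (u \<oplus>\<^bsub>tns M\<^esub> v)
      = tensor_map R M' A f u \<oplus>\<^bsub>tns M'\<^esub> tensor_map R M' A f v"
    by (simp add: z w add_tensor[OF M] add_tensor[OF M'] tensor_map_class[OF M M' f] frags_add
        frag_pair_add)
qed

lemma tensor_map_linear:
  assumes M: "Module.module R M" and M': "Module.module R M'" and f: "linear_map R M M' f"
  shows "linear_map A (tns M) (tns M') (tensor_map R M' A f)"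
proof -
  note ad = tensor_map_additive[OF assms]
  have "tensor_map R M' A f (a \<odot>\<^bsub>tns M\<^esub> u) = a \<odot>\<^bsub>tns M'\<^esub> tensor_map R M' A f u"
    if a: "a \<in> carrier A" and u: "u \<in> carrier (tns M)" for a u
    by (rule tensor_ext[OF M abelian_group_tensor[OF M']
          additive_map_comp[OF smult_tensor_additive[OF M a] ad]
          additive_map_comp[OF ad smult_tensor_additive[OF M' a]] _ u])
       (use a in \<open>simp add: smult_pure_tensor[OF M] smult_pure_tensor[OF M'] tensor_map_pure[OF assms]
         linear_map_closed[OF f]\<close>)
  then show ?thesis
    using ad by (auto simp: linear_map_def additive_map_def)
qed

lemma tensor_map_comp:
  assumes M: "Module.module R M" and M': "Module.module R M'" and M'': "Module.module R M''"
    and f: "linear_map R M M' f" and k: "linear_map R M' M'' k" and e: "linear_map R M M'' e"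
    and eq: "\<And>x. x \<in> carrier M \<Longrightarrow> k (f x) = e x"
    and u: "u \<in> carrier (tns M)"
  shows "tensor_map R M'' A k (tensor_map R M' A f u) = tensor_map R M'' A e u"
  by (rule tensor_ext[OF M abelian_group_tensor[OF M'']
        additive_map_comp[OF tensor_map_additive[OF M M' f] tensor_map_additive[OF M' M'' k]]
        tensor_map_additive[OF M M'' e] _ u])
     (simp add: tensor_map_pure[OF M M' f] tensor_map_pure[OF M' M'' k] tensor_map_pure[OF M M'' e]
       linear_map_closed[OF f] eq)

lemma tensor_map_id:
  assumes M: "Module.module R M" and f: "linear_map R M M f"
    and eq: "\<And>x. x \<in> carrier M \<Longrightarrow> f x = x" and u: "u \<in> carrier (tns M)"
  shows "tensor_map R M A f u = u"
  by (rule tensor_ext[OF M abelian_group_tensor[OF M] tensor_map_additive[OF M M f] _ _ u])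
     (auto simp: tensor_map_pure[OF M M f] eq additive_map_def)

lemma pure_tensor_additive:
  assumes M: "Module.module R M" and a: "a \<in> carrier A"
  shows "additive_map M (tns M) (\<lambda>x. ptens M x a)"
  by (rule additive_mapI) (auto simp: pure_tensor_closed pure_tensor_add_left[OF M] a)

end

subsection \<open>The kernel of the map to the localization\<close>

sublocale domain \<subseteq> Q: scalar_extension R "fraction_field R"
  by (intro scalar_extension.intro algebra.intro module_Frac cring_Frac algebra_axioms.intro)
     (rule Frac_smult_assoc)

context domain
begin

context
  fixes M :: "('a, 'm, 'y) module_scheme"
  assumes M: "Module.module R M"
begin

interpretation M: Module.module R M by (rule M)

text \<open>This is (1/s)R inside the fraction field when s is nonzero: the fractions for which s is
  a denominator.\<close>

definition integral_part :: "'a \<Rightarrow> ('a \<times> 'a) set set" where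
  "integral_part s = {q \<in> carrier Frac. \<exists>r\<in>carrier R. s \<odot>\<^bsub>Frac\<^esub> q = frac r \<one>}"

definition numerator :: "'a \<Rightarrow> ('a \<times> 'a) set \<Rightarrow> 'a" where
  "numerator s q = (SOME r. r \<in> carrier R \<and> s \<odot>\<^bsub>Frac\<^esub> q = frac r \<one>)"

text \<open>Models the map from x tensor q to (s q) x. It makes sense only for fractions with
  denominator s, because M admits no division; so it is a homomorphism on a part of the free group
  that depends on s, and each element of the kernel is treated with a denominator of its
  own.\<close>

definition clears :: "'a \<Rightarrow> (('m \<times> ('a \<times> 'a) set \<Rightarrow>\<^sub>0 int) \<Rightarrow> 'm) \<Rightarrow> bool" where
  "clears s f \<longleftrightarrow> f \<in> hom (free_Abelian_group (carrier M \<times> integral_part s)) (add_monoid M) \<and>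
     (\<forall>x\<in>carrier M. \<forall>q\<in>integral_part s. f (frag_of (x, q)) = numerator s q \<odot>\<^bsub>M\<^esub> x)"

lemma numerator_eqI:
  assumes "r \<in> carrier R" "s \<odot>\<^bsub>Frac\<^esub> q = frac r \<one>"
  shows "numerator s q = r"
  unfolding numerator_def
  by (rule some_equality) (use assms in \<open>auto simp: fraction_eq_iff\<close>)

lemma numerator:
  assumes "q \<in> integral_part s"
  shows "numerator s q \<in> carrier R" "s \<odot>\<^bsub>Frac\<^esub> q = frac (numerator s q) \<one>" "q \<in> carrier Frac"
  using assms numerator_eqI by (auto simp: integral_part_def)

lemma integral_partI:
  "q \<in> carrier Frac \<Longrightarrow> r \<in> carrier R \<Longrightarrow> s \<odot>\<^bsub>Frac\<^esub> q = frac r \<one> \<Longrightarrow> q \<in> integral_part s"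
  by (auto simp: integral_part_def)

lemma integral_part_mult:
  assumes q: "q \<in> integral_part s" and s: "s \<in> carrier R" and t: "t \<in> carrier R"
  shows "q \<in> integral_part (s \<otimes> t)" "numerator (s \<otimes> t) q = t \<otimes> numerator s q"
proof -
  note n = numerator[OF q]
  have "(s \<otimes> t) \<odot>\<^bsub>Frac\<^esub> q = t \<odot>\<^bsub>Frac\<^esub> (s \<odot>\<^bsub>Frac\<^esub> q)"
    using Q.smult_assoc1[of t s q] m_comm[OF s t] s t n(3) by simp
  also have "\<dots> = frac (t \<otimes> numerator s q) \<one>"
    using n t by (simp add: fraction_smult)
  finally have *: "(s \<otimes> t) \<odot>\<^bsub>Frac\<^esub> q = frac (t \<otimes> numerator s q) \<one>" .
  then show "q \<in> integral_part (s \<otimes> t)" "numerator (s \<otimes> t) q = t \<otimes> numerator s q"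
    using n t by (auto intro: integral_partI numerator_eqI)
qed

lemma integral_part_exists:
  assumes "q \<in> carrier Frac"
  obtains s where "s \<in> dens" "q \<in> integral_part s"
proof -
  obtain a s where *: "a \<in> carrier R" "s \<in> dens" "q = frac a s" using assms by (rule fraction_cases)
  then have "s \<odot>\<^bsub>Frac\<^esub> q = frac a \<one>" by (simp add: fraction_smult fraction_eq_iff m_comm)
  then show ?thesis using * assms that integral_partI by metis
qed

lemma clears_exists: obtains f where "clears s f"
proof -
  have *: "(\<lambda>(x, q). numerator s q \<odot>\<^bsub>M\<^esub> x) ` (carrier M \<times> integral_part s) \<subseteq> carrier (add_monoid M)"
    using numerator(1) by auto
  show ?thesis
    by (rule comm_group.free_Abelian_group_universal[OF M.a_comm_group *]) (rule that, auto simp: clears_def)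
qed

lemma clears_hom:
  assumes "clears s f" "Poly_Mapping.keys z \<subseteq> carrier M \<times> integral_part s"
    "Poly_Mapping.keys w \<subseteq> carrier M \<times> integral_part s"
  shows "f z \<in> carrier M" "f (z + w) = f z \<oplus>\<^bsub>M\<^esub> f w" "f (z - w) = f z \<ominus>\<^bsub>M\<^esub> f w"
proof -
  have h: "f \<in> hom (free_Abelian_group (carrier M \<times> integral_part s)) (add_monoid M)"
    using assms(1) by (simp add: clears_def)
  have ad: "f (z + w) = f z \<oplus>\<^bsub>M\<^esub> f w" if "Poly_Mapping.keys z \<subseteq> carrier M \<times> integral_part s"
    "Poly_Mapping.keys w \<subseteq> carrier M \<times> integral_part s" for z w
    using hom_mult[OF h, of z w] that by simp
  have cl: "f z \<in> carrier M" if "Poly_Mapping.keys z \<subseteq> carrier M \<times> integral_part s" for z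
    using hom_in_carrier[OF h, of z] that by simp
  show "f z \<in> carrier M" "f (z + w) = f z \<oplus>\<^bsub>M\<^esub> f w" using ad cl assms by auto
  have k: "Poly_Mapping.keys (z - w) \<subseteq> carrier M \<times> integral_part s"
    using keys_diff[of z w] assms by auto
  have "f z = f (z - w) \<oplus>\<^bsub>M\<^esub> f w" using ad[OF k assms(3)] by simp
  then show "f (z - w) = f z \<ominus>\<^bsub>M\<^esub> f w"
    using cl[OF k] cl[OF assms(2)] cl[OF assms(3)]
    by (metis M.add.inv_solve_right' a_minus_def)
qed

text \<open>Enlarging the denominator from s to s t multiplies all numerators by t. This makes
  vanishing persist, so that two kernel elements can be compared over a common denominator.\<close>

lemma clears_mult:
  assumes f: "clears s f" and f': "clears (s \<otimes> t) f'" and s: "s \<in> carrier R" and t: "t \<in> carrier R"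
    and z: "Poly_Mapping.keys z \<subseteq> carrier M \<times> integral_part s"
  shows "f' z = t \<odot>\<^bsub>M\<^esub> f z" "Poly_Mapping.keys z \<subseteq> carrier M \<times> integral_part (s \<otimes> t)"
proof -
  have sub: "carrier M \<times> integral_part s \<subseteq> carrier M \<times> integral_part (s \<otimes> t)"
    using integral_part_mult(1)[OF _ s t] by auto
  then show "Poly_Mapping.keys z \<subseteq> carrier M \<times> integral_part (s \<otimes> t)" using z by auto
  show "f' z = t \<odot>\<^bsub>M\<^esub> f z"
    using z
  proof (induction z rule: free_Abelian_group_induct [consumes 1, case_names zero diff gen])
    case zero
    have "f 0 = \<zero>\<^bsub>M\<^esub>" "f' 0 = \<zero>\<^bsub>M\<^esub>"
      using clears_hom(1,3)[OF f, of 0 0] clears_hom(1,3)[OF f', of 0 0]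
      by (simp_all add: a_minus_def M.r_neg)
    then show ?case using t by simp
  next
    case (diff x y)
    have "Poly_Mapping.keys x \<subseteq> carrier M \<times> integral_part (s \<otimes> t)"
      "Poly_Mapping.keys y \<subseteq> carrier M \<times> integral_part (s \<otimes> t)" using diff sub by auto
    then show ?case
      using diff clears_hom[OF f, of x y] clears_hom[OF f, of y x] clears_hom(3)[OF f', of x y] t
      by (simp add: a_minus_def M.smult_r_distr M.smult_r_minus)
  next
    case (gen a)
    then show ?case
      using f f' sub integral_part_mult(2)[OF _ s t] t numerator(1)
      by (cases a) (auto simp: clears_def M.smult_assoc1)
  qed
qed

text \<open>A relation involves at most two fractions. Once s is a denominator of all of them, the
  clearing map sends the relation to an identity between numerators, which holds because numerators
  are additive and R-linear in the fraction.\<close>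

lemma clears_relation:
  assumes "z \<in> tensor_relations R M Frac"
  shows "\<exists>s\<in>dens. Poly_Mapping.keys z \<subseteq> carrier M \<times> integral_part s \<and> (\<forall>f. clears s f \<longrightarrow> f z = \<zero>\<^bsub>M\<^esub>)"
  using assms[unfolded tensor_relations_def]
proof (elim UnE CollectE exE conjE)
  fix x y a assume z: "z = frag_of (x \<oplus>\<^bsub>M\<^esub> y, a) - frag_of (x, a) - frag_of (y, a)"
    and *: "x \<in> carrier M" "y \<in> carrier M" "a \<in> carrier Frac"
  obtain s where s: "s \<in> dens" "a \<in> integral_part s" using *(3) by (rule integral_part_exists)
  have k: "Poly_Mapping.keys (frag_of (u, a)) \<subseteq> carrier M \<times> integral_part s" if "u \<in> carrier M" for u
    using that s by simp
  have k': "Poly_Mapping.keys (frag_of (x \<oplus>\<^bsub>M\<^esub> y, a) - frag_of (x, a)) \<subseteq> carrier M \<times> integral_part s"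
    using keys_diff[of "frag_of (x \<oplus>\<^bsub>M\<^esub> y, a)" "frag_of (x, a)"] * s by auto
  have "f z = \<zero>\<^bsub>M\<^esub>" if f: "clears s f" for f
  proof -
    have v: "f (frag_of (u, a)) = numerator s a \<odot>\<^bsub>M\<^esub> u" if "u \<in> carrier M" for u
      using f that s by (simp add: clears_def)
    have "f z = (numerator s a \<odot>\<^bsub>M\<^esub> (x \<oplus>\<^bsub>M\<^esub> y) \<ominus>\<^bsub>M\<^esub> numerator s a \<odot>\<^bsub>M\<^esub> x) \<ominus>\<^bsub>M\<^esub> numerator s a \<odot>\<^bsub>M\<^esub> y"
      unfolding z using * by (simp add: clears_hom(3)[OF f k' k] clears_hom(3)[OF f k k] v)
    also have "\<dots> = \<zero>\<^bsub>M\<^esub>"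
      using * numerator(1)[OF s(2)]
      by (simp add: a_minus_def M.smult_r_distr) (simp add: M.add_minus_minus[unfolded a_minus_def])
    finally show ?thesis .
  qed
  moreover have "Poly_Mapping.keys z \<subseteq> carrier M \<times> integral_part s"
    unfolding z using keys_diff[of "frag_of (x \<oplus>\<^bsub>M\<^esub> y, a) - frag_of (x, a)" "frag_of (y, a)"] k' k[OF *(2)]
    by auto
  ultimately show ?thesis using s(1) by blast
next
  fix x a b assume z: "z = frag_of (x, a \<oplus>\<^bsub>Frac\<^esub> b) - frag_of (x, a) - frag_of (x, b)"
    and *: "x \<in> carrier M" "a \<in> carrier Frac" "b \<in> carrier Frac"
  obtain s1 where s1: "s1 \<in> dens" "a \<in> integral_part s1" using *(2) by (rule integral_part_exists)
  obtain s2 where s2: "s2 \<in> dens" "b \<in> integral_part s2" using *(3) by (rule integral_part_exists)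
  \<comment> \<open>Additivity in the second argument mixes two fractions, so a product of their
    denominators serves both; it is nonzero because R is a domain.\<close>
  define s where "s = s1 \<otimes> s2"
  have s: "s \<in> dens" "s \<in> carrier R" using s1 s2 by (auto simp: s_def integral_iff)
  have a: "a \<in> integral_part s" using integral_part_mult(1)[OF s1(2)] s1 s2 by (simp add: s_def)
  have b: "b \<in> integral_part s" using integral_part_mult(1)[OF s2(2), of s1] s1 s2
    by (simp add: s_def m_comm)
  have "s \<odot>\<^bsub>Frac\<^esub> (a \<oplus>\<^bsub>Frac\<^esub> b) = frac (numerator s a \<oplus> numerator s b) \<one>"
    using numerator[OF a] numerator[OF b] s by (simp add: Q.smult_r_distr fraction_add)
  then have ab: "a \<oplus>\<^bsub>Frac\<^esub> b \<in> integral_part s"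
    "numerator s (a \<oplus>\<^bsub>Frac\<^esub> b) = numerator s a \<oplus> numerator s b"
    using numerator[OF a] numerator[OF b]
    by (intro integral_partI numerator_eqI; simp)+
  have k: "Poly_Mapping.keys (frag_of (x, q)) \<subseteq> carrier M \<times> integral_part s" if "q \<in> integral_part s" for q
    using that * by simp
  have k': "Poly_Mapping.keys (frag_of (x, a \<oplus>\<^bsub>Frac\<^esub> b) - frag_of (x, a)) \<subseteq> carrier M \<times> integral_part s"
    using keys_diff[of "frag_of (x, a \<oplus>\<^bsub>Frac\<^esub> b)" "frag_of (x, a)"] * a ab by auto
  have "f z = \<zero>\<^bsub>M\<^esub>" if f: "clears s f" for f
  proof -
    have v: "f (frag_of (x, q)) = numerator s q \<odot>\<^bsub>M\<^esub> x" if "q \<in> integral_part s" for q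
      using f that * by (simp add: clears_def)
    have "f z = ((numerator s a \<oplus> numerator s b) \<odot>\<^bsub>M\<^esub> x \<ominus>\<^bsub>M\<^esub> numerator s a \<odot>\<^bsub>M\<^esub> x) \<ominus>\<^bsub>M\<^esub> numerator s b \<odot>\<^bsub>M\<^esub> x"
      unfolding z using a b ab by (simp add: clears_hom(3)[OF f k' k] clears_hom(3)[OF f k k] v)
    also have "\<dots> = \<zero>\<^bsub>M\<^esub>"
      using * numerator(1)[OF a] numerator(1)[OF b]
      by (simp add: a_minus_def M.smult_l_distr) (simp add: M.add_minus_minus[unfolded a_minus_def])
    finally show ?thesis .
  qed
  moreover have "Poly_Mapping.keys z \<subseteq> carrier M \<times> integral_part s"
    unfolding z using keys_diff[of "frag_of (x, a \<oplus>\<^bsub>Frac\<^esub> b) - frag_of (x, a)" "frag_of (x, b)"] k' k[OF b]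
    by auto
  ultimately show ?thesis using s(1) by blast
next
  fix r x a assume z: "z = frag_of (r \<odot>\<^bsub>M\<^esub> x, a) - frag_of (x, r \<odot>\<^bsub>Frac\<^esub> a)"
    and *: "r \<in> carrier R" "x \<in> carrier M" "a \<in> carrier Frac"
  obtain s where s: "s \<in> dens" "a \<in> integral_part s" using *(3) by (rule integral_part_exists)
  note n = numerator[OF s(2)]
  have "s \<odot>\<^bsub>Frac\<^esub> (r \<odot>\<^bsub>Frac\<^esub> a) = r \<odot>\<^bsub>Frac\<^esub> (s \<odot>\<^bsub>Frac\<^esub> a)"
    using Q.smult_assoc1[of s r a] Q.smult_assoc1[of r s a] m_comm[of r s] s(1) * by simp
  also have "\<dots> = frac (r \<otimes> numerator s a) \<one>"
    using n * by (simp add: fraction_smult)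
  finally have ra: "r \<odot>\<^bsub>Frac\<^esub> a \<in> integral_part s" "numerator s (r \<odot>\<^bsub>Frac\<^esub> a) = r \<otimes> numerator s a"
    using n * by (intro integral_partI numerator_eqI; simp)+
  have k: "Poly_Mapping.keys (frag_of (u, q)) \<subseteq> carrier M \<times> integral_part s"
    if "q \<in> integral_part s" "u \<in> carrier M" for q u
    using that by simp
  have "f z = \<zero>\<^bsub>M\<^esub>" if f: "clears s f" for f
  proof -
    have v: "f (frag_of (u, q)) = numerator s q \<odot>\<^bsub>M\<^esub> u" if "q \<in> integral_part s" "u \<in> carrier M" for q u
      using f that by (simp add: clears_def)
    have "f z = numerator s a \<odot>\<^bsub>M\<^esub> (r \<odot>\<^bsub>M\<^esub> x) \<ominus>\<^bsub>M\<^esub> (r \<otimes> numerator s a) \<odot>\<^bsub>M\<^esub> x"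
      unfolding z using * s ra by (simp add: clears_hom(3)[OF f k k] v)
    also have "\<dots> = \<zero>\<^bsub>M\<^esub>"
      using * n by (simp add: M.smult_assoc1[symmetric] m_comm[of r] a_minus_def M.r_neg)
    finally show ?thesis .
  qed
  moreover have "Poly_Mapping.keys z \<subseteq> carrier M \<times> integral_part s"
    unfolding z using keys_diff[of "frag_of (r \<odot>\<^bsub>M\<^esub> x, a)" "frag_of (x, r \<odot>\<^bsub>Frac\<^esub> a)"] s ra *
    by auto
  ultimately show ?thesis using s(1) by blast
qed

text \<open>The kernel consists of sums of relations and their negatives. For a sum, the product of
  the two denominators clears both summands and both still vanish by
  \<open>clears_mult\<close>.\<close>

lemma clears_kernel:
  assumes "z \<in> Q.tker M"
  shows "\<exists>s\<in>dens. Poly_Mapping.keys z \<subseteq> carrier M \<times> integral_part s \<and> (\<forall>f. clears s f \<longrightarrow> f z = \<zero>\<^bsub>M\<^esub>)"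
  using M assms
proof (induction rule: Q.tker_induct)
  case (relation z)
  then show ?case by (rule clears_relation)
next
  case zero
  have "f 0 = \<zero>\<^bsub>M\<^esub>" if "clears \<one> f" for f
    using clears_hom(1,3)[OF that, of 0 0] by (simp add: a_minus_def M.r_neg)
  then show ?case by (intro bexI[of _ \<one>]) auto
next
  case (add z w)
  then obtain s t where s: "s \<in> dens" "Poly_Mapping.keys z \<subseteq> carrier M \<times> integral_part s"
      "\<And>f. clears s f \<Longrightarrow> f z = \<zero>\<^bsub>M\<^esub>"
    and t: "t \<in> dens" "Poly_Mapping.keys w \<subseteq> carrier M \<times> integral_part t"
      "\<And>f. clears t f \<Longrightarrow> f w = \<zero>\<^bsub>M\<^esub>" by blast
  obtain f1 where f1: "clears s f1" by (rule clears_exists)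
  obtain f2 where f2: "clears t f2" by (rule clears_exists)
  have ts: "s \<otimes> t = t \<otimes> s" using s t by (simp add: m_comm)
  have st: "s \<otimes> t \<in> dens" using s t by (simp add: integral_iff)
  obtain f0 where f0: "clears (s \<otimes> t) f0" by (rule clears_exists)
  have kz: "Poly_Mapping.keys z \<subseteq> carrier M \<times> integral_part (s \<otimes> t)"
    using clears_mult(2)[OF f1 f0] s t by simp
  have kw: "Poly_Mapping.keys w \<subseteq> carrier M \<times> integral_part (s \<otimes> t)"
    using clears_mult(2)[OF f2 f0[unfolded ts]] s t ts by simp
  have "f (z + w) = \<zero>\<^bsub>M\<^esub>" if f: "clears (s \<otimes> t) f" for f
  proof -
    have "f z = \<zero>\<^bsub>M\<^esub>" using clears_mult(1)[OF f1 f] s(1,2) s(3)[OF f1] t by simp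
    moreover have "f w = \<zero>\<^bsub>M\<^esub>"
      using clears_mult(1)[OF f2 f[unfolded ts]] s t(1,2) t(3)[OF f2] by simp
    ultimately show ?thesis using clears_hom(2)[OF f kz kw] by simp
  qed
  moreover have "Poly_Mapping.keys (z + w) \<subseteq> carrier M \<times> integral_part (s \<otimes> t)"
    using keys_add[of z w] kz kw by auto
  ultimately show ?case using st by blast
next
  case (minus z)
  then obtain s where s: "s \<in> dens" "Poly_Mapping.keys z \<subseteq> carrier M \<times> integral_part s"
      "\<And>f. clears s f \<Longrightarrow> f z = \<zero>\<^bsub>M\<^esub>" using clears_relation by blast
  have "f (- z) = \<zero>\<^bsub>M\<^esub>" if f: "clears s f" for f
    using clears_hom(1,3)[OF f, of 0 z] clears_hom(1,3)[OF f, of 0 0] s(2) s(3)[OF f]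
    by (simp add: a_minus_def M.r_neg)
  then show ?case using s by (intro bexI[of _ s]) auto
qed

text \<open>The generator (x, 1) lies in the kernel, hence is annihilated by clearing with some
  nonzero s. The numerator of 1 over s is s itself, so this reads s x = 0.\<close>

lemma pure_tensor_one_zero_imp_torsion:
  assumes x: "x \<in> carrier M" and zero: "pure_tensor R M Frac x \<one>\<^bsub>Frac\<^esub> = \<zero>\<^bsub>tensor R M Frac\<^esub>"
  shows "is_torsion R M x"
proof -
  have "frag_of (x, \<one>\<^bsub>Frac\<^esub>) \<in> Q.tker M"
    using zero by (simp add: pure_tensor_def Q.zero_tensor Q.tensor_class_eq_iff[OF M])
  then obtain s where s: "s \<in> dens" "\<one>\<^bsub>Frac\<^esub> \<in> integral_part s"
      "\<And>f. clears s f \<Longrightarrow> f (frag_of (x, \<one>\<^bsub>Frac\<^esub>)) = \<zero>\<^bsub>M\<^esub>"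
    using clears_kernel[of "frag_of (x, \<one>\<^bsub>Frac\<^esub>)"] by auto
  obtain f where f: "clears s f" by (rule clears_exists)
  have "numerator s \<one>\<^bsub>Frac\<^esub> = s"
    using s(1) by (intro numerator_eqI) (simp_all add: fraction_one fraction_smult)
  then have "s \<odot>\<^bsub>M\<^esub> x = \<zero>\<^bsub>M\<^esub>"
    using f s(2) s(3)[OF f] x by (simp add: clears_def)
  then show ?thesis using s(1) x by (auto simp: is_torsion_def)
qed

end

text \<open>If r x = 0, write q = r (q / r) and move r across the tensor sign.\<close>

lemma torsion_imp_pure_tensor_zero:
  assumes M: "Module.module R M" and t: "is_torsion R M x" and q: "q \<in> carrier Frac"
  shows "pure_tensor R M Frac x q = \<zero>\<^bsub>tensor R M Frac\<^esub>"
proof -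
  interpret M: Module.module R M by (rule M)
  obtain r where r: "r \<in> dens" "r \<odot>\<^bsub>M\<^esub> x = \<zero>\<^bsub>M\<^esub>" and x: "x \<in> carrier M"
    using t by (auto simp: is_torsion_def)
  have fr: "frac \<one> r \<otimes>\<^bsub>Frac\<^esub> q \<in> carrier Frac" using r q by (intro Q.A.m_closed) auto
  have "r \<odot>\<^bsub>Frac\<^esub> (frac \<one> r \<otimes>\<^bsub>Frac\<^esub> q) = (r \<odot>\<^bsub>Frac\<^esub> frac \<one> r) \<otimes>\<^bsub>Frac\<^esub> q"
    using r q by (simp add: Frac_smult_assoc)
  also have "r \<odot>\<^bsub>Frac\<^esub> frac \<one> r = \<one>\<^bsub>Frac\<^esub>"
    using r by (simp add: fraction_smult fraction_one fraction_eq_iff)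
  finally have "r \<odot>\<^bsub>Frac\<^esub> (frac \<one> r \<otimes>\<^bsub>Frac\<^esub> q) = q" using q by simp
  then have "pure_tensor R M Frac x q = pure_tensor R M Frac (r \<odot>\<^bsub>M\<^esub> x) (frac \<one> r \<otimes>\<^bsub>Frac\<^esub> q)"
    using r(1) x fr by (subst Q.pure_tensor_smult[OF M]) auto
  also have "\<dots> = \<zero>\<^bsub>tensor R M Frac\<^esub>"
    unfolding r(2)
    by (rule additive_map_zero[OF M.abelian_group_axioms Q.abelian_group_tensor[OF M] Q.pure_tensor_additive[OF M fr]])
  finally show ?thesis .
qed

end

section \<open>Direct limits\<close>

text \<open>Directedness is supplied by intersections: two levels have their intersection as a
  common refinement, and every argument about representatives restricts to it.\<close>

locale directed_modules =
  fixes F :: "('f, 'w) ring_scheme" and \<Upsilon> :: "'i set set" and D :: "'i set \<Rightarrow> ('f, 'm, 'y) module_scheme"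
    and t :: "'i set \<Rightarrow> 'i set \<Rightarrow> 'm \<Rightarrow> 'm"
  assumes nonempty: "\<Upsilon> \<noteq> {}"
    and inter: "\<And>V W. V \<in> \<Upsilon> \<Longrightarrow> W \<in> \<Upsilon> \<Longrightarrow> V \<inter> W \<in> \<Upsilon>"
    and modules: "\<And>V. V \<in> \<Upsilon> \<Longrightarrow> Module.module F (D V)"
    and linear: "\<And>L K. L \<in> \<Upsilon> \<Longrightarrow> K \<in> \<Upsilon> \<Longrightarrow> L \<subseteq> K \<Longrightarrow> linear_map F (D K) (D L) (t L K)"
    and trans_id: "\<And>K x. K \<in> \<Upsilon> \<Longrightarrow> x \<in> carrier (D K) \<Longrightarrow> t K K x = x"
    and trans_comp: "\<And>Z L K x. Z \<in> \<Upsilon> \<Longrightarrow> L \<in> \<Upsilon> \<Longrightarrow> K \<in> \<Upsilon> \<Longrightarrow> Z \<subseteq> L \<Longrightarrow> L \<subseteq> K \<Longrightarrow>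
      x \<in> carrier (D K) \<Longrightarrow> t Z L (t L K x) = t Z K x"
begin

abbreviation "cls \<equiv> limit_class \<Upsilon> D t"
abbreviation "DL \<equiv> direct_limit \<Upsilon> D t"

lemma abelian: "V \<in> \<Upsilon> \<Longrightarrow> abelian_group (D V)"
  using modules by (simp add: module_def)

lemma trans_closed:
  "L \<in> \<Upsilon> \<Longrightarrow> K \<in> \<Upsilon> \<Longrightarrow> L \<subseteq> K \<Longrightarrow> x \<in> carrier (D K) \<Longrightarrow> t L K x \<in> carrier (D L)"
  by (rule linear_map_closed[OF linear])

lemma equiv_limit_rel: "equiv (SIGMA V:\<Upsilon>. carrier (D V)) (limit_rel \<Upsilon> D t)"
proof (rule equivI)
  show "limit_rel \<Upsilon> D t \<subseteq> (SIGMA V:\<Upsilon>. carrier (D V)) \<times> (SIGMA V:\<Upsilon>. carrier (D V))"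
    by (auto simp: limit_rel_def)
  show "refl_on (SIGMA V:\<Upsilon>. carrier (D V)) (limit_rel \<Upsilon> D t)"
    by (rule refl_onI) (auto simp: limit_rel_def)
  show "sym (limit_rel \<Upsilon> D t)"
  proof (rule symI)
    fix a b assume "(a, b) \<in> limit_rel \<Upsilon> D t"
    then show "(b, a) \<in> limit_rel \<Upsilon> D t"
      by (cases a; cases b) (simp add: limit_rel_def, metis)
  qed
  show "trans (limit_rel \<Upsilon> D t)"
  proof (rule transI)
    fix a b c assume ab: "(a, b) \<in> limit_rel \<Upsilon> D t" and bc: "(b, c) \<in> limit_rel \<Upsilon> D t"
    obtain U x where a: "a = (U, x)" by (cases a)
    obtain V y where b: "b = (V, y)" by (cases b)
    obtain W z where c: "c = (W, z)" by (cases c)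
    have UVW: "U \<in> \<Upsilon>" "V \<in> \<Upsilon>" "W \<in> \<Upsilon>" "x \<in> carrier (D U)" "y \<in> carrier (D V)" "z \<in> carrier (D W)"
      using ab bc by (auto simp: a b c limit_rel_def)
    obtain Y where Y: "Y \<in> \<Upsilon>" "Y \<subseteq> U" "Y \<subseteq> V" "t Y U x = t Y V y"
      using ab by (auto simp: a b limit_rel_def)
    obtain Z where Z: "Z \<in> \<Upsilon>" "Z \<subseteq> V" "Z \<subseteq> W" "t Z V y = t Z W z"
      using bc by (auto simp: b c limit_rel_def)
    have YZ: "Y \<inter> Z \<in> \<Upsilon>" using inter Y Z by blast
    have "t (Y \<inter> Z) U x = t (Y \<inter> Z) Y (t Y U x)"
      using trans_comp[of "Y \<inter> Z" Y U x] Y(1-3) UVW YZ by simp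
    also have "\<dots> = t (Y \<inter> Z) V y"
      using trans_comp[of "Y \<inter> Z" Y V y] Y UVW YZ by simp
    also have "\<dots> = t (Y \<inter> Z) Z (t Z V y)"
      using trans_comp[of "Y \<inter> Z" Z V y] Z(1-3) UVW YZ by simp
    also have "\<dots> = t (Y \<inter> Z) W z"
      using trans_comp[of "Y \<inter> Z" Z W z] Z UVW YZ by simp
    finally have "t (Y \<inter> Z) U x = t (Y \<inter> Z) W z" .
    moreover have "Y \<inter> Z \<subseteq> U" "Y \<inter> Z \<subseteq> W" using Y Z by auto
    ultimately show "(a, c) \<in> limit_rel \<Upsilon> D t"
      using UVW YZ by (auto simp: a c limit_rel_def)
  qed
qed

lemma limit_class_eq_iff:
  assumes "V \<in> \<Upsilon>" "x \<in> carrier (D V)" "W \<in> \<Upsilon>" "y \<in> carrier (D W)"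
  shows "cls V x = cls W y \<longleftrightarrow> (\<exists>Z\<in>\<Upsilon>. Z \<subseteq> V \<and> Z \<subseteq> W \<and> t Z V x = t Z W y)"
  using eq_equiv_class_iff[OF equiv_limit_rel, of "(V, x)" "(W, y)"] assms
  by (simp add: limit_class_def limit_rel_def)

lemma limit_class_trans:
  assumes "Z \<in> \<Upsilon>" "V \<in> \<Upsilon>" "Z \<subseteq> V" "x \<in> carrier (D V)"
  shows "cls Z (t Z V x) = cls V x"
  using assms trans_closed by (subst limit_class_eq_iff) (auto intro!: bexI[of _ Z] simp: trans_id)

lemma limit_class_closed [simp]: "V \<in> \<Upsilon> \<Longrightarrow> x \<in> carrier (D V) \<Longrightarrow> cls V x \<in> carrier DL"
  by (auto simp: direct_limit_def limit_class_def intro!: quotientI)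

lemma limit_cases:
  assumes "u \<in> carrier DL"
  obtains V x where "V \<in> \<Upsilon>" "x \<in> carrier (D V)" "u = cls V x"
  using assms by (auto simp: direct_limit_def limit_class_def elim!: quotientE)

lemma limit_cases_below:
  assumes "u \<in> carrier DL" "W \<in> \<Upsilon>"
  obtains V x where "V \<in> \<Upsilon>" "V \<subseteq> W" "x \<in> carrier (D V)" "u = cls V x"
proof -
  obtain V x where *: "V \<in> \<Upsilon>" "x \<in> carrier (D V)" "u = cls V x" using assms(1) by (rule limit_cases)
  have VW: "V \<inter> W \<in> \<Upsilon>" "V \<inter> W \<subseteq> V" "V \<inter> W \<subseteq> W" using inter * assms by auto
  have "u = cls (V \<inter> W) (t (V \<inter> W) V x)" using limit_class_trans[OF VW(1) *(1) VW(2) *(2)] * by simp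
  then show ?thesis using that[OF VW(1,3) trans_closed[OF VW(1) *(1) VW(2) *(2)]] by simp
qed

text \<open>Two representatives of a class agree after restriction to some Z, and compatibility with
  restriction carries this agreement to f. It evaluates each operation that is defined as a union
  over a class.\<close>

lemma UN_limit_class:
  assumes V: "V \<in> \<Upsilon>" and x: "x \<in> carrier (D V)"
    and comp: "\<And>Z W y. Z \<in> \<Upsilon> \<Longrightarrow> W \<in> \<Upsilon> \<Longrightarrow> Z \<subseteq> W \<Longrightarrow> y \<in> carrier (D W) \<Longrightarrow> f Z (t Z W y) = f W y"
  shows "(\<Union>(W, y)\<in>cls V x. f W y) = f V x"
proof (rule UN_constant_eq)
  show "(V, x) \<in> cls V x"
    using equiv_class_self[OF equiv_limit_rel] V x by (simp add: limit_class_def)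
  show "\<forall>z\<in>cls V x. (case z of (W, y) \<Rightarrow> f W y) = f V x"
  proof
    fix z assume z: "z \<in> cls V x"
    obtain W y where [simp]: "z = (W, y)" by (cases z)
    obtain Z where "Z \<in> \<Upsilon>" "Z \<subseteq> V" "Z \<subseteq> W" "t Z V x = t Z W y" "W \<in> \<Upsilon>" "y \<in> carrier (D W)"
      using z by (auto simp: limit_class_def limit_rel_def)
    then show "(case z of (W, y) \<Rightarrow> f W y) = f V x" using comp[of Z] V x by (metis case_prod_conv \<open>z = (W, y)\<close>)
  qed
qed

lemma add_limit_class_same:
  assumes Z: "Z \<in> \<Upsilon>" "Z' \<in> \<Upsilon>" "Z \<subseteq> V" "Z \<subseteq> W" "Z' \<subseteq> V" "Z' \<subseteq> W"
    and V: "V \<in> \<Upsilon>" "W \<in> \<Upsilon>" and x: "x \<in> carrier (D V)" and y: "y \<in> carrier (D W)"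
  shows "cls Z (t Z V x \<oplus>\<^bsub>D Z\<^esub> t Z W y) = cls Z' (t Z' V x \<oplus>\<^bsub>D Z'\<^esub> t Z' W y)"
proof -
  have below: "cls Z (t Z V x \<oplus>\<^bsub>D Z\<^esub> t Z W y) = cls Y (t Y V x \<oplus>\<^bsub>D Y\<^esub> t Y W y)"
    if "Y \<in> \<Upsilon>" "Y \<subseteq> Z" "Z \<in> \<Upsilon>" "Z \<subseteq> V" "Z \<subseteq> W" for Y Z
  proof -
    interpret DZ: abelian_group "D Z" using abelian that by blast
    have xy: "t Z V x \<in> carrier (D Z)" "t Z W y \<in> carrier (D Z)" using trans_closed that V x y by auto
    have "t Y Z (t Z V x \<oplus>\<^bsub>D Z\<^esub> t Z W y) = t Y V x \<oplus>\<^bsub>D Y\<^esub> t Y W y"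
      using additive_map_add[OF linear_imp_additive[OF linear[OF that(1,3,2)]] xy] that V x y
      by (simp add: trans_comp)
    then show ?thesis
      using limit_class_trans[OF that(1,3,2), of "t Z V x \<oplus>\<^bsub>D Z\<^esub> t Z W y"] xy by simp
  qed
  have "Z \<inter> Z' \<in> \<Upsilon>" using inter Z by blast
  then show ?thesis using below[of "Z \<inter> Z'" Z] below[of "Z \<inter> Z'" Z'] Z by simp
qed

text \<open>The addition is a union over both representatives and over all common refinements Z. The
  choice of Z is harmless by passing to intersections; the auxiliary \<open>f\<close>, the union
  over Z alone, is then seen to be unchanged when either representative is restricted.\<close>

lemma add_limit_class_gen:
  assumes Z: "Z \<in> \<Upsilon>" "Z \<subseteq> V" "Z \<subseteq> W" and V: "V \<in> \<Upsilon>" "W \<in> \<Upsilon>"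
    and x: "x \<in> carrier (D V)" and y: "y \<in> carrier (D W)"
  shows "cls V x \<oplus>\<^bsub>DL\<^esub> cls W y = cls Z (t Z V x \<oplus>\<^bsub>D Z\<^esub> t Z W y)"
proof -
  define f where "f V x W y = (\<Union>Z\<in>{Z \<in> \<Upsilon>. Z \<subseteq> V \<and> Z \<subseteq> W}. cls Z (t Z V x \<oplus>\<^bsub>D Z\<^esub> t Z W y))"
    for V x W y
  have f: "f V x W y = cls Z (t Z V x \<oplus>\<^bsub>D Z\<^esub> t Z W y)"
    if "Z \<in> \<Upsilon>" "Z \<subseteq> V" "Z \<subseteq> W" "V \<in> \<Upsilon>" "W \<in> \<Upsilon>" "x \<in> carrier (D V)" "y \<in> carrier (D W)" for V x W y Z
    unfolding f_def
  proof (rule UN_constant_eq[of Z])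
    show "Z \<in> {Z \<in> \<Upsilon>. Z \<subseteq> V \<and> Z \<subseteq> W}" using that by simp
    show "\<forall>Z'\<in>{Z \<in> \<Upsilon>. Z \<subseteq> V \<and> Z \<subseteq> W}. cls Z' (t Z' V x \<oplus>\<^bsub>D Z'\<^esub> t Z' W y) =
        cls Z (t Z V x \<oplus>\<^bsub>D Z\<^esub> t Z W y)"
      using add_limit_class_same that by blast
  qed
  have comp2: "f V x Y (t Y W y) = f V x W y"
    if "Y \<in> \<Upsilon>" "Y \<subseteq> W" "V \<in> \<Upsilon>" "W \<in> \<Upsilon>" "x \<in> carrier (D V)" "y \<in> carrier (D W)" for V x W y Y
  proof -
    have *: "V \<inter> Y \<in> \<Upsilon>" using inter that by blast
    show ?thesis
      using that * f[of "V \<inter> Y" V W x y] f[of "V \<inter> Y" V Y x "t Y W y"] trans_closed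
      by (simp add: trans_comp le_infI2)
  qed
  have comp1: "f Y (t Y V x) W y = f V x W y"
    if "Y \<in> \<Upsilon>" "Y \<subseteq> V" "V \<in> \<Upsilon>" "W \<in> \<Upsilon>" "x \<in> carrier (D V)" "y \<in> carrier (D W)" for V x W y Y
  proof -
    have *: "Y \<inter> W \<in> \<Upsilon>" using inter that by blast
    show ?thesis
      using that * f[of "Y \<inter> W" V W x y] f[of "Y \<inter> W" Y W "t Y V x" y] trans_closed
      by (simp add: trans_comp le_infI1)
  qed
  have in2: "(\<Union>(W, y)\<in>cls W y. f V x W y) = f V x W y"
    if "V \<in> \<Upsilon>" "x \<in> carrier (D V)" for V x
    by (rule UN_limit_class[OF V(2) y]) (rule comp2, use that in auto)
  have "(\<Union>(V, x)\<in>cls V x. \<Union>(W, y)\<in>cls W y. f V x W y) = (\<Union>(W, y)\<in>cls W y. f V x W y)"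
  proof (rule UN_limit_class[OF V(1) x])
    fix Y U z assume *: "Y \<in> \<Upsilon>" "U \<in> \<Upsilon>" "Y \<subseteq> U" "z \<in> carrier (D U)"
    then show "(\<Union>(W, y)\<in>cls W y. f Y (t Y U z) W y) = (\<Union>(W, y)\<in>cls W y. f U z W y)"
      using in2[of Y "t Y U z"] in2[of U z] comp1[of Y U W z y] V y trans_closed by simp
  qed
  then have "cls V x \<oplus>\<^bsub>DL\<^esub> cls W y = f V x W y"
    using in2[OF V(1) x] by (simp add: direct_limit_def f_def)
  then show ?thesis using f[OF Z V x y] by simp
qed

lemma add_limit_class:
  assumes "V \<in> \<Upsilon>" "x \<in> carrier (D V)" "y \<in> carrier (D V)"
  shows "cls V x \<oplus>\<^bsub>DL\<^esub> cls V y = cls V (x \<oplus>\<^bsub>D V\<^esub> y)"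
  using add_limit_class_gen[of V V V x y] assms by (simp add: trans_id)

lemma smult_limit_class:
  assumes V: "V \<in> \<Upsilon>" and x: "x \<in> carrier (D V)" and a: "a \<in> carrier F"
  shows "a \<odot>\<^bsub>DL\<^esub> cls V x = cls V (a \<odot>\<^bsub>D V\<^esub> x)"
proof -
  have "(\<Union>(W, y)\<in>cls V x. cls W (a \<odot>\<^bsub>D W\<^esub> y)) = cls V (a \<odot>\<^bsub>D V\<^esub> x)"
  proof (rule UN_limit_class[OF V x])
    fix Z W y assume *: "Z \<in> \<Upsilon>" "W \<in> \<Upsilon>" "Z \<subseteq> W" "y \<in> carrier (D W)"
    then have "a \<odot>\<^bsub>D Z\<^esub> t Z W y = t Z W (a \<odot>\<^bsub>D W\<^esub> y)"
      using linear_map_smult[OF linear] a by metis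
    moreover have "a \<odot>\<^bsub>D W\<^esub> y \<in> carrier (D W)"
      using module.smult_closed[OF modules] * a by blast
    ultimately show "cls Z (a \<odot>\<^bsub>D Z\<^esub> t Z W y) = cls W (a \<odot>\<^bsub>D W\<^esub> y)"
      using * limit_class_trans by simp
  qed
  then show ?thesis by (simp add: direct_limit_def)
qed

lemma zero_limit_class:
  assumes V: "V \<in> \<Upsilon>"
  shows "\<zero>\<^bsub>DL\<^esub> = cls V \<zero>\<^bsub>D V\<^esub>"
proof -
  have zero: "\<zero>\<^bsub>D W\<^esub> \<in> carrier (D W)" if "W \<in> \<Upsilon>" for W
    using abelian[OF that] by (simp add: abelian_group_def abelian_monoid.zero_closed)
  have below: "cls Z \<zero>\<^bsub>D Z\<^esub> = cls W \<zero>\<^bsub>D W\<^esub>" if "Z \<in> \<Upsilon>" "W \<in> \<Upsilon>" "Z \<subseteq> W" for Z W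
    using limit_class_trans[OF that, of "\<zero>\<^bsub>D W\<^esub>"] zero that
      additive_map_zero[OF abelian abelian linear_imp_additive[OF linear[OF that]]] by simp
  have "\<forall>W\<in>\<Upsilon>. cls W \<zero>\<^bsub>D W\<^esub> = cls V \<zero>\<^bsub>D V\<^esub>"
  proof
    fix W assume "W \<in> \<Upsilon>"
    then show "cls W \<zero>\<^bsub>D W\<^esub> = cls V \<zero>\<^bsub>D V\<^esub>"
      using below[of "V \<inter> W" V] below[of "V \<inter> W" W] V inter by simp
  qed
  then have "(\<Union>W\<in>\<Upsilon>. cls W \<zero>\<^bsub>D W\<^esub>) = cls V \<zero>\<^bsub>D V\<^esub>"
    by (rule UN_constant_eq[OF V])
  then show ?thesis by (simp add: direct_limit_def)
qed

lemma limit_cases2: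
  assumes "u \<in> carrier DL" "v \<in> carrier DL"
  obtains V x y where "V \<in> \<Upsilon>" "x \<in> carrier (D V)" "u = cls V x" "y \<in> carrier (D V)" "v = cls V y"
proof -
  obtain W x where *: "W \<in> \<Upsilon>" "x \<in> carrier (D W)" "u = cls W x" using assms(1) by (rule limit_cases)
  obtain V y where **: "V \<in> \<Upsilon>" "V \<subseteq> W" "y \<in> carrier (D V)" "v = cls V y"
    using assms(2) *(1) by (rule limit_cases_below)
  have "u = cls V (t V W x)" using limit_class_trans[of V W x] * ** by simp
  then show ?thesis using that[OF **(1) _ _ **(3,4)] trans_closed * ** by blast
qed

lemma module_limit: "Module.module F DL"
proof -
  obtain V0 where V0: "V0 \<in> \<Upsilon>" using nonempty by blast
  show ?thesis
  proof (rule moduleI)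
    show "cring F" using modules[OF V0] by (simp add: module_def)
    show "abelian_group DL"
    proof (rule abelian_groupI)
      fix u v w assume uv: "u \<in> carrier DL" "v \<in> carrier DL" and w: "w \<in> carrier DL"
      obtain V x y where *: "V \<in> \<Upsilon>" "x \<in> carrier (D V)" "u = cls V x" "y \<in> carrier (D V)" "v = cls V y"
        using uv by (rule limit_cases2)
      obtain Z z where **: "Z \<in> \<Upsilon>" "Z \<subseteq> V" "z \<in> carrier (D Z)" "w = cls Z z"
        using w *(1) by (rule limit_cases_below)
      interpret Z: abelian_group "D Z" by (rule abelian[OF **(1)])
      have x: "u = cls Z (t Z V x)" "t Z V x \<in> carrier (D Z)"
        using limit_class_trans[of Z V x] * ** trans_closed by auto
      have y: "v = cls Z (t Z V y)" "t Z V y \<in> carrier (D Z)"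
        using limit_class_trans[of Z V y] * ** trans_closed by auto
      show "u \<oplus>\<^bsub>DL\<^esub> v \<oplus>\<^bsub>DL\<^esub> w = u \<oplus>\<^bsub>DL\<^esub> (v \<oplus>\<^bsub>DL\<^esub> w)"
        unfolding x(1) y(1) **(4) using **(1,3) x(2) y(2)
        by (simp add: add_limit_class Z.a_assoc)
    next
      fix u v assume "u \<in> carrier DL" "v \<in> carrier DL"
      then obtain V x y where *: "V \<in> \<Upsilon>" "x \<in> carrier (D V)" "u = cls V x" "y \<in> carrier (D V)" "v = cls V y"
        by (rule limit_cases2)
      interpret V: abelian_group "D V" by (rule abelian[OF *(1)])
      show "u \<oplus>\<^bsub>DL\<^esub> v = v \<oplus>\<^bsub>DL\<^esub> u" "u \<oplus>\<^bsub>DL\<^esub> v \<in> carrier DL"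
        using * by (simp_all add: add_limit_class V.a_comm)
    next
      interpret V: abelian_group "D V0" by (rule abelian[OF V0])
      show "\<zero>\<^bsub>DL\<^esub> \<in> carrier DL" using zero_limit_class[OF V0] V0 by simp
    next
      fix u assume "u \<in> carrier DL"
      then obtain V x where *: "V \<in> \<Upsilon>" "x \<in> carrier (D V)" "u = cls V x" by (rule limit_cases)
      interpret V: abelian_group "D V" by (rule abelian[OF *(1)])
      show "\<zero>\<^bsub>DL\<^esub> \<oplus>\<^bsub>DL\<^esub> u = u"
        using * by (simp add: zero_limit_class[OF *(1)] add_limit_class)
      show "\<exists>v\<in>carrier DL. v \<oplus>\<^bsub>DL\<^esub> u = \<zero>\<^bsub>DL\<^esub>"
        using * by (intro bexI[of _ "cls V (\<ominus>\<^bsub>D V\<^esub> x)"])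
          (simp_all add: zero_limit_class[OF *(1)] add_limit_class V.l_neg)
    qed
  next
    fix a u assume a: "a \<in> carrier F" and "u \<in> carrier DL"
    then obtain V x where *: "V \<in> \<Upsilon>" "x \<in> carrier (D V)" "u = cls V x" by (meson limit_cases)
    interpret V: Module.module F "D V" by (rule modules[OF *(1)])
    show "a \<odot>\<^bsub>DL\<^esub> u \<in> carrier DL" using a * by (simp add: smult_limit_class)
    fix b assume b: "b \<in> carrier F"
    show "(a \<oplus>\<^bsub>F\<^esub> b) \<odot>\<^bsub>DL\<^esub> u = a \<odot>\<^bsub>DL\<^esub> u \<oplus>\<^bsub>DL\<^esub> b \<odot>\<^bsub>DL\<^esub> u"
      using a b * by (simp add: smult_limit_class add_limit_class V.smult_l_distr)
    show "(a \<otimes>\<^bsub>F\<^esub> b) \<odot>\<^bsub>DL\<^esub> u = a \<odot>\<^bsub>DL\<^esub> (b \<odot>\<^bsub>DL\<^esub> u)"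
      using a b * by (simp add: smult_limit_class V.smult_assoc1)
  next
    fix a u v assume a: "a \<in> carrier F" and "u \<in> carrier DL" "v \<in> carrier DL"
    then obtain V x y where *: "V \<in> \<Upsilon>" "x \<in> carrier (D V)" "u = cls V x" "y \<in> carrier (D V)" "v = cls V y"
      by (meson limit_cases2)
    interpret V: Module.module F "D V" by (rule modules[OF *(1)])
    show "a \<odot>\<^bsub>DL\<^esub> (u \<oplus>\<^bsub>DL\<^esub> v) = a \<odot>\<^bsub>DL\<^esub> u \<oplus>\<^bsub>DL\<^esub> a \<odot>\<^bsub>DL\<^esub> v"
      using a * by (simp add: smult_limit_class add_limit_class V.smult_r_distr)
  next
    fix u assume "u \<in> carrier DL"
    then obtain V x where *: "V \<in> \<Upsilon>" "x \<in> carrier (D V)" "u = cls V x" by (rule limit_cases)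
    interpret V: Module.module F "D V" by (rule modules[OF *(1)])
    show "\<one>\<^bsub>F\<^esub> \<odot>\<^bsub>DL\<^esub> u = u" using * by (simp add: smult_limit_class)
  qed
qed

lemma limit_class_linear: "V \<in> \<Upsilon> \<Longrightarrow> linear_map F (D V) DL (cls V)"
  by (simp add: linear_map_def add_limit_class smult_limit_class)

text \<open>The existence half of the universal property of the direct limit, with the induced map
  written as a union over representatives. The group action and the averaging operator on the
  completion are both maps of this form.\<close>

lemma limit_map_linear:
  assumes f: "\<And>V. V \<in> \<Upsilon> \<Longrightarrow> linear_map F (D V) B (f V)"
    and comp: "\<And>Z W y. Z \<in> \<Upsilon> \<Longrightarrow> W \<in> \<Upsilon> \<Longrightarrow> Z \<subseteq> W \<Longrightarrow> y \<in> carrier (D W) \<Longrightarrow> f Z (t Z W y) = f W y"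
  shows "linear_map F DL B (\<lambda>u. \<Union>(V, x)\<in>u. f V x)"
proof -
  note val = UN_limit_class[where f = f, OF _ _ comp]
  have "(\<Union>(V, x)\<in>u. f V x) \<in> carrier B" if "u \<in> carrier DL" for u
    using that by (rule limit_cases) (simp add: val linear_map_closed[OF f])
  moreover have "(\<Union>(V, x)\<in>u \<oplus>\<^bsub>DL\<^esub> v. f V x) = (\<Union>(V, x)\<in>u. f V x) \<oplus>\<^bsub>B\<^esub> (\<Union>(V, x)\<in>v. f V x)"
    if uv: "u \<in> carrier DL" "v \<in> carrier DL" for u v
  proof -
    obtain V x y where *: "V \<in> \<Upsilon>" "x \<in> carrier (D V)" "u = cls V x" "y \<in> carrier (D V)" "v = cls V y"
      using uv by (rule limit_cases2)
    interpret V: abelian_group "D V" by (rule abelian[OF *(1)])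
    show ?thesis
      using * by (simp add: add_limit_class val additive_map_add[OF linear_imp_additive[OF f]])
  qed
  moreover have "(\<Union>(V, x)\<in>a \<odot>\<^bsub>DL\<^esub> u. f V x) = a \<odot>\<^bsub>B\<^esub> (\<Union>(V, x)\<in>u. f V x)"
    if a: "a \<in> carrier F" and u: "u \<in> carrier DL" for a u
  proof -
    obtain V x where *: "V \<in> \<Upsilon>" "x \<in> carrier (D V)" "u = cls V x" using u by (rule limit_cases)
    interpret V: Module.module F "D V" by (rule modules[OF *(1)])
    show ?thesis using a * by (simp add: smult_limit_class val linear_map_smult[OF f])
  qed
  ultimately show ?thesis by (simp add: linear_map_def)
qed

end

section \<open>Indices of compact open subgroups\<close>

context locally_profinite_group
begin

lemma continuous_map_left_mult: "a \<in> carrier G \<Longrightarrow> continuous_map T T (\<lambda>x. a \<otimes> x)"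
proof -
  assume a: "a \<in> carrier G"
  have "continuous_map T (prod_topology T T) (\<lambda>x. (a, x))"
    using a topspace_eq by (intro continuous_map_pairedI) auto
  from continuous_map_compose[OF this continuous_mult] show ?thesis by (simp add: o_def)
qed

lemma continuous_map_right_mult: "a \<in> carrier G \<Longrightarrow> continuous_map T T (\<lambda>x. x \<otimes> a)"
proof -
  assume a: "a \<in> carrier G"
  have "continuous_map T (prod_topology T T) (\<lambda>x. (x, a))"
    using a topspace_eq by (intro continuous_map_pairedI) auto
  from continuous_map_compose[OF this continuous_mult] show ?thesis by (simp add: o_def)
qed

lemma open_subset_carrier: "openin T V \<Longrightarrow> V \<subseteq> carrier G"
  using openin_subset topspace_eq by blast

lemma openin_l_coset:
  assumes "openin T V" "a \<in> carrier G"
  shows "openin T (a <# V)"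
proof -
  have "V \<subseteq> carrier G" using assms(1) by (rule open_subset_carrier)
  have "a <# V = {x \<in> topspace T. inv a \<otimes> x \<in> V}"
  proof (intro equalityI subsetI)
    fix x assume "x \<in> a <# V"
    then show "x \<in> {x \<in> topspace T. inv a \<otimes> x \<in> V}"
      using assms(2) \<open>V \<subseteq> carrier G\<close> by (auto simp: l_coset_def topspace_eq m_assoc[symmetric])
  next
    fix x assume x: "x \<in> {x \<in> topspace T. inv a \<otimes> x \<in> V}"
    then have "x = a \<otimes> (inv a \<otimes> x)" using assms(2) by (simp add: topspace_eq m_assoc[symmetric])
    then show "x \<in> a <# V" using x unfolding l_coset_def by blast
  qed
  then show ?thesis
    using openin_continuous_map_preimage[OF continuous_map_left_mult assms(1), of "inv a"] assms(2) by simp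
qed

lemma openin_r_coset:
  assumes "openin T V" "a \<in> carrier G"
  shows "openin T (V #> a)"
proof -
  have "V \<subseteq> carrier G" using assms(1) by (rule open_subset_carrier)
  have "V #> a = {x \<in> topspace T. x \<otimes> inv a \<in> V}"
  proof (intro equalityI subsetI)
    fix x assume "x \<in> V #> a"
    then show "x \<in> {x \<in> topspace T. x \<otimes> inv a \<in> V}"
      using assms(2) \<open>V \<subseteq> carrier G\<close> by (auto simp: r_coset_def topspace_eq m_assoc)
  next
    fix x assume x: "x \<in> {x \<in> topspace T. x \<otimes> inv a \<in> V}"
    then have "x = (x \<otimes> inv a) \<otimes> a" using assms(2) by (simp add: topspace_eq m_assoc)
    then show "x \<in> V #> a" using x unfolding r_coset_def by blast
  qed
  then show ?thesis
    using openin_continuous_map_preimage[OF continuous_map_right_mult assms(1), of "inv a"] assms(2) by simp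
qed

lemma compactin_l_coset:
  assumes "compactin T V" "a \<in> carrier G"
  shows "compactin T (a <# V)"
proof -
  have "a <# V = (\<lambda>x. a \<otimes> x) ` V" by (auto simp: l_coset_def)
  then show ?thesis using image_compactin[OF assms(1) continuous_map_left_mult[OF assms(2)]] by simp
qed

lemma conjugate_eq_cosets: "conjugate G a V = (a <# V) #> inv a"
  by (auto simp: conjugate_def l_coset_def r_coset_def)

end

text \<open>A finite subcover already contains every member: a member meets W in some point, and by
  disjointness the element of the subcover through that point is the member itself.\<close>

lemma compactin_disjoint_open_cover_finite:
  assumes W: "compactin T W" and "\<And>A. A \<in> \<C> \<Longrightarrow> openin T A" and cover: "W \<subseteq> \<Union>\<C>"
    and disj: "pairwise disjnt \<C>" and meets: "\<And>A. A \<in> \<C> \<Longrightarrow> A \<inter> W \<noteq> {}"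
  shows "finite \<C>"
proof -
  obtain \<F> where F: "finite \<F>" "\<F> \<subseteq> \<C>" "W \<subseteq> \<Union>\<F>"
    using compactinD[OF W assms(2) cover] by blast
  have "\<C> \<subseteq> \<F>"
  proof
    fix A assume A: "A \<in> \<C>"
    then obtain x where x: "x \<in> A" "x \<in> W" using meets by blast
    then obtain B where B: "B \<in> \<F>" "x \<in> B" using F(3) by blast
    then have "A = B" using disj A F(2) x unfolding pairwise_def disjnt_def by blast
    then show "A \<in> \<F>" using B by simp
  qed
  then show ?thesis using F(1) finite_subset by blast
qed

lemma pairwise_disjnt_l_cosets:
  assumes "group G" "subgroup V G"
  shows "pairwise disjnt ((\<lambda>w. w <#\<^bsub>G\<^esub> V) ` carrier G)"
proof -
  interpret group G by fact
  show ?thesis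
  proof (rule pairwiseI)
    fix A B assume "A \<in> (\<lambda>w. w <#\<^bsub>G\<^esub> V) ` carrier G" "B \<in> (\<lambda>w. w <#\<^bsub>G\<^esub> V) ` carrier G" "A \<noteq> B"
    then obtain a b where ab: "a \<in> carrier G" "A = a <#\<^bsub>G\<^esub> V" "b \<in> carrier G" "B = b <#\<^bsub>G\<^esub> V" by auto
    show "disjnt A B"
    proof (rule ccontr)
      assume "\<not> disjnt A B"
      then obtain x where "x \<in> a <#\<^bsub>G\<^esub> V" "x \<in> b <#\<^bsub>G\<^esub> V" using ab by (auto simp: disjnt_def)
      then have "a <#\<^bsub>G\<^esub> V = x <#\<^bsub>G\<^esub> V" "b <#\<^bsub>G\<^esub> V = x <#\<^bsub>G\<^esub> V"
        using l_repr_independence[OF _ _ assms(2)] ab(1,3) by blast+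
      then show False using ab \<open>A \<noteq> B\<close> by simp
    qed
  qed
qed

lemma pairwise_disjnt_r_cosets:
  assumes "group G" "subgroup V G"
  shows "pairwise disjnt ((\<lambda>w. V #>\<^bsub>G\<^esub> w) ` carrier G)"
proof -
  interpret group G by fact
  have "(\<lambda>w. V #>\<^bsub>G\<^esub> w) ` carrier G = rcosets\<^bsub>G\<^esub> V" by (auto simp: RCOSETS_def)
  then show ?thesis using rcos_disjoint[OF assms(2)] by simp
qed

context level_collection
begin

lemma level_subgroup: "V \<in> \<Upsilon> \<Longrightarrow> subgroup V G"
  and level_open: "V \<in> \<Upsilon> \<Longrightarrow> openin T V"
  and level_compact: "V \<in> \<Upsilon> \<Longrightarrow> compactin T V"
  using compact_open by auto

lemma level_subset: "V \<in> \<Upsilon> \<Longrightarrow> V \<subseteq> carrier G"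
  using level_subgroup subgroup.subset by blast

definition left_cosets :: "'g set \<Rightarrow> 'g set \<Rightarrow> 'g set set" where
  "left_cosets W V = (\<lambda>w. w <# V) ` W"

definition right_cosets :: "'g set \<Rightarrow> 'g set \<Rightarrow> 'g set set" where
  "right_cosets W V = (\<lambda>w. V #> w) ` W"

lemma rcosets_level: "rcosets\<^bsub>G\<lparr>carrier := W\<rparr>\<^esub> V = right_cosets W V"
  by (auto simp: RCOSETS_def right_cosets_def r_coset_def)

lemma l_coset_subset_level:
  assumes "W \<in> \<Upsilon>" "V \<subseteq> W" "w \<in> W"
  shows "w <# V \<subseteq> W" "V #> w \<subseteq> W"
  using assms subgroup.m_closed[OF level_subgroup[OF assms(1)]]
  by (auto simp: l_coset_def r_coset_def)

lemma coset_self: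
  assumes "V \<in> \<Upsilon>" "w \<in> carrier G"
  shows "w \<in> w <# V" "w \<in> V #> w"
proof -
  have "\<one> \<in> V" by (rule subgroup.one_closed[OF level_subgroup[OF assms(1)]])
  then have "w \<otimes> \<one> \<in> w <# V" "\<one> \<otimes> w \<in> V #> w"
    unfolding l_coset_def r_coset_def by blast+
  then show "w \<in> w <# V" "w \<in> V #> w" using assms(2) by simp_all
qed

lemma left_cosets_props:
  assumes V: "V \<in> \<Upsilon>" and W: "W \<in> \<Upsilon>" and VW: "V \<subseteq> W"
  shows "finite (left_cosets W V)" "\<Union>(left_cosets W V) = W" "pairwise disjnt (left_cosets W V)"
    "finite (right_cosets W V)" "\<Union>(right_cosets W V) = W" "pairwise disjnt (right_cosets W V)"
proof -
  note sub = level_subset[OF W]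
  show *: "\<Union>(left_cosets W V) = W" "\<Union>(right_cosets W V) = W"
  proof -
    show "\<Union>(left_cosets W V) = W"
    proof (intro equalityI Union_least subsetI)
      fix A x assume "A \<in> left_cosets W V" "x \<in> A"
      then show "x \<in> W" using l_coset_subset_level(1)[OF W VW] by (auto simp: left_cosets_def)
    next
      fix w assume "w \<in> W"
      then show "w \<in> \<Union>(left_cosets W V)" using coset_self(1)[OF V, of w] sub
        by (auto simp: left_cosets_def)
    qed
    show "\<Union>(right_cosets W V) = W"
    proof (intro equalityI Union_least subsetI)
      fix A x assume "A \<in> right_cosets W V" "x \<in> A"
      then show "x \<in> W" using l_coset_subset_level(2)[OF W VW] by (auto simp: right_cosets_def)
    next
      fix w assume "w \<in> W"
      then show "w \<in> \<Union>(right_cosets W V)" using coset_self(2)[OF V, of w] sub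
        by (auto simp: right_cosets_def)
    qed
  qed
  show **: "pairwise disjnt (left_cosets W V)" "pairwise disjnt (right_cosets W V)"
    using pairwise_disjnt_l_cosets[OF is_group level_subgroup[OF V]]
      pairwise_disjnt_r_cosets[OF is_group level_subgroup[OF V]] sub
    unfolding left_cosets_def right_cosets_def by (blast intro: pairwise_mono)+
  have meets: "A \<inter> W \<noteq> {}" "openin T A" if A: "A \<in> left_cosets W V \<union> right_cosets W V" for A
  proof -
    obtain w where w: "w \<in> W" "A = w <# V \<or> A = V #> w"
      using A by (auto simp: left_cosets_def right_cosets_def)
    then have "w \<in> carrier G" using sub by blast
    then show "A \<inter> W \<noteq> {}" "openin T A"
      using w coset_self[OF V, of w] openin_l_coset[OF level_open[OF V]] openin_r_coset[OF level_open[OF V]]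
      by blast+
  qed
  show "finite (left_cosets W V)"
    by (rule compactin_disjoint_open_cover_finite[OF level_compact[OF W] _ _ **(1)])
       (use *(1) meets in simp_all)
  show "finite (right_cosets W V)"
    by (rule compactin_disjoint_open_cover_finite[OF level_compact[OF W] _ _ **(2)])
       (use *(2) meets in simp_all)
qed

section \<open>Haar measure and coset counts of compact open subgroups\<close>

context
  fixes \<mu> :: "'g measure"
  assumes haar: "left_haar_measure G T \<mu>"
begin

lemma haar_open: "openin T V \<Longrightarrow> V \<in> sets \<mu>"
  using haar by (auto simp: left_haar_measure_def)

lemma haar_left: "a \<in> carrier G \<Longrightarrow> openin T V \<Longrightarrow> emeasure \<mu> (a <# V) = emeasure \<mu> V"
  using haar haar_open by (auto simp: left_haar_measure_def)

lemma haar_level_finite: "V \<in> \<Upsilon> \<Longrightarrow> emeasure \<mu> V < \<infinity>"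
  using haar level_compact by (auto simp: left_haar_measure_def)

text \<open>Finitely many left translates of V cover a compact set, so a null V would make every
  compact set null. Inner regularity on the whole space would then make the measure zero.\<close>

lemma haar_level_nonzero:
  assumes V: "V \<in> \<Upsilon>"
  shows "emeasure \<mu> V \<noteq> 0"
proof
  assume zero: "emeasure \<mu> V = 0"
  have "emeasure \<mu> C = 0" if C: "compactin T C" for C
  proof -
    have "C \<subseteq> carrier G" using compactin_subset_topspace[OF C] topspace_eq by simp
    then have "C \<subseteq> \<Union>((\<lambda>w. w <# V) ` carrier G)" using coset_self(1)[OF V] by blast
    then obtain \<F> where F: "finite \<F>" "\<F> \<subseteq> (\<lambda>w. w <# V) ` carrier G" "C \<subseteq> \<Union>\<F>"
      using compactinD[OF C, of "(\<lambda>w. w <# V) ` carrier G"] openin_l_coset[OF level_open[OF V]] by auto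
    have sets: "A \<in> sets \<mu>" "emeasure \<mu> A = 0" if "A \<in> \<F>" for A
      using that F(2) haar_open openin_l_coset[OF level_open[OF V]] haar_left[OF _ level_open[OF V]] zero
      by auto
    then have U: "\<Union>\<F> \<in> sets \<mu>" using F(1) by (meson sets.finite_Union subsetI)
    have "emeasure \<mu> (\<Union>\<F>) \<le> (\<Sum>A\<in>\<F>. emeasure \<mu> A)"
      using emeasure_subadditive_finite[OF F(1), of "\<lambda>A. A" \<mu>] sets by auto
    also have "\<dots> = 0" using sets by simp
    finally have "emeasure \<mu> (\<Union>\<F>) = 0" by simp
    then show ?thesis using emeasure_mono[OF F(3) U] by simp
  qed
  then have "(SUP C\<in>{C. compactin T C \<and> C \<subseteq> topspace T}. emeasure \<mu> C) = 0"
    by (intro antisym SUP_least) auto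
  moreover have "emeasure \<mu> (topspace T) = (SUP C\<in>{C. compactin T C \<and> C \<subseteq> topspace T}. emeasure \<mu> C)"
    using haar openin_topspace unfolding left_haar_measure_def by blast
  moreover have "emeasure \<mu> (topspace T) \<noteq> 0"
    using haar unfolding left_haar_measure_def by metis
  ultimately show False by simp
qed

lemma haar_level_pos: "V \<in> \<Upsilon> \<Longrightarrow> measure \<mu> V > 0"
  using haar_level_finite haar_level_nonzero
  by (simp add: measure_def enn2real_positive_iff less_top zero_less_iff_neq_zero)

lemma haar_partition:
  assumes fin: "finite \<C>" and disj: "pairwise disjnt \<C>" and un: "\<Union>\<C> = W"
    and op: "\<And>A. A \<in> \<C> \<Longrightarrow> openin T A" and eq: "\<And>A. A \<in> \<C> \<Longrightarrow> emeasure \<mu> A = emeasure \<mu> V"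
  shows "measure \<mu> W = card \<C> * measure \<mu> V"
proof -
  have "(\<Sum>A\<in>\<C>. emeasure \<mu> A) = emeasure \<mu> (\<Union>A\<in>\<C>. A)"
    by (rule sum_emeasure)
       (use assms haar_open disj in \<open>auto simp: disjoint_family_on_def pairwise_def disjnt_def\<close>)
  then have "emeasure \<mu> W = of_nat (card \<C>) * emeasure \<mu> V" using un eq by simp
  then show ?thesis by (simp add: measure_def enn2real_mult)
qed

lemma haar_left_cosets:
  assumes "V \<in> \<Upsilon>" "W \<in> \<Upsilon>" "V \<subseteq> W"
  shows "measure \<mu> W = card (left_cosets W V) * measure \<mu> V"
proof (rule haar_partition[OF left_cosets_props(1,3,2)[OF assms]])
  fix A assume "A \<in> left_cosets W V"
  then obtain w where "w \<in> carrier G" "A = w <# V" using level_subset[OF assms(2)] by (auto simp: left_cosets_def)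
  then show "openin T A" "emeasure \<mu> A = emeasure \<mu> V"
    using openin_l_coset haar_left level_open[OF assms(1)] by auto
qed

lemma haar_right_cosets:
  assumes "V \<in> \<Upsilon>" "W \<in> \<Upsilon>" "V \<subseteq> W"
    and "\<And>a. a \<in> carrier G \<Longrightarrow> emeasure \<mu> (V #> a) = emeasure \<mu> V"
  shows "measure \<mu> W = card (right_cosets W V) * measure \<mu> V"
proof (rule haar_partition[OF left_cosets_props(4,6,5)[OF assms(1-3)]])
  fix A assume "A \<in> right_cosets W V"
  then obtain w where "w \<in> carrier G" "A = V #> w" using level_subset[OF assms(2)] by (auto simp: right_cosets_def)
  then show "openin T A" "emeasure \<mu> A = emeasure \<mu> V"
    using openin_r_coset level_open[OF assms(1)] assms(4) by auto
qed

text \<open>Both levels are finite disjoint unions of left translates of their intersection. The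
  right hand side mentions no measure, so the quotient is the same for every left Haar measure; this
  is used to pass between two of them.\<close>

lemma haar_ratio:
  assumes "U \<in> \<Upsilon>" "V \<in> \<Upsilon>"
  shows "measure \<mu> U / measure \<mu> V =
    of_nat (card (left_cosets U (U \<inter> V))) / of_nat (card (left_cosets V (U \<inter> V)))"
proof -
  have UV: "U \<inter> V \<in> \<Upsilon>" using T3 assms by blast
  show ?thesis
    using haar_left_cosets[OF UV assms(1)] haar_left_cosets[OF UV assms(2)] haar_level_pos[OF UV] by simp
qed

lemma card_left_cosets_pos:
  assumes "V \<in> \<Upsilon>" "W \<in> \<Upsilon>" "V \<subseteq> W"
  shows "card (left_cosets W V) > 0"
  using haar_left_cosets[OF assms] haar_level_pos[OF assms(2)] by (cases "card (left_cosets W V)") auto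

text \<open>The coset counts supply the rational number, and injectivity of the embedding into the
  reals makes it unique. Identities between indices can therefore be checked on real
  measures.\<close>

lemma haar_index_rat:
  assumes "U \<in> \<Upsilon>" "V \<in> \<Upsilon>"
  shows "haar_index \<mu> U V =
    of_nat (card (left_cosets U (U \<inter> V))) / of_nat (card (left_cosets V (U \<inter> V)))"
    "real_of_rat (haar_index \<mu> U V) = measure \<mu> U / measure \<mu> V"
proof -
  define q :: rat where
    "q = of_nat (card (left_cosets U (U \<inter> V))) / of_nat (card (left_cosets V (U \<inter> V)))"
  have q: "real_of_rat q = measure \<mu> U / measure \<mu> V"
    unfolding haar_ratio[OF assms] by (simp add: q_def of_rat_divide)
  then have "haar_index \<mu> U V = q"
    unfolding haar_index_def by (intro the_equality) (auto simp: q[symmetric])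
  then show "haar_index \<mu> U V =
      of_nat (card (left_cosets U (U \<inter> V))) / of_nat (card (left_cosets V (U \<inter> V)))"
    "real_of_rat (haar_index \<mu> U V) = measure \<mu> U / measure \<mu> V"
    using q by (simp_all add: q_def)
qed

context
  assumes unimodular: "unimodular G T"
begin

text \<open>Unimodularity provides some bi-invariant measure \<nu>, not bi-invariance of \<mu>
  itself. For \<nu> the claim is left and right invariance; by \<open>haar_ratio\<close> the
  quotient of the measures of the two levels is the same for \<nu> and \<mu>.\<close>

lemma measure_conjugate:
  assumes V: "V \<in> \<Upsilon>" and a: "a \<in> carrier G"
  shows "measure \<mu> (conjugate G a V) = measure \<mu> V"
proof -
  obtain \<nu> where nu: "left_haar_measure G T \<nu>"
    "\<And>a A. a \<in> carrier G \<Longrightarrow> A \<in> sets \<nu> \<Longrightarrow> emeasure \<nu> (A #> a) = emeasure \<nu> A"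
    using unimodular by (auto simp: unimodular_def)
  have aV: "conjugate G a V \<in> \<Upsilon>" using T1 V a by blast
  have "emeasure \<nu> (conjugate G a V) = emeasure \<nu> (a <# V)"
    unfolding conjugate_eq_cosets
    using nu(2)[OF inv_closed[OF a] level_collection.haar_open[OF level_collection_axioms nu(1)
        openin_l_coset[OF level_open[OF V] a]]] .
  also have "\<dots> = emeasure \<nu> V"
    by (rule level_collection.haar_left[OF level_collection_axioms nu(1) a level_open[OF V]])
  finally have "measure \<nu> (conjugate G a V) = measure \<nu> V" by (simp add: measure_def)
  moreover have "measure \<nu> V > 0"
    using level_collection.haar_level_pos[OF level_collection_axioms nu(1) V] .
  ultimately have "1 = measure \<nu> (conjugate G a V) / measure \<nu> V" by simp
  also have "\<dots> = measure \<mu> (conjugate G a V) / measure \<mu> V"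
    unfolding haar_ratio[OF aV V] level_collection.haar_ratio[OF level_collection_axioms nu(1) aV V] ..
  finally show ?thesis using haar_level_pos[OF V] by simp
qed

text \<open>For a bi-invariant measure, left and right cosets of V all have the measure of V, so
  both counts equal the same quotient. The cohomological axiom counts right cosets, while Haar
  indices are expressed here by left cosets.\<close>

lemma card_right_cosets:
  assumes "V \<in> \<Upsilon>" "W \<in> \<Upsilon>" "V \<subseteq> W"
  shows "card (right_cosets W V) = card (left_cosets W V)"
proof -
  obtain \<nu> where nu: "left_haar_measure G T \<nu>"
    "\<And>a A. a \<in> carrier G \<Longrightarrow> A \<in> sets \<nu> \<Longrightarrow> emeasure \<nu> (A #> a) = emeasure \<nu> A"
    using unimodular by (auto simp: unimodular_def)
  have V: "V \<in> sets \<nu>"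
    by (rule level_collection.haar_open[OF level_collection_axioms nu(1) level_open[OF assms(1)]])
  show ?thesis
    using level_collection.haar_left_cosets[OF level_collection_axioms nu(1) assms]
      level_collection.haar_right_cosets[OF level_collection_axioms nu(1) assms nu(2)[OF _ V]]
      level_collection.haar_level_pos[OF level_collection_axioms nu(1) assms(1)] by simp
qed

lemma haar_index_pos:
  assumes "U \<in> \<Upsilon>" "V \<in> \<Upsilon>"
  shows "haar_index \<mu> U V > 0"
proof -
  have "real_of_rat (haar_index \<mu> U V) > 0"
    using haar_index_rat(2)[OF assms] haar_level_pos[OF assms(1)] haar_level_pos[OF assms(2)] by simp
  then show ?thesis by simp
qed

lemma haar_index_trans:
  assumes "U \<in> \<Upsilon>" "V \<in> \<Upsilon>" "W \<in> \<Upsilon>"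
  shows "haar_index \<mu> U V * haar_index \<mu> V W = haar_index \<mu> U W"
proof -
  have "real_of_rat (haar_index \<mu> U V * haar_index \<mu> V W) = real_of_rat (haar_index \<mu> U W)"
    using haar_index_rat(2)[OF assms(1,2)] haar_index_rat(2)[OF assms(2,3)]
      haar_index_rat(2)[OF assms(1,3)] haar_level_pos[OF assms(2)]
    by (simp add: of_rat_mult)
  then show ?thesis by (simp only: of_rat_eq_iff)
qed

lemma haar_index_self: "U \<in> \<Upsilon> \<Longrightarrow> haar_index \<mu> U U = 1"
  using haar_index_rat(2)[of U U] haar_level_pos[of U] by (simp add: of_rat_eq_1_iff)

lemma haar_index_conjugate:
  assumes "U \<in> \<Upsilon>" "V \<in> \<Upsilon>" "a \<in> carrier G"
  shows "haar_index \<mu> (conjugate G a U) (conjugate G a V) = haar_index \<mu> U V"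
    "haar_index \<mu> U (conjugate G a V) = haar_index \<mu> U V"
    "haar_index \<mu> (conjugate G a U) V = haar_index \<mu> U V"
proof -
  note m = measure_conjugate[OF assms(1,3)] measure_conjugate[OF assms(2,3)]
  note i = haar_index_rat(2) assms T1
  have "real_of_rat (haar_index \<mu> (conjugate G a U) (conjugate G a V)) = real_of_rat (haar_index \<mu> U V)"
    "real_of_rat (haar_index \<mu> U (conjugate G a V)) = real_of_rat (haar_index \<mu> U V)"
    "real_of_rat (haar_index \<mu> (conjugate G a U) V) = real_of_rat (haar_index \<mu> U V)"
    by (simp_all add: i m)
  then show "haar_index \<mu> (conjugate G a U) (conjugate G a V) = haar_index \<mu> U V"
    "haar_index \<mu> U (conjugate G a V) = haar_index \<mu> U V"
    "haar_index \<mu> (conjugate G a U) V = haar_index \<mu> U V"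
    by (simp_all only: of_rat_eq_iff)
qed

lemma haar_index_subset:
  assumes "V \<in> \<Upsilon>" "W \<in> \<Upsilon>" "V \<subseteq> W"
  shows "haar_index \<mu> W V = of_nat (card (left_cosets W V))"
proof -
  have "real_of_rat (haar_index \<mu> W V) = real_of_rat (of_nat (card (left_cosets W V)))"
    using haar_index_rat(2)[OF assms(2,1)] haar_left_cosets[OF assms] haar_level_pos[OF assms(1)]
    by simp
  then show ?thesis by (simp only: of_rat_eq_iff)
qed

end

end

end

section \<open>Positive rational scalars\<close>

context field
begin

context
  assumes char0: "\<And>k::nat. k > 0 \<Longrightarrow> add_pow R k \<one> \<noteq> \<zero>"
begin

lemma add_pow_one_mult: "add_pow R (k::nat) \<one> \<otimes> add_pow R (l::nat) \<one> = add_pow R (k * l) \<one>"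
  by (simp add: add_pow_ldistr add.nat_pow_pow mult.commute)

lemma pos_rat_cases:
  assumes "(q::rat) > 0"
  obtains m n :: nat where "m > 0" "n > 0" "q = of_nat m / of_nat n"
proof -
  obtain a b where ab: "quotient_of q = (a, b)" by (cases "quotient_of q")
  have b: "b > 0" using quotient_of_denom_pos[OF ab] .
  have q: "q = of_int a / of_int b" using quotient_of_div[OF ab] .
  then have "a > 0" using assms b by (simp add: zero_less_divide_iff)
  then show ?thesis using that[of "nat a" "nat b"] b q by simp
qed

lemma rat_in_of_nat: "n > 0 \<Longrightarrow> rat_in R (of_nat n) = add_pow R n \<one>"
  using rat_in_div[OF char0, of 1 n] by simp

lemma rat_in_closed: "q > 0 \<Longrightarrow> rat_in R q \<in> carrier R"
  using char0 by (elim pos_rat_cases) (simp add: rat_in_div[OF char0] field_Units)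

text \<open>The product of two reduced fractions need not be reduced, so multiplicativity is derived
  from the description by arbitrary fractions in \<open>rat_in_div\<close>.\<close>

lemma rat_in_mult:
  assumes "q > 0" "q' > 0"
  shows "rat_in R (q * q') = rat_in R q \<otimes> rat_in R q'"
proof -
  obtain m n :: nat where q: "m > 0" "n > 0" "q = of_nat m / of_nat n" using assms(1) by (rule pos_rat_cases)
  obtain m' n' :: nat where q': "m' > 0" "n' > 0" "q' = of_nat m' / of_nat n'" using assms(2) by (rule pos_rat_cases)
  have U: "add_pow R n \<one> \<in> Units R" "add_pow R n' \<one> \<in> Units R"
    using char0 q q' by (auto simp: field_Units)
  have "(add_pow R n \<one> \<otimes> add_pow R n' \<one>) \<otimes> (inv (add_pow R n \<one>) \<otimes> inv (add_pow R n' \<one>)) =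
      (add_pow R n \<one> \<otimes> inv (add_pow R n \<one>)) \<otimes> (add_pow R n' \<one> \<otimes> inv (add_pow R n' \<one>))"
    using U by (simp add: m_ac del: Units_r_inv Units_l_inv)
  then have inv: "inv (add_pow R n \<one> \<otimes> add_pow R n' \<one>) = inv (add_pow R n \<one>) \<otimes> inv (add_pow R n' \<one>)"
    using U by (intro comm_inv_char) auto
  have nn: "n * n' > 0" using q q' by simp
  have e: "q * q' = of_nat (m * m') / of_nat (n * n')" using q q' by simp
  have 1: "rat_in R (q * q') = add_pow R (m * m') \<one> \<otimes> inv (add_pow R (n * n') \<one>)"
    unfolding e by (rule rat_in_div[OF char0 nn])
  have 2: "rat_in R q = add_pow R m \<one> \<otimes> inv (add_pow R n \<one>)"
    unfolding q(3) by (rule rat_in_div[OF char0 q(2)])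
  have 3: "rat_in R q' = add_pow R m' \<one> \<otimes> inv (add_pow R n' \<one>)"
    unfolding q'(3) by (rule rat_in_div[OF char0 q'(2)])
  show ?thesis
    unfolding 1 2 3 add_pow_one_mult[symmetric] inv using U by (simp add: m_ac)
qed

end

end

section \<open>Conjugates of subsets and subgroups\<close>

lemma (in group) conjugate_conjugate:
  assumes "g \<in> carrier G" "h \<in> carrier G" "V \<subseteq> carrier G"
  shows "conjugate G g (conjugate G h V) = conjugate G (g \<otimes> h) V"
proof -
  have "g \<otimes> (h \<otimes> k \<otimes> inv h) \<otimes> inv g = (g \<otimes> h) \<otimes> k \<otimes> inv (g \<otimes> h)" if "k \<in> V" for k
    using that assms by (auto simp: m_assoc inv_mult_group)
  then show ?thesis unfolding conjugate_def image_image by (intro image_cong) auto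
qed

lemma (in group) conjugate_one: "V \<subseteq> carrier G \<Longrightarrow> conjugate G \<one> V = V"
  by (force simp: conjugate_def)

lemma conjugate_mono: "V \<subseteq> W \<Longrightarrow> conjugate G g V \<subseteq> conjugate G g W"
  by (auto simp: conjugate_def)

lemma (in group) conjugate_inv_conjugate:
  assumes "g \<in> carrier G" "V \<subseteq> carrier G"
  shows "conjugate G (inv g) (conjugate G g V) = V" "conjugate G g (conjugate G (inv g) V) = V"
  using assms by (simp_all add: conjugate_conjugate conjugate_one)

lemma (in group) conjugate_subgroup:
  assumes V: "subgroup V G" and g: "g \<in> V"
  shows "conjugate G g V = V"
proof -
  interpret V: subgroup V G by fact
  have sub: "conjugate G h V \<subseteq> V" if "h \<in> V" for h
    using that by (auto simp: conjugate_def)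
  have "conjugate G g (conjugate G (inv g) V) \<subseteq> conjugate G g V"
    using sub[of "inv g"] g by (intro conjugate_mono) auto
  then show ?thesis using sub[OF g] conjugate_inv_conjugate(2)[of g V] g V.subset by auto
qed

lemma (in group) conjugate_Int:
  assumes "g \<in> carrier G" "V \<subseteq> carrier G" "W \<subseteq> carrier G"
  shows "conjugate G g (V \<inter> W) = conjugate G g V \<inter> conjugate G g W"
proof -
  have "inj_on (\<lambda>k. g \<otimes> k \<otimes> inv g) (carrier G)"
    using assms(1) by (intro inj_onI) simp
  then show ?thesis unfolding conjugate_def using assms(2,3) by (intro inj_on_image_Int) auto
qed

section \<open>The completion of a CoMack functor\<close>

text \<open>\<open>U\<close> is the reference level against which all indices are normalised. The
  condition on multiples of one makes indices invertible in the fraction field, and the domain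
  condition lets the kernel of localisation be identified with the torsion.\<close>

locale comack_haar = comack_functor G T \<Upsilon> R M + Rd: domain R
  for G :: "('g, 'b) monoid_scheme" (structure) and T :: "'g topology" and \<Upsilon> :: "'g set set"
    and R :: "('r, 'x) ring_scheme" and M :: "('g, 'r, 'm) ric" +
  fixes \<mu> :: "'g measure" and U :: "'g set"
  assumes haar: "left_haar_measure G T \<mu>" and unimod: "unimodular G T" and U: "U \<in> \<Upsilon>"
    and char0: "\<And>k::nat. k > 0 \<Longrightarrow> add_pow R k \<one>\<^bsub>R\<^esub> \<noteq> \<zero>\<^bsub>R\<^esub>"
begin

abbreviation Q where "Q \<equiv> fraction_field R"
abbreviation D where "D \<equiv> rational_obj R M"
abbreviation rpull where "rpull \<equiv> rational_pull R M"
abbreviation rpush where "rpush g L K \<equiv> tensor_map R (obj M K) Q (push M g L K)"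
abbreviation cls where "cls \<equiv> completion_class G \<Upsilon> R M"
abbreviation Nh where "Nh \<equiv> completion G \<Upsilon> R M"
abbreviation act where "act \<equiv> completion_act G \<Upsilon> R M"

lemma level_homI:
  assumes "L \<in> \<Upsilon>" "K \<in> \<Upsilon>" "g \<in> carrier G" "L \<subseteq> conjugate G g K"
  shows "g \<in> level_hom G \<Upsilon> L K"
proof -
  have "conjugate G (inv g) L \<subseteq> conjugate G (inv g) (conjugate G g K)"
    by (rule conjugate_mono) fact
  then show ?thesis using assms conjugate_inv_conjugate(1)[OF assms(3) level_subset[OF assms(2)]]
    by (simp add: level_hom_def)
qed

lemma level_hom_one: "L \<in> \<Upsilon> \<Longrightarrow> K \<in> \<Upsilon> \<Longrightarrow> L \<subseteq> K \<Longrightarrow> \<one> \<in> level_hom G \<Upsilon> L K"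
  by (rule level_homI) (auto simp: conjugate_one level_subset)

lemma level_hom_conjugate: "V \<in> \<Upsilon> \<Longrightarrow> g \<in> carrier G \<Longrightarrow> g \<in> level_hom G \<Upsilon> (conjugate G g V) V"
  by (rule level_homI) (auto simp: T1)

lemma rpull_linear:
  assumes "g \<in> level_hom G \<Upsilon> L K"
  shows "linear_map Q (D K) (D L) (rpull g L K)"
  unfolding rational_obj_def rational_pull_def
  by (rule Rd.Q.tensor_map_linear) (use assms obj_module pull_linear in \<open>auto simp: level_hom_def\<close>)

lemma rpush_linear:
  assumes "g \<in> level_hom G \<Upsilon> L K"
  shows "linear_map Q (D L) (D K) (rpush g L K)"
  unfolding rational_obj_def
  by (rule Rd.Q.tensor_map_linear) (use assms obj_module push_linear in \<open>auto simp: level_hom_def\<close>)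

lemma level_hom_comp:
  assumes "h \<in> level_hom G \<Upsilon> L' L" "g \<in> level_hom G \<Upsilon> L K"
  shows "h \<otimes> g \<in> level_hom G \<Upsilon> L' K"
proof (rule level_homI)
  have hg: "h \<in> carrier G" "g \<in> carrier G" "L' \<in> \<Upsilon>" "L \<in> \<Upsilon>" "K \<in> \<Upsilon>"
    and sub: "conjugate G (inv h) L' \<subseteq> L" "conjugate G (inv g) L \<subseteq> K"
    using assms by (auto simp: level_hom_def)
  show "L' \<in> \<Upsilon>" "K \<in> \<Upsilon>" "h \<otimes> g \<in> carrier G" using hg by auto
  have "L' \<subseteq> conjugate G h L"
    using conjugate_mono[OF sub(1), of G h] conjugate_inv_conjugate(2)[OF hg(1) level_subset[OF hg(3)]] by simp
  also have "L \<subseteq> conjugate G g K"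
    using conjugate_mono[OF sub(2), of G g] conjugate_inv_conjugate(2)[OF hg(2) level_subset[OF hg(4)]] by simp
  then have "conjugate G h L \<subseteq> conjugate G h (conjugate G g K)" by (rule conjugate_mono)
  finally show "L' \<subseteq> conjugate G (h \<otimes> g) K"
    using conjugate_conjugate[OF hg(1,2) level_subset[OF hg(5)]] by simp
qed

lemma rpull_comp:
  assumes h: "h \<in> level_hom G \<Upsilon> L' L" and g: "g \<in> level_hom G \<Upsilon> L K" and y: "y \<in> carrier (D K)"
  shows "rpull h L' L (rpull g L K y) = rpull (h \<otimes> g) L' K y"
proof -
  have l: "L' \<in> \<Upsilon>" "L \<in> \<Upsilon>" "K \<in> \<Upsilon>" using h g by (auto simp: level_hom_def)
  show ?thesis
    using y unfolding rational_obj_def rational_pull_def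
    by (intro Rd.Q.tensor_map_comp[OF obj_module[OF l(3)] obj_module[OF l(2)] obj_module[OF l(1)]
          pull_linear[OF g] pull_linear[OF h] pull_linear[OF level_hom_comp[OF h g]]])
       (simp add: pull_comp[OF h g])
qed

lemma rpull_id: "K \<in> \<Upsilon> \<Longrightarrow> y \<in> carrier (D K) \<Longrightarrow> rpull \<one> K K y = y"
  unfolding rational_obj_def rational_pull_def
  by (rule Rd.Q.tensor_map_id) (auto simp: obj_module pull_linear level_hom_one pull_id)

lemma module_D: "V \<in> \<Upsilon> \<Longrightarrow> Module.module Q (D V)"
  unfolding rational_obj_def by (rule Rd.Q.module_tensor[OF obj_module])

sublocale dm: directed_modules Q \<Upsilon> D "rpull \<one>"
proof (rule directed_modules.intro)
  show "\<Upsilon> \<noteq> {}" by (rule nonempty)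
  fix V W assume "V \<in> \<Upsilon>" "W \<in> \<Upsilon>"
  then show "V \<inter> W \<in> \<Upsilon>" by (rule T3)
next
  fix V assume "V \<in> \<Upsilon>"
  then show "Module.module Q (D V)" by (rule module_D)
next
  fix L K assume "L \<in> \<Upsilon>" "K \<in> \<Upsilon>" "L \<subseteq> K"
  then show "linear_map Q (D K) (D L) (rpull \<one> L K)" by (intro rpull_linear level_hom_one)
next
  fix K x assume "K \<in> \<Upsilon>" "x \<in> carrier (D K)"
  then show "rpull \<one> K K x = x" by (rule rpull_id)
next
  fix Z L K x assume "Z \<in> \<Upsilon>" "L \<in> \<Upsilon>" "K \<in> \<Upsilon>" "Z \<subseteq> L" "L \<subseteq> K" "x \<in> carrier (D K)"
  then show "rpull \<one> Z L (rpull \<one> L K x) = rpull \<one> Z K x"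
    using rpull_comp[OF level_hom_one level_hom_one] by simp
qed

lemma Nh_eq: "Nh = dm.DL" and cls_eq: "cls = dm.cls"
  by (simp_all add: completion_def completion_class_def)

sublocale Nh: Module.module Q Nh
  unfolding Nh_eq by (rule dm.module_limit)

lemmas cls_restrict = dm.limit_class_trans[folded cls_eq]
  and Nh_cases = dm.limit_cases[folded Nh_eq cls_eq]
  and Nh_cases_below = dm.limit_cases_below[folded Nh_eq cls_eq]
  and cls_linear = dm.limit_class_linear[folded Nh_eq cls_eq]
  and UN_cls = dm.UN_limit_class[folded cls_eq]
  and Nh_map_linear = dm.limit_map_linear[folded Nh_eq]
  and smult_cls = dm.smult_limit_class[folded Nh_eq cls_eq]

text \<open>Restricting and then transporting by h, or transporting and then restricting, are both
  the pull-back along the same morphism h from the conjugate of Z to W.\<close>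

lemma act_compatible:
  assumes h: "h \<in> carrier G" and Z: "Z \<in> \<Upsilon>" "W \<in> \<Upsilon>" "Z \<subseteq> W" and y: "y \<in> carrier (D W)"
  shows "cls (conjugate G h Z) (rpull h (conjugate G h Z) Z (rpull \<one> Z W y)) =
    cls (conjugate G h W) (rpull h (conjugate G h W) W y)"
proof -
  have hZ: "conjugate G h Z \<in> \<Upsilon>" and hW: "conjugate G h W \<in> \<Upsilon>" using T1 Z h by auto
  have sub: "conjugate G h Z \<subseteq> conjugate G h W" by (rule conjugate_mono[OF Z(3)])
  have "rpull h (conjugate G h Z) Z (rpull \<one> Z W y) = rpull h (conjugate G h Z) W y"
    using rpull_comp[OF level_hom_conjugate[OF Z(1) h] level_hom_one[OF Z] y] h by simp
  also have "\<dots> = rpull \<one> (conjugate G h Z) (conjugate G h W) (rpull h (conjugate G h W) W y)"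
    using rpull_comp[OF level_hom_one[OF hZ hW sub] level_hom_conjugate[OF Z(2) h] y] h by simp
  finally show ?thesis
    using cls_restrict[OF hZ hW sub] linear_map_closed[OF rpull_linear[OF level_hom_conjugate[OF Z(2) h]] y]
    by simp
qed

lemma act_linear:
  assumes h: "h \<in> carrier G"
  shows "linear_map Q Nh Nh (act h)"
proof -
  have "linear_map Q (D V) Nh (\<lambda>y. cls (conjugate G h V) (rpull h (conjugate G h V) V y))" if V: "V \<in> \<Upsilon>" for V
    using rpull_linear[OF level_hom_conjugate[OF V h]] cls_linear[OF T1[OF V h]]
    by (auto simp: linear_map_def Pi_iff)
  from Nh_map_linear[OF this act_compatible[OF h]]
  show ?thesis by (simp add: completion_act_def[abs_def])
qed

lemma act_cls:
  assumes h: "h \<in> carrier G" and V: "V \<in> \<Upsilon>" and y: "y \<in> carrier (D V)"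
  shows "act h (cls V y) = cls (conjugate G h V) (rpull h (conjugate G h V) V y)"
  unfolding completion_act_def
  by (rule UN_cls[where f = "\<lambda>V y. cls (conjugate G h V) (rpull h (conjugate G h V) V y)",
        OF V y act_compatible[OF h]])

lemma act_one: "v \<in> carrier Nh \<Longrightarrow> act \<one> v = v"
  by (erule Nh_cases) (simp add: act_cls conjugate_one level_subset rpull_id)

lemma act_mult:
  assumes h: "h \<in> carrier G" and k: "k \<in> carrier G" and v: "v \<in> carrier Nh"
  shows "act h (act k v) = act (h \<otimes> k) v"
proof -
  obtain V y where *: "V \<in> \<Upsilon>" "y \<in> carrier (D V)" "v = cls V y" using v by (rule Nh_cases)
  note kV = T1[OF *(1) k]
  have "rpull h (conjugate G h (conjugate G k V)) (conjugate G k V) (rpull k (conjugate G k V) V y)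
      = rpull (h \<otimes> k) (conjugate G h (conjugate G k V)) V y"
    by (rule rpull_comp[OF level_hom_conjugate[OF kV h] level_hom_conjugate[OF *(1) k] *(2)])
  then show ?thesis
    using * h k kV linear_map_closed[OF rpull_linear[OF level_hom_conjugate[OF *(1) k]] *(2)]
    by (simp add: act_cls conjugate_conjugate level_subset)
qed

definition scal :: "'g set \<Rightarrow> 'g set \<Rightarrow> ('r \<times> 'r) set" where
  "scal V W = rat_in Q (haar_index \<mu> V W)"

lemma charQ: "k > 0 \<Longrightarrow> add_pow Q (k::nat) \<one>\<^bsub>Q\<^esub> \<noteq> \<zero>\<^bsub>Q\<^esub>"
  using char0 by (simp add: Rd.fraction_add_pow Rd.fraction_eq_zero_iff)

lemma scal_closed [simp]: "V \<in> \<Upsilon> \<Longrightarrow> W \<in> \<Upsilon> \<Longrightarrow> scal V W \<in> carrier Q"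
  unfolding scal_def using field.rat_in_closed[OF Rd.field_Frac charQ] haar_index_pos[OF haar unimod] by blast

lemma scal_trans:
  "V \<in> \<Upsilon> \<Longrightarrow> W \<in> \<Upsilon> \<Longrightarrow> Z \<in> \<Upsilon> \<Longrightarrow> scal V W \<otimes>\<^bsub>Q\<^esub> scal W Z = scal V Z"
  unfolding scal_def
  using field.rat_in_mult[OF Rd.field_Frac charQ] haar_index_pos[OF haar unimod] haar_index_trans[OF haar unimod]
  by metis

lemma scal_subset:
  assumes "V \<in> \<Upsilon>" "W \<in> \<Upsilon>" "V \<subseteq> W"
  shows "scal W V = add_pow Q (card (left_cosets W V)) \<one>\<^bsub>Q\<^esub>"
  unfolding scal_def haar_index_subset[OF haar unimod assms]
  by (rule field.rat_in_of_nat[OF Rd.field_Frac charQ card_left_cosets_pos[OF haar assms]])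

lemma scal_self [simp]: "V \<in> \<Upsilon> \<Longrightarrow> scal V V = \<one>\<^bsub>Q\<^esub>"
  unfolding scal_def haar_index_self[OF haar unimod]
  using field.rat_in_of_nat[OF Rd.field_Frac charQ, of 1] Rd.fraction_add_pow[of 1]
  by (simp add: Rd.fraction_one)

lemma scal_conjugate:
  assumes "V \<in> \<Upsilon>" "W \<in> \<Upsilon>" "a \<in> carrier G"
  shows "scal (conjugate G a V) (conjugate G a W) = scal V W"
    "scal V (conjugate G a W) = scal V W" "scal (conjugate G a V) W = scal V W"
  using haar_index_conjugate[OF haar unimod assms] by (simp_all add: scal_def)


section \<open>Averaging over a compact open subgroup\<close>

text \<open>For a vector at level V: restrict to the intersection with W, push forward to W, and
  divide by the index, since [V \<inter> W : W] is the inverse of the index of V \<inter> W in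
  W.\<close>

definition average_part :: "'g set \<Rightarrow> 'g set \<Rightarrow> ('m \<times> ('r \<times> 'r) set \<Rightarrow>\<^sub>0 int) set \<Rightarrow> ('g, 'r, 'm) completion_elt" where
  "average_part W V y = cls W (scal (V \<inter> W) W \<odot>\<^bsub>D W\<^esub> rpush \<one> (V \<inter> W) W (rpull \<one> (V \<inter> W) V y))"

definition average :: "'g set \<Rightarrow> ('g, 'r, 'm) completion_elt \<Rightarrow> ('g, 'r, 'm) completion_elt" where
  "average W v = (\<Union>(V, y)\<in>v. average_part W V y)"

lemma rpush_comp:
  assumes h: "h \<in> level_hom G \<Upsilon> L' L" and g: "g \<in> level_hom G \<Upsilon> L K" and y: "y \<in> carrier (D L')"
  shows "rpush g L K (rpush h L' L y) = rpush (h \<otimes> g) L' K y"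
proof -
  have l: "L' \<in> \<Upsilon>" "L \<in> \<Upsilon>" "K \<in> \<Upsilon>" using h g by (auto simp: level_hom_def)
  show ?thesis
    using y unfolding rational_obj_def
    by (intro Rd.Q.tensor_map_comp[OF obj_module[OF l(1)] obj_module[OF l(2)] obj_module[OF l(3)]
          push_linear[OF h] push_linear[OF g] push_linear[OF level_hom_comp[OF h g]]])
       (simp add: push_comp[OF h g])
qed

lemma obj_add_pow:
  assumes "K \<in> \<Upsilon>" "x \<in> carrier (obj M K)"
  shows "add_pow (obj M K) (n::nat) x = add_pow R n \<one>\<^bsub>R\<^esub> \<odot>\<^bsub>obj M K\<^esub> x"
proof -
  interpret K: Module.module R "obj M K" by (rule obj_module[OF assms(1)])
  show ?thesis
    using assms(2) by (induction n) (simp_all add: K.smult_l_distr)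
qed

lemma push_pull:
  assumes "L \<in> \<Upsilon>" "K \<in> \<Upsilon>" "L \<subseteq> K" "x \<in> carrier (obj M K)"
  shows "push M \<one> L K (pull M \<one> L K x) = add_pow (obj M K) (card (left_cosets K L)) x"
  using cohomological[OF assms] by (simp add: rcosets_level card_right_cosets[OF haar unimod assms(1-3)])

text \<open>On pure tensors this is the cohomological axiom; the integer multiple moves across the
  tensor sign and becomes the scalar [K : L].\<close>

lemma rpush_rpull:
  assumes "L \<in> \<Upsilon>" "K \<in> \<Upsilon>" "L \<subseteq> K" "y \<in> carrier (D K)"
  shows "rpush \<one> L K (rpull \<one> L K y) = scal K L \<odot>\<^bsub>D K\<^esub> y"
proof -
  interpret DK: Module.module Q "D K" by (rule module_D[OF assms(2)])
  interpret K: Module.module R "obj M K" by (rule obj_module[OF assms(2)])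
  note one = level_hom_one[OF assms(1-3)]
  note lin = linear_imp_additive[OF rpull_linear[OF one]] linear_imp_additive[OF rpush_linear[OF one]]
  let ?n = "card (left_cosets K L)"
  have sc: "scal K L \<in> carrier Q" using assms by simp
  have sca: "additive_map (D K) (D K) (\<lambda>y. scal K L \<odot>\<^bsub>D K\<^esub> y)"
    using sc by (simp add: additive_map_def DK.smult_r_distr)
  show ?thesis
  proof (rule Rd.Q.tensor_ext[OF obj_module[OF assms(2)] DK.abelian_group_axioms,
      folded rational_obj_def, OF additive_map_comp[OF lin] sca _ assms(4)])
    fix x a assume x: "x \<in> carrier (obj M K)" and a: "a \<in> carrier Q"
    have "rpush \<one> L K (rpull \<one> L K (pure_tensor R (obj M K) Q x a))
        = pure_tensor R (obj M K) Q (push M \<one> L K (pull M \<one> L K x)) a"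
      unfolding rational_pull_def
      using x a obj_module[OF assms(1)] obj_module[OF assms(2)] pull_linear[OF one] push_linear[OF one]
      by (simp add: Rd.Q.tensor_map_pure linear_map_closed)
    also have "push M \<one> L K (pull M \<one> L K x) = add_pow R ?n \<one>\<^bsub>R\<^esub> \<odot>\<^bsub>obj M K\<^esub> x"
      using push_pull[OF assms(1-3) x] obj_add_pow[OF assms(2) x] by simp
    also have "pure_tensor R (obj M K) Q (add_pow R ?n \<one>\<^bsub>R\<^esub> \<odot>\<^bsub>obj M K\<^esub> x) a
        = pure_tensor R (obj M K) Q x (add_pow R ?n \<one>\<^bsub>R\<^esub> \<odot>\<^bsub>Q\<^esub> a)"
      using x a by (intro Rd.Q.pure_tensor_smult[OF obj_module[OF assms(2)]]) auto
    also have "add_pow R ?n \<one>\<^bsub>R\<^esub> \<odot>\<^bsub>Q\<^esub> a = scal K L \<otimes>\<^bsub>Q\<^esub> a"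
    proof -
      have "add_pow R ?n \<one>\<^bsub>R\<^esub> \<odot>\<^bsub>Q\<^esub> \<one>\<^bsub>Q\<^esub> = scal K L"
        unfolding scal_subset[OF assms(1-3)] Rd.fraction_add_pow
        by (simp add: Rd.fraction_one Rd.fraction_smult)
      then show ?thesis
        using a Rd.Frac_smult_assoc[of "add_pow R ?n \<one>\<^bsub>R\<^esub>" "\<one>\<^bsub>Q\<^esub>" a] by simp
    qed
    finally show "rpush \<one> L K (rpull \<one> L K (pure_tensor R (obj M K) Q x a))
        = scal K L \<odot>\<^bsub>D K\<^esub> pure_tensor R (obj M K) Q x a"
      using x a sc unfolding rational_obj_def
      by (simp add: Rd.Q.smult_pure_tensor[OF obj_module[OF assms(2)]])
  qed
qed

lemma average_part_linear:
  assumes W: "W \<in> \<Upsilon>" and V: "V \<in> \<Upsilon>"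
  shows "linear_map Q (D V) Nh (average_part W V)"
proof -
  interpret DW: Module.module Q "D W" by (rule module_D[OF W])
  have VW: "V \<inter> W \<in> \<Upsilon>" using T3 V W by blast
  have l1: "linear_map Q (D V) (D (V \<inter> W)) (rpull \<one> (V \<inter> W) V)"
    using V W VW by (intro rpull_linear level_hom_one) auto
  have l2: "linear_map Q (D (V \<inter> W)) (D W) (rpush \<one> (V \<inter> W) W)"
    using V W VW by (intro rpush_linear level_hom_one) auto
  have sc: "scal (V \<inter> W) W \<in> carrier Q" using VW W by simp
  have l3: "linear_map Q (D W) (D W) (\<lambda>y. scal (V \<inter> W) W \<odot>\<^bsub>D W\<^esub> y)"
    using sc by (simp add: linear_map_def DW.smult_r_distr DW.smult_assoc1[symmetric] Rd.Q.A.m_comm)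
  show ?thesis
    using l1 l2 l3 cls_linear[OF W] unfolding linear_map_def average_part_def by (simp add: Pi_iff)
qed

text \<open>The push-forward from Z \<inter> W factors through V \<inter> W, where the cohomological
  axiom produces [V \<inter> W : Z \<inter> W]. This factor is exactly the discrepancy between the
  two normalising denominators.\<close>

lemma average_compatible:
  assumes W: "W \<in> \<Upsilon>" and Z: "Z \<in> \<Upsilon>" "V \<in> \<Upsilon>" "Z \<subseteq> V" and y: "y \<in> carrier (D V)"
  shows "average_part W Z (rpull \<one> Z V y) = average_part W V y"
proof -
  interpret DW: Module.module Q "D W" by (rule module_D[OF W])
  have VW: "V \<inter> W \<in> \<Upsilon>" and ZW: "Z \<inter> W \<in> \<Upsilon>" using T3 Z W by auto
  have sub: "Z \<inter> W \<subseteq> V \<inter> W" "V \<inter> W \<subseteq> W" "V \<inter> W \<subseteq> V" "Z \<inter> W \<subseteq> Z" using Z by auto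
  interpret DVW: Module.module Q "D (V \<inter> W)" by (rule module_D[OF VW])
  define y' where "y' = rpull \<one> (V \<inter> W) V y"
  have y': "y' \<in> carrier (D (V \<inter> W))" unfolding y'_def using dm.trans_closed[OF VW Z(2) sub(3) y] .
  have l2: "linear_map Q (D (V \<inter> W)) (D W) (rpush \<one> (V \<inter> W) W)"
    using W VW by (intro rpush_linear level_hom_one) auto
  have "rpush \<one> (Z \<inter> W) W (rpull \<one> (Z \<inter> W) Z (rpull \<one> Z V y))
      = rpush \<one> (Z \<inter> W) W (rpull \<one> (Z \<inter> W) (V \<inter> W) y')"
    using Z VW ZW sub y by (simp add: y'_def dm.trans_comp)
  also have "\<dots> = rpush \<one> (V \<inter> W) W (rpush \<one> (Z \<inter> W) (V \<inter> W) (rpull \<one> (Z \<inter> W) (V \<inter> W) y'))"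
    using rpush_comp[OF level_hom_one[OF ZW VW sub(1)] level_hom_one[OF VW W sub(2)]]
      dm.trans_closed[OF ZW VW sub(1) y'] by simp
  also have "\<dots> = rpush \<one> (V \<inter> W) W (scal (V \<inter> W) (Z \<inter> W) \<odot>\<^bsub>D (V \<inter> W)\<^esub> y')"
    using rpush_rpull[OF ZW VW sub(1) y'] by simp
  also have "\<dots> = scal (V \<inter> W) (Z \<inter> W) \<odot>\<^bsub>D W\<^esub> rpush \<one> (V \<inter> W) W y'"
    using linear_map_smult[OF l2] VW ZW y' by simp
  finally have "scal (Z \<inter> W) W \<odot>\<^bsub>D W\<^esub> rpush \<one> (Z \<inter> W) W (rpull \<one> (Z \<inter> W) Z (rpull \<one> Z V y))
      = (scal (V \<inter> W) (Z \<inter> W) \<otimes>\<^bsub>Q\<^esub> scal (Z \<inter> W) W) \<odot>\<^bsub>D W\<^esub> rpush \<one> (V \<inter> W) W y'"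
    using VW ZW W linear_map_closed[OF l2 y']
    by (simp add: DW.smult_assoc1[symmetric] Rd.Q.A.m_comm)
  then show ?thesis
    using VW ZW W by (simp add: average_part_def y'_def scal_trans)
qed

lemma average_linear: "W \<in> \<Upsilon> \<Longrightarrow> linear_map Q Nh Nh (average W)"
  using Nh_map_linear[OF average_part_linear average_compatible] by (simp add: average_def[abs_def])

lemma average_cls:
  assumes W: "W \<in> \<Upsilon>" and V: "V \<in> \<Upsilon>" "V \<subseteq> W" and y: "y \<in> carrier (D V)"
  shows "average W (cls V y) = cls W (scal V W \<odot>\<^bsub>D W\<^esub> rpush \<one> V W y)"
proof -
  have "average W (cls V y) = average_part W V y"
    unfolding average_def
    by (rule UN_cls[where f = "average_part W", OF V(1) y average_compatible[OF W]])
  then show ?thesis using V y by (simp add: average_part_def Int_absorb2 rpull_id)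
qed

text \<open>Pull-back along g is push-forward along its inverse. Followed by the push-forward to W,
  that translation can be carried out at level W, where elements of W act trivially.\<close>

lemma average_act:
  assumes W: "W \<in> \<Upsilon>" and g: "g \<in> W" and v: "v \<in> carrier Nh"
  shows "average W (act g v) = average W v"
proof -
  obtain V y where V: "V \<in> \<Upsilon>" "V \<subseteq> W" "y \<in> carrier (D V)" "v = cls V y"
    using v W by (rule Nh_cases_below)
  have gG: "g \<in> carrier G" using g level_subset[OF W] by blast
  let ?gV = "conjugate G g V"
  have gV: "?gV \<in> \<Upsilon>" using T1 V gG by blast
  have gVW: "?gV \<subseteq> W"
    using conjugate_mono[OF V(2), of G g] conjugate_subgroup[OF level_subgroup[OF W] g] by simp
  note pl = level_hom_conjugate[OF V(1) gG] and one = level_hom_one[OF gV W gVW]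
    and one' = level_hom_one[OF V(1) W V(2)]
  have "push M \<one> ?gV W (pull M g ?gV V x) = push M \<one> V W x" if x: "x \<in> carrier (obj M V)" for x
  proof -
    have cV: "conjugate G (inv g) ?gV = V" using conjugate_inv_conjugate(1)[OF gG level_subset[OF V(1)]] .
    have ig: "inv g \<in> level_hom G \<Upsilon> V ?gV"
      by (rule level_homI) (use V gV gG cV in auto)
    have igW: "inv g \<in> W" using subgroup.m_inv_closed[OF level_subgroup[OF W] g] .
    have ig': "inv g \<in> level_hom G \<Upsilon> W W"
      by (rule level_homI) (use W gG conjugate_subgroup[OF level_subgroup[OF W] igW] in auto)
    have px: "push M \<one> V W x \<in> carrier (obj M W)" using linear_map_closed[OF push_linear[OF one'] x] .
    have "push M \<one> ?gV W (pull M g ?gV V x) = push M \<one> ?gV W (push M (inv g) V ?gV x)"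
      using pull_eq_push_inv[OF gV V(1) gG cV x] by simp
    also have "\<dots> = push M (inv g) V W x"
      using push_comp[OF ig one x] gG by simp
    also have "\<dots> = push M (inv g) W W (push M \<one> V W x)"
      using push_comp[OF one' ig' x] gG by simp
    also have "\<dots> = push M \<one> V W x" by (rule push_inner[OF W igW px])
    finally show ?thesis .
  qed
  then have "rpush \<one> ?gV W (rpull g ?gV V y) = rpush \<one> V W y"
    using V(3) unfolding rational_obj_def rational_pull_def
    by (intro Rd.Q.tensor_map_comp[OF obj_module[OF V(1)] obj_module[OF gV] obj_module[OF W]
          pull_linear[OF pl] push_linear[OF one] push_linear[OF one']])
  then show ?thesis
    using V gV gVW W gG linear_map_closed[OF rpull_linear[OF pl] V(3)] scal_conjugate(3)[OF V(1) W gG]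
    by (simp add: act_cls average_cls)
qed

text \<open>By the Mackey formula for a normal subgroup, \<^const>\<open>average\<close> really is an average.\<close>

lemma average_eq_finsum:
  assumes W: "W \<in> \<Upsilon>" and v: "v \<in> carrier Nh"
  obtains \<Gamma> w where "finite \<Gamma>" "\<Gamma> \<subseteq> W" "w \<in> carrier Nh"
    "average W v = (\<Oplus>\<^bsub>Nh\<^esub>\<gamma>\<in>\<Gamma>. act \<gamma> w)" "v = (\<Oplus>\<^bsub>Nh\<^esub>\<gamma>\<in>\<Gamma>. w)"
proof -
  obtain V0 y0 where V0: "V0 \<in> \<Upsilon>" "V0 \<subseteq> W" "y0 \<in> carrier (D V0)" "v = cls V0 y0"
    using v W by (rule Nh_cases_below)
  \<comment> \<open>A normal level turns double cosets of V in W into left cosets and makes every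
    conjugate by W equal to V. In the Mackey sum the push-forwards then become identities and only
    the pull-backs by the representatives survive.\<close>
  obtain V where V: "V \<in> \<Upsilon>" "V \<lhd> G\<lparr>carrier := W\<rparr>" "V \<subseteq> V0" using T2[OF W V0(1)] by blast
  have VW: "V \<subseteq> W" using V V0 by blast
  define y where "y = rpull \<one> V V0 y0"
  have y: "y \<in> carrier (D V)" unfolding y_def by (rule dm.trans_closed[OF V(1) V0(1) V(3) V0(3)])
  have vy: "v = cls V y" unfolding y_def V0(4) by (rule cls_restrict[OF V(1) V0(1) V(3) V0(3), symmetric])
  have WG: "W \<subseteq> carrier G" by (rule level_subset[OF W])
  have sW: "subgroup W G" and sV: "subgroup V G" using level_subgroup W V by auto
  have coset_eq: "w <# V = V #> w" if "w \<in> W" for w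
    using normal.coset_eq[OF V(2)] that by (auto simp: l_coset_def r_coset_def)
  have conjV: "conjugate G w V = V" if w: "w \<in> W" for w
  proof -
    have wG: "w \<in> carrier G" using w WG by blast
    have "conjugate G w V = (V #> w) #> inv w" by (simp add: conjugate_eq_cosets coset_eq[OF w])
    also have "\<dots> = V" using coset_mult_assoc[OF level_subset[OF V(1)] wG inv_closed[OF wG]] wG
        level_subset[OF V(1)] by simp
    finally show ?thesis .
  qed
  define rep where "rep A = (SOME w. w \<in> A)" for A :: "'g set"
  define \<Gamma> where "\<Gamma> = rep ` left_cosets W V"
  have rep: "rep A \<in> A" "rep A \<in> W" "rep A <# V = A" if "A \<in> left_cosets W V" for A
  proof -
    obtain w where w: "w \<in> W" "A = w <# V" using \<open>A \<in> left_cosets W V\<close> by (auto simp: left_cosets_def)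
    have "w \<in> A" using coset_self(1)[OF V(1), of w] w WG by auto
    then show r: "rep A \<in> A" unfolding rep_def by (rule someI)
    then show "rep A \<in> W" using l_coset_subset_level(1)[OF W VW w(1)] w by blast
    show "rep A <# V = A" using l_repr_independence[of "rep A" w V] r w WG sV by auto
  qed
  have inj: "inj_on rep (left_cosets W V)" using rep(3) by (metis inj_onI)
  have fin: "finite \<Gamma>" using left_cosets_props(1)[OF V(1) W VW] by (simp add: \<Gamma>_def)
  have cardG: "card \<Gamma> = card (left_cosets W V)" unfolding \<Gamma>_def by (rule card_image[OF inj])
  have GW: "\<Gamma> \<subseteq> W" using rep(2) by (auto simp: \<Gamma>_def)
  have dc: "double_coset G V \<gamma> V = \<gamma> <# V" if g: "\<gamma> \<in> W" for \<gamma>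
  proof -
    have gG: "\<gamma> \<in> carrier G" using g WG by blast
    have "V <#> {\<gamma>} = \<gamma> <# V" using coset_eq[OF g] by (auto simp: set_mult_def r_coset_def)
    then have "double_coset G V \<gamma> V = (\<gamma> <# V) <#> V" by (simp add: double_coset_def)
    also have "\<dots> = \<gamma> <# (V <#> V)"
      using gG level_subset[OF V(1)] by (simp add: setmult_lcos_assoc)
    also have "V <#> V = V" by (rule subgroup_mult_id[OF sV])
    finally show ?thesis .
  qed
  have uniq: "\<exists>!\<gamma>. \<gamma> \<in> \<Gamma> \<and> k \<in> double_coset G V \<gamma> V" if k: "k \<in> W" for k
  proof (rule ex1I)
    have kA: "k <# V \<in> left_cosets W V" using k by (auto simp: left_cosets_def)
    show "rep (k <# V) \<in> \<Gamma> \<and> k \<in> double_coset G V (rep (k <# V)) V"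
      using kA rep[OF kA] dc coset_self(1)[OF V(1), of k] k WG by (auto simp: \<Gamma>_def)
    fix \<gamma> assume g: "\<gamma> \<in> \<Gamma> \<and> k \<in> double_coset G V \<gamma> V"
    then obtain A where A: "A \<in> left_cosets W V" "\<gamma> = rep A" by (auto simp: \<Gamma>_def)
    have "k \<in> rep A <# V" using g A dc rep(2)[OF A(1)] by simp
    then have "A = k <# V"
      using l_repr_independence[of k "rep A" V] rep[OF A(1)] WG sV by auto
    then show "\<gamma> = rep (k <# V)" using A by simp
  qed
  have mack: "pull M \<one> V W (push M \<one> V W x) = (\<Oplus>\<^bsub>obj M V\<^esub>\<gamma>\<in>\<Gamma>. pull M \<gamma> V V x)"
    if x: "x \<in> carrier (obj M V)" for x
  proof -
    interpret V: Module.module R "obj M V" by (rule obj_module[OF V(1)])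
    have lh: "\<gamma> \<in> level_hom G \<Upsilon> V V" if "\<gamma> \<in> \<Gamma>" for \<gamma>
      by (rule level_homI) (use that GW WG V conjV[of \<gamma>] in auto)
    have cl: "pull M \<gamma> V V x \<in> carrier (obj M V)" if "\<gamma> \<in> \<Gamma>" for \<gamma>
      using linear_map_closed[OF pull_linear[OF lh[OF that]] x] .
    have "pull M \<one> V W (push M \<one> V W x) = (\<Oplus>\<^bsub>obj M V\<^esub> \<gamma>\<in>\<Gamma>. push M \<one> (V \<inter> conjugate G \<gamma> V) V
                                (pull M \<gamma> (V \<inter> conjugate G \<gamma> V) V x))"
      by (rule mackey[OF V(1) V(1) W VW VW GW uniq x])
    also have "\<dots> = (\<Oplus>\<^bsub>obj M V\<^esub>\<gamma>\<in>\<Gamma>. pull M \<gamma> V V x)"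
    proof (rule V.finsum_cong')
      fix \<gamma> assume "\<gamma> \<in> \<Gamma>"
      then have "conjugate G \<gamma> V = V" using GW conjV by blast
      then show "push M \<one> (V \<inter> conjugate G \<gamma> V) V (pull M \<gamma> (V \<inter> conjugate G \<gamma> V) V x) = pull M \<gamma> V V x"
        using push_id[OF V(1) cl[OF \<open>\<gamma> \<in> \<Gamma>\<close>]] by simp
    qed (use cl in auto)
    finally show ?thesis .
  qed
  interpret DV: Module.module Q "D V" by (rule module_D[OF V(1)])
  have lh: "\<gamma> \<in> level_hom G \<Upsilon> V V" if "\<gamma> \<in> \<Gamma>" for \<gamma>
    by (rule level_homI) (use that GW WG V conjV[of \<gamma>] in auto)
  note one = level_hom_one[OF V(1) W VW]
  have rcl: "rpull \<gamma> V V u \<in> carrier (D V)" if "\<gamma> \<in> \<Gamma>" "u \<in> carrier (D V)" for \<gamma> u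
    using linear_map_closed[OF rpull_linear[OF lh[OF that(1)]] that(2)] .
  have sum_add: "additive_map (D V) (D V) (\<lambda>u. \<Oplus>\<^bsub>D V\<^esub>\<gamma>\<in>\<Gamma>. rpull \<gamma> V V u)"
  proof (rule additive_mapI)
    fix u w assume u: "u \<in> carrier (D V)" and w: "w \<in> carrier (D V)"
    have "(\<Oplus>\<^bsub>D V\<^esub>\<gamma>\<in>\<Gamma>. rpull \<gamma> V V (u \<oplus>\<^bsub>D V\<^esub> w)) = (\<Oplus>\<^bsub>D V\<^esub>\<gamma>\<in>\<Gamma>. rpull \<gamma> V V u \<oplus>\<^bsub>D V\<^esub> rpull \<gamma> V V w)"
      by (rule DV.finsum_cong')
        (use u w rcl additive_map_add[OF linear_imp_additive[OF rpull_linear[OF lh]]] in auto)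
    then show "(\<Oplus>\<^bsub>D V\<^esub>\<gamma>\<in>\<Gamma>. rpull \<gamma> V V (u \<oplus>\<^bsub>D V\<^esub> w)) =
        (\<Oplus>\<^bsub>D V\<^esub>\<gamma>\<in>\<Gamma>. rpull \<gamma> V V u) \<oplus>\<^bsub>D V\<^esub> (\<Oplus>\<^bsub>D V\<^esub>\<gamma>\<in>\<Gamma>. rpull \<gamma> V V w)"
      using u w rcl by (simp add: DV.finsum_addf Pi_iff)
  qed (use rcl in auto)
  have rmack: "rpull \<one> V W (rpush \<one> V W y) = (\<Oplus>\<^bsub>D V\<^esub>\<gamma>\<in>\<Gamma>. rpull \<gamma> V V y)"
  proof (rule Rd.Q.tensor_ext[OF obj_module[OF V(1)] DV.abelian_group_axioms, folded rational_obj_def,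
        OF additive_map_comp[OF linear_imp_additive[OF rpush_linear[OF one]]
          linear_imp_additive[OF rpull_linear[OF one]]] sum_add _ y])
    fix x a assume x: "x \<in> carrier (obj M V)" and a: "a \<in> carrier Q"
    note VWm = obj_module[OF V(1)] obj_module[OF W]
    note pt = Rd.Q.pure_tensor_additive[OF VWm(1) a]
    interpret V: Module.module R "obj M V" by (rule VWm(1))
    have cl: "pull M \<gamma> V V x \<in> carrier (obj M V)" if "\<gamma> \<in> \<Gamma>" for \<gamma>
      using linear_map_closed[OF pull_linear[OF lh[OF that]] x] .
    have "rpull \<one> V W (rpush \<one> V W (pure_tensor R (obj M V) Q x a))
        = pure_tensor R (obj M V) Q (pull M \<one> V W (push M \<one> V W x)) a"
      unfolding rational_pull_def
      using x a VWm pull_linear[OF one] push_linear[OF one]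
      by (simp add: Rd.Q.tensor_map_pure linear_map_closed)
    also have "\<dots> = (\<Oplus>\<^bsub>D V\<^esub>\<gamma>\<in>\<Gamma>. pure_tensor R (obj M V) Q (pull M \<gamma> V V x) a)"
      unfolding mack[OF x]
      using additive_map_finsum[OF V.abelian_group_axioms DV.abelian_group_axioms, folded rational_obj_def,
          OF pt[folded rational_obj_def] fin, of "\<lambda>\<gamma>. pull M \<gamma> V V x"] cl by simp
    also have "\<dots> = (\<Oplus>\<^bsub>D V\<^esub>\<gamma>\<in>\<Gamma>. rpull \<gamma> V V (pure_tensor R (obj M V) Q x a))"
    proof (rule DV.finsum_cong')
      fix \<gamma> assume g: "\<gamma> \<in> \<Gamma>"
      show "pure_tensor R (obj M V) Q (pull M \<gamma> V V x) a = rpull \<gamma> V V (pure_tensor R (obj M V) Q x a)"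
        unfolding rational_pull_def
        by (rule Rd.Q.tensor_map_pure[OF VWm(1) VWm(1) pull_linear[OF lh[OF g]] x a, symmetric])
    qed (use rcl additive_map_closed[OF Rd.Q.pure_tensor_additive[OF VWm(1) a] x] in \<open>auto simp: rational_obj_def\<close>)
    finally show "rpull \<one> V W (rpush \<one> V W (pure_tensor R (obj M V) Q x a)) =
        (\<Oplus>\<^bsub>D V\<^esub>\<gamma>\<in>\<Gamma>. rpull \<gamma> V V (pure_tensor R (obj M V) Q x a))" .
  qed
  \<comment> \<open>\<open>w\<close> is v divided by the index of V in W. As many copies of it as
    there are representatives add up to v, while the corresponding translates add up to the
    average.\<close>
  define w where "w = scal V W \<odot>\<^bsub>Nh\<^esub> v"
  have sc: "scal V W \<in> carrier Q" using V W by simp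
  have w: "w \<in> carrier Nh" using sc v by (simp add: w_def)
  have py: "rpush \<one> V W y \<in> carrier (D W)" by (rule linear_map_closed[OF rpush_linear[OF one] y])
  interpret DW: Module.module Q "D W" by (rule module_D[OF W])
  have "average W v = scal V W \<odot>\<^bsub>Nh\<^esub> cls W (rpush \<one> V W y)"
    unfolding vy using average_cls[OF W V(1) VW y] smult_cls[OF W py sc] by simp
  also have "cls W (rpush \<one> V W y) = cls V (rpull \<one> V W (rpush \<one> V W y))"
    by (rule cls_restrict[OF V(1) W VW py, symmetric])
  also have "\<dots> = (\<Oplus>\<^bsub>Nh\<^esub>\<gamma>\<in>\<Gamma>. cls V (rpull \<gamma> V V y))"
    unfolding rmack
    by (rule additive_map_finsum[OF DV.abelian_group_axioms Nh.abelian_group_axioms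
          linear_imp_additive[OF cls_linear[OF V(1)]] fin]) (use rcl y in auto)
  also have "\<dots> = (\<Oplus>\<^bsub>Nh\<^esub>\<gamma>\<in>\<Gamma>. act \<gamma> v)"
  proof (rule Nh.finsum_cong')
    fix \<gamma> assume g: "\<gamma> \<in> \<Gamma>"
    then have "\<gamma> \<in> carrier G" "conjugate G \<gamma> V = V" using GW WG conjV by auto
    then show "cls V (rpull \<gamma> V V y) = act \<gamma> v" unfolding vy using act_cls[of \<gamma>, OF _ V(1) y] by simp
  qed (use GW WG linear_map_closed[OF act_linear] v in auto)
  also have "scal V W \<odot>\<^bsub>Nh\<^esub> \<dots> = (\<Oplus>\<^bsub>Nh\<^esub>\<gamma>\<in>\<Gamma>. scal V W \<odot>\<^bsub>Nh\<^esub> act \<gamma> v)"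
    by (rule Nh.finsum_smult_ldistr[OF fin sc]) (use GW WG linear_map_closed[OF act_linear] v in auto)
  also have "\<dots> = (\<Oplus>\<^bsub>Nh\<^esub>\<gamma>\<in>\<Gamma>. act \<gamma> w)"
  proof (rule Nh.finsum_cong')
    fix \<gamma> assume "\<gamma> \<in> \<Gamma>"
    then have "\<gamma> \<in> carrier G" using GW WG by blast
    then show "scal V W \<odot>\<^bsub>Nh\<^esub> act \<gamma> v = act \<gamma> w"
      using linear_map_smult[OF act_linear sc v] by (simp add: w_def)
  qed (use GW WG linear_map_closed[OF act_linear] w in auto)
  finally have av: "average W v = (\<Oplus>\<^bsub>Nh\<^esub>\<gamma>\<in>\<Gamma>. act \<gamma> w)" .
  have const: "(\<Oplus>\<^bsub>Nh\<^esub>\<gamma>\<in>\<Gamma>. w) = v"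
  proof -
    have "(\<Oplus>\<^bsub>Nh\<^esub>\<gamma>\<in>\<Gamma>. w) = add_pow Nh (card \<Gamma>) w" by (rule Nh.add.finprod_const[OF w])
    also have "\<dots> = add_pow Q (card \<Gamma>) \<one>\<^bsub>Q\<^esub> \<odot>\<^bsub>Nh\<^esub> w"
    proof -
      have "add_pow Nh n w = add_pow Q n \<one>\<^bsub>Q\<^esub> \<odot>\<^bsub>Nh\<^esub> w" for n :: nat
        using w by (induction n) (simp_all add: Nh.smult_l_distr)
      then show ?thesis .
    qed
    also have "\<dots> = (scal W V \<otimes>\<^bsub>Q\<^esub> scal V W) \<odot>\<^bsub>Nh\<^esub> v"
      using V W v sc scal_subset[OF V(1) W VW] unfolding w_def cardG by (simp add: Nh.smult_assoc1)
    finally show ?thesis using V W v by (simp add: scal_trans)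
  qed
  show ?thesis by (rule that[OF fin GW w av const[symmetric]])
qed

section \<open>Normalised classes\<close>

text \<open>Scaling by \<open>[U : V]\<close> makes the classes covariantly functorial: averaging then corresponds
  to the push-forward.\<close>

definition jmap :: "'g set \<Rightarrow> 'm \<Rightarrow> ('g, 'r, 'm) completion_elt" where
  "jmap V x = scal U V \<odot>\<^bsub>Nh\<^esub> completion_map G \<Upsilon> R M V x"

abbreviation ptens where "ptens V x \<equiv> pure_tensor R (obj M V) Q x \<one>\<^bsub>Q\<^esub>"

lemma ptens_closed: "V \<in> \<Upsilon> \<Longrightarrow> x \<in> carrier (obj M V) \<Longrightarrow> ptens V x \<in> carrier (D V)"
  unfolding rational_obj_def by (rule Rd.Q.pure_tensor_closed) auto

lemma ptens_additive: "V \<in> \<Upsilon> \<Longrightarrow> additive_map (obj M V) (D V) (ptens V)"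
  unfolding rational_obj_def by (rule Rd.Q.pure_tensor_additive[OF obj_module]) auto

lemma completion_map_additive: "V \<in> \<Upsilon> \<Longrightarrow> additive_map (obj M V) Nh (completion_map G \<Upsilon> R M V)"
  using additive_map_comp[OF ptens_additive linear_imp_additive[OF cls_linear]]
  by (simp add: completion_map_def[abs_def])

lemma completion_map_closed:
  "V \<in> \<Upsilon> \<Longrightarrow> x \<in> carrier (obj M V) \<Longrightarrow> completion_map G \<Upsilon> R M V x \<in> carrier Nh"
  by (rule additive_map_closed[OF completion_map_additive])

lemma jmap_closed: "V \<in> \<Upsilon> \<Longrightarrow> x \<in> carrier (obj M V) \<Longrightarrow> jmap V x \<in> carrier Nh"
  using U by (simp add: jmap_def completion_map_closed)

lemma jmap_additive:
  assumes "V \<in> \<Upsilon>"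
  shows "additive_map (obj M V) Nh (jmap V)"
proof -
  have "additive_map Nh Nh (\<lambda>v. scal U V \<odot>\<^bsub>Nh\<^esub> v)"
    using assms U by (simp add: additive_map_def Nh.smult_r_distr)
  from additive_map_comp[OF completion_map_additive[OF assms] this]
  show ?thesis by (simp add: jmap_def[abs_def])
qed

lemma jmap_smult:
  assumes "V \<in> \<Upsilon>" "x \<in> carrier (obj M V)" "r \<in> carrier R"
  shows "jmap V (r \<odot>\<^bsub>obj M V\<^esub> x) = fraction R r \<one>\<^bsub>R\<^esub> \<odot>\<^bsub>Nh\<^esub> jmap V x"
proof -
  have r: "fraction R r \<one>\<^bsub>R\<^esub> \<in> carrier Q" using assms by simp
  have "r \<odot>\<^bsub>Q\<^esub> \<one>\<^bsub>Q\<^esub> = fraction R r \<one>\<^bsub>R\<^esub> \<otimes>\<^bsub>Q\<^esub> \<one>\<^bsub>Q\<^esub>"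
    using assms by (simp add: Rd.fraction_one Rd.fraction_smult Rd.fraction_mult)
  then have "ptens V (r \<odot>\<^bsub>obj M V\<^esub> x) = fraction R r \<one>\<^bsub>R\<^esub> \<odot>\<^bsub>D V\<^esub> ptens V x"
    using assms r unfolding rational_obj_def
    by (simp add: Rd.Q.pure_tensor_smult[OF obj_module] Rd.Q.smult_pure_tensor[OF obj_module])
  then have "completion_map G \<Upsilon> R M V (r \<odot>\<^bsub>obj M V\<^esub> x) = fraction R r \<one>\<^bsub>R\<^esub> \<odot>\<^bsub>Nh\<^esub> completion_map G \<Upsilon> R M V x"
    using assms r by (simp add: completion_map_def smult_cls ptens_closed)
  then show ?thesis
    using assms r U completion_map_closed[OF assms(1,2)]
    by (simp add: jmap_def Nh.smult_assoc1[symmetric] Rd.Q.A.m_comm)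
qed

lemma jmap_base: "x \<in> carrier (obj M U) \<Longrightarrow> jmap U x = completion_map G \<Upsilon> R M U x"
  using U by (simp add: jmap_def completion_map_closed)

lemma rpull_ptens:
  assumes "g \<in> level_hom G \<Upsilon> L K" "x \<in> carrier (obj M K)"
  shows "rpull g L K (ptens K x) = ptens L (pull M g L K x)"
  unfolding rational_pull_def
  using assms obj_module pull_linear[OF assms(1)]
  by (intro Rd.Q.tensor_map_pure) (auto simp: level_hom_def)

lemma rpush_ptens:
  assumes "g \<in> level_hom G \<Upsilon> L K" "x \<in> carrier (obj M L)"
  shows "rpush g L K (ptens L x) = ptens K (push M g L K x)"
  using assms obj_module push_linear[OF assms(1)]
  by (intro Rd.Q.tensor_map_pure) (auto simp: level_hom_def)

lemma pull_closed: "g \<in> level_hom G \<Upsilon> L K \<Longrightarrow> x \<in> carrier (obj M K) \<Longrightarrow> pull M g L K x \<in> carrier (obj M L)"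
  by (rule linear_map_closed[OF pull_linear])

lemma push_closed: "g \<in> level_hom G \<Upsilon> L K \<Longrightarrow> x \<in> carrier (obj M L) \<Longrightarrow> push M g L K x \<in> carrier (obj M K)"
  by (rule linear_map_closed[OF push_linear])

text \<open>The action transports a class to the conjugate level; the factor [U : V] is unchanged
  because conjugation preserves Haar measure in the unimodular case.\<close>

lemma act_jmap:
  assumes h: "h \<in> carrier G" and V: "V \<in> \<Upsilon>" and x: "x \<in> carrier (obj M V)"
  shows "act h (jmap V x) = jmap (conjugate G h V) (pull M h (conjugate G h V) V x)"
proof -
  have "act h (completion_map G \<Upsilon> R M V x) =
      completion_map G \<Upsilon> R M (conjugate G h V) (pull M h (conjugate G h V) V x)"
    using assms by (simp add: completion_map_def act_cls ptens_closed rpull_ptens level_hom_conjugate)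
  then show ?thesis
    using linear_map_smult[OF act_linear[OF h], of "scal U V" "completion_map G \<Upsilon> R M V x"]
      completion_map_closed[OF V x] U V scal_conjugate(2)[OF U V h]
    by (simp add: jmap_def)
qed

text \<open>The average contributes the denominator through [V : W], and [U : V] [V : W] = [U : W]
  is the factor that \<open>jmap\<close> carries at level W.\<close>

lemma average_jmap:
  assumes W: "W \<in> \<Upsilon>" and V: "V \<in> \<Upsilon>" "V \<subseteq> W" and x: "x \<in> carrier (obj M V)"
  shows "average W (jmap V x) = jmap W (push M \<one> V W x)"
proof -
  note one = level_hom_one[OF V(1) W V(2)]
  have "average W (completion_map G \<Upsilon> R M V x) = scal V W \<odot>\<^bsub>Nh\<^esub> completion_map G \<Upsilon> R M W (push M \<one> V W x)"
    using assms push_closed[OF one x]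
    by (simp add: completion_map_def average_cls ptens_closed rpush_ptens[OF one] smult_cls)
  then show ?thesis
    using linear_map_smult[OF average_linear[OF W], of "scal U V" "completion_map G \<Upsilon> R M V x"]
      completion_map_closed[OF V(1) x] completion_map_closed[OF W push_closed[OF one x]] U V W
    by (simp add: jmap_def Nh.smult_assoc1[symmetric] scal_trans)
qed

text \<open>Unscaled classes do not change under restriction, so the two sides differ only by
  [U : L] = [K : L] [U : K].\<close>

lemma jmap_pull:
  assumes "L \<in> \<Upsilon>" "K \<in> \<Upsilon>" "L \<subseteq> K" "x \<in> carrier (obj M K)"
  shows "jmap L (pull M \<one> L K x) = scal K L \<odot>\<^bsub>Nh\<^esub> jmap K x"
proof -
  have "completion_map G \<Upsilon> R M L (pull M \<one> L K x) = completion_map G \<Upsilon> R M K x"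
    using assms cls_restrict[OF assms(1-3) ptens_closed[OF assms(2,4)]]
    by (simp add: completion_map_def rpull_ptens level_hom_one)
  then show ?thesis
    using assms U completion_map_closed[OF assms(2,4)]
    by (simp add: jmap_def Nh.smult_assoc1[symmetric] Rd.Q.A.m_comm[of "scal K L"] scal_trans)
qed

text \<open>Vanishing in the limit means vanishing at a smaller level Z, where some nonzero s kills
  the restriction of x. Pushing back to V multiplies x by the index k of Z in V, so s k kills x, and
  s k is nonzero in a domain of characteristic zero.\<close>

lemma completion_map_zero_imp_torsion:
  assumes V: "V \<in> \<Upsilon>" and x: "x \<in> carrier (obj M V)"
    and zero: "completion_map G \<Upsilon> R M V x = \<zero>\<^bsub>Nh\<^esub>"
  shows "is_torsion R (obj M V) x"
proof -
  interpret V: Module.module R "obj M V" by (rule obj_module[OF V])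
  interpret DV: Module.module Q "D V" by (rule module_D[OF V])
  have "cls V (ptens V x) = cls V \<zero>\<^bsub>D V\<^esub>"
    using zero dm.zero_limit_class[OF V] by (simp add: completion_map_def Nh_eq cls_eq)
  then obtain Z where Z: "Z \<in> \<Upsilon>" "Z \<subseteq> V" "rpull \<one> Z V (ptens V x) = rpull \<one> Z V \<zero>\<^bsub>D V\<^esub>"
    using dm.limit_class_eq_iff[OF V ptens_closed[OF V x] V DV.zero_closed] by (auto simp: cls_eq)
  note one = level_hom_one[OF Z(1) V Z(2)]
  interpret Z: Module.module R "obj M Z" by (rule obj_module[OF Z(1)])
  interpret DZ: Module.module Q "D Z" by (rule module_D[OF Z(1)])
  have "ptens Z (pull M \<one> Z V x) = \<zero>\<^bsub>D Z\<^esub>"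
    using Z(3) rpull_ptens[OF one x]
      additive_map_zero[OF DV.abelian_group_axioms DZ.abelian_group_axioms linear_imp_additive[OF rpull_linear[OF one]]]
    by simp
  then have "is_torsion R (obj M Z) (pull M \<one> Z V x)"
    unfolding rational_obj_def
    by (rule Rd.pure_tensor_one_zero_imp_torsion[OF obj_module[OF Z(1)] pull_closed[OF one x]])
  then obtain s where s: "s \<in> carrier R" "s \<noteq> \<zero>\<^bsub>R\<^esub>" "s \<odot>\<^bsub>obj M Z\<^esub> pull M \<one> Z V x = \<zero>\<^bsub>obj M Z\<^esub>"
    by (auto simp: is_torsion_def)
  define k where "k = card (left_cosets V Z)"
  have k: "k > 0" unfolding k_def by (rule card_left_cosets_pos[OF haar Z(1) V Z(2)])
  have "\<zero>\<^bsub>obj M V\<^esub> = push M \<one> Z V (s \<odot>\<^bsub>obj M Z\<^esub> pull M \<one> Z V x)"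
    unfolding s(3)
    by (rule additive_map_zero[OF Z.abelian_group_axioms V.abelian_group_axioms
          linear_imp_additive[OF push_linear[OF one]], symmetric])
  also have "\<dots> = s \<odot>\<^bsub>obj M V\<^esub> push M \<one> Z V (pull M \<one> Z V x)"
    by (rule linear_map_smult[OF push_linear[OF one] s(1) pull_closed[OF one x]])
  also have "\<dots> = (s \<otimes>\<^bsub>R\<^esub> add_pow R k \<one>\<^bsub>R\<^esub>) \<odot>\<^bsub>obj M V\<^esub> x"
    using s(1) x by (simp add: push_pull[OF Z(1) V Z(2) x] obj_add_pow[OF V x] V.smult_assoc1 k_def)
  finally have "(s \<otimes>\<^bsub>R\<^esub> add_pow R k \<one>\<^bsub>R\<^esub>) \<odot>\<^bsub>obj M V\<^esub> x = \<zero>\<^bsub>obj M V\<^esub>" by simp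
  moreover have "s \<otimes>\<^bsub>R\<^esub> add_pow R k \<one>\<^bsub>R\<^esub> \<noteq> \<zero>\<^bsub>R\<^esub>" "s \<otimes>\<^bsub>R\<^esub> add_pow R k \<one>\<^bsub>R\<^esub> \<in> carrier R"
    using s char0[OF k] by (auto simp: Rd.integral_iff)
  ultimately show ?thesis using x unfolding is_torsion_def by blast
qed

lemma jmap_eq_zero_iff:
  assumes V: "V \<in> \<Upsilon>" and x: "x \<in> carrier (obj M V)"
  shows "jmap V x = \<zero>\<^bsub>Nh\<^esub> \<longleftrightarrow> is_torsion R (obj M V) x"
proof
  assume "jmap V x = \<zero>\<^bsub>Nh\<^esub>"
  then have "scal V U \<odot>\<^bsub>Nh\<^esub> (scal U V \<odot>\<^bsub>Nh\<^esub> completion_map G \<Upsilon> R M V x) = \<zero>\<^bsub>Nh\<^esub>"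
    using V U by (simp add: jmap_def)
  then have "completion_map G \<Upsilon> R M V x = \<zero>\<^bsub>Nh\<^esub>"
    using V U completion_map_closed[OF V x] by (simp add: Nh.smult_assoc1[symmetric] scal_trans)
  then show "is_torsion R (obj M V) x" by (rule completion_map_zero_imp_torsion[OF V x])
next
  interpret DV: Module.module Q "D V" by (rule module_D[OF V])
  assume "is_torsion R (obj M V) x"
  then have "ptens V x = \<zero>\<^bsub>D V\<^esub>"
    unfolding rational_obj_def by (intro Rd.torsion_imp_pure_tensor_zero[OF obj_module[OF V]]) auto
  then have "completion_map G \<Upsilon> R M V x = \<zero>\<^bsub>Nh\<^esub>"
    using dm.zero_limit_class[OF V] by (simp add: completion_map_def Nh_eq cls_eq)
  then show "jmap V x = \<zero>\<^bsub>Nh\<^esub>" using U V by (simp add: jmap_def)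
qed

lemma Nh_add_pow:
  "v \<in> carrier Nh \<Longrightarrow> add_pow Nh (n::nat) v = add_pow Q n \<one>\<^bsub>Q\<^esub> \<odot>\<^bsub>Nh\<^esub> v"
  by (induction n) (simp_all add: Nh.smult_l_distr)

text \<open>Transporting x by the inverse of h gives y at the level h^-1 U h. Restricting y to the
  intersection B with W multiplies J by an index, which equals the count on the left after
  conjugating back by h. So the multiple on the left is the average of J_B of the restricted vector,
  and averaging pushes it forward to W, as the Hecke correspondence does.\<close>

lemma hecke_average:
  assumes W: "W \<in> \<Upsilon>" and h: "h \<in> carrier G" and x: "x \<in> carrier (obj M U)"
  shows "hecke_corr_push G M U h W x \<in> carrier (obj M W)"
    "add_pow Nh (card (left_cosets U (U \<inter> conjugate G h W))) (average W (act (inv h) (jmap U x))) =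
      jmap W (hecke_corr_push G M U h W x)"
proof -
  let ?A = "U \<inter> conjugate G h W" and ?U' = "conjugate G (inv h) U"
  let ?B = "W \<inter> ?U'"
  have ih: "inv h \<in> carrier G" using h by simp
  have U': "?U' \<in> \<Upsilon>" using T1[OF U ih] .
  have A: "?A \<in> \<Upsilon>" "?A \<subseteq> U" using T3[OF U T1[OF W h]] by auto
  have B: "?B \<in> \<Upsilon>" "?B \<subseteq> W" "?B \<subseteq> ?U'" using T3[OF W U'] by auto
  have conjA: "conjugate G (inv h) ?A = ?B"
    using conjugate_Int[OF ih level_subset[OF U] level_subset[OF T1[OF W h]]]
      conjugate_inv_conjugate(1)[OF h level_subset[OF W]] by auto
  then have lhA: "inv h \<in> level_hom G \<Upsilon> ?B ?A" using level_hom_conjugate[OF A(1) ih] by simp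
  note oneA = level_hom_one[OF A(1) U A(2)] and oneB = level_hom_one[OF B(1) W B(2)]
    and oneB' = level_hom_one[OF B(1) U' B(3)] and lhU = level_hom_conjugate[OF U ih]
  define z where "z = pull M (inv h) ?B U x"
  have lhBU: "inv h \<in> level_hom G \<Upsilon> ?B U" using level_hom_comp[OF lhA oneA] h by simp
  have z: "z \<in> carrier (obj M ?B)" unfolding z_def by (rule pull_closed[OF lhBU x])
  have "pull M (inv h) ?B ?A (pull M \<one> ?A U x) = z"
    using pull_comp[OF lhA oneA x] h by (simp add: z_def)
  then have hecke: "hecke_corr_push G M U h W x = push M \<one> ?B W z"
    using h by (simp add: hecke_corr_push_def hecke_corr_def)
  then show "hecke_corr_push G M U h W x \<in> carrier (obj M W)"
    using push_closed[OF oneB z] by simp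
  define y where "y = pull M (inv h) ?U' U x"
  have y: "y \<in> carrier (obj M ?U')" unfolding y_def by (rule pull_closed[OF lhU x])
  have "pull M \<one> ?B ?U' y = z"
    using pull_comp[OF oneB' lhU x] h by (simp add: z_def y_def)
  then have jz: "jmap ?B z = scal ?U' ?B \<odot>\<^bsub>Nh\<^esub> jmap ?U' y"
    using jmap_pull[OF B(1) U' B(3) y] by simp
  have ay: "act (inv h) (jmap U x) = jmap ?U' y" using act_jmap[OF ih U x] by (simp add: y_def)
  have cl: "average W (jmap ?U' y) \<in> carrier Nh"
    using linear_map_closed[OF average_linear[OF W] jmap_closed[OF U' y]] .
  have "scal U ?A = scal (conjugate G (inv h) U) (conjugate G (inv h) ?A)"
    by (rule scal_conjugate(1)[OF U A(1) ih, symmetric])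
  then have "scal U ?A = scal ?U' ?B" by (simp only: conjA)
  then have "add_pow Nh (card (left_cosets U ?A)) (average W (jmap ?U' y)) = scal ?U' ?B \<odot>\<^bsub>Nh\<^esub> average W (jmap ?U' y)"
    using Nh_add_pow[OF cl] scal_subset[OF A(1) U A(2)] by simp
  also have "\<dots> = average W (jmap ?B z)"
    unfolding jz using linear_map_smult[OF average_linear[OF W] _ jmap_closed[OF U' y]] U' B(1) by simp
  also have "\<dots> = jmap W (hecke_corr_push G M U h W x)"
    unfolding hecke by (rule average_jmap[OF W B(1,2) z])
  finally show "add_pow Nh (card (left_cosets U ?A)) (average W (act (inv h) (jmap U x))) =
      jmap W (hecke_corr_push G M U h W x)" by (simp only: ay)
qed

end

section \<open>Functions with compact support modulo a compact open subgroup\<close>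

locale equivariant_functions = locally_profinite_group G T
  for G :: "('g, 'b) monoid_scheme" (structure) and T :: "'g topology" +
  fixes K H :: "'g set" and A :: "('f, 'n, 'y) module_scheme" and act :: "'g \<Rightarrow> 'n \<Rightarrow> 'n"
  assumes K_subgroup: "subgroup K G" and K_open: "openin T K" and K_compact: "compactin T K"
    and H_subgroup: "subgroup H G" and A_group: "abelian_group A"
    and act_additive: "\<And>h. h \<in> H \<Longrightarrow> additive_map A A (act h)"
    and act_one: "\<And>v. v \<in> carrier A \<Longrightarrow> act \<one> v = v"
    and act_mult: "\<And>h k v. h \<in> H \<Longrightarrow> k \<in> H \<Longrightarrow> v \<in> carrier A \<Longrightarrow> act h (act k v) = act (h \<otimes> k) v"
begin

sublocale A: abelian_group A by (rule A_group)

abbreviation C where "C \<equiv> compact_functions G T K A"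

text \<open>For a right K-invariant function the support is the union of these cosets, which makes
  compactness of the support a finiteness statement.\<close>

definition coset_supp :: "('g \<Rightarrow> 'n) \<Rightarrow> 'g set set" where
  "coset_supp \<xi> = {a <# K | a. a \<in> carrier G \<and> \<xi> a \<noteq> \<zero>\<^bsub>A\<^esub>}"

lemma K_sub: "K \<subseteq> carrier G" using K_subgroup by (rule subgroup.subset)

lemma H_sub: "H \<subseteq> carrier G" using H_subgroup by (rule subgroup.subset)

lemma H_closed [simp]: "h \<in> H \<Longrightarrow> h \<in> carrier G" using H_sub by blast

lemma H_inv [simp]: "h \<in> H \<Longrightarrow> inv h \<in> H" using H_subgroup by (rule subgroup.m_inv_closed)

lemma H_mult [simp]: "h \<in> H \<Longrightarrow> k \<in> H \<Longrightarrow> h \<otimes> k \<in> H" using H_subgroup by (rule subgroup.m_closed)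

lemma H_one [simp]: "\<one> \<in> H" using H_subgroup by (rule subgroup.one_closed)

lemma act_closed [simp]: "h \<in> H \<Longrightarrow> v \<in> carrier A \<Longrightarrow> act h v \<in> carrier A"
  by (rule additive_map_closed[OF act_additive])

lemma act_zero [simp]: "h \<in> H \<Longrightarrow> act h \<zero>\<^bsub>A\<^esub> = \<zero>\<^bsub>A\<^esub>"
  by (rule additive_map_zero[OF A_group A_group act_additive])

lemma coset_self: "a \<in> carrier G \<Longrightarrow> a \<in> a <# K"
proof -
  assume "a \<in> carrier G"
  moreover have "a \<otimes> \<one> \<in> a <# K"
    unfolding l_coset_def using subgroup.one_closed[OF K_subgroup] by blast
  ultimately show ?thesis by simp
qed

lemma coset_mem_iff:
  assumes "a \<in> carrier G" "b \<in> carrier G"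
  shows "b \<in> a <# K \<longleftrightarrow> inv a \<otimes> b \<in> K"
proof
  assume "b \<in> a <# K"
  then show "inv a \<otimes> b \<in> K" using assms K_sub by (auto simp: l_coset_def m_assoc[symmetric])
next
  assume "inv a \<otimes> b \<in> K"
  moreover have "b = a \<otimes> (inv a \<otimes> b)" using assms by (simp add: m_assoc[symmetric])
  ultimately show "b \<in> a <# K" unfolding l_coset_def by blast
qed

lemma coset_eq_iff:
  assumes "a \<in> carrier G" "b \<in> carrier G"
  shows "a <# K = b <# K \<longleftrightarrow> b \<in> a <# K"
  using coset_self[OF assms(2)] l_repr_independence[OF _ assms(1) K_subgroup] by blast

lemma coset_sub: "a \<in> carrier G \<Longrightarrow> a <# K \<subseteq> carrier G"
  using K_sub by (auto simp: l_coset_def)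

lemma invariant_coset:
  assumes "\<And>g k. g \<in> carrier G \<Longrightarrow> k \<in> K \<Longrightarrow> \<xi> (g \<otimes> k) = \<xi> g" "a \<in> carrier G" "b \<in> a <# K"
  shows "\<xi> b = \<xi> a"
  using assms by (auto simp: l_coset_def)

text \<open>Left cosets of K are open and compact. A compact closure of the support is covered by
  finitely many of them, and since cosets are disjoint these include all cosets in the support.
  Conversely a finite union of cosets is compact, hence closed in a Hausdorff space and equal to its
  closure.\<close>

lemma carrier_C_iff:
  "\<xi> \<in> carrier C \<longleftrightarrow> \<xi> \<in> carrier G \<rightarrow>\<^sub>E carrier A \<and>
    (\<forall>g\<in>carrier G. \<forall>k\<in>K. \<xi> (g \<otimes> k) = \<xi> g) \<and> finite (coset_supp \<xi>)"
proof -
  have "compactin T (T closure_of {g \<in> carrier G. \<xi> g \<noteq> \<zero>\<^bsub>A\<^esub>}) \<longleftrightarrow> finite (coset_supp \<xi>)"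
    if inv: "\<And>g k. g \<in> carrier G \<Longrightarrow> k \<in> K \<Longrightarrow> \<xi> (g \<otimes> k) = \<xi> g"
  proof -
    let ?S = "{g \<in> carrier G. \<xi> g \<noteq> \<zero>\<^bsub>A\<^esub>}"
    have S: "\<Union>(coset_supp \<xi>) = ?S"
    proof (intro equalityI subsetI)
      fix b assume "b \<in> \<Union>(coset_supp \<xi>)"
      then obtain a where a: "a \<in> carrier G" "\<xi> a \<noteq> \<zero>\<^bsub>A\<^esub>" "b \<in> a <# K" by (auto simp: coset_supp_def)
      then show "b \<in> ?S" using coset_sub[OF a(1)] invariant_coset[of \<xi>, OF inv a(1,3)] by auto
    next
      fix b assume "b \<in> ?S"
      then show "b \<in> \<Union>(coset_supp \<xi>)" using coset_self[of b] by (auto simp: coset_supp_def)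
    qed
    have op: "openin T B" "compactin T B" if "B \<in> coset_supp \<xi>" for B
      using that openin_l_coset[OF K_open] compactin_l_coset[OF K_compact] by (auto simp: coset_supp_def)
    show ?thesis
    proof
      assume c: "compactin T (T closure_of ?S)"
      let ?all = "(\<lambda>a. a <# K) ` carrier G"
      have sub: "T closure_of ?S \<subseteq> \<Union>?all"
        using closure_of_subset_topspace[of T ?S] topspace_eq coset_self by blast
      have opn: "openin T B" if "B \<in> ?all" for B using that openin_l_coset[OF K_open] by auto
      obtain \<F> where F: "finite \<F>" "\<F> \<subseteq> ?all" "T closure_of ?S \<subseteq> \<Union>\<F>"
        using compactinD[OF c opn sub] by blast
      have "?S \<subseteq> \<Union>\<F>" using F(3) closure_of_subset[of ?S T] topspace_eq by auto
      have "coset_supp \<xi> \<subseteq> \<F>"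
      proof
        fix B assume "B \<in> coset_supp \<xi>"
        then obtain a where a: "a \<in> carrier G" "\<xi> a \<noteq> \<zero>\<^bsub>A\<^esub>" "B = a <# K" by (auto simp: coset_supp_def)
        then obtain B' where B': "B' \<in> \<F>" "a \<in> B'" using \<open>?S \<subseteq> \<Union>\<F>\<close> by auto
        then obtain b where b: "b \<in> carrier G" "B' = b <# K" using F(2) by auto
        then have "B' = B" using coset_eq_iff[OF b(1) a(1)] B'(2) a(3) by simp
        then show "B \<in> \<F>" using B'(1) by simp
      qed
      then show "finite (coset_supp \<xi>)" using F(1) finite_subset by blast
    next
      assume "finite (coset_supp \<xi>)"
      then have c: "compactin T ?S"
        unfolding S[symmetric] using op(2) by (intro compactin_Union) auto
      then have "closedin T ?S" using Hausdorff compactin_imp_closedin by blast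
      then show "compactin T (T closure_of ?S)" using c by (simp add: closure_of_closedin)
    qed
  qed
  then show ?thesis by (auto simp: compact_functions_def)
qed

lemma C_closed: "\<xi> \<in> carrier C \<Longrightarrow> a \<in> carrier G \<Longrightarrow> \<xi> a \<in> carrier A"
  by (auto simp: carrier_C_iff)

lemma C_invariant: "\<xi> \<in> carrier C \<Longrightarrow> a \<in> carrier G \<Longrightarrow> b \<in> a <# K \<Longrightarrow> \<xi> b = \<xi> a"
  by (rule invariant_coset[of \<xi>]) (auto simp: carrier_C_iff)

lemma C_finite: "\<xi> \<in> carrier C \<Longrightarrow> finite (coset_supp \<xi>)"
  by (simp add: carrier_C_iff)

lemma C_eqI:
  assumes "\<xi> \<in> carrier C" "\<eta> \<in> carrier C" "\<And>a. a \<in> carrier G \<Longrightarrow> \<xi> a = \<eta> a"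
  shows "\<xi> = \<eta>"
proof (rule PiE_ext)
  show "\<xi> \<in> carrier G \<rightarrow>\<^sub>E carrier A" "\<eta> \<in> carrier G \<rightarrow>\<^sub>E carrier A"
    using assms(1,2) by (simp_all add: carrier_C_iff)
qed (rule assms(3))

lemma C_I:
  assumes "\<And>a. a \<in> carrier G \<Longrightarrow> f a \<in> carrier A"
    and "\<And>g k. g \<in> carrier G \<Longrightarrow> k \<in> K \<Longrightarrow> f (g \<otimes> k) = f g"
    and "finite \<F>" "\<And>a. a \<in> carrier G \<Longrightarrow> f a \<noteq> \<zero>\<^bsub>A\<^esub> \<Longrightarrow> a <# K \<in> \<F>"
  shows "(\<lambda>a\<in>carrier G. f a) \<in> carrier C"
proof -
  have "coset_supp (\<lambda>a\<in>carrier G. f a) \<subseteq> \<F>" using assms(4) by (auto simp: coset_supp_def)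
  then have "finite (coset_supp (\<lambda>a\<in>carrier G. f a))" using assms(3) finite_subset by blast
  then show ?thesis using assms(1,2) K_sub by (auto simp: carrier_C_iff subset_iff)
qed

lemma coset_supp_coset: "a \<in> carrier G \<Longrightarrow> \<xi> a \<noteq> \<zero>\<^bsub>A\<^esub> \<Longrightarrow> a <# K \<in> coset_supp \<xi>"
  by (auto simp: coset_supp_def)

lemma zero_C: "\<zero>\<^bsub>C\<^esub> = (\<lambda>a\<in>carrier G. \<zero>\<^bsub>A\<^esub>)"
  and add_C: "\<xi> \<oplus>\<^bsub>C\<^esub> \<eta> = (\<lambda>a\<in>carrier G. \<xi> a \<oplus>\<^bsub>A\<^esub> \<eta> a)"
  by (simp_all add: compact_functions_def)

lemma zero_C_closed: "\<zero>\<^bsub>C\<^esub> \<in> carrier C"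
  unfolding zero_C by (rule C_I[of _ "{}"]) auto

lemma K_inv: "\<xi> \<in> carrier C \<Longrightarrow> g \<in> carrier G \<Longrightarrow> k \<in> K \<Longrightarrow> \<xi> (g \<otimes> k) = \<xi> g"
  by (simp add: carrier_C_iff)

lemma add_C_closed:
  assumes "\<xi> \<in> carrier C" "\<eta> \<in> carrier C"
  shows "\<xi> \<oplus>\<^bsub>C\<^esub> \<eta> \<in> carrier C"
  unfolding add_C
proof (rule C_I[of _ "coset_supp \<xi> \<union> coset_supp \<eta>"])
  fix a assume a: "a \<in> carrier G" "\<xi> a \<oplus>\<^bsub>A\<^esub> \<eta> a \<noteq> \<zero>\<^bsub>A\<^esub>"
  then have "\<xi> a \<noteq> \<zero>\<^bsub>A\<^esub> \<or> \<eta> a \<noteq> \<zero>\<^bsub>A\<^esub>" by auto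
  then show "a <# K \<in> coset_supp \<xi> \<union> coset_supp \<eta>" using coset_supp_coset a(1) by blast
qed (use C_closed C_finite assms in \<open>auto simp: K_inv[OF assms(1)] K_inv[OF assms(2)]\<close>)

lemma abelian_group_C: "abelian_group C"
proof (rule abelian_groupI)
  fix \<xi> assume x: "\<xi> \<in> carrier C"
  have "(\<lambda>a\<in>carrier G. \<ominus>\<^bsub>A\<^esub> \<xi> a) \<in> carrier C"
    by (rule C_I[of _ "coset_supp \<xi>"])
       (use x C_closed C_finite coset_supp_coset[of _ \<xi>] in \<open>auto simp: K_inv[OF x]\<close>)
  moreover have "(\<lambda>a\<in>carrier G. \<ominus>\<^bsub>A\<^esub> \<xi> a) \<oplus>\<^bsub>C\<^esub> \<xi> = \<zero>\<^bsub>C\<^esub>"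
    unfolding add_C zero_C using C_closed[OF x] by (auto simp: A.l_neg intro!: restrict_ext)
  ultimately show "\<exists>\<eta>\<in>carrier C. \<eta> \<oplus>\<^bsub>C\<^esub> \<xi> = \<zero>\<^bsub>C\<^esub>" by blast
  show "\<zero>\<^bsub>C\<^esub> \<oplus>\<^bsub>C\<^esub> \<xi> = \<xi>"
  proof (rule C_eqI[OF add_C_closed[OF zero_C_closed x] x])
    fix a assume "a \<in> carrier G"
    then show "(\<zero>\<^bsub>C\<^esub> \<oplus>\<^bsub>C\<^esub> \<xi>) a = \<xi> a" using C_closed[OF x] by (simp add: add_C zero_C)
  qed
next
  fix \<xi> \<eta> assume x: "\<xi> \<in> carrier C" and y: "\<eta> \<in> carrier C"
  show "\<xi> \<oplus>\<^bsub>C\<^esub> \<eta> = \<eta> \<oplus>\<^bsub>C\<^esub> \<xi>"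
    unfolding add_C using C_closed x y by (auto simp: A.a_comm intro!: restrict_ext)
  fix \<zeta> assume z: "\<zeta> \<in> carrier C"
  show "\<xi> \<oplus>\<^bsub>C\<^esub> \<eta> \<oplus>\<^bsub>C\<^esub> \<zeta> = \<xi> \<oplus>\<^bsub>C\<^esub> (\<eta> \<oplus>\<^bsub>C\<^esub> \<zeta>)"
    unfolding add_C using C_closed x y z by (auto simp: A.a_assoc intro!: restrict_ext)
qed (auto intro: zero_C_closed add_C_closed)

sublocale C: abelian_group C by (rule abelian_group_C)

lemma eval_additive: "a \<in> carrier G \<Longrightarrow> additive_map C A (\<lambda>\<xi>. \<xi> a)"
  by (rule additive_mapI) (auto simp: C_closed add_C)

lemma minus_C:
  assumes "\<xi> \<in> carrier C" "\<eta> \<in> carrier C" "a \<in> carrier G"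
  shows "(\<xi> \<ominus>\<^bsub>C\<^esub> \<eta>) a = \<xi> a \<ominus>\<^bsub>A\<^esub> \<eta> a"
  by (rule additive_map_minus[OF abelian_group_C A_group eval_additive[OF assms(3)] assms(1,2)])

definition const_on :: "'g set \<Rightarrow> 'n \<Rightarrow> 'g \<Rightarrow> 'n" where
  "const_on S v = (\<lambda>a\<in>carrier G. if a \<in> S then v else \<zero>\<^bsub>A\<^esub>)"

lemma const_on_closed:
  assumes v: "v \<in> carrier A" and fin: "finite \<F>" and F: "\<F> \<subseteq> (\<lambda>a. a <# K) ` carrier G"
  shows "const_on (\<Union>\<F>) v \<in> carrier C"
  unfolding const_on_def
proof (rule C_I[OF _ _ fin])
  have *: "b <# K = B" if B: "B \<in> \<F>" "b \<in> B" for b B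
  proof -
    obtain a where a: "a \<in> carrier G" "B = a <# K" using F B by auto
    then show ?thesis using coset_eq_iff[of a b] coset_sub[OF a(1)] B by auto
  qed
  fix a assume a: "a \<in> carrier G"
  show "(if a \<in> \<Union>\<F> then v else \<zero>\<^bsub>A\<^esub>) \<noteq> \<zero>\<^bsub>A\<^esub> \<Longrightarrow> a <# K \<in> \<F>"
    using * by (auto split: if_splits)
  fix k assume k: "k \<in> K"
  have ak: "a \<otimes> k \<in> carrier G" using a k K_sub by auto
  have "a <# K = (a \<otimes> k) <# K" using coset_eq_iff[OF a ak] k by (auto simp: l_coset_def)
  then have "a \<in> \<Union>\<F> \<longleftrightarrow> a \<otimes> k \<in> \<Union>\<F>" using * coset_self[OF a] coset_self[OF ak] by (metis UnionE UnionI)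
  then show "(if a \<otimes> k \<in> \<Union>\<F> then v else \<zero>\<^bsub>A\<^esub>) = (if a \<in> \<Union>\<F> then v else \<zero>\<^bsub>A\<^esub>)" by simp
qed (use v in auto)

definition delta :: "'g \<Rightarrow> 'n \<Rightarrow> 'g \<Rightarrow> 'n" where
  "delta a = const_on (a <# K)"

lemma delta_closed: "a \<in> carrier G \<Longrightarrow> v \<in> carrier A \<Longrightarrow> delta a v \<in> carrier C"
  using const_on_closed[of v "{a <# K}"] by (simp add: delta_def)

lemma delta_additive: "a \<in> carrier G \<Longrightarrow> additive_map A C (delta a)"
  by (rule additive_mapI) (auto simp: delta_closed, auto simp: delta_def const_on_def add_C intro!: restrict_ext)

lemma delta_coset: "a \<in> carrier G \<Longrightarrow> b \<in> a <# K \<Longrightarrow> delta b v = delta a v"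
  using coset_eq_iff[of a b] coset_sub[of a] by (auto simp: delta_def)

text \<open>Subtracting the value on one coset of the support shortens the support by that coset, so
  the number of cosets decreases. The set Z records where the support lies, so that the summands
  added in the induction are placed there.\<close>

lemma C_induct [consumes 1, case_names supp zero add]:
  assumes x: "\<xi> \<in> carrier C" and Z: "\<And>a. a \<in> carrier G \<Longrightarrow> \<xi> a \<noteq> \<zero>\<^bsub>A\<^esub> \<Longrightarrow> a \<in> Z"
    and zero: "P \<zero>\<^bsub>C\<^esub>"
    and add: "\<And>a v \<eta>. a \<in> carrier G \<Longrightarrow> a \<in> Z \<Longrightarrow> v \<in> carrier A \<Longrightarrow> \<eta> \<in> carrier C \<Longrightarrow> P \<eta> \<Longrightarrow> P (delta a v \<oplus>\<^bsub>C\<^esub> \<eta>)"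
  shows "P \<xi>"
  using x Z
proof (induction "card (coset_supp \<xi>)" arbitrary: \<xi> rule: less_induct)
  case less
  show ?case
  proof (cases "\<exists>a\<in>carrier G. \<xi> a \<noteq> \<zero>\<^bsub>A\<^esub>")
    case False
    then have "\<xi> = \<zero>\<^bsub>C\<^esub>" using less(2) by (intro C_eqI zero_C_closed) (auto simp: zero_C)
    then show ?thesis using zero by simp
  next
    case True
    then obtain a where a: "a \<in> carrier G" "\<xi> a \<noteq> \<zero>\<^bsub>A\<^esub>" by blast
    define \<eta> where "\<eta> = \<xi> \<ominus>\<^bsub>C\<^esub> delta a (\<xi> a)"
    have d: "delta a (\<xi> a) \<in> carrier C" using delta_closed[OF a(1)] C_closed[OF less(2) a(1)] by simp
    have n: "\<eta> \<in> carrier C" using less(2) d by (simp add: \<eta>_def)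
    have val: "\<eta> b = (if b \<in> a <# K then \<zero>\<^bsub>A\<^esub> else \<xi> b)" if b: "b \<in> carrier G" for b
      using minus_C[OF less(2) d b] C_closed[OF less(2)] C_invariant[OF less(2) a(1), of b] b a
      by (simp add: \<eta>_def delta_def const_on_def a_minus_def A.r_neg)
    have "coset_supp \<eta> \<subseteq> coset_supp \<xi> - {a <# K}"
    proof
      fix B assume "B \<in> coset_supp \<eta>"
      then obtain b where b: "b \<in> carrier G" "\<eta> b \<noteq> \<zero>\<^bsub>A\<^esub>" "B = b <# K" by (auto simp: coset_supp_def)
      then have "b \<notin> a <# K" "\<xi> b \<noteq> \<zero>\<^bsub>A\<^esub>" using val[OF b(1)] by (auto split: if_splits)
      then show "B \<in> coset_supp \<xi> - {a <# K}"
        using b coset_eq_iff[OF a(1) b(1)] coset_supp_coset by auto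
    qed
    moreover have "a <# K \<in> coset_supp \<xi>" using coset_supp_coset a by blast
    ultimately have "card (coset_supp \<eta>) < card (coset_supp \<xi>)"
      using C_finite[OF less(2)] by (intro psubset_card_mono) auto
    moreover have "b \<in> Z" if "b \<in> carrier G" "\<eta> b \<noteq> \<zero>\<^bsub>A\<^esub>" for b
      using less(3)[of b] that val by (auto split: if_splits)
    ultimately have "P \<eta>" using less(1) n by blast
    then have "P (delta a (\<xi> a) \<oplus>\<^bsub>C\<^esub> \<eta>)"
      using add a less(3) C_closed[OF less(2) a(1)] n by blast
    moreover have "delta a (\<xi> a) \<oplus>\<^bsub>C\<^esub> \<eta> = \<xi>"
    proof -
      have "delta a (\<xi> a) \<oplus>\<^bsub>C\<^esub> \<eta> = \<eta> \<oplus>\<^bsub>C\<^esub> delta a (\<xi> a)" using d n by (rule C.a_comm)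
      also have "\<dots> = \<xi>" using d less(2) by (simp add: \<eta>_def a_minus_def C.a_assoc C.l_neg)
      finally show ?thesis .
    qed
    ultimately show ?thesis by simp
  qed
qed

subsection \<open>Coinvariants\<close>

abbreviation trans where "trans \<equiv> translate G act"

lemma translate_closed:
  assumes h: "h \<in> H" and x: "\<xi> \<in> carrier C"
  shows "trans h \<xi> \<in> carrier C"
  unfolding translate_def
proof (rule C_I[of _ "(\<lambda>B. h <# B) ` coset_supp \<xi>"])
  fix a assume a: "a \<in> carrier G" "act h (\<xi> (inv h \<otimes> a)) \<noteq> \<zero>\<^bsub>A\<^esub>"
  then have "\<xi> (inv h \<otimes> a) \<noteq> \<zero>\<^bsub>A\<^esub>" using h by auto
  then have "(inv h \<otimes> a) <# K \<in> coset_supp \<xi>" using a h by (intro coset_supp_coset) auto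
  moreover have "a <# K = h <# ((inv h \<otimes> a) <# K)"
    using a h K_sub by (simp add: lcos_m_assoc m_assoc[symmetric])
  ultimately show "a <# K \<in> (\<lambda>B. h <# B) ` coset_supp \<xi>" by blast
next
  fix g k assume "g \<in> carrier G" "k \<in> K"
  then show "act h (\<xi> (inv h \<otimes> (g \<otimes> k))) = act h (\<xi> (inv h \<otimes> g))"
    using K_inv[OF x, of "inv h \<otimes> g" k] h K_sub by (simp add: m_assoc subset_iff)
qed (use h x C_closed C_finite in auto)

lemma translate_delta:
  assumes h: "h \<in> H" and a: "a \<in> carrier G" and v: "v \<in> carrier A"
  shows "trans h (delta a v) = delta (h \<otimes> a) (act h v)"
proof (rule C_eqI)
  show "trans h (delta a v) \<in> carrier C" using translate_closed[OF h delta_closed[OF a v]] .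
  show "delta (h \<otimes> a) (act h v) \<in> carrier C" using h a v by (intro delta_closed) auto
  fix b assume b: "b \<in> carrier G"
  have "inv h \<otimes> b \<in> a <# K \<longleftrightarrow> b \<in> (h \<otimes> a) <# K"
    using coset_mem_iff[of a "inv h \<otimes> b"] coset_mem_iff[of "h \<otimes> a" b] a b h
    by (simp add: inv_mult_group m_assoc)
  then show "trans h (delta a v) b = delta (h \<otimes> a) (act h v) b"
    using a b h by (simp add: translate_def delta_def const_on_def)
qed

text \<open>The kernel of the projection to the H-coinvariants, with the generators of
  \<open>coinvariant_class\<close>; equality of classes becomes membership of a difference.\<close>

definition aug :: "('g \<Rightarrow> 'n) set" where
  "aug = generate (add_monoid C) {trans h \<eta> \<ominus>\<^bsub>C\<^esub> \<eta> | h \<eta>. h \<in> H \<and> \<eta> \<in> carrier C}"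

lemma aug_gen: "h \<in> H \<Longrightarrow> \<eta> \<in> carrier C \<Longrightarrow> trans h \<eta> \<ominus>\<^bsub>C\<^esub> \<eta> \<in> aug"
  unfolding aug_def by (rule generate.incl) blast

lemma aug_subgroup: "subgroup aug (add_monoid C)"
  unfolding aug_def by (rule C.add.generate_is_subgroup) (use translate_closed in auto)

lemma aug_zero: "\<zero>\<^bsub>C\<^esub> \<in> aug"
  using subgroup.one_closed[OF aug_subgroup] by simp

lemma aug_add: "\<xi> \<in> aug \<Longrightarrow> \<eta> \<in> aug \<Longrightarrow> \<xi> \<oplus>\<^bsub>C\<^esub> \<eta> \<in> aug"
  using subgroup.m_closed[OF aug_subgroup] by simp

lemma aug_minus: "\<xi> \<in> aug \<Longrightarrow> \<ominus>\<^bsub>C\<^esub> \<xi> \<in> aug"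
  using subgroup.m_inv_closed[OF aug_subgroup] by (simp add: a_inv_def)

lemma coinvariant_class_eq_iff:
  assumes "\<xi> \<in> carrier C" "\<eta> \<in> carrier C"
  shows "coinvariant_class C H trans \<xi> = coinvariant_class C H trans \<eta> \<longleftrightarrow> \<xi> \<ominus>\<^bsub>C\<^esub> \<eta> \<in> aug"
proof -
  have "coinvariant_class C H trans \<zeta> = aug #>\<^bsub>add_monoid C\<^esub> \<zeta>" for \<zeta>
    by (simp add: coinvariant_class_def aug_def a_r_coset_def)
  moreover have "aug #>\<^bsub>add_monoid C\<^esub> \<xi> = aug #>\<^bsub>add_monoid C\<^esub> \<eta> \<longleftrightarrow> \<xi> \<in> aug #>\<^bsub>add_monoid C\<^esub> \<eta>"
    using C.add.repr_independence[OF _ _ aug_subgroup, of \<xi> \<eta>] C.add.rcos_self[OF _ aug_subgroup, of \<xi>] assms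
    by auto
  moreover have "\<xi> \<in> aug #>\<^bsub>add_monoid C\<^esub> \<eta> \<longleftrightarrow> \<xi> \<ominus>\<^bsub>C\<^esub> \<eta> \<in> aug"
    using subgroup.rcos_module[OF aug_subgroup C.a_group, of \<eta> \<xi>] assms
    by (simp add: a_minus_def a_inv_def)
  ultimately show ?thesis by simp
qed

lemma aug_trans:
  assumes "\<xi> \<ominus>\<^bsub>C\<^esub> \<eta> \<in> aug" "\<eta> \<ominus>\<^bsub>C\<^esub> \<zeta> \<in> aug" "\<xi> \<in> carrier C" "\<eta> \<in> carrier C" "\<zeta> \<in> carrier C"
  shows "\<xi> \<ominus>\<^bsub>C\<^esub> \<zeta> \<in> aug"
proof -
  have "(\<xi> \<ominus>\<^bsub>C\<^esub> \<eta>) \<oplus>\<^bsub>C\<^esub> (\<eta> \<ominus>\<^bsub>C\<^esub> \<zeta>) = \<xi> \<oplus>\<^bsub>C\<^esub> ((\<ominus>\<^bsub>C\<^esub> \<eta> \<oplus>\<^bsub>C\<^esub> \<eta>) \<oplus>\<^bsub>C\<^esub> \<ominus>\<^bsub>C\<^esub> \<zeta>)"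
    using assms(3-5) by (simp add: a_minus_def C.a_assoc)
  also have "\<dots> = \<xi> \<ominus>\<^bsub>C\<^esub> \<zeta>" using assms(3-5) by (simp add: a_minus_def C.l_neg)
  finally show ?thesis using aug_add[OF assms(1,2)] by simp
qed

lemma aug_sum:
  assumes "\<xi> \<ominus>\<^bsub>C\<^esub> \<eta> \<in> aug" "\<xi>' \<ominus>\<^bsub>C\<^esub> \<eta>' \<in> aug"
    "\<xi> \<in> carrier C" "\<eta> \<in> carrier C" "\<xi>' \<in> carrier C" "\<eta>' \<in> carrier C"
  shows "(\<xi> \<oplus>\<^bsub>C\<^esub> \<xi>') \<ominus>\<^bsub>C\<^esub> (\<eta> \<oplus>\<^bsub>C\<^esub> \<eta>') \<in> aug"
proof -
  have "(\<xi> \<oplus>\<^bsub>C\<^esub> \<xi>') \<ominus>\<^bsub>C\<^esub> (\<eta> \<oplus>\<^bsub>C\<^esub> \<eta>') = (\<xi> \<ominus>\<^bsub>C\<^esub> \<eta>) \<oplus>\<^bsub>C\<^esub> (\<xi>' \<ominus>\<^bsub>C\<^esub> \<eta>')"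
    using assms(3-6) by (simp add: a_minus_def C.minus_add C.a_ac)
  then show ?thesis using aug_add[OF assms(1,2)] by simp
qed

lemma aug_sym: "\<xi> \<ominus>\<^bsub>C\<^esub> \<eta> \<in> aug \<Longrightarrow> \<xi> \<in> carrier C \<Longrightarrow> \<eta> \<in> carrier C \<Longrightarrow> \<eta> \<ominus>\<^bsub>C\<^esub> \<xi> \<in> aug"
  using aug_minus[of "\<xi> \<ominus>\<^bsub>C\<^esub> \<eta>"] by (simp add: a_minus_def C.minus_add C.a_comm)

lemma delta_translate_aug:
  assumes h: "h \<in> H" and a: "a \<in> carrier G" and v: "v \<in> carrier A"
  shows "delta (h \<otimes> a) (act h v) \<ominus>\<^bsub>C\<^esub> delta a v \<in> aug"
  using aug_gen[OF h delta_closed[OF a v]] translate_delta[OF assms] by simp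

end

subsection \<open>Averaged orbit sums\<close>

text \<open>The map \<open>e\<close> abstracts the averaging operator of the stabiliser of the coset
  gK in H. The last condition says that e v is a genuine average: equal pieces w of v, each moved by
  an element of the stabiliser.\<close>

locale orbit_sum = equivariant_functions G T K H A act
  for G :: "('g, 'b) monoid_scheme" (structure) and T :: "'g topology"
    and K H :: "'g set" and A :: "('f, 'n, 'y) module_scheme" and act :: "'g \<Rightarrow> 'n \<Rightarrow> 'n" +
  fixes g :: 'g and e :: "'n \<Rightarrow> 'n"
  assumes g_closed: "g \<in> carrier G"
    and e_additive: "additive_map A A e"
    and e_invariant: "\<And>w v. w \<in> H \<inter> conjugate G g K \<Longrightarrow> v \<in> carrier A \<Longrightarrow> e (act w v) = e v"
    and e_average: "\<And>v. v \<in> carrier A \<Longrightarrow> \<exists>\<Gamma> w. finite \<Gamma> \<and> \<Gamma> \<subseteq> H \<inter> conjugate G g K \<and> w \<in> carrier A \<and>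
      e v = (\<Oplus>\<^bsub>A\<^esub>\<gamma>\<in>\<Gamma>. act \<gamma> w) \<and> v = (\<Oplus>\<^bsub>A\<^esub>\<gamma>\<in>\<Gamma>. w)"
begin

text \<open>Meaningful for cosets B that meet H g; then B = q g K, and q is determined up to the
  stabiliser.\<close>

definition orbit_rep :: "'g set \<Rightarrow> 'g" where
  "orbit_rep B = (SOME q. q \<in> H \<and> q \<otimes> g \<in> B)"

definition orbit_term :: "('g \<Rightarrow> 'n) \<Rightarrow> 'g set \<Rightarrow> 'n" where
  "orbit_term \<xi> B = (if \<exists>q\<in>H. q \<otimes> g \<in> B
     then e (act (inv (orbit_rep B)) (\<xi> (orbit_rep B \<otimes> g))) else \<zero>\<^bsub>A\<^esub>)"

text \<open>Sending q to q g K identifies the quotient of H by the stabiliser with the left K-cosets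
  in H g K. Indexing by the cosets in the support keeps the sum finite; cosets outside H g K receive
  the term zero.\<close>

definition Phi :: "('g \<Rightarrow> 'n) \<Rightarrow> 'n" where
  "Phi \<xi> = (\<Oplus>\<^bsub>A\<^esub>B\<in>coset_supp \<xi>. orbit_term \<xi> B)"

lemma e_closed [simp]: "v \<in> carrier A \<Longrightarrow> e v \<in> carrier A"
  by (rule additive_map_closed[OF e_additive])

lemma e_zero [simp]: "e \<zero>\<^bsub>A\<^esub> = \<zero>\<^bsub>A\<^esub>"
  by (rule additive_map_zero[OF A_group A_group e_additive])

lemma orbit_repI:
  assumes "q \<in> H" "q \<otimes> g \<in> B"
  shows "orbit_rep B \<in> H" "orbit_rep B \<otimes> g \<in> B"
  using someI[of "\<lambda>q. q \<in> H \<and> q \<otimes> g \<in> B" q] assms by (simp_all add: orbit_rep_def)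

lemma stabilizer:
  assumes "q \<in> H" "q' \<in> H" "a \<in> carrier G" "q \<otimes> g \<in> a <# K" "q' \<otimes> g \<in> a <# K"
  shows "inv q \<otimes> q' \<in> H \<inter> conjugate G g K"
proof -
  have "a <# K = (q \<otimes> g) <# K" using assms g_closed coset_eq_iff[of a "q \<otimes> g"] by simp
  then have "q' \<otimes> g \<in> (q \<otimes> g) <# K" using assms by simp
  then have k: "inv (q \<otimes> g) \<otimes> (q' \<otimes> g) \<in> K" using coset_mem_iff assms g_closed by simp
  have "inv q \<otimes> q' = g \<otimes> (inv (q \<otimes> g) \<otimes> (q' \<otimes> g)) \<otimes> inv g"
  proof -
    have "g \<otimes> (inv (q \<otimes> g) \<otimes> (q' \<otimes> g)) \<otimes> inv g = inv q \<otimes> q'"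
      using assms(1,2) g_closed by (simp add: inv_mult_group m_assoc) (simp add: m_assoc[symmetric])
    then show ?thesis by simp
  qed
  then have "inv q \<otimes> q' \<in> conjugate G g K" unfolding conjugate_def using k by blast
  then show ?thesis using assms by simp
qed

text \<open>Two representatives differ by an element of the stabiliser, which e absorbs; so the
  arbitrary choice in \<open>orbit_rep\<close> does not matter.\<close>

lemma orbit_term_eq:
  assumes x: "\<xi> \<in> carrier C" and a: "a \<in> carrier G" and q: "q \<in> H" "q \<otimes> g \<in> a <# K"
  shows "orbit_term \<xi> (a <# K) = e (act (inv q) (\<xi> (q \<otimes> g)))"
proof -
  define q' where "q' = orbit_rep (a <# K)"
  have q': "q' \<in> H" "q' \<otimes> g \<in> a <# K" using orbit_repI[OF q] by (simp_all add: q'_def)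
  have val: "\<xi> (q' \<otimes> g) = \<xi> (q \<otimes> g)" using C_invariant[OF x a] q q' by simp
  have v: "\<xi> (q \<otimes> g) \<in> carrier A" using C_closed[OF x] q g_closed by simp
  have w: "inv q' \<otimes> q \<in> H \<inter> conjugate G g K" using stabilizer[OF q'(1) q(1) a q'(2) q(2)] .
  have "e (act (inv q') (\<xi> (q \<otimes> g))) = e (act (inv q' \<otimes> q) (act (inv q) (\<xi> (q \<otimes> g))))"
    using act_mult[of "inv q' \<otimes> q" "inv q"] q q' v by (simp add: m_assoc)
  also have "\<dots> = e (act (inv q) (\<xi> (q \<otimes> g)))" using e_invariant[OF w] q v by simp
  finally show ?thesis using q val by (auto simp: orbit_term_def q'_def)
qed

lemma orbit_term_zero:
  assumes x: "\<xi> \<in> carrier C" and a: "a \<in> carrier G" and z: "\<xi> a = \<zero>\<^bsub>A\<^esub> \<or> \<not> (\<exists>q\<in>H. q \<otimes> g \<in> a <# K)"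
  shows "orbit_term \<xi> (a <# K) = \<zero>\<^bsub>A\<^esub>"
proof (cases "\<exists>q\<in>H. q \<otimes> g \<in> a <# K")
  case True
  then obtain q where q: "q \<in> H" "q \<otimes> g \<in> a <# K" by blast
  have "\<xi> (q \<otimes> g) = \<zero>\<^bsub>A\<^esub>" using C_invariant[OF x a q(2)] z True by auto
  then show ?thesis using orbit_term_eq[OF x a q] q by simp
qed (auto simp: orbit_term_def)

lemma orbit_term_closed:
  assumes x: "\<xi> \<in> carrier C" and a: "a \<in> carrier G"
  shows "orbit_term \<xi> (a <# K) \<in> carrier A"
proof (cases "\<exists>q\<in>H. q \<otimes> g \<in> a <# K")
  case True
  then obtain q where q: "q \<in> H" "q \<otimes> g \<in> a <# K" by blast
  have "\<xi> (q \<otimes> g) \<in> carrier A" using C_closed[OF x] q g_closed by simp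
  then show ?thesis using orbit_term_eq[OF x a q] q by simp
qed (auto simp: orbit_term_def)

abbreviation all_cosets where "all_cosets \<equiv> (\<lambda>a. a <# K) ` carrier G"

lemma coset_supp_all: "coset_supp \<xi> \<subseteq> all_cosets"
  by (auto simp: coset_supp_def)

text \<open>Enlarging the index set adds zero terms. This gives different functions a common index
  set, as additivity requires.\<close>

lemma Phi_eq:
  assumes x: "\<xi> \<in> carrier C" and F: "finite \<F>" "coset_supp \<xi> \<subseteq> \<F>" "\<F> \<subseteq> all_cosets"
  shows "Phi \<xi> = (\<Oplus>\<^bsub>A\<^esub>B\<in>\<F>. orbit_term \<xi> B)"
  unfolding Phi_def
proof (rule A.add.finprod_mono_neutral_cong_left[OF F(1,2)])
  fix B assume B: "B \<in> \<F> - coset_supp \<xi>"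
  then obtain a where a: "a \<in> carrier G" "B = a <# K" using F(3) by blast
  then have "\<xi> a = \<zero>\<^bsub>A\<^esub>" using B coset_supp_coset by blast
  then show "orbit_term \<xi> B = \<zero>\<^bsub>A\<^esub>" unfolding a(2) using orbit_term_zero[OF x a(1)] by simp
next
  show "orbit_term \<xi> \<in> \<F> \<rightarrow> carrier A" using F(3) orbit_term_closed[OF x] by auto
qed simp

lemma Phi_closed: "\<xi> \<in> carrier C \<Longrightarrow> Phi \<xi> \<in> carrier A"
  unfolding Phi_def using orbit_term_closed coset_supp_all[of \<xi>] by (intro A.finsum_closed) auto

lemma Phi_additive: "additive_map C A Phi"
proof (rule additive_mapI)
  fix \<xi> \<eta> assume x: "\<xi> \<in> carrier C" and y: "\<eta> \<in> carrier C"
  let ?F = "coset_supp \<xi> \<union> coset_supp \<eta> \<union> coset_supp (\<xi> \<oplus>\<^bsub>C\<^esub> \<eta>)"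
  have F: "finite ?F" "?F \<subseteq> all_cosets" using C_finite x y coset_supp_all by auto
  have tm: "orbit_term (\<xi> \<oplus>\<^bsub>C\<^esub> \<eta>) B = orbit_term \<xi> B \<oplus>\<^bsub>A\<^esub> orbit_term \<eta> B" if B: "B \<in> all_cosets" for B
  proof -
    obtain a where a: "a \<in> carrier G" "B = a <# K" using B by blast
    show ?thesis
    proof (cases "\<exists>q\<in>H. q \<otimes> g \<in> a <# K")
      case True
      then obtain q where q: "q \<in> H" "q \<otimes> g \<in> a <# K" by blast
      have v: "\<xi> (q \<otimes> g) \<in> carrier A" "\<eta> (q \<otimes> g) \<in> carrier A" using C_closed x y q g_closed by auto
      have "(\<xi> \<oplus>\<^bsub>C\<^esub> \<eta>) (q \<otimes> g) = \<xi> (q \<otimes> g) \<oplus>\<^bsub>A\<^esub> \<eta> (q \<otimes> g)" using q g_closed by (simp add: add_C)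
      then show ?thesis
        unfolding a(2) using orbit_term_eq[OF x a(1) q] orbit_term_eq[OF y a(1) q]
          orbit_term_eq[OF add_C_closed[OF x y] a(1) q] q v
        by (simp add: additive_map_add[OF act_additive] additive_map_add[OF e_additive])
    qed (simp add: a orbit_term_def)
  qed
  have "Phi (\<xi> \<oplus>\<^bsub>C\<^esub> \<eta>) = (\<Oplus>\<^bsub>A\<^esub>B\<in>?F. orbit_term (\<xi> \<oplus>\<^bsub>C\<^esub> \<eta>) B)"
    using add_C_closed[OF x y] F by (intro Phi_eq) auto
  also have "\<dots> = (\<Oplus>\<^bsub>A\<^esub>B\<in>?F. orbit_term \<xi> B \<oplus>\<^bsub>A\<^esub> orbit_term \<eta> B)"
  proof (rule A.finsum_cong')
    show "(\<lambda>B. orbit_term \<xi> B \<oplus>\<^bsub>A\<^esub> orbit_term \<eta> B) \<in> ?F \<rightarrow> carrier A"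
      using F(2) orbit_term_closed[OF x] orbit_term_closed[OF y] by auto
  qed (use tm F(2) in auto)
  also have "\<dots> = (\<Oplus>\<^bsub>A\<^esub>B\<in>?F. orbit_term \<xi> B) \<oplus>\<^bsub>A\<^esub> (\<Oplus>\<^bsub>A\<^esub>B\<in>?F. orbit_term \<eta> B)"
    using F(2) orbit_term_closed[OF x] orbit_term_closed[OF y] by (intro A.finsum_addf) auto
  also have "\<dots> = Phi \<xi> \<oplus>\<^bsub>A\<^esub> Phi \<eta>"
    by (subst (1 2) Phi_eq[OF _ F(1) _ F(2)]) (use x y in auto)
  finally show "Phi (\<xi> \<oplus>\<^bsub>C\<^esub> \<eta>) = Phi \<xi> \<oplus>\<^bsub>A\<^esub> Phi \<eta>" .
qed (rule Phi_closed)

lemma coset_translate: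
  assumes "h \<in> H" "a \<in> carrier G"
  shows "h <# (a <# K) = (h \<otimes> a) <# K"
  using assms K_sub by (simp add: lcos_m_assoc)

text \<open>Translation by h moves the coset B to h B and a representative q to h q. The h in the
  action and in the new representative cancel, so the terms are the same after reindexing.\<close>

lemma Phi_translate:
  assumes h: "h \<in> H" and x: "\<xi> \<in> carrier C"
  shows "Phi (trans h \<xi>) = Phi \<xi>"
proof -
  let ?F = "(\<lambda>B. h <# B) ` coset_supp \<xi>"
  have tx: "trans h \<xi> \<in> carrier C" by (rule translate_closed[OF h x])
  have sub: "coset_supp (trans h \<xi>) \<subseteq> ?F"
  proof
    fix B assume "B \<in> coset_supp (trans h \<xi>)"
    then obtain a where a: "a \<in> carrier G" "trans h \<xi> a \<noteq> \<zero>\<^bsub>A\<^esub>" "B = a <# K" by (auto simp: coset_supp_def)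
    then have "\<xi> (inv h \<otimes> a) \<noteq> \<zero>\<^bsub>A\<^esub>" using h by (auto simp: translate_def)
    then have "(inv h \<otimes> a) <# K \<in> coset_supp \<xi>" using a h by (intro coset_supp_coset) auto
    moreover have "B = h <# ((inv h \<otimes> a) <# K)"
      using a h coset_translate[OF h, of "inv h \<otimes> a"] by (simp add: m_assoc[symmetric])
    ultimately show "B \<in> ?F" by blast
  qed
  have all: "?F \<subseteq> all_cosets"
    using h coset_translate[OF h] by (auto simp: coset_supp_def)
  have inj: "inj_on (\<lambda>B. h <# B) (coset_supp \<xi>)"
  proof (rule inj_onI)
    fix B B' assume "B \<in> coset_supp \<xi>" "B' \<in> coset_supp \<xi>" and eq: "h <# B = h <# B'"
    then have "B \<subseteq> carrier G" "B' \<subseteq> carrier G" using coset_sub by (auto simp: coset_supp_def)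
    then have *: "inv h <# (h <# B) = B" "inv h <# (h <# B') = B'"
      using h by (simp_all add: lcos_m_assoc lcos_mult_one)
    show "B = B'" using *(2) unfolding eq[symmetric] *(1) .
  qed
  have tm: "orbit_term (trans h \<xi>) (h <# B) = orbit_term \<xi> B" if B: "B \<in> coset_supp \<xi>" for B
  proof -
    obtain a where a: "a \<in> carrier G" "B = a <# K" using B by (auto simp: coset_supp_def)
    have ha: "h \<otimes> a \<in> carrier G" using h a by simp
    have shift: "h \<otimes> q \<otimes> g \<in> (h \<otimes> a) <# K \<longleftrightarrow> q \<otimes> g \<in> a <# K" if "q \<in> H" for q
      using coset_mem_iff[OF a(1), of "q \<otimes> g"] coset_mem_iff[OF ha, of "h \<otimes> q \<otimes> g"] h that a(1) g_closed
      by (simp add: inv_mult_group m_assoc) (simp add: m_assoc[symmetric])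
    show ?thesis
    proof (cases "\<exists>q\<in>H. q \<otimes> g \<in> a <# K")
      case True
      then obtain q where q: "q \<in> H" "q \<otimes> g \<in> a <# K" by blast
      have hq: "h \<otimes> q \<in> H" "h \<otimes> q \<otimes> g \<in> (h \<otimes> a) <# K" using shift[OF q(1)] q h by auto
      have v: "\<xi> (q \<otimes> g) \<in> carrier A" using C_closed[OF x] q g_closed by simp
      have "trans h \<xi> (h \<otimes> q \<otimes> g) = act h (\<xi> (q \<otimes> g))"
        using h q g_closed by (simp add: translate_def m_assoc[symmetric])
      then have "act (inv (h \<otimes> q)) (trans h \<xi> (h \<otimes> q \<otimes> g)) = act (inv q) (\<xi> (q \<otimes> g))"
        using act_mult[of "inv (h \<otimes> q)" h "\<xi> (q \<otimes> g)"] h q v by (simp add: inv_mult_group m_assoc)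
      then show ?thesis
        unfolding a(2) coset_translate[OF h a(1)]
        using orbit_term_eq[OF tx ha hq] orbit_term_eq[OF x a(1) q] by simp
    next
      case False
      have "\<not> (\<exists>q\<in>H. q \<otimes> g \<in> (h \<otimes> a) <# K)"
      proof
        assume "\<exists>q\<in>H. q \<otimes> g \<in> (h \<otimes> a) <# K"
        then obtain q where q: "q \<in> H" "q \<otimes> g \<in> (h \<otimes> a) <# K" by blast
        then have "inv h \<otimes> q \<otimes> g \<in> a <# K"
          using shift[of "inv h \<otimes> q"] h by (simp add: m_assoc[symmetric])
        then show False using False q h H_mult H_inv by blast
      qed
      then show ?thesis unfolding a(2) coset_translate[OF h a(1)] using False by (simp add: orbit_term_def)
    qed
  qed
  have "Phi (trans h \<xi>) = (\<Oplus>\<^bsub>A\<^esub>B\<in>?F. orbit_term (trans h \<xi>) B)"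
    using C_finite[OF x] by (intro Phi_eq[OF tx _ sub all]) simp
  also have "\<dots> = (\<Oplus>\<^bsub>A\<^esub>B\<in>coset_supp \<xi>. orbit_term (trans h \<xi>) (h <# B))"
  proof (rule A.finsum_reindex[OF _ inj])
    show "orbit_term (trans h \<xi>) \<in> ?F \<rightarrow> carrier A"
      using all orbit_term_closed[OF tx] by auto
  qed
  also have "\<dots> = Phi \<xi>"
    unfolding Phi_def
  proof (rule A.finsum_cong')
    show "orbit_term \<xi> \<in> coset_supp \<xi> \<rightarrow> carrier A"
      using coset_supp_all[of \<xi>] orbit_term_closed[OF x] by auto
  qed (simp_all add: tm)
  finally show ?thesis .
qed

lemma Phi_minus: "\<xi> \<in> carrier C \<Longrightarrow> \<eta> \<in> carrier C \<Longrightarrow> Phi (\<xi> \<ominus>\<^bsub>C\<^esub> \<eta>) = Phi \<xi> \<ominus>\<^bsub>A\<^esub> Phi \<eta>"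
  by (rule additive_map_minus[OF abelian_group_C A_group Phi_additive])

text \<open>The functions with vanishing orbit sum form a subgroup, and it contains the generators
  by translation invariance.\<close>

lemma Phi_aug:
  assumes "\<xi> \<in> aug"
  shows "Phi \<xi> = \<zero>\<^bsub>A\<^esub>"
proof -
  let ?N = "{\<xi> \<in> carrier C. Phi \<xi> = \<zero>\<^bsub>A\<^esub>}"
  have zero: "Phi \<zero>\<^bsub>C\<^esub> = \<zero>\<^bsub>A\<^esub>" by (rule additive_map_zero[OF abelian_group_C A_group Phi_additive])
  have sub: "subgroup ?N (add_monoid C)"
  proof (rule group.subgroupI[OF C.a_group])
    fix \<xi> assume x: "\<xi> \<in> ?N"
    have "Phi (\<ominus>\<^bsub>C\<^esub> \<xi>) = \<zero>\<^bsub>A\<^esub>"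
      using Phi_minus[of "\<zero>\<^bsub>C\<^esub>" \<xi>] zero x by (simp add: a_minus_def)
    then show "inv\<^bsub>add_monoid C\<^esub> \<xi> \<in> ?N" using x by (simp add: a_inv_def[symmetric])
    fix \<eta> assume "\<eta> \<in> ?N"
    then show "\<xi> \<otimes>\<^bsub>add_monoid C\<^esub> \<eta> \<in> ?N" using x additive_map_add[OF Phi_additive] by simp
  qed (use zero in auto)
  have "{trans h \<eta> \<ominus>\<^bsub>C\<^esub> \<eta> | h \<eta>. h \<in> H \<and> \<eta> \<in> carrier C} \<subseteq> ?N"
    using translate_closed Phi_minus Phi_translate Phi_closed
    by (auto simp: a_minus_def A.r_neg)
  then have "aug \<subseteq> ?N" unfolding aug_def by (rule C.add.generate_subgroup_incl[OF _ sub])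
  then show ?thesis using assms by blast
qed

text \<open>The hypothesis makes every coset contribute the same term u, hence the multiplicity. For
  one double coset of the Hecke function this multiplicity becomes an index.\<close>

lemma Phi_const_on:
  assumes v: "v \<in> carrier A" and F: "finite \<F>" "\<F> \<subseteq> all_cosets"
    and u: "u \<in> carrier A" and rep: "\<And>B. B \<in> \<F> \<Longrightarrow> \<exists>q\<in>H. q \<otimes> g \<in> B \<and> e (act (inv q) v) = u"
  shows "Phi (const_on (\<Union>\<F>) v) = add_pow A (card \<F>) u"
proof -
  have c: "const_on (\<Union>\<F>) v \<in> carrier C" by (rule const_on_closed[OF v F])
  have sub: "coset_supp (const_on (\<Union>\<F>) v) \<subseteq> \<F>"
  proof
    fix B assume "B \<in> coset_supp (const_on (\<Union>\<F>) v)"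
    then obtain a where a: "a \<in> carrier G" "B = a <# K" "a \<in> \<Union>\<F>"
      by (auto simp: coset_supp_def const_on_def split: if_splits)
    then obtain B' where B': "B' \<in> \<F>" "a \<in> B'" by blast
    then obtain b where b: "b \<in> carrier G" "B' = b <# K" using F(2) by blast
    then have "B' = B" using coset_eq_iff[OF b(1) a(1)] B' a by simp
    then show "B \<in> \<F>" using B' by simp
  qed
  have "Phi (const_on (\<Union>\<F>) v) = (\<Oplus>\<^bsub>A\<^esub>B\<in>\<F>. orbit_term (const_on (\<Union>\<F>) v) B)"
    by (rule Phi_eq[OF c F(1) sub F(2)])
  also have "\<dots> = (\<Oplus>\<^bsub>A\<^esub>B\<in>\<F>. u)"
  proof (rule A.finsum_cong')
    fix B assume B: "B \<in> \<F>"
    then obtain a where a: "a \<in> carrier G" "B = a <# K" using F(2) by blast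
    obtain q where q: "q \<in> H" "q \<otimes> g \<in> B" "e (act (inv q) v) = u" using rep[OF B] by blast
    have "const_on (\<Union>\<F>) v (q \<otimes> g) = v" using q g_closed B by (auto simp: const_on_def)
    then show "orbit_term (const_on (\<Union>\<F>) v) B = u"
      using orbit_term_eq[OF c a(1), of q] q a(2) by simp
  qed (use u in auto)
  also have "\<dots> = add_pow A (card \<F>) u" by (rule A.add.finprod_const[OF u])
  finally show ?thesis .
qed

lemma Phi_delta:
  assumes "q \<in> H" "v \<in> carrier A"
  shows "Phi (delta (q \<otimes> g) v) = e (act (inv q) v)"
  using Phi_const_on[of v "{(q \<otimes> g) <# K}" "e (act (inv q) v)"] assms g_closed coset_self[of "q \<otimes> g"]
  by (auto simp: delta_def)

lemma Phi_outside:
  assumes x: "\<xi> \<in> carrier C" and z: "\<And>q. q \<in> H \<Longrightarrow> \<xi> (q \<otimes> g) = \<zero>\<^bsub>A\<^esub>"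
  shows "Phi \<xi> = \<zero>\<^bsub>A\<^esub>"
proof -
  have "orbit_term \<xi> B = \<zero>\<^bsub>A\<^esub>" if B: "B \<in> coset_supp \<xi>" for B
  proof -
    obtain a where a: "a \<in> carrier G" "B = a <# K" "\<xi> a \<noteq> \<zero>\<^bsub>A\<^esub>" using B by (auto simp: coset_supp_def)
    have "\<not> (\<exists>q\<in>H. q \<otimes> g \<in> a <# K)" using C_invariant[OF x a(1)] z a(3) by metis
    then show ?thesis unfolding a(2) by (intro orbit_term_zero[OF x a(1)]) simp
  qed
  then have "Phi \<xi> = (\<Oplus>\<^bsub>A\<^esub>B\<in>coset_supp \<xi>. \<zero>\<^bsub>A\<^esub>)"
    unfolding Phi_def by (intro A.finsum_cong') auto
  then show ?thesis by simp
qed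

lemma Phi_cong:
  assumes x: "\<xi> \<in> carrier C" and y: "\<eta> \<in> carrier C" and eq: "\<And>q. q \<in> H \<Longrightarrow> \<xi> (q \<otimes> g) = \<eta> (q \<otimes> g)"
  shows "Phi \<xi> = Phi \<eta>"
proof -
  have "Phi (\<xi> \<ominus>\<^bsub>C\<^esub> \<eta>) = \<zero>\<^bsub>A\<^esub>"
  proof (rule Phi_outside)
    fix q assume "q \<in> H"
    then show "(\<xi> \<ominus>\<^bsub>C\<^esub> \<eta>) (q \<otimes> g) = \<zero>\<^bsub>A\<^esub>"
      using minus_C[OF x y] eq C_closed[OF y] g_closed by (simp add: a_minus_def A.r_neg)
  qed (use x y in simp)
  then show ?thesis
    using Phi_minus[OF x y] A.minus_eq_zero_iff[OF Phi_closed[OF x] Phi_closed[OF y]] by simp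
qed

text \<open>An element \<gamma> of the stabiliser fixes the coset gK, so moving the value by
  \<gamma> amounts to translating the whole function. Summing these congruences over the pieces of v
  gives the claim.\<close>

lemma delta_average:
  assumes v: "v \<in> carrier A"
  shows "delta g (e v) \<ominus>\<^bsub>C\<^esub> delta g v \<in> aug"
proof -
  obtain \<Gamma> w where G: "finite \<Gamma>" "\<Gamma> \<subseteq> H \<inter> conjugate G g K" "w \<in> carrier A"
    "e v = (\<Oplus>\<^bsub>A\<^esub>\<gamma>\<in>\<Gamma>. act \<gamma> w)" "v = (\<Oplus>\<^bsub>A\<^esub>\<gamma>\<in>\<Gamma>. w)" using e_average[OF v] by blast
  note d = delta_additive[OF g_closed]
  have step: "delta g (act \<gamma> w) \<ominus>\<^bsub>C\<^esub> delta g w \<in> aug" if c: "\<gamma> \<in> H \<inter> conjugate G g K" for \<gamma>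
  proof -
    have cH: "\<gamma> \<in> H" using c by simp
    obtain k where k: "k \<in> K" "\<gamma> = g \<otimes> k \<otimes> inv g" using c by (auto simp: conjugate_def)
    then have "\<gamma> \<otimes> g = g \<otimes> k" using g_closed K_sub by (auto simp: m_assoc)
    then have "\<gamma> \<otimes> g \<in> g <# K" using k(1) by (auto simp: l_coset_def)
    then have "delta (\<gamma> \<otimes> g) (act \<gamma> w) = delta g (act \<gamma> w)" by (rule delta_coset[OF g_closed])
    then show ?thesis using delta_translate_aug[OF cH g_closed G(3)] by simp
  qed
  have "delta g (\<Oplus>\<^bsub>A\<^esub>\<gamma>\<in>\<Delta>. act \<gamma> w) \<ominus>\<^bsub>C\<^esub> delta g (\<Oplus>\<^bsub>A\<^esub>\<gamma>\<in>\<Delta>. w) \<in> aug"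
    if "finite \<Delta>" "\<Delta> \<subseteq> H \<inter> conjugate G g K" for \<Delta>
    using that
  proof (induction \<Delta>)
    case empty
    then show ?case using additive_map_zero[OF A_group abelian_group_C d] aug_minus[OF aug_zero]
      by (simp add: a_minus_def)
  next
    case (insert \<gamma> \<Delta>)
    have cl: "(\<lambda>\<gamma>. act \<gamma> w) \<in> \<Delta> \<rightarrow> carrier A" "act \<gamma> w \<in> carrier A" using insert G(3) by auto
    have cl2: "(\<Oplus>\<^bsub>A\<^esub>\<gamma>\<in>\<Delta>. act \<gamma> w) \<in> carrier A" "(\<Oplus>\<^bsub>A\<^esub>\<gamma>\<in>\<Delta>. w) \<in> carrier A"
      using cl G(3) by auto
    have "(delta g (act \<gamma> w) \<oplus>\<^bsub>C\<^esub> delta g (\<Oplus>\<^bsub>A\<^esub>\<gamma>\<in>\<Delta>. act \<gamma> w)) \<ominus>\<^bsub>C\<^esub>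
        (delta g w \<oplus>\<^bsub>C\<^esub> delta g (\<Oplus>\<^bsub>A\<^esub>\<gamma>\<in>\<Delta>. w)) \<in> aug"
      by (rule aug_sum[OF step insert.IH]) (use insert cl cl2 G(3) delta_closed[OF g_closed] in auto)
    then show ?case
      using insert cl cl2 G(3) additive_map_add[OF d] by simp
  qed
  from this[OF G(1,2)] show ?thesis unfolding G(4)[symmetric] G(5)[symmetric] .
qed

end

section \<open>Normal forms of functions modulo the augmentation part\<close>

context equivariant_functions
begin

text \<open>The normal form keeps, for each double coset, one value on g_i K. By additivity it
  suffices to treat a function carried by one coset h g_i K: it can be translated to g_i K and its
  value then averaged, both without leaving its class.\<close>

lemma orbit_decomposition:
  fixes I :: "'i set" and g :: "'i \<Rightarrow> 'g" and e :: "'i \<Rightarrow> 'n \<Rightarrow> 'n"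
  assumes I: "finite I"
    and orb: "\<And>i. i \<in> I \<Longrightarrow> orbit_sum G T K H A act (g i) (e i)"
    and disj: "\<And>i j h k. i \<in> I \<Longrightarrow> j \<in> I \<Longrightarrow> h \<in> H \<Longrightarrow> k \<in> K \<Longrightarrow> g i = h \<otimes> g j \<otimes> k \<Longrightarrow> i = j"
    and x: "\<xi> \<in> carrier C"
    and supp: "\<And>a. a \<in> carrier G \<Longrightarrow> \<xi> a \<noteq> \<zero>\<^bsub>A\<^esub> \<Longrightarrow> \<exists>i\<in>I. \<exists>h\<in>H. \<exists>k\<in>K. a = h \<otimes> g i \<otimes> k"
  shows "\<xi> \<ominus>\<^bsub>C\<^esub> (\<Oplus>\<^bsub>C\<^esub>i\<in>I. delta (g i) (orbit_sum.Phi G K H A act (g i) (e i) \<xi>)) \<in> aug"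
proof -
  define Ph where "Ph i = orbit_sum.Phi G K H A act (g i) (e i)" for i
  have gc: "g i \<in> carrier G" if "i \<in> I" for i using orbit_sum.g_closed[OF orb[OF that]] .
  have Pa: "additive_map C A (Ph i)" if "i \<in> I" for i
    unfolding Ph_def by (rule orbit_sum.Phi_additive[OF orb[OF that]])
  have tm: "additive_map C C (\<lambda>\<xi>. delta (g i) (Ph i \<xi>))" if "i \<in> I" for i
    by (rule additive_map_comp[OF Pa delta_additive]) (use that gc in auto)
  have cl: "delta (g i) (Ph i \<xi>) \<in> carrier C" if "i \<in> I" "\<xi> \<in> carrier C" for i \<xi>
    using additive_map_closed[OF tm[OF that(1)] that(2)] .
  \<comment> \<open>The candidate normal form. It is additive in the function, which is what makes
    the induction over cosets possible.\<close>
  define th where "th \<xi> = (\<Oplus>\<^bsub>C\<^esub>i\<in>I. delta (g i) (Ph i \<xi>))" for \<xi>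
  have thcl: "th \<xi> \<in> carrier C" if "\<xi> \<in> carrier C" for \<xi>
    unfolding th_def using cl that by (intro C.finsum_closed) auto
  have thadd: "th (\<xi> \<oplus>\<^bsub>C\<^esub> \<eta>) = th \<xi> \<oplus>\<^bsub>C\<^esub> th \<eta>" if "\<xi> \<in> carrier C" "\<eta> \<in> carrier C" for \<xi> \<eta>
  proof -
    have "th (\<xi> \<oplus>\<^bsub>C\<^esub> \<eta>) = (\<Oplus>\<^bsub>C\<^esub>i\<in>I. delta (g i) (Ph i \<xi>) \<oplus>\<^bsub>C\<^esub> delta (g i) (Ph i \<eta>))"
      unfolding th_def by (rule C.finsum_cong') (use additive_map_add[OF tm] that cl in auto)
    then show ?thesis unfolding th_def using cl that by (simp add: C.finsum_addf Pi_iff)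
  qed
  have "\<xi> \<ominus>\<^bsub>C\<^esub> th \<xi> \<in> aug"
    using x
  proof (induction rule: C_induct[where Z = "{h \<otimes> g i \<otimes> k | i h k. i \<in> I \<and> h \<in> H \<and> k \<in> K}"])
    case (supp a)
    then show ?case using assms(5) by blast
  next
    case zero
    have "th \<zero>\<^bsub>C\<^esub> \<oplus>\<^bsub>C\<^esub> th \<zero>\<^bsub>C\<^esub> = th \<zero>\<^bsub>C\<^esub>" using thadd[of "\<zero>\<^bsub>C\<^esub>" "\<zero>\<^bsub>C\<^esub>"] by simp
    then have "th \<zero>\<^bsub>C\<^esub> = \<zero>\<^bsub>C\<^esub>" using thcl[of "\<zero>\<^bsub>C\<^esub>"] by (simp add: C.add.l_cancel_one)
    then show ?case using aug_minus[OF aug_zero] by (simp add: a_minus_def)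
  next
    case (add a v \<eta>)
    then obtain i h k where ihk: "i \<in> I" "h \<in> H" "k \<in> K" "a = h \<otimes> g i \<otimes> k" by blast
    note gi = gc[OF ihk(1)]
    interpret O: orbit_sum G T K H A act "g i" "e i" by (rule orb[OF ihk(1)])
    have hg: "h \<otimes> g i \<in> carrier G" using ihk gi by simp
    have "a \<in> (h \<otimes> g i) <# K" using ihk by (auto simp: l_coset_def)
    then have da: "delta a v = delta (h \<otimes> g i) v" by (rule delta_coset[OF hg])
    have dcl: "delta (h \<otimes> g i) v \<in> carrier C" by (rule delta_closed[OF hg add(3)])
    \<comment> \<open>Chosen so that the function with value v on h g_i K is the translate by h of
      the function with value w on g_i K.\<close>
    define w where "w = act (inv h) v"
    have w: "w \<in> carrier A" "act h w = v" using ihk add(3) act_one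
      by (simp_all add: w_def act_mult)
    have Pi: "Ph i (delta (h \<otimes> g i) v) = e i w"
      unfolding Ph_def w_def by (rule O.Phi_delta[OF ihk(2) add(3)])
    \<comment> \<open>A point of H g_j in the coset h g_i K would put g_j into H g_i K, contrary to
      disjointness of the double cosets.\<close>
    have Pj: "Ph j (delta (h \<otimes> g i) v) = \<zero>\<^bsub>A\<^esub>" if j: "j \<in> I" "j \<noteq> i" for j
      unfolding Ph_def
    proof (rule orbit_sum.Phi_outside[OF orb[OF j(1)] dcl])
      fix q assume q: "q \<in> H"
      have "q \<otimes> g j \<notin> (h \<otimes> g i) <# K"
      proof
        assume "q \<otimes> g j \<in> (h \<otimes> g i) <# K"
        then obtain l where l: "l \<in> K" "q \<otimes> g j = h \<otimes> g i \<otimes> l" by (auto simp: l_coset_def)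
        have "g j = inv q \<otimes> (q \<otimes> g j)" using q gc[OF j(1)] by (simp add: m_assoc[symmetric])
        also have "\<dots> = (inv q \<otimes> h) \<otimes> g i \<otimes> l" using q gi ihk l K_sub by (simp add: m_assoc subset_iff)
        finally show False using disj[OF j(1) ihk(1) _ l(1), of "inv q \<otimes> h"] q ihk(2) j(2) by simp
      qed
      then show "delta (h \<otimes> g i) v (q \<otimes> g j) = \<zero>\<^bsub>A\<^esub>"
        using q gc[OF j(1)] by (simp add: delta_def const_on_def)
    qed
    have "th (delta (h \<otimes> g i) v) = (\<Oplus>\<^bsub>C\<^esub>j\<in>I. if i = j then delta (g j) (e j w) else \<zero>\<^bsub>C\<^esub>)"
      unfolding th_def
    proof (rule C.finsum_cong')
      fix j assume j: "j \<in> I"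
      show "delta (g j) (Ph j (delta (h \<otimes> g i) v)) = (if i = j then delta (g j) (e j w) else \<zero>\<^bsub>C\<^esub>)"
        using Pi Pj[OF j] additive_map_zero[OF A_group abelian_group_C delta_additive[OF gc[OF j]]] by auto
    qed (use w delta_closed[OF gi] in auto)
    also have "\<dots> = delta (g i) (e i w)"
      using ihk(1) I w delta_closed[OF gc] orbit_sum.e_closed[OF orb] by (intro C.add.finprod_singleton) auto
    finally have thd: "th (delta (h \<otimes> g i) v) = delta (g i) (e i w)" .
    have c1: "delta (g i) w \<in> carrier C" "delta (g i) (e i w) \<in> carrier C"
      using w delta_closed[OF gi] by auto
    have "delta (h \<otimes> g i) v \<ominus>\<^bsub>C\<^esub> delta (g i) w \<in> aug"
      using delta_translate_aug[OF ihk(2) gi w(1)] w(2) by simp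
    moreover have "delta (g i) w \<ominus>\<^bsub>C\<^esub> delta (g i) (e i w) \<in> aug"
      by (rule aug_sym[OF O.delta_average[OF w(1)] c1(2,1)])
    ultimately have "delta (h \<otimes> g i) v \<ominus>\<^bsub>C\<^esub> th (delta (h \<otimes> g i) v) \<in> aug"
      unfolding thd using aug_trans dcl c1 by blast
    then show ?case
      unfolding da using aug_sum[OF _ add(5)] thadd[OF dcl add(4)] thcl[OF dcl] thcl[OF add(4)] dcl add(4)
      by simp
  qed
  then show ?thesis by (simp add: th_def Ph_def)
qed

text \<open>Equal orbit sums give both functions the same normal form, to which each is
  congruent.\<close>

lemma coinvariant_class_eqI:
  fixes I :: "'i set" and g :: "'i \<Rightarrow> 'g" and e :: "'i \<Rightarrow> 'n \<Rightarrow> 'n"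
  assumes I: "finite I"
    and orb: "\<And>i. i \<in> I \<Longrightarrow> orbit_sum G T K H A act (g i) (e i)"
    and disj: "\<And>i j h k. i \<in> I \<Longrightarrow> j \<in> I \<Longrightarrow> h \<in> H \<Longrightarrow> k \<in> K \<Longrightarrow> g i = h \<otimes> g j \<otimes> k \<Longrightarrow> i = j"
    and x: "\<xi> \<in> carrier C" and y: "\<eta> \<in> carrier C"
    and suppx: "\<And>a. a \<in> carrier G \<Longrightarrow> \<xi> a \<noteq> \<zero>\<^bsub>A\<^esub> \<Longrightarrow> \<exists>i\<in>I. \<exists>h\<in>H. \<exists>k\<in>K. a = h \<otimes> g i \<otimes> k"
    and suppy: "\<And>a. a \<in> carrier G \<Longrightarrow> \<eta> a \<noteq> \<zero>\<^bsub>A\<^esub> \<Longrightarrow> \<exists>i\<in>I. \<exists>h\<in>H. \<exists>k\<in>K. a = h \<otimes> g i \<otimes> k"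
    and Phi: "\<And>i. i \<in> I \<Longrightarrow> orbit_sum.Phi G K H A act (g i) (e i) \<xi> = orbit_sum.Phi G K H A act (g i) (e i) \<eta>"
  shows "coinvariant_class C H trans \<xi> = coinvariant_class C H trans \<eta>"
proof -
  let ?th = "\<lambda>\<xi>. \<Oplus>\<^bsub>C\<^esub>i\<in>I. delta (g i) (orbit_sum.Phi G K H A act (g i) (e i) \<xi>)"
  have cl: "delta (g i) (orbit_sum.Phi G K H A act (g i) (e i) \<zeta>) \<in> carrier C" if "i \<in> I" "\<zeta> \<in> carrier C" for i \<zeta>
    using delta_closed[OF orbit_sum.g_closed[OF orb[OF that(1)]] orbit_sum.Phi_closed[OF orb[OF that(1)] that(2)]] .
  have thy: "?th \<eta> \<in> carrier C" using cl y by (intro C.finsum_closed) auto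
  have eq: "?th \<xi> = ?th \<eta>" by (rule C.finsum_cong') (use cl y Phi in auto)
  have 1: "\<xi> \<ominus>\<^bsub>C\<^esub> ?th \<eta> \<in> aug" using orbit_decomposition[OF I orb disj x suppx] by (simp add: eq)
  have 2: "\<eta> \<ominus>\<^bsub>C\<^esub> ?th \<eta> \<in> aug" by (rule orbit_decomposition[OF I orb disj y suppy])
  have "\<xi> \<ominus>\<^bsub>C\<^esub> \<eta> \<in> aug" by (rule aug_trans[OF 1 aug_sym[OF 2 y thy] x thy y])
  then show ?thesis by (simp add: coinvariant_class_eq_iff[OF x y])
qed

end

section \<open>Abstract zeta elements\<close>

text \<open>The two maps have the same fibres on P, so their images are in bijection. It compares
  coset spaces whose elements are sets of different shape.\<close>

lemma card_image_eq:
  assumes "\<And>x y. x \<in> P \<Longrightarrow> y \<in> P \<Longrightarrow> f x = f y \<longleftrightarrow> k x = k y"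
  shows "finite (f ` P) \<longleftrightarrow> finite (k ` P)" "card (f ` P) = card (k ` P)"
proof -
  have val: "k (inv_into P f (f x)) = k x" if "x \<in> P" for x
    using assms[of "inv_into P f (f x)" x] that by (simp add: f_inv_into_f inv_into_into)
  have "bij_betw (\<lambda>z. k (inv_into P f z)) (f ` P) (k ` P)"
    unfolding bij_betw_def
  proof
    show "inj_on (\<lambda>z. k (inv_into P f z)) (f ` P)"
      by (rule inj_onI) (auto simp: val assms)
    show "(\<lambda>z. k (inv_into P f z)) ` f ` P = k ` P"
      unfolding image_image by (rule image_cong) (auto simp: val)
  qed
  then show "finite (f ` P) \<longleftrightarrow> finite (k ` P)" "card (f ` P) = card (k ` P)"
    by (auto dest: bij_betw_finite bij_betw_same_card)
qed

lemma mem_double_coset: "x \<in> double_coset G A g B \<longleftrightarrow> (\<exists>a\<in>A. \<exists>b\<in>B. x = a \<otimes>\<^bsub>G\<^esub> g \<otimes>\<^bsub>G\<^esub> b)"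
  by (auto simp: double_coset_def set_mult_def)

lemma finsum_in_image:
  assumes M: "abelian_group M" and N: "abelian_group N" and f: "additive_map M N f"
    and fin: "finite I" and t: "\<And>i. i \<in> I \<Longrightarrow> t i \<in> f ` carrier M"
  shows "(\<Oplus>\<^bsub>N\<^esub>i\<in>I. t i) \<in> f ` carrier M"
proof -
  interpret M: abelian_group M by fact
  interpret N: abelian_group N by fact
  have "\<forall>i\<in>I. \<exists>m. m \<in> carrier M \<and> t i = f m" using t by blast
  then obtain m where m: "\<And>i. i \<in> I \<Longrightarrow> m i \<in> carrier M \<and> t i = f (m i)" by metis
  have "(\<Oplus>\<^bsub>N\<^esub>i\<in>I. t i) = (\<Oplus>\<^bsub>N\<^esub>i\<in>I. f (m i))"
    by (rule N.finsum_cong') (use m additive_map_closed[OF f] in auto)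
  also have "\<dots> = f (\<Oplus>\<^bsub>M\<^esub>i\<in>I. m i)"
    using additive_map_finsum[OF M N f fin, of m] m by auto
  finally show ?thesis using m by auto
qed

text \<open>Orbit and stabiliser for P acting on left cosets of K: the stabiliser of aK in P is P
  \<inter> aKa^-1.\<close>

lemma (in group) coset_conjugate_eq:
  assumes P: "subgroup P G" and K: "subgroup K G" and a: "a \<in> carrier G" and p: "p \<in> P" "p' \<in> P"
  shows "p <# (P \<inter> conjugate G a K) = p' <# (P \<inter> conjugate G a K) \<longleftrightarrow> (p \<otimes> a) <# K = (p' \<otimes> a) <# K"
proof -
  have pG: "p \<in> carrier G" "p' \<in> carrier G" using subgroup.subset[OF P] p by auto
  have KG: "K \<subseteq> carrier G" by (rule subgroup.subset[OF K])
  have one: "\<one> \<in> K" "\<one> \<in> P" using K P by (auto intro: subgroup.one_closed)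
  have conj: "u \<in> conjugate G a K \<longleftrightarrow> inv a \<otimes> u \<otimes> a \<in> K" if u: "u \<in> carrier G" for u
  proof
    assume "u \<in> conjugate G a K"
    then obtain k where k: "k \<in> K" "u = a \<otimes> k \<otimes> inv a" by (auto simp: conjugate_def)
    have kG: "k \<in> carrier G" using k KG by blast
    have "inv a \<otimes> u \<otimes> a = k"
      unfolding k(2) using a kG by (simp add: m_assoc) (simp add: m_assoc[symmetric])
    then show "inv a \<otimes> u \<otimes> a \<in> K" using k by simp
  next
    assume k: "inv a \<otimes> u \<otimes> a \<in> K"
    have "a \<otimes> (inv a \<otimes> u \<otimes> a) \<otimes> inv a = u"
      using a u by (simp add: m_assoc) (simp add: m_assoc[symmetric])
    then have "u = a \<otimes> (inv a \<otimes> u \<otimes> a) \<otimes> inv a" by simp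
    then show "u \<in> conjugate G a K" unfolding conjugate_def using k by blast
  qed
  have S: "subgroup (P \<inter> conjugate G a K) G"
  proof (rule subgroupI)
    show "P \<inter> conjugate G a K \<subseteq> carrier G" using subgroup.subset[OF P] by blast
    have "\<one> \<in> conjugate G a K" using conj[of \<one>] a one by simp
    then show "P \<inter> conjugate G a K \<noteq> {}" using one by blast
    fix u assume u: "u \<in> P \<inter> conjugate G a K"
    then have uG: "u \<in> carrier G" using subgroup.subset[OF P] by blast
    have "inv (inv a \<otimes> u \<otimes> a) \<in> K" using u conj[OF uG] subgroup.m_inv_closed[OF K] by blast
    then have "inv a \<otimes> inv u \<otimes> a \<in> K" using a uG by (simp add: inv_mult_group m_assoc)
    then show "inv u \<in> P \<inter> conjugate G a K" using u uG conj subgroup.m_inv_closed[OF P] by simp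
    fix v assume v: "v \<in> P \<inter> conjugate G a K"
    then have vG: "v \<in> carrier G" using subgroup.subset[OF P] by blast
    have "(inv a \<otimes> u \<otimes> a) \<otimes> (inv a \<otimes> v \<otimes> a) \<in> K"
      using u v conj[OF uG] conj[OF vG] subgroup.m_closed[OF K] by blast
    also have "(inv a \<otimes> u \<otimes> a) \<otimes> (inv a \<otimes> v \<otimes> a) = inv a \<otimes> (u \<otimes> v) \<otimes> a"
      using a uG vG by (simp add: m_assoc) (simp add: m_assoc[symmetric])
    finally have "inv a \<otimes> (u \<otimes> v) \<otimes> a \<in> K" .
    then show "u \<otimes> v \<in> P \<inter> conjugate G a K" using u v uG vG conj subgroup.m_closed[OF P] by simp
  qed
  have cos: "c <# Q = d <# Q \<longleftrightarrow> inv c \<otimes> d \<in> Q"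
    if Q: "subgroup Q G" and cd: "c \<in> carrier G" "d \<in> carrier G" for c d Q
  proof
    assume eq: "c <# Q = d <# Q"
    have "d \<otimes> \<one> \<in> d <# Q" unfolding l_coset_def using subgroup.one_closed[OF Q] by blast
    then have "d \<in> c <# Q" using cd eq by simp
    then obtain q where "q \<in> Q" "d = c \<otimes> q" by (auto simp: l_coset_def)
    then show "inv c \<otimes> d \<in> Q" using cd subgroup.subset[OF Q] by (auto simp: m_assoc[symmetric])
  next
    assume q: "inv c \<otimes> d \<in> Q"
    have "d = c \<otimes> (inv c \<otimes> d)" using cd by (simp add: m_assoc[symmetric])
    then have "d \<in> c <# Q" unfolding l_coset_def using q by blast
    then show "c <# Q = d <# Q" by (rule l_repr_independence[OF _ cd(1) Q])
  qed
  have pp: "inv p \<otimes> p' \<in> P" using p subgroup.m_closed[OF P] subgroup.m_inv_closed[OF P] by blast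
  have "inv (p \<otimes> a) \<otimes> (p' \<otimes> a) = inv a \<otimes> (inv p \<otimes> p') \<otimes> a" using pG a by (simp add: inv_mult_group m_assoc)
  then show ?thesis using cos[OF S pG] cos[OF K, of "p \<otimes> a" "p' \<otimes> a"] conj[of "inv p \<otimes> p'"] pp pG a by simp
qed

locale zeta_setting = level_collection G T \<Upsilon>
  for G :: "('g, 'b) monoid_scheme" (structure) and T :: "'g topology" and \<Upsilon> :: "'g set set" +
  fixes H :: "'g set" and \<mu> :: "'g measure" and \<Upsilon>\<^sub>H :: "'g set set"
    and R :: "('r, 'x) ring_scheme" and N :: "('g, 'r, 'm) ric"
    and K L :: "'g set" and x :: 'm and \<HH> :: "'g \<Rightarrow> 'r"
  assumes H: "subgroup H G"
    and comack: "comack_haar (G\<lparr>carrier := H\<rparr>) (subtopology T H) \<Upsilon>\<^sub>H R N \<mu> (H \<inter> K)"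
    and trace_level: "\<And>K'. K' \<in> \<Upsilon> \<Longrightarrow> K' \<inter> H \<in> \<Upsilon>\<^sub>H"
    and K: "K \<in> \<Upsilon>" and L: "L \<in> \<Upsilon>" and L_normal: "L \<lhd> G\<lparr>carrier := K\<rparr>"
    and x: "x \<in> carrier (obj N (H \<inter> K))"
    and hecke: "hecke_function G R K \<HH>"
begin

sublocale HC: comack_haar "G\<lparr>carrier := H\<rparr>" "subtopology T H" \<Upsilon>\<^sub>H R N \<mu> "H \<inter> K"
  by (rule comack)

lemma inv_H: "h \<in> H \<Longrightarrow> inv\<^bsub>G\<lparr>carrier := H\<rparr>\<^esub> h = inv h"
  by (rule m_inv_consistent[OF H])

lemma conjugate_H: "h \<in> H \<Longrightarrow> conjugate (G\<lparr>carrier := H\<rparr>) h V = conjugate G h V"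
  by (simp add: conjugate_def inv_H)

lemma l_coset_H: "h <#\<^bsub>G\<lparr>carrier := H\<rparr>\<^esub> V = h <# V"
  by (simp add: l_coset_def)

sublocale E: equivariant_functions G T K H HC.Nh HC.act
proof (intro equivariant_functions.intro equivariant_functions_axioms.intro)
  show "locally_profinite_group G T" by (rule locally_profinite_group_axioms)
  show "subgroup K G" "openin T K" "compactin T K" using compact_open[OF K] by auto
  show "subgroup H G" by (rule H)
  show "abelian_group HC.Nh" by (rule HC.Nh.abelian_group_axioms)
  show "additive_map HC.Nh HC.Nh (HC.act h)" if "h \<in> H" for h
    using linear_imp_additive[OF HC.act_linear] that by simp
  show "HC.act \<one> v = v" if "v \<in> carrier HC.Nh" for v using HC.act_one that by simp
  show "HC.act h (HC.act k v) = HC.act (h \<otimes> k) v" if "h \<in> H" "k \<in> H" "v \<in> carrier HC.Nh" for h k v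
    using HC.act_mult[of h k v] that by simp
qed

text \<open>For a = g_i these are the groups H_{v,i} and, with L, V_{v,i}. They are needed at
  arbitrary points a, since orbit sums are formed for any a.\<close>

abbreviation stab where "stab a \<equiv> H \<inter> conjugate G a K"
abbreviation stabL where "stabL a \<equiv> H \<inter> conjugate G a L"

lemma LK: "L \<subseteq> K"
  using normal_imp_subgroup[OF L_normal] subgroup.subset by fastforce

lemma stab_level: "a \<in> carrier G \<Longrightarrow> stab a \<in> \<Upsilon>\<^sub>H" and stabL_level: "a \<in> carrier G \<Longrightarrow> stabL a \<in> \<Upsilon>\<^sub>H"
  using trace_level[OF T1[OF K]] trace_level[OF T1[OF L]] by (simp_all add: Int_commute)

lemma stabL_subset: "stabL a \<subseteq> stab a"
  using conjugate_mono[OF LK] by blast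

lemma orbit_sum_stab:
  assumes a: "a \<in> carrier G"
  shows "orbit_sum G T K H HC.Nh HC.act a (HC.average (stab a))"
proof (intro orbit_sum.intro orbit_sum_axioms.intro)
  note W = stab_level[OF a]
  show "equivariant_functions G T K H HC.Nh HC.act" by (rule E.equivariant_functions_axioms)
  show "a \<in> carrier G" by (rule a)
  show "additive_map HC.Nh HC.Nh (HC.average (stab a))" by (rule linear_imp_additive[OF HC.average_linear[OF W]])
  show "HC.average (stab a) (HC.act w v) = HC.average (stab a) v" if "w \<in> stab a" "v \<in> carrier HC.Nh" for w v
    by (rule HC.average_act[OF W that])
  fix v assume "v \<in> carrier HC.Nh"
  then obtain \<Gamma> w where "finite \<Gamma>" "\<Gamma> \<subseteq> stab a" "w \<in> carrier HC.Nh"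
    "HC.average (stab a) v = (\<Oplus>\<^bsub>HC.Nh\<^esub>\<gamma>\<in>\<Gamma>. HC.act \<gamma> w)" "v = (\<Oplus>\<^bsub>HC.Nh\<^esub>\<gamma>\<in>\<Gamma>. w)"
    by (rule HC.average_eq_finsum[OF W])
  then show "\<exists>\<Gamma> w. finite \<Gamma> \<and> \<Gamma> \<subseteq> stab a \<and> w \<in> carrier HC.Nh \<and>
      HC.average (stab a) v = (\<Oplus>\<^bsub>HC.Nh\<^esub>\<gamma>\<in>\<Gamma>. HC.act \<gamma> w) \<and> v = (\<Oplus>\<^bsub>HC.Nh\<^esub>\<gamma>\<in>\<Gamma>. w)" by blast
qed

section \<open>The elementary function and its orbit sums\<close>

abbreviation Phi where "Phi a \<equiv> orbit_sum.Phi G K H HC.Nh HC.act a (HC.average (stab a))"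
abbreviation elem where "elem \<equiv> elementary_function G H \<Upsilon>\<^sub>H R N (H \<inter> K) x \<HH>"

lemma hecke_closed: "a \<in> carrier G \<Longrightarrow> \<HH> a \<in> carrier R"
  and hecke_invariant: "a \<in> carrier G \<Longrightarrow> k \<in> K \<Longrightarrow> \<HH> (a \<otimes> k) = \<HH> a"
  and hecke_finite: "finite {a <# K | a. a \<in> carrier G \<and> \<HH> a \<noteq> \<zero>\<^bsub>R\<^esub>}"
proof -
  obtain \<D> c where D: "finite \<D>" "\<D> \<subseteq> {double_coset G K g K | g. g \<in> carrier G}" "c \<in> \<D> \<rightarrow> carrier R"
    "\<And>a. a \<in> carrier G \<Longrightarrow> \<HH> a = (\<Oplus>\<^bsub>R\<^esub> A\<in>\<D>. c A \<otimes>\<^bsub>R\<^esub> char_fun R A a)"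
    using hecke by (auto simp: hecke_function_def)
  have ch: "char_fun R A a \<in> carrier R" for A a by (simp add: char_fun_def)
  show "\<HH> a \<in> carrier R" if "a \<in> carrier G" for a
    unfolding D(4)[OF that] using D(3) ch by (intro HC.Rd.finsum_closed) (auto intro!: HC.Rd.m_closed)
  show "\<HH> (a \<otimes> k) = \<HH> a" if a: "a \<in> carrier G" and k: "k \<in> K" for a k
  proof -
    have kG: "k \<in> carrier G" using k E.K_sub by blast
    have "a \<otimes> k \<in> A \<longleftrightarrow> a \<in> A" if A: "A \<in> \<D>" for A
    proof -
      obtain g where g: "g \<in> carrier G" "A = double_coset G K g K" using A D(2) by blast
      show ?thesis
      proof
        assume "a \<in> A"
        then obtain k1 k2 where k12: "k1 \<in> K" "k2 \<in> K" "a = k1 \<otimes> g \<otimes> k2" by (auto simp: g mem_double_coset)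
        then have "a \<otimes> k = k1 \<otimes> g \<otimes> (k2 \<otimes> k)" using g(1) kG E.K_sub by (simp add: m_assoc subset_iff)
        then show "a \<otimes> k \<in> A"
          unfolding g(2) mem_double_coset using k12 k subgroup.m_closed[OF E.K_subgroup] by blast
      next
        assume "a \<otimes> k \<in> A"
        then obtain k1 k2 where k12: "k1 \<in> K" "k2 \<in> K" "a \<otimes> k = k1 \<otimes> g \<otimes> k2" by (auto simp: g mem_double_coset)
        then have "a = k1 \<otimes> g \<otimes> k2 \<otimes> inv k" using a kG E.K_sub by (metis inv_solve_right g(1) m_closed subsetD)
        then have "a = k1 \<otimes> g \<otimes> (k2 \<otimes> inv k)" using g(1) kG k12 E.K_sub by (simp add: m_assoc subset_iff)
        then show "a \<in> A"
          unfolding g(2) mem_double_coset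
          using k12 k subgroup.m_closed[OF E.K_subgroup] subgroup.m_inv_closed[OF E.K_subgroup] by blast
      qed
    qed
    then have "char_fun R A (a \<otimes> k) = char_fun R A a" if "A \<in> \<D>" for A
      using that by (simp add: char_fun_def)
    moreover have "c A \<otimes>\<^bsub>R\<^esub> char_fun R A a \<in> carrier R" if "A \<in> \<D>" for A
      using that D(3) ch by (intro HC.Rd.m_closed) auto
    ultimately have "(\<Oplus>\<^bsub>R\<^esub> A\<in>\<D>. c A \<otimes>\<^bsub>R\<^esub> char_fun R A (a \<otimes> k)) = (\<Oplus>\<^bsub>R\<^esub> A\<in>\<D>. c A \<otimes>\<^bsub>R\<^esub> char_fun R A a)"
      by (intro HC.Rd.finsum_cong') auto
    then show ?thesis using D(4)[OF a] D(4)[of "a \<otimes> k"] a kG by simp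
  qed
  have sub: "{a <# K | a. a \<in> carrier G \<and> \<HH> a \<noteq> \<zero>\<^bsub>R\<^esub>} \<subseteq> (\<Union>A\<in>\<D>. {a <# K | a. a \<in> A})"
  proof
    fix B assume "B \<in> {a <# K | a. a \<in> carrier G \<and> \<HH> a \<noteq> \<zero>\<^bsub>R\<^esub>}"
    then obtain a where a: "a \<in> carrier G" "\<HH> a \<noteq> \<zero>\<^bsub>R\<^esub>" "B = a <# K" by blast
    have "\<exists>A\<in>\<D>. a \<in> A"
    proof (rule ccontr)
      assume "\<not> (\<exists>A\<in>\<D>. a \<in> A)"
      then have "(\<Oplus>\<^bsub>R\<^esub> A\<in>\<D>. c A \<otimes>\<^bsub>R\<^esub> char_fun R A a) = (\<Oplus>\<^bsub>R\<^esub> A\<in>\<D>. \<zero>\<^bsub>R\<^esub>)"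
        using D(3) by (intro HC.Rd.finsum_cong') (auto simp: char_fun_def Pi_iff)
      then show False using a D(4) by simp
    qed
    then show "B \<in> (\<Union>A\<in>\<D>. {a <# K | a. a \<in> A})" using a by blast
  qed
  have "finite {a <# K | a. a \<in> A}" if A: "A \<in> \<D>" for A
  proof -
    obtain g where g: "g \<in> carrier G" "A = double_coset G K g K" using A D(2) by blast
    \<comment> \<open>The left K-cosets in KgK correspond to cosets of this intersection in K, a
      finite set because both are compact open.\<close>
    have gK: "K \<inter> conjugate G g K \<in> \<Upsilon>" using T3[OF K T1[OF K g(1)]] .
    have eq: "{a <# K | a. a \<in> A} \<subseteq> (\<lambda>k. (k \<otimes> g) <# K) ` K"
    proof
      fix B assume "B \<in> {a <# K | a. a \<in> A}"
      then obtain k1 k2 where k12: "k1 \<in> K" "k2 \<in> K" "B = (k1 \<otimes> g \<otimes> k2) <# K"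
        by (auto simp: g mem_double_coset)
      have kg: "k1 \<otimes> g \<in> carrier G" "k1 \<otimes> g \<otimes> k2 \<in> carrier G" using k12 g E.K_sub by auto
      have "k1 \<otimes> g \<otimes> k2 \<in> (k1 \<otimes> g) <# K" using k12 by (auto simp: l_coset_def)
      then have "B = (k1 \<otimes> g) <# K" using E.coset_eq_iff[OF kg] k12 by simp
      then show "B \<in> (\<lambda>k. (k \<otimes> g) <# K) ` K" using k12 by blast
    qed
    have "finite (left_cosets K (K \<inter> conjugate G g K))"
      by (rule left_cosets_props(1)[OF gK K]) blast
    moreover have "finite ((\<lambda>k. k <# (K \<inter> conjugate G g K)) ` K) \<longleftrightarrow> finite ((\<lambda>k. (k \<otimes> g) <# K) ` K)"
      by (rule card_image_eq(1)) (rule coset_conjugate_eq[OF E.K_subgroup E.K_subgroup g(1)])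
    ultimately show ?thesis using finite_subset[OF eq] by (simp add: left_cosets_def)
  qed
  then show "finite {a <# K | a. a \<in> carrier G \<and> \<HH> a \<noteq> \<zero>\<^bsub>R\<^esub>}"
    using finite_subset[OF sub] D(1) by simp
qed

text \<open>At the reference level the factor [U : U] is one, so the elementary function takes
  normalised classes as values and the calculus of \<open>jmap\<close> applies.\<close>

lemma elem_apply: "a \<in> carrier G \<Longrightarrow> elem a = HC.jmap (H \<inter> K) (\<HH> a \<odot>\<^bsub>obj N (H \<inter> K)\<^esub> x)"
  by (simp add: elementary_function_def HC.jmap_smult[OF HC.U x hecke_closed] HC.jmap_base[OF x])

lemma smult_x_closed: "s \<in> carrier R \<Longrightarrow> s \<odot>\<^bsub>obj N (H \<inter> K)\<^esub> x \<in> carrier (obj N (H \<inter> K))"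
  using module.smult_closed[OF HC.obj_module[OF HC.U]] x by blast

lemma elem_zero:
  assumes "a \<in> carrier G" "\<HH> a = \<zero>\<^bsub>R\<^esub>"
  shows "elem a = \<zero>\<^bsub>HC.Nh\<^esub>"
proof -
  interpret U: Module.module R "obj N (H \<inter> K)" by (rule HC.obj_module[OF HC.U])
  show ?thesis
    using assms x additive_map_zero[OF U.abelian_group_axioms HC.Nh.abelian_group_axioms HC.jmap_additive[OF HC.U]]
    by (simp add: elem_apply U.smult_l_null)
qed

lemma elem_closed: "elem \<in> carrier E.C"
proof -
  have "elem = (\<lambda>a\<in>carrier G. HC.jmap (H \<inter> K) (\<HH> a \<odot>\<^bsub>obj N (H \<inter> K)\<^esub> x))"
    by (rule extensionalityI[of _ "carrier G"]) (simp_all add: elem_apply, simp add: elementary_function_def)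
  also have "\<dots> \<in> carrier E.C"
  proof (rule E.C_I[OF _ _ hecke_finite])
    fix a assume a: "a \<in> carrier G"
    show "HC.jmap (H \<inter> K) (\<HH> a \<odot>\<^bsub>obj N (H \<inter> K)\<^esub> x) \<in> carrier HC.Nh"
      by (rule HC.jmap_closed[OF HC.U smult_x_closed[OF hecke_closed[OF a]]])
    show "HC.jmap (H \<inter> K) (\<HH> (a \<otimes> k) \<odot>\<^bsub>obj N (H \<inter> K)\<^esub> x) =
        HC.jmap (H \<inter> K) (\<HH> a \<odot>\<^bsub>obj N (H \<inter> K)\<^esub> x)" if "k \<in> K" for k
      by (simp add: hecke_invariant[OF a that])
    assume "HC.jmap (H \<inter> K) (\<HH> a \<odot>\<^bsub>obj N (H \<inter> K)\<^esub> x) \<noteq> \<zero>\<^bsub>HC.Nh\<^esub>"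
    then have "\<HH> a \<noteq> \<zero>\<^bsub>R\<^esub>" using elem_zero[OF a] elem_apply[OF a] by auto
    then show "a <# K \<in> {a <# K | a. a \<in> carrier G \<and> \<HH> a \<noteq> \<zero>\<^bsub>R\<^esub>}" using a by blast
  qed
  finally show ?thesis .
qed

text \<open>Elements of U fix the level U, and their pull-back there is a push-forward by an inner
  element, which is trivial.\<close>

lemma act_jmap_U:
  assumes u: "u \<in> H \<inter> K" and y: "y \<in> carrier (obj N (H \<inter> K))"
  shows "HC.act u (HC.jmap (H \<inter> K) y) = HC.jmap (H \<inter> K) y"
proof -
  note sub = HC.level_subgroup[OF HC.U]
  have uH: "u \<in> H" and iu: "inv\<^bsub>G\<lparr>carrier := H\<rparr>\<^esub> u \<in> H \<inter> K"
    using u subgroup.m_inv_closed[OF sub u] by auto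
  have c: "conjugate (G\<lparr>carrier := H\<rparr>) u (H \<inter> K) = H \<inter> K"
    "conjugate (G\<lparr>carrier := H\<rparr>) (inv\<^bsub>G\<lparr>carrier := H\<rparr>\<^esub> u) (H \<inter> K) = H \<inter> K"
    by (rule HC.conjugate_subgroup[OF sub u], rule HC.conjugate_subgroup[OF sub iu])
  have "pull N u (H \<inter> K) (H \<inter> K) y = push N (inv\<^bsub>G\<lparr>carrier := H\<rparr>\<^esub> u) (H \<inter> K) (H \<inter> K) y"
    using HC.pull_eq_push_inv[OF HC.U HC.U _ c(2) y] uH by simp
  also have "\<dots> = y" by (rule HC.push_inner[OF HC.U iu y])
  finally show ?thesis using HC.act_jmap[OF _ HC.U y, of u] uH c(1) by simp
qed

text \<open>The function is constant on UhaK. Since U fixes the value, all its cosets contribute the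
  same average, and their number is the index that \<open>hecke_average\<close> absorbs into the
  Hecke correspondence. The last claim matches this piece of the support, read along H a, with the
  double coset UhW.\<close>

lemma Phi_double_coset:
  assumes a: "a \<in> carrier G" and h: "h \<in> H" and c: "c \<in> carrier R"
  defines "\<F> \<equiv> (\<lambda>u. (u \<otimes> (h \<otimes> a)) <# K) ` (H \<inter> K)"
    and "v \<equiv> HC.jmap (H \<inter> K) (c \<odot>\<^bsub>obj N (H \<inter> K)\<^esub> x)"
  shows "E.const_on (\<Union>\<F>) v \<in> carrier E.C"
    "Phi a (E.const_on (\<Union>\<F>) v) = HC.jmap (stab a) (c \<odot>\<^bsub>obj N (stab a)\<^esub>
       hecke_corr_push (G\<lparr>carrier := H\<rparr>) N (H \<inter> K) h (stab a) x)"
    "\<And>q. q \<in> H \<Longrightarrow> q \<otimes> a \<in> \<Union>\<F> \<longleftrightarrow> q \<in> double_coset G (H \<inter> K) h (stab a)"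
proof -
  let ?U = "H \<inter> K" and ?W = "stab a"
  interpret O: orbit_sum G T K H HC.Nh HC.act a "HC.average ?W" by (rule orbit_sum_stab[OF a])
  note W = stab_level[OF a]
  have hG: "h \<in> carrier G" using h by simp
  have ha: "h \<otimes> a \<in> carrier G" using hG a by simp
  have sU: "subgroup ?U G" using subgroups_Inter_pair[OF H E.K_subgroup] .
  have uG: "u \<in> carrier G" if "u \<in> ?U" for u using that by simp
  \<comment> \<open>Conjugation by h preserves H, and U lies in H, so the condition of lying in H
    disappears. What remains is the stabiliser in U of the coset haK, whose cosets are counted
    next.\<close>
  have conj: "?U \<inter> conjugate G h ?W = ?U \<inter> conjugate G (h \<otimes> a) K"
  proof -
    have "conjugate G h ?W = conjugate G h H \<inter> conjugate G h (conjugate G a K)"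
      using conjugate_Int[OF hG E.H_sub level_subset[OF T1[OF K a]]] .
    then show ?thesis
      using conjugate_subgroup[OF H h] conjugate_conjugate[OF hG a E.K_sub] by auto
  qed
  have cosets: "HC.left_cosets ?U (?U \<inter> conjugate (G\<lparr>carrier := H\<rparr>) h ?W) =
      (\<lambda>u. u <# (?U \<inter> conjugate G (h \<otimes> a) K)) ` ?U"
    by (simp add: HC.left_cosets_def l_coset_H conjugate_H[OF h] conj)
  have card: "card \<F> = card (HC.left_cosets ?U (?U \<inter> conjugate (G\<lparr>carrier := H\<rparr>) h ?W))"
    and fin: "finite \<F>"
  proof -
    note eq = coset_conjugate_eq[OF sU E.K_subgroup ha]
    show "card \<F> = card (HC.left_cosets ?U (?U \<inter> conjugate (G\<lparr>carrier := H\<rparr>) h ?W))"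
      unfolding cosets \<F>_def by (rule card_image_eq(2)[symmetric]) (rule eq)
    have "?U \<inter> conjugate (G\<lparr>carrier := H\<rparr>) h ?W \<in> \<Upsilon>\<^sub>H"
      using HC.T3[OF HC.U HC.T1[OF W]] h by simp
    then have "finite (HC.left_cosets ?U (?U \<inter> conjugate (G\<lparr>carrier := H\<rparr>) h ?W))"
      using HC.left_cosets_props(1) HC.U by blast
    then show "finite \<F>"
      unfolding cosets \<F>_def by (subst (asm) card_image_eq(1)) (auto simp: eq)
  qed
  have all: "\<F> \<subseteq> O.all_cosets" using ha uG by (auto simp: \<F>_def)
  have cx: "c \<odot>\<^bsub>obj N ?U\<^esub> x \<in> carrier (obj N ?U)" by (rule smult_x_closed[OF c])
  have v: "v \<in> carrier HC.Nh" unfolding v_def by (rule HC.jmap_closed[OF HC.U cx])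
  show "E.const_on (\<Union>\<F>) v \<in> carrier E.C" by (rule E.const_on_closed[OF v fin all])
  define f where "f = fraction R c \<one>\<^bsub>R\<^esub>"
  have f: "f \<in> carrier HC.Q" using c by (simp add: f_def)
  have vf: "v = f \<odot>\<^bsub>HC.Nh\<^esub> HC.jmap ?U x" unfolding v_def f_def by (rule HC.jmap_smult[OF HC.U x c])
  have jx: "HC.jmap ?U x \<in> carrier HC.Nh" by (rule HC.jmap_closed[OF HC.U x])
  have ihH: "inv h \<in> H" using h by simp
  define w where "w = HC.average ?W (HC.act (inv h) (HC.jmap ?U x))"
  have ax: "HC.act (inv h) (HC.jmap ?U x) \<in> carrier HC.Nh" using ihH jx by simp
  have w: "w \<in> carrier HC.Nh" unfolding w_def using linear_map_closed[OF HC.average_linear[OF W] ax] .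
  have fw: "f \<odot>\<^bsub>HC.Nh\<^esub> w \<in> carrier HC.Nh" using f w by simp
  \<comment> \<open>The coset uhaK is represented by uh. The inverse of u fixes v, so the averaged
    term does not depend on u.\<close>
  have rep: "\<exists>q\<in>H. q \<otimes> a \<in> B \<and> HC.average ?W (HC.act (inv q) v) = f \<odot>\<^bsub>HC.Nh\<^esub> w" if B: "B \<in> \<F>" for B
  proof -
    obtain u where u: "u \<in> ?U" "B = (u \<otimes> (h \<otimes> a)) <# K" using B by (auto simp: \<F>_def)
    have uH: "u \<in> H" "inv u \<in> H" using u by auto
    have iu: "inv u \<in> ?U" using subgroup.m_inv_closed[OF sU u(1)] .
    have mem: "(u \<otimes> h) \<otimes> a \<in> B"
      using E.coset_self[of "u \<otimes> (h \<otimes> a)"] ha uG[OF u(1)] hG a u(2) by (simp add: m_assoc)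
    have "HC.act (inv (u \<otimes> h)) v = HC.act (inv h) (HC.act (inv u) v)"
      using E.act_mult[OF ihH uH(2) v] uG[OF u(1)] hG by (simp add: inv_mult_group)
    also have "HC.act (inv u) v = v" unfolding v_def by (rule act_jmap_U[OF iu cx])
    also have "HC.act (inv h) v = f \<odot>\<^bsub>HC.Nh\<^esub> HC.act (inv h) (HC.jmap ?U x)"
      unfolding vf using linear_map_smult[OF HC.act_linear f jx] ihH by simp
    finally have "HC.average ?W (HC.act (inv (u \<otimes> h)) v) = f \<odot>\<^bsub>HC.Nh\<^esub> w"
      using linear_map_smult[OF HC.average_linear[OF W] f ax] by (simp add: w_def)
    then show ?thesis using mem uH h by (intro bexI[of _ "u \<otimes> h"] conjI) auto
  qed
  let ?hx = "hecke_corr_push (G\<lparr>carrier := H\<rparr>) N ?U h ?W x"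
  have hh: "h \<in> carrier (G\<lparr>carrier := H\<rparr>)" using h by simp
  note ha' = HC.hecke_average[OF W hh x]
  have "Phi a (E.const_on (\<Union>\<F>) v) = add_pow HC.Nh (card \<F>) (f \<odot>\<^bsub>HC.Nh\<^esub> w)"
    by (rule O.Phi_const_on[OF v fin all fw rep])
  also have "\<dots> = f \<odot>\<^bsub>HC.Nh\<^esub> add_pow HC.Nh (card \<F>) w"
  proof -
    have "additive_map HC.Nh HC.Nh (\<lambda>v. f \<odot>\<^bsub>HC.Nh\<^esub> v)"
      using f by (simp add: additive_map_def HC.Nh.smult_r_distr)
    from additive_map_add_pow[OF HC.Nh.abelian_group_axioms HC.Nh.abelian_group_axioms this w]
    show ?thesis by simp
  qed
  also have "add_pow HC.Nh (card \<F>) w = HC.jmap ?W ?hx"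
    using ha'(2) unfolding card w_def inv_H[OF h] .
  also have "f \<odot>\<^bsub>HC.Nh\<^esub> HC.jmap ?W ?hx = HC.jmap ?W (c \<odot>\<^bsub>obj N ?W\<^esub> ?hx)"
    unfolding f_def by (rule HC.jmap_smult[OF W ha'(1) c, symmetric])
  finally show "Phi a (E.const_on (\<Union>\<F>) v) = HC.jmap ?W (c \<odot>\<^bsub>obj N ?W\<^esub> ?hx)" .
  fix q assume q: "q \<in> H"
  then have qG: "q \<in> carrier G" by simp
  show "q \<otimes> a \<in> \<Union>\<F> \<longleftrightarrow> q \<in> double_coset G ?U h ?W"
  proof
    assume "q \<otimes> a \<in> \<Union>\<F>"
    then obtain u where u: "u \<in> ?U" "q \<otimes> a \<in> (u \<otimes> (h \<otimes> a)) <# K" by (auto simp: \<F>_def)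
    have uh: "u \<otimes> h \<in> H" "u \<otimes> (h \<otimes> a) \<in> carrier G" using u h ha by auto
    have uha: "(u \<otimes> h) \<otimes> a \<in> (u \<otimes> (h \<otimes> a)) <# K"
      using E.coset_self[OF uh(2)] uG[OF u(1)] hG a by (simp add: m_assoc)
    have "inv (u \<otimes> h) \<otimes> q \<in> ?W" by (rule O.stabilizer[OF uh(1) q uh(2) uha u(2)])
    moreover have "q = u \<otimes> h \<otimes> (inv (u \<otimes> h) \<otimes> q)"
      using uh(1) qG by (simp add: m_assoc[symmetric])
    ultimately show "q \<in> double_coset G ?U h ?W" using u(1) unfolding mem_double_coset by blast
  next
    assume "q \<in> double_coset G ?U h ?W"
    then obtain u w where uw: "u \<in> ?U" "w \<in> ?W" "q = u \<otimes> h \<otimes> w" by (auto simp: mem_double_coset)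
    obtain k where k: "k \<in> K" "w = a \<otimes> k \<otimes> inv a" using uw(2) by (auto simp: conjugate_def)
    have kG: "k \<in> carrier G" using k E.K_sub by blast
    have "q \<otimes> a = u \<otimes> (h \<otimes> a) \<otimes> k"
      unfolding uw(3) k(2) using uG[OF uw(1)] hG a kG by (simp add: m_assoc)
    then have "q \<otimes> a \<in> (u \<otimes> (h \<otimes> a)) <# K" using k(1) by (auto simp: l_coset_def)
    then show "q \<otimes> a \<in> \<Union>\<F>" using uw(1) by (auto simp: \<F>_def)
  qed
qed

text \<open>The expansion of the Hecke function along H a splits the values of the elementary
  function into constant functions on double cosets. Additivity of the orbit sum then gives the
  Hecke expression term by term.\<close>

lemma Phi_elem:
  assumes a: "a \<in> carrier G" and J: "finite J"
    and ch: "\<And>j. j \<in> J \<Longrightarrow> c j \<in> carrier R \<and> h j \<in> H"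
    and exp: "\<And>y. y \<in> H \<Longrightarrow> \<HH> (y \<otimes> a) =
      (\<Oplus>\<^bsub>R\<^esub> j\<in>J. c j \<otimes>\<^bsub>R\<^esub> char_fun R (double_coset G (H \<inter> K) (h j) (stab a)) y)"
  shows "Phi a elem = HC.jmap (stab a) (\<Oplus>\<^bsub>obj N (stab a)\<^esub> j\<in>J. c j \<odot>\<^bsub>obj N (stab a)\<^esub>
      hecke_corr_push (G\<lparr>carrier := H\<rparr>) N (H \<inter> K) (h j) (stab a) x)"
proof -
  let ?U = "H \<inter> K" and ?W = "stab a"
  interpret O: orbit_sum G T K H HC.Nh HC.act a "HC.average ?W" by (rule orbit_sum_stab[OF a])
  interpret U: Module.module R "obj N ?U" by (rule HC.obj_module[OF HC.U])
  note W = stab_level[OF a]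
  interpret W: Module.module R "obj N ?W" by (rule HC.obj_module[OF W])
  define F where "F j = \<Union>((\<lambda>u. (u \<otimes> (h j \<otimes> a)) <# K) ` ?U)" for j
  define v where "v j = HC.jmap ?U (c j \<odot>\<^bsub>obj N ?U\<^esub> x)" for j
  define hx where "hx j = hecke_corr_push (G\<lparr>carrier := H\<rparr>) N ?U (h j) ?W x" for j
  note dc = Phi_double_coset[OF a, of "h _" "c _", folded F_def v_def hx_def]
  have cl: "E.const_on (F j) (v j) \<in> carrier E.C" if "j \<in> J" for j using dc(1) ch[OF that] by blast
  have vcl: "v j \<in> carrier HC.Nh" if "j \<in> J" for j
    unfolding v_def using HC.jmap_closed[OF HC.U smult_x_closed] ch[OF that] by blast
  have hxcl: "hx j \<in> carrier (obj N ?W)" if "j \<in> J" for j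
    unfolding hx_def using HC.hecke_average(1)[OF W _ x] ch[OF that] by simp
  define s where "s = (\<Oplus>\<^bsub>E.C\<^esub>j\<in>J. E.const_on (F j) (v j))"
  have s: "s \<in> carrier E.C" unfolding s_def using cl by (intro E.C.finsum_closed) auto
  \<comment> \<open>Agreement on H a is all that can be expected: the expansion is given only there,
    and the elementary function may have support in other double cosets.\<close>
  have "Phi a elem = Phi a s"
  proof (rule O.Phi_cong[OF elem_closed s])
    fix q assume q: "q \<in> H"
    then have qa: "q \<otimes> a \<in> carrier G" using a by simp
    let ?ch = "\<lambda>j. char_fun R (double_coset G ?U (h j) ?W) q"
    have chcl: "?ch j \<in> carrier R" for j by (simp add: char_fun_def)
    have ad: "additive_map R HC.Nh (\<lambda>r. HC.jmap ?U (r \<odot>\<^bsub>obj N ?U\<^esub> x))"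
      by (rule additive_map_comp[OF _ HC.jmap_additive[OF HC.U]])
         (use x in \<open>auto simp: additive_map_def U.smult_l_distr\<close>)
    have "elem (q \<otimes> a) = HC.jmap ?U ((\<Oplus>\<^bsub>R\<^esub> j\<in>J. c j \<otimes>\<^bsub>R\<^esub> ?ch j) \<odot>\<^bsub>obj N ?U\<^esub> x)"
      by (simp add: elem_apply[OF qa] exp[OF q])
    also have "\<dots> = (\<Oplus>\<^bsub>HC.Nh\<^esub>j\<in>J. HC.jmap ?U ((c j \<otimes>\<^bsub>R\<^esub> ?ch j) \<odot>\<^bsub>obj N ?U\<^esub> x))"
      using ch chcl
      by (intro additive_map_finsum[OF HC.Rd.abelian_group_axioms HC.Nh.abelian_group_axioms ad J])
         (auto intro!: HC.Rd.m_closed)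
    also have "\<dots> = (\<Oplus>\<^bsub>HC.Nh\<^esub>j\<in>J. E.const_on (F j) (v j) (q \<otimes> a))"
    proof (rule HC.Nh.finsum_cong')
      fix j assume j: "j \<in> J"
      have mem: "q \<otimes> a \<in> F j \<longleftrightarrow> q \<in> double_coset G ?U (h j) ?W"
        using dc(3)[of j j q] ch[OF j] q by blast
      show "HC.jmap ?U ((c j \<otimes>\<^bsub>R\<^esub> ?ch j) \<odot>\<^bsub>obj N ?U\<^esub> x) = E.const_on (F j) (v j) (q \<otimes> a)"
      proof (cases "q \<otimes> a \<in> F j")
        case True
        then show ?thesis using mem ch[OF j] qa by (simp add: char_fun_def E.const_on_def v_def)
      next
        case False
        then show ?thesis
          using mem ch[OF j] qa x additive_map_zero[OF U.abelian_group_axioms HC.Nh.abelian_group_axioms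
              HC.jmap_additive[OF HC.U]]
          by (simp add: char_fun_def E.const_on_def U.smult_l_null)
      qed
    qed (use cl qa E.C_closed in auto)
    also have "\<dots> = s (q \<otimes> a)"
      unfolding s_def
      by (rule additive_map_finsum[OF E.abelian_group_C HC.Nh.abelian_group_axioms E.eval_additive[OF qa] J, symmetric])
         (use cl in auto)
    finally show "elem (q \<otimes> a) = s (q \<otimes> a)" .
  qed
  also have "\<dots> = (\<Oplus>\<^bsub>HC.Nh\<^esub>j\<in>J. Phi a (E.const_on (F j) (v j)))"
    unfolding s_def
    by (rule additive_map_finsum[OF E.abelian_group_C HC.Nh.abelian_group_axioms O.Phi_additive J])
       (use cl in auto)
  also have "\<dots> = (\<Oplus>\<^bsub>HC.Nh\<^esub>j\<in>J. HC.jmap ?W (c j \<odot>\<^bsub>obj N ?W\<^esub> hx j))"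
  proof (rule HC.Nh.finsum_cong')
    fix j assume j: "j \<in> J"
    show "Phi a (E.const_on (F j) (v j)) = HC.jmap ?W (c j \<odot>\<^bsub>obj N ?W\<^esub> hx j)"
      using dc(2)[of j j] ch[OF j] by blast
  qed (use hxcl ch HC.jmap_closed[OF W] in auto)
  also have "\<dots> = HC.jmap ?W (\<Oplus>\<^bsub>obj N ?W\<^esub>j\<in>J. c j \<odot>\<^bsub>obj N ?W\<^esub> hx j)"
    by (rule additive_map_finsum[OF W.abelian_group_axioms HC.Nh.abelian_group_axioms HC.jmap_additive[OF W] J, symmetric])
       (use hxcl ch in auto)
  finally show ?thesis by (simp add: hx_def)
qed

section \<open>Orbit sums of integral functions\<close>

lemma push_jmap_additive:
  assumes a: "a \<in> carrier G"
  shows "additive_map (obj N (stabL a)) HC.Nh (\<lambda>y. HC.jmap (stab a) (push N \<one> (stabL a) (stab a) y))"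
  using additive_map_comp[OF linear_imp_additive[OF HC.push_linear[OF HC.level_hom_one[OF stabL_level[OF a]
          stab_level[OF a] stabL_subset]]] HC.jmap_additive[OF stab_level[OF a]]] by simp

text \<open>Each summand of an integral value is moved into the conjugate of L at a by the inverse
  of its representative. Averaging it over the stabiliser is a push-forward that factors through V,
  the stabiliser for L. The values of this form are the image of an additive map, so the whole orbit
  sum is again of this form.\<close>

lemma Phi_integral:
  assumes a: "a \<in> carrier G" and xi: "\<xi> \<in> carrier E.C"
    and int: "integral_at_level G H \<mu> \<Upsilon>\<^sub>H R N (H \<inter> K) L \<xi>"
  obtains y where "y \<in> carrier (obj N (stabL a))" "Phi a \<xi> = HC.jmap (stab a) (push N \<one> (stabL a) (stab a) y)"
proof -
  let ?W = "stab a" and ?V = "stabL a"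
  interpret O: orbit_sum G T K H HC.Nh HC.act a "HC.average ?W" by (rule orbit_sum_stab[OF a])
  note W = stab_level[OF a] and V = stabL_level[OF a]
  interpret V: Module.module R "obj N ?V" by (rule HC.obj_module[OF V])
  let ?f = "\<lambda>y. HC.jmap ?W (push N \<one> ?V ?W y)"
  note f = push_jmap_additive[OF a]
  note VN = V.abelian_group_axioms HC.Nh.abelian_group_axioms
  note oneVW = HC.level_hom_one[OF V W stabL_subset]
  have tm: "HC.average ?W (HC.act (inv q) (\<xi> (q \<otimes> a))) \<in> ?f ` carrier (obj N ?V)" if q: "q \<in> H" for q
  proof -
    have qG: "q \<in> carrier G" and iq: "inv q \<in> H" using q by auto
    have qa: "q \<otimes> a \<in> carrier G" using qG a by simp
    from bspec[OF int[unfolded integral_at_level_def] qa]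
    obtain n :: nat and Vs y where
      nVy: "\<forall>k<n. Vs k \<in> \<Upsilon>\<^sub>H \<and> Vs k \<subseteq> conjugate G (q \<otimes> a) L \<and> y k \<in> carrier (obj N (Vs k))"
      and val0: "\<xi> (q \<otimes> a) = (\<Oplus>\<^bsub>HC.Nh\<^esub>k\<in>{..<n}. rat_in HC.Q (haar_index \<mu> (H \<inter> K) (Vs k)) \<odot>\<^bsub>HC.Nh\<^esub>
          completion_map (G\<lparr>carrier := H\<rparr>) \<Upsilon>\<^sub>H R N (Vs k) (y k))"
      by (elim exE conjE) blast
    have val: "\<xi> (q \<otimes> a) = (\<Oplus>\<^bsub>HC.Nh\<^esub>k\<in>{..<n}. HC.jmap (Vs k) (y k))"
      using val0 by (simp add: HC.jmap_def HC.scal_def)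
    have jcl: "HC.jmap (Vs k) (y k) \<in> carrier HC.Nh" if "k < n" for k using HC.jmap_closed nVy that by blast
    have ad: "additive_map HC.Nh HC.Nh (\<lambda>v. HC.average ?W (HC.act (inv q) v))"
      by (rule additive_map_comp[OF E.act_additive[OF iq] O.e_additive])
    have "HC.average ?W (HC.act (inv q) (\<xi> (q \<otimes> a))) =
        (\<Oplus>\<^bsub>HC.Nh\<^esub>k\<in>{..<n}. HC.average ?W (HC.act (inv q) (HC.jmap (Vs k) (y k))))"
      unfolding val by (rule additive_map_finsum[OF VN(2) VN(2) ad]) (use jcl in auto)
    also have "\<dots> \<in> ?f ` carrier (obj N ?V)"
    proof (rule finsum_in_image[OF VN f])
      fix k assume "k \<in> {..<n}"
      then have k: "Vs k \<in> \<Upsilon>\<^sub>H" "Vs k \<subseteq> conjugate G (q \<otimes> a) L" "y k \<in> carrier (obj N (Vs k))" using nVy by auto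
      let ?X = "conjugate (G\<lparr>carrier := H\<rparr>) (inv q) (Vs k)"
      have iqc: "inv q \<in> carrier (G\<lparr>carrier := H\<rparr>)" using iq by simp
      have X: "?X \<in> \<Upsilon>\<^sub>H" by (rule HC.T1[OF k(1) iqc])
      \<comment> \<open>Conjugating by the inverse of q turns the group attached to the point qa
        into the one attached to a; together with containment in H this places the level inside
        \<open>stabL a\<close>.\<close>
      have "?X \<subseteq> conjugate G (inv q) (conjugate G (q \<otimes> a) L)"
        unfolding conjugate_H[OF iq] by (rule conjugate_mono[OF k(2)])
      also have "\<dots> = conjugate G a L"
        using conjugate_conjugate[of "inv q" "q \<otimes> a" L] qG a qa level_subset[OF L] by (simp add: m_assoc[symmetric])
      finally have XV: "?X \<subseteq> ?V" using HC.level_subset[OF X] by auto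
      have XW: "?X \<subseteq> ?W" using XV stabL_subset by blast
      define z where "z = pull N (inv q) ?X (Vs k) (y k)"
      have z: "z \<in> carrier (obj N ?X)"
        unfolding z_def by (rule HC.pull_closed[OF HC.level_hom_conjugate[OF k(1) iqc] k(3)])
      note oneXV = HC.level_hom_one[OF X V XV]
      have pz: "push N \<one> ?X ?V z \<in> carrier (obj N ?V)" using HC.push_closed[OF oneXV z] by simp
      have "HC.act (inv q) (HC.jmap (Vs k) (y k)) = HC.jmap ?X z"
        unfolding z_def by (rule HC.act_jmap[OF iqc k(1) k(3)])
      then have "HC.average ?W (HC.act (inv q) (HC.jmap (Vs k) (y k))) = HC.jmap ?W (push N \<one> ?X ?W z)"
        using HC.average_jmap[OF W X XW z] by simp
      also have "push N \<one> ?X ?W z = push N \<one> ?V ?W (push N \<one> ?X ?V z)"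
        using HC.push_comp[OF oneXV oneVW z] by simp
      finally show "HC.average ?W (HC.act (inv q) (HC.jmap (Vs k) (y k))) \<in> ?f ` carrier (obj N ?V)"
        using pz by blast
    qed simp
    finally show ?thesis .
  qed
  have "Phi a \<xi> \<in> ?f ` carrier (obj N ?V)"
    unfolding O.Phi_def
  proof (rule finsum_in_image[OF VN f E.C_finite[OF xi]])
    fix B assume "B \<in> E.coset_supp \<xi>"
    have "O.orbit_term \<xi> B = HC.average ?W (HC.act (inv (O.orbit_rep B)) (\<xi> (O.orbit_rep B \<otimes> a)))"
      if "\<exists>q\<in>H. q \<otimes> a \<in> B" using that by (simp add: O.orbit_term_def)
    moreover have "O.orbit_rep B \<in> H" if "\<exists>q\<in>H. q \<otimes> a \<in> B" using that O.orbit_repI(1) by blast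
    \<comment> \<open>The default value zero for cosets outside H a K also lies in the image, as the
      value at zero.\<close>
    moreover have "O.orbit_term \<xi> B = ?f \<zero>\<^bsub>obj N ?V\<^esub>" if "\<not> (\<exists>q\<in>H. q \<otimes> a \<in> B)"
      using that additive_map_zero[OF VN f] by (simp add: O.orbit_term_def)
    ultimately show "O.orbit_term \<xi> B \<in> ?f ` carrier (obj N ?V)" using tm by (cases "\<exists>q\<in>H. q \<otimes> a \<in> B") auto
  qed
  then show ?thesis using that by blast
qed

text \<open>Additivity turns the equation into vanishing of J on the difference, and the kernel of J
  at one level is the torsion.\<close>

lemma jmap_eq_push_iff_torsion:
  assumes a: "a \<in> carrier G" and s: "s \<in> carrier (obj N (stab a))" and y: "y \<in> carrier (obj N (stabL a))"
  shows "HC.jmap (stab a) s = HC.jmap (stab a) (push N \<one> (stabL a) (stab a) y) \<longleftrightarrow>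
    is_torsion R (obj N (stab a)) (s \<ominus>\<^bsub>obj N (stab a)\<^esub> push N \<one> (stabL a) (stab a) y)"
proof -
  note W = stab_level[OF a]
  interpret W: Module.module R "obj N (stab a)" by (rule HC.obj_module[OF W])
  let ?p = "push N \<one> (stabL a) (stab a) y"
  have p: "?p \<in> carrier (obj N (stab a))"
    using HC.push_closed[OF HC.level_hom_one[OF stabL_level[OF a] W stabL_subset] y] by simp
  have "HC.jmap (stab a) s = HC.jmap (stab a) ?p \<longleftrightarrow> HC.jmap (stab a) s \<ominus>\<^bsub>HC.Nh\<^esub> HC.jmap (stab a) ?p = \<zero>\<^bsub>HC.Nh\<^esub>"
    using HC.jmap_closed[OF W s] HC.jmap_closed[OF W p] by (simp add: HC.Nh.minus_eq_zero_iff)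
  also have "\<dots> \<longleftrightarrow> HC.jmap (stab a) (s \<ominus>\<^bsub>obj N (stab a)\<^esub> ?p) = \<zero>\<^bsub>HC.Nh\<^esub>"
    using additive_map_minus[OF W.abelian_group_axioms HC.Nh.abelian_group_axioms HC.jmap_additive[OF W] s p] by simp
  also have "\<dots> \<longleftrightarrow> is_torsion R (obj N (stab a)) (s \<ominus>\<^bsub>obj N (stab a)\<^esub> ?p)"
    using s p by (intro HC.jmap_eq_zero_iff[OF W]) simp
  finally show ?thesis .
qed

end

section \<open>Equivalence of integrality with the torsion conditions at the representatives\<close>

theorem theorem4:
  fixes p :: nat
    and G :: "('g, 'b) monoid_scheme" and T :: "'g topology" and \<Upsilon>\<^sub>G :: "'g set set"
    and H :: "'g set" and \<mu> :: "'g measure" and \<Upsilon>\<^sub>H :: "'g set set"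
    and K L :: "'g set"
    and N :: "('g, nat \<Rightarrow> int, 'm) ric" and x\<^sub>U :: 'm
    and \<HH> :: "'g \<Rightarrow> nat \<Rightarrow> int"
    and r :: nat and g :: "nat \<Rightarrow> 'g"
    and n :: "nat \<Rightarrow> nat" and c :: "nat \<Rightarrow> nat \<Rightarrow> nat \<Rightarrow> int" and h :: "nat \<Rightarrow> nat \<Rightarrow> 'g"
  assumes "Factorial_Ring.prime p"
    and "level_collection G T \<Upsilon>\<^sub>G" and "unimodular G T"
    and "subgroup H G" and "closedin T H"
    and "level_collection (G\<lparr>carrier := H\<rparr>) (subtopology T H) \<Upsilon>\<^sub>H"
    and "unimodular (G\<lparr>carrier := H\<rparr>) (subtopology T H)"
    and "left_haar_measure (G\<lparr>carrier := H\<rparr>) (subtopology T H) \<mu>"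
    and "\<And>K'. K' \<in> \<Upsilon>\<^sub>G \<Longrightarrow> K' \<inter> H \<in> \<Upsilon>\<^sub>H"
    and "K \<in> \<Upsilon>\<^sub>G" and "L \<in> \<Upsilon>\<^sub>G" and "L \<lhd> G\<lparr>carrier := K\<rparr>"
    and "comack_functor (G\<lparr>carrier := H\<rparr>) (subtopology T H) \<Upsilon>\<^sub>H (padic_integers p) N"
    and "x\<^sub>U \<in> carrier (obj N (H \<inter> K))"
    and "hecke_function G (padic_integers p) K \<HH>"
    and "supp G (padic_integers p) \<HH> \<noteq> {}"
    and "\<And>i. i \<in> {1..r} \<Longrightarrow> g i \<in> H <#>\<^bsub>G\<^esub> supp G (padic_integers p) \<HH>"
    and "\<And>y. y \<in> H <#>\<^bsub>G\<^esub> supp G (padic_integers p) \<HH> \<Longrightarrow>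
           \<exists>!i. i \<in> {1..r} \<and> y \<in> double_coset G H (g i) K"
    and "\<And>i j. i \<in> {1..r} \<Longrightarrow> j \<in> {1..n i} \<Longrightarrow> c i j \<in> carrier (padic_integers p) \<and> h i j \<in> H"
    and "\<And>i. i \<in> {1..r} \<Longrightarrow>
           inj_on (\<lambda>j. double_coset G (H \<inter> K) (h i j) (H \<inter> conjugate G (g i) K)) {1..n i}"
    and "\<And>i y. i \<in> {1..r} \<Longrightarrow> y \<in> H \<Longrightarrow>
           \<HH> (y \<otimes>\<^bsub>G\<^esub> g i) =
             (\<Oplus>\<^bsub>padic_integers p\<^esub> j\<in>{1..n i}. c i j \<otimes>\<^bsub>padic_integers p\<^esub>
                char_fun (padic_integers p)
                  (double_coset G (H \<inter> K) (h i j) (H \<inter> conjugate G (g i) K)) y)"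
  shows "(\<exists>\<xi>. abstract_zeta_element G T H \<mu> \<Upsilon>\<^sub>H (padic_integers p) N K x\<^sub>U \<HH> L \<xi>) \<longleftrightarrow>
    (\<forall>i\<in>{1..r}. \<exists>x\<in>carrier (obj N (H \<inter> conjugate G (g i) L)).
       is_torsion (padic_integers p) (obj N (H \<inter> conjugate G (g i) K))
         ((\<Oplus>\<^bsub>obj N (H \<inter> conjugate G (g i) K)\<^esub> j\<in>{1..n i}.
             c i j \<odot>\<^bsub>obj N (H \<inter> conjugate G (g i) K)\<^esub>
               hecke_corr_push (G\<lparr>carrier := H\<rparr>) N (H \<inter> K) (h i j)
                 (H \<inter> conjugate G (g i) K) x\<^sub>U)
          \<ominus>\<^bsub>obj N (H \<inter> conjugate G (g i) K)\<^esub>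
          push N \<one>\<^bsub>G\<^esub> (H \<inter> conjugate G (g i) L) (H \<inter> conjugate G (g i) K) x))"
proof -
  note asm = assms
  let ?R = "padic_integers p" and ?Hs = "G\<lparr>carrier := H\<rparr>" and ?I = "{1..r}"
  interpret GL: level_collection G T \<Upsilon>\<^sub>G by (rule asm(2))
  have HK: "H \<inter> K \<in> \<Upsilon>\<^sub>H" using asm(9)[OF asm(10)] by (simp add: Int_commute)
  have comack: "comack_haar ?Hs (subtopology T H) \<Upsilon>\<^sub>H ?R N \<mu> (H \<inter> K)"
    by (intro comack_haar.intro comack_haar_axioms.intro asm(13) domain_padic_integers asm(1) asm(8) asm(7) HK
        padic_integers_add_pow_nonzero)
  interpret Z: zeta_setting G T \<Upsilon>\<^sub>G H \<mu> \<Upsilon>\<^sub>H ?R N K L x\<^sub>U \<HH>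
    by (intro zeta_setting.intro zeta_setting_axioms.intro asm(2) asm(4) comack asm(9) asm(10-12) asm(14) asm(15))
  let ?S = "H <#>\<^bsub>G\<^esub> supp G ?R \<HH>"
  let ?N = "\<lambda>i. obj N (Z.stab (g i))"
  have memS: "y \<in> ?S \<longleftrightarrow> (\<exists>h\<in>H. \<exists>s\<in>carrier G. \<HH> s \<noteq> \<zero>\<^bsub>?R\<^esub> \<and> y = h \<otimes>\<^bsub>G\<^esub> s)" for y
    by (auto simp: set_mult_def supp_def)
  have gG: "g i \<in> carrier G" if "i \<in> ?I" for i
    using asm(17)[OF that] memS[of "g i"] by auto
  have disj: "i = j"
    if i: "i \<in> ?I" and j: "j \<in> ?I" and h: "h \<in> H" and k: "k \<in> K" and eq: "g i = h \<otimes>\<^bsub>G\<^esub> g j \<otimes>\<^bsub>G\<^esub> k"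
    for i j h k
  proof -
    have "g i \<in> double_coset G H (g j) K" unfolding mem_double_coset using h k eq by blast
    moreover have "g i = \<one>\<^bsub>G\<^esub> \<otimes>\<^bsub>G\<^esub> g i \<otimes>\<^bsub>G\<^esub> \<one>\<^bsub>G\<^esub>" using gG[OF i] by simp
    then have "g i \<in> double_coset G H (g i) K"
      unfolding mem_double_coset using Z.E.H_one subgroup.one_closed[OF Z.E.K_subgroup] by blast
    ultimately show ?thesis using asm(18)[OF asm(17)[OF i]] i j by blast
  qed
  have orb: "orbit_sum G T K H Z.HC.Nh Z.HC.act (g i) (Z.HC.average (Z.stab (g i)))" if "i \<in> ?I" for i
    by (rule Z.orbit_sum_stab[OF gG[OF that]])
  have supp_elem: "\<exists>i\<in>?I. \<exists>h\<in>H. \<exists>k\<in>K. a = h \<otimes>\<^bsub>G\<^esub> g i \<otimes>\<^bsub>G\<^esub> k"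
    if a: "a \<in> carrier G" and nz: "Z.elem a \<noteq> \<zero>\<^bsub>Z.HC.Nh\<^esub>" for a
  proof -
    have "\<HH> a \<noteq> \<zero>\<^bsub>?R\<^esub>" using Z.elem_zero[OF a] nz by blast
    moreover have "a = \<one>\<^bsub>G\<^esub> \<otimes>\<^bsub>G\<^esub> a" using a by simp
    ultimately have "a \<in> ?S" unfolding memS using a Z.E.H_one by blast
    then obtain i where "i \<in> ?I" "a \<in> double_coset G H (g i) K" using asm(18) by blast
    then show ?thesis unfolding mem_double_coset by blast
  qed
  \<comment> \<open>The Hecke expression h_{v,i,*}(x_U) of the statement, as a finite sum over the
    double cosets in its expansion.\<close>
  define s where "s i = (\<Oplus>\<^bsub>?N i\<^esub> j\<in>{1..n i}. c i j \<odot>\<^bsub>?N i\<^esub>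
      hecke_corr_push ?Hs N (H \<inter> K) (h i j) (Z.stab (g i)) x\<^sub>U)" for i
  have s_closed: "s i \<in> carrier (?N i)" if i: "i \<in> ?I" for i
  proof -
    note W = Z.stab_level[OF gG[OF i]]
    interpret W: Module.module ?R "?N i" by (rule Z.HC.obj_module[OF W])
    show ?thesis
      unfolding s_def using asm(19)[OF i] Z.HC.hecke_average(1)[OF W _ asm(14)]
      by (intro W.finsum_closed) auto
  qed
  have Phi_elem: "Z.Phi (g i) Z.elem = Z.HC.jmap (Z.stab (g i)) (s i)" if i: "i \<in> ?I" for i
    unfolding s_def
    by (rule Z.Phi_elem[OF gG[OF i] _ asm(19)[OF i] asm(21)[OF i]]) simp_all
  \<comment> \<open>Restates the condition at i without torsion: the orbit sum of the elementary
    function at g_i must be J of a push-forward from V_{v,i}. Both directions work with this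
    form.\<close>
  have key: "is_torsion ?R (?N i) (s i \<ominus>\<^bsub>?N i\<^esub> push N \<one>\<^bsub>G\<^esub> (Z.stabL (g i)) (Z.stab (g i)) y) \<longleftrightarrow>
      Z.Phi (g i) Z.elem = Z.HC.jmap (Z.stab (g i)) (push N \<one>\<^bsub>G\<^esub> (Z.stabL (g i)) (Z.stab (g i)) y)"
    if i: "i \<in> ?I" and y: "y \<in> carrier (obj N (Z.stabL (g i)))" for i y
    using Z.jmap_eq_push_iff_torsion[OF gG[OF i] s_closed[OF i] y] Phi_elem[OF i] by simp
  have "(\<exists>\<xi>. abstract_zeta_element G T H \<mu> \<Upsilon>\<^sub>H ?R N K x\<^sub>U \<HH> L \<xi>) \<longleftrightarrow>
    (\<forall>i\<in>?I. \<exists>y\<in>carrier (obj N (Z.stabL (g i))).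
      is_torsion ?R (?N i) (s i \<ominus>\<^bsub>?N i\<^esub> push N \<one>\<^bsub>G\<^esub> (Z.stabL (g i)) (Z.stab (g i)) y))"
  proof
    assume "\<exists>\<xi>. abstract_zeta_element G T H \<mu> \<Upsilon>\<^sub>H ?R N K x\<^sub>U \<HH> L \<xi>"
    then obtain \<xi> where xi: "\<xi> \<in> carrier Z.E.C"
      and int: "integral_at_level G H \<mu> \<Upsilon>\<^sub>H ?R N (H \<inter> K) L \<xi>"
      and cls: "coinvariant_class Z.E.C H Z.E.trans \<xi> = coinvariant_class Z.E.C H Z.E.trans Z.elem"
      by (auto simp: abstract_zeta_element_def Let_def)
    \<comment> \<open>The support of \<xi> may reach outside the double cosets H g_i K; this is
      harmless, since orbit sums vanish on all of \<open>aug\<close>.\<close>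
    have aug: "\<xi> \<ominus>\<^bsub>Z.E.C\<^esub> Z.elem \<in> Z.E.aug"
      using cls Z.E.coinvariant_class_eq_iff[OF xi Z.elem_closed] by simp
    show "\<forall>i\<in>?I. \<exists>y\<in>carrier (obj N (Z.stabL (g i))).
      is_torsion ?R (?N i) (s i \<ominus>\<^bsub>?N i\<^esub> push N \<one>\<^bsub>G\<^esub> (Z.stabL (g i)) (Z.stab (g i)) y)"
    proof
      fix i assume i: "i \<in> ?I"
      interpret O: orbit_sum G T K H Z.HC.Nh Z.HC.act "g i" "Z.HC.average (Z.stab (g i))" by (rule orb[OF i])
      obtain y where y: "y \<in> carrier (obj N (Z.stabL (g i)))"
        "Z.Phi (g i) \<xi> = Z.HC.jmap (Z.stab (g i)) (push N \<one>\<^bsub>G\<^esub> (Z.stabL (g i)) (Z.stab (g i)) y)"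
        by (rule Z.Phi_integral[OF gG[OF i] xi int])
      have "Z.Phi (g i) \<xi> \<ominus>\<^bsub>Z.HC.Nh\<^esub> Z.Phi (g i) Z.elem = \<zero>\<^bsub>Z.HC.Nh\<^esub>"
        using O.Phi_aug[OF aug] O.Phi_minus[OF xi Z.elem_closed] by simp
      then have "Z.Phi (g i) \<xi> = Z.Phi (g i) Z.elem"
        using Z.HC.Nh.minus_eq_zero_iff[OF O.Phi_closed[OF xi] O.Phi_closed[OF Z.elem_closed]] by simp
      then show "\<exists>y\<in>carrier (obj N (Z.stabL (g i))).
          is_torsion ?R (?N i) (s i \<ominus>\<^bsub>?N i\<^esub> push N \<one>\<^bsub>G\<^esub> (Z.stabL (g i)) (Z.stab (g i)) y)"
        using y key[OF i y(1)] by auto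
    qed
  next
    assume "\<forall>i\<in>?I. \<exists>y\<in>carrier (obj N (Z.stabL (g i))).
      is_torsion ?R (?N i) (s i \<ominus>\<^bsub>?N i\<^esub> push N \<one>\<^bsub>G\<^esub> (Z.stabL (g i)) (Z.stab (g i)) y)"
    then have "\<forall>i\<in>?I. \<exists>y. y \<in> carrier (obj N (Z.stabL (g i))) \<and>
        Z.Phi (g i) Z.elem = Z.HC.jmap (Z.stab (g i)) (push N \<one>\<^bsub>G\<^esub> (Z.stabL (g i)) (Z.stab (g i)) y)"
      using key by blast
    then obtain y where y: "\<And>i. i \<in> ?I \<Longrightarrow> y i \<in> carrier (obj N (Z.stabL (g i))) \<and>
        Z.Phi (g i) Z.elem = Z.HC.jmap (Z.stab (g i)) (push N \<one>\<^bsub>G\<^esub> (Z.stabL (g i)) (Z.stab (g i)) (y i))"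
      by (rule bchoice[THEN exE]) blast
    \<comment> \<open>The witness takes on g_i K the normalised class of y_i at level V_{v,i}. That
      value is integral at level L by its form, and averaging over H_{v,i} turns it into J of the
      push-forward of y_i.\<close>
    define v where "v i = Z.HC.jmap (Z.stabL (g i)) (y i)" for i
    have v: "v i \<in> carrier Z.HC.Nh" if "i \<in> ?I" for i
      unfolding v_def using Z.HC.jmap_closed[OF Z.stabL_level[OF gG[OF that]]] y[OF that] by blast
    define \<xi> where "\<xi> = (\<Oplus>\<^bsub>Z.E.C\<^esub>i\<in>?I. Z.E.delta (g i) (v i))"
    have dcl: "Z.E.delta (g i) (v i) \<in> carrier Z.E.C" if "i \<in> ?I" for i
      using Z.E.delta_closed gG v that by blast
    have xi: "\<xi> \<in> carrier Z.E.C" unfolding \<xi>_def using dcl by (intro Z.E.C.finsum_closed) auto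
    \<comment> \<open>The cosets g_i K are pairwise disjoint because the double cosets H g_i K are,
      so the values of the sum can be read off one summand at a time.\<close>
    have own: "i = j" if "i \<in> ?I" "j \<in> ?I" "a \<in> carrier G" "a \<in> g i <#\<^bsub>G\<^esub> K" "a \<in> g j <#\<^bsub>G\<^esub> K" for i j a
    proof -
      have "g i <#\<^bsub>G\<^esub> K = g j <#\<^bsub>G\<^esub> K"
        using Z.E.coset_eq_iff[OF gG[OF that(1)] that(3)] Z.E.coset_eq_iff[OF gG[OF that(2)] that(3)] that by simp
      then have "g i \<in> g j <#\<^bsub>G\<^esub> K" using Z.E.coset_self[OF gG[OF that(1)]] by simp
      moreover have "g j \<in> carrier G" using gG[OF that(2)] .
      ultimately obtain k where "k \<in> K" "g i = \<one>\<^bsub>G\<^esub> \<otimes>\<^bsub>G\<^esub> g j \<otimes>\<^bsub>G\<^esub> k"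
        by (auto simp: l_coset_def)
      then show ?thesis using disj[OF that(1,2) Z.E.H_one] by blast
    qed
    have xi_apply: "\<xi> a = (\<Oplus>\<^bsub>Z.HC.Nh\<^esub>i\<in>?I. if a \<in> g i <#\<^bsub>G\<^esub> K then v i else \<zero>\<^bsub>Z.HC.Nh\<^esub>)"
      if a: "a \<in> carrier G" for a
    proof -
      have "\<xi> a = (\<Oplus>\<^bsub>Z.HC.Nh\<^esub>i\<in>?I. Z.E.delta (g i) (v i) a)"
        unfolding \<xi>_def
        by (rule additive_map_finsum[OF Z.E.abelian_group_C Z.HC.Nh.abelian_group_axioms Z.E.eval_additive[OF a]])
           (use dcl in auto)
      then show ?thesis using a by (simp add: Z.E.delta_def Z.E.const_on_def)
    qed
    have xi_on: "\<xi> a = v i" if i: "i \<in> ?I" and a: "a \<in> carrier G" "a \<in> g i <#\<^bsub>G\<^esub> K" for i a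
    proof -
      have "\<xi> a = (\<Oplus>\<^bsub>Z.HC.Nh\<^esub>j\<in>?I. if i = j then v j else \<zero>\<^bsub>Z.HC.Nh\<^esub>)"
        unfolding xi_apply[OF a(1)]
        by (rule Z.HC.Nh.finsum_cong') (use v own[OF i _ a(1,2)] a(2) in auto)
      then show ?thesis using i v by (simp add: Z.HC.Nh.add.finprod_singleton Pi_iff)
    qed
    have xi_off: "\<xi> a = \<zero>\<^bsub>Z.HC.Nh\<^esub>" if a: "a \<in> carrier G" "\<not> (\<exists>i\<in>?I. a \<in> g i <#\<^bsub>G\<^esub> K)" for a
    proof -
      have "\<xi> a = (\<Oplus>\<^bsub>Z.HC.Nh\<^esub>j\<in>?I. \<zero>\<^bsub>Z.HC.Nh\<^esub>)"
        unfolding xi_apply[OF a(1)] by (rule Z.HC.Nh.finsum_cong') (use a(2) in auto)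
      then show ?thesis by simp
    qed
    have int: "integral_at_level G H \<mu> \<Upsilon>\<^sub>H ?R N (H \<inter> K) L \<xi>"
      unfolding integral_at_level_def
    proof
      fix a assume a: "a \<in> carrier G"
      show "\<exists>(n::nat) V x. (\<forall>k<n. V k \<in> \<Upsilon>\<^sub>H \<and> V k \<subseteq> conjugate G a L \<and> x k \<in> carrier (obj N (V k))) \<and>
          \<xi> a = (\<Oplus>\<^bsub>Z.HC.Nh\<^esub> k\<in>{..<n}. rat_in Z.HC.Q (haar_index \<mu> (H \<inter> K) (V k)) \<odot>\<^bsub>Z.HC.Nh\<^esub>
            completion_map ?Hs \<Upsilon>\<^sub>H ?R N (V k) (x k))"
      proof (cases "\<exists>i\<in>?I. a \<in> g i <#\<^bsub>G\<^esub> K")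
        case True
        then obtain i where i: "i \<in> ?I" "a \<in> g i <#\<^bsub>G\<^esub> K" by blast
        then obtain k where k: "k \<in> K" "a = g i \<otimes>\<^bsub>G\<^esub> k" by (auto simp: l_coset_def)
        have kG: "k \<in> carrier G" using k Z.E.K_sub by blast
        \<comment> \<open>Normality of L in K makes the conjugate of L constant along the coset g_i
          K, as the value of \<xi> is; one level therefore serves all points of the coset.\<close>
        have kL: "conjugate G k L = L"
        proof -
          have "k <#\<^bsub>G\<^esub> L = L #>\<^bsub>G\<^esub> k"
            using normal.coset_eq[OF asm(12)] k(1) by (auto simp: l_coset_def r_coset_def)
          then show ?thesis
            using GL.coset_mult_assoc[OF GL.level_subset[OF asm(11)] kG GL.inv_closed[OF kG]] kG
              GL.level_subset[OF asm(11)]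
            by (simp add: GL.conjugate_eq_cosets)
        qed
        have "conjugate G a L = conjugate G (g i) L"
          unfolding k(2) using GL.conjugate_conjugate[OF gG[OF i(1)] kG GL.level_subset[OF asm(11)]] kL by simp
        then have sub: "Z.stabL (g i) \<subseteq> conjugate G a L" by blast
        have "\<xi> a = rat_in Z.HC.Q (haar_index \<mu> (H \<inter> K) (Z.stabL (g i))) \<odot>\<^bsub>Z.HC.Nh\<^esub>
            completion_map ?Hs \<Upsilon>\<^sub>H ?R N (Z.stabL (g i)) (y i)"
          using xi_on[OF i(1) a i(2)] by (simp add: v_def Z.HC.jmap_def Z.HC.scal_def)
        moreover have "\<xi> a \<in> carrier Z.HC.Nh" by (rule Z.E.C_closed[OF xi a])
        ultimately show ?thesis
          using sub y[OF i(1)] Z.stabL_level[OF gG[OF i(1)]]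
          by (intro exI[of _ "Suc 0"] exI[of _ "\<lambda>_. Z.stabL (g i)"] exI[of _ "\<lambda>_. y i"])
            (simp add: lessThan_Suc)
      next
        case False
        \<comment> \<open>Off the chosen cosets the value is zero, which is the empty sum, so no
          level has to be exhibited.\<close>
        then show ?thesis using xi_off[OF a] by (intro exI[of _ 0]) simp
      qed
    qed
    \<comment> \<open>Along H g_i the function \<xi> coincides with its i-th summand, whose orbit
      sum is one averaged value: J of the push-forward of y_i, hence the orbit sum of the elementary
      function by the choice of y_i.\<close>
    have Phi_xi: "Z.Phi (g i) \<xi> = Z.Phi (g i) Z.elem" if i: "i \<in> ?I" for i
    proof -
      interpret O: orbit_sum G T K H Z.HC.Nh Z.HC.act "g i" "Z.HC.average (Z.stab (g i))" by (rule orb[OF i])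
      have "Z.Phi (g i) \<xi> = Z.Phi (g i) (Z.E.delta (g i) (v i))"
      proof (rule O.Phi_cong[OF xi dcl[OF i]])
        fix q assume q: "q \<in> H"
        then have qg: "q \<otimes>\<^bsub>G\<^esub> g i \<in> carrier G" using gG[OF i] by simp
        show "\<xi> (q \<otimes>\<^bsub>G\<^esub> g i) = Z.E.delta (g i) (v i) (q \<otimes>\<^bsub>G\<^esub> g i)"
        proof (cases "q \<otimes>\<^bsub>G\<^esub> g i \<in> g i <#\<^bsub>G\<^esub> K")
          case True
          then show ?thesis using xi_on[OF i qg True] qg by (simp add: Z.E.delta_def Z.E.const_on_def)
        next
          case False
          \<comment> \<open>A point of H g_i in g_j K forces i = j, which was excluded by the case
            at hand; so both functions vanish at this point.\<close>
          have "\<not> (\<exists>j\<in>?I. q \<otimes>\<^bsub>G\<^esub> g i \<in> g j <#\<^bsub>G\<^esub> K)"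
          proof
            assume "\<exists>j\<in>?I. q \<otimes>\<^bsub>G\<^esub> g i \<in> g j <#\<^bsub>G\<^esub> K"
            then obtain j where "j \<in> ?I" "q \<otimes>\<^bsub>G\<^esub> g i \<in> g j <#\<^bsub>G\<^esub> K" by blast
            moreover from this(2) obtain k where "k \<in> K" "q \<otimes>\<^bsub>G\<^esub> g i = g j \<otimes>\<^bsub>G\<^esub> k"
              by (auto simp: l_coset_def)
            ultimately have j: "j \<in> ?I" "q \<otimes>\<^bsub>G\<^esub> g i \<in> g j <#\<^bsub>G\<^esub> K" "k \<in> K" "q \<otimes>\<^bsub>G\<^esub> g i = g j \<otimes>\<^bsub>G\<^esub> k"
              by blast+
            have kG: "k \<in> carrier G" using j(3) Z.E.K_sub by blast
            have "g i = inv\<^bsub>G\<^esub> q \<otimes>\<^bsub>G\<^esub> (q \<otimes>\<^bsub>G\<^esub> g i)" using q gG[OF i] by (simp add: GL.m_assoc[symmetric])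
            then have "g i = inv\<^bsub>G\<^esub> q \<otimes>\<^bsub>G\<^esub> g j \<otimes>\<^bsub>G\<^esub> k"
              unfolding j(4) using q gG[OF j(1)] kG by (simp add: GL.m_assoc)
            then have "i = j" using disj[OF i j(1) Z.E.H_inv[OF q] j(3)] by blast
            then show False using False j(2) by simp
          qed
          then show ?thesis using xi_off[OF qg] False qg by (simp add: Z.E.delta_def Z.E.const_on_def)
        qed
      qed
      also have "\<dots> = Z.HC.average (Z.stab (g i)) (v i)"
        using O.Phi_delta[OF Z.E.H_one v[OF i]] gG[OF i] Z.E.act_one[OF v[OF i]] by simp
      also have "\<dots> = Z.Phi (g i) Z.elem"
        unfolding v_def
        using Z.HC.average_jmap[OF Z.stab_level[OF gG[OF i]] Z.stabL_level[OF gG[OF i]] Z.stabL_subset] y[OF i]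
        by simp
      finally show ?thesis .
    qed
    have supp_xi: "\<exists>i\<in>?I. \<exists>h\<in>H. \<exists>k\<in>K. a = h \<otimes>\<^bsub>G\<^esub> g i \<otimes>\<^bsub>G\<^esub> k"
      if a: "a \<in> carrier G" and nz: "\<xi> a \<noteq> \<zero>\<^bsub>Z.HC.Nh\<^esub>" for a
    proof -
      have "\<exists>i\<in>?I. a \<in> g i <#\<^bsub>G\<^esub> K" using xi_off[OF a] nz by blast
      then obtain i k where i: "i \<in> ?I" "k \<in> K" "a = g i \<otimes>\<^bsub>G\<^esub> k" unfolding l_coset_def by blast
      then have "a = \<one>\<^bsub>G\<^esub> \<otimes>\<^bsub>G\<^esub> g i \<otimes>\<^bsub>G\<^esub> k" using gG[OF i(1)] by simp
      then show ?thesis using i(1,2) Z.E.H_one by blast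
    qed
    have "coinvariant_class Z.E.C H Z.E.trans \<xi> = coinvariant_class Z.E.C H Z.E.trans Z.elem"
      by (rule Z.E.coinvariant_class_eqI[OF _ orb disj xi Z.elem_closed supp_xi supp_elem Phi_xi]) auto
    then have "abstract_zeta_element G T H \<mu> \<Upsilon>\<^sub>H ?R N K x\<^sub>U \<HH> L \<xi>"
      using xi int by (simp add: abstract_zeta_element_def Let_def)
    then show "\<exists>\<xi>. abstract_zeta_element G T H \<mu> \<Upsilon>\<^sub>H ?R N K x\<^sub>U \<HH> L \<xi>" by blast
  qed
  then show ?thesis unfolding s_def .
qed

end
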